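(* Let $n\in\mathbb Z_{>0}$. For every $\tau\in\mathbb H$ and every $p\in E_\tau\setminus E_\tau[2]$ there is a natural isomorphism $$\iota_p:\hat\Gamma^{(1)}_{n,p}(\tau)\xrightarrow{\ \sim\ }\widetilde\Gamma_n(\tau)$$ between the quotient non-even spectral curve and the spectral curve of the classical Lamé equation of weight $n$, compatible with the addition maps and with the rational functions $\kappa,\tilde\kappa$: $$\tilde\sigma_n\circ\iota_p=\hat\sigma^{(1)}_{n,p},\qquad \tilde\kappa\circ\iota_p=\kappa.$$
   Context: Notation: $\Lambda_\tau=\mathbb Z+\mathbb Z\tau$, $E_\tau=\mathbb C/\Lambda_\tau$; $\wp,\zeta,\sigma$ are the Weierstrass functions of $\Lambda_\tau$. Non-even equation $\mathrm{GLE}^{(1)}_n(p,T,\tau)$, $T\in\mathbb C$: $y''=q^{(1)}_n(z;p,T)y$ with $q_n^{(1)}=n(n+1)\wp(z)+\frac34(\wp(z+p)+\wp(z-p))+T(\zeta(z+p)+\zeta(z-p)-2\zeta(z))-\frac{\wp''(p)}{4\wp'(p)}(\zeta(z+p)-\zeta(z-p))+B$, $B=T^2+\frac{\wp''(p)}{2\wp'(p)}\zeta(p)-\frac12(2n^2+2n-3)\wp(p)$. It is log-free at all singularities. The equation $\Phi'''-4q^{(1)}_n\Phi'-2(q^{(1)}_n)'\Phi=0$ has, up to scalar, a unique nonzero elliptic solution in $z$; $\Phi(z;T)$ denotes the solution that is a monic polynomial of degree $2n$ in $T$ (coefficients elliptic in $z$). The spectral polynomial $Q^{(1)}_{n,p}(T):=q^{(1)}_n\Phi^2-\frac12\Phi\Phi''+\frac14(\Phi')^2$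 is independent of $z$, monic of degree $4n+2$ and even in $T$: $Q^{(1)}_{n,p}(T)=\hat Q^{(1)}_{n,p}(T^2)$. Set $\Gamma^{(1)}_{n,p}(\tau)=\{(T,C)\in\mathbb C^2:C^2=Q^{(1)}_{n,p}(T)\}$, and let $\hat\Gamma^{(1)}_{n,p}(\tau)=\{(X,C)\in\mathbb C^2:C^2=\hat Q^{(1)}_{n,p}(X)\}$, $X=T^2$, be its quotient by $(T,C)\mapsto(-T,C)$. For $P=(T,C)\in\Gamma^{(1)}_{n,p}(\tau)$ the Baker–Akhiezer function $\psi(P;z)=\exp\int^z\frac{C+\frac12\Phi'(\xi;T)}{\Phi(\xi;T)}d\xi$ solves $\mathrm{GLE}^{(1)}_n(p,T,\tau)$ and, up to a constant factor, has the form $$\psi(P;z)=\frac{e^{c(P)z}\prod_{i=1}^{n+1}\sigma(z-a_i(P))}{\sigma(z)^n\sqrt{\sigma(z+p)\sigma(z-p)}}.$$ Put $\sigma^{(1)}_{n,p}(P)=\sum_ia_i(P)\in E_\tau$ and $\kappa(P)=\zeta\bigl(\sum_ia_i(P)\bigr)-c(P)\in\mathbb C\cup\{\infty\}$, computed with the same lifts of the $a_i(P)$ to $\mathbb C$ (the value of $\kappa$ does not depend on the lifts). Both are invariant under $(T,C)\mapsto(-T,C)$ and descend to $\hat\sigma^{(1)}_{n,p}$ and $\kappa$ on $\hat\Gamma^{(1)}_{n,p}(\tau)$. Classical side: for $\mathrm L_n(\widetilde B,\tau)$: $w''=(n(n+1)\wp(z)+\widetilde B)w$, let $\tilde\Phi(z;\widetilde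 B)$ be the elliptic solution of $\tilde\Phi'''-4\tilde q\tilde\Phi'-2\tilde q'\tilde\Phi=0$, $\tilde q=n(n+1)\wp+\widetilde B$, that is monic of degree $n$ in $\widetilde B$; $\widetilde Q_n(\widetilde B;\tau):=\tilde q\tilde\Phi^2-\frac12\tilde\Phi\tilde\Phi''+\frac14(\tilde\Phi')^2$ (monic of degree $2n+1$); $\widetilde\Gamma_n(\tau)=\{(\widetilde B,\widetilde C):\widetilde C^2=\widetilde Q_n(\widetilde B;\tau)\}$. For $\widetilde P=(\widetilde B,\widetilde C)$ the Baker–Akhiezer function $\exp\int^z\frac{\widetilde C+\frac12\tilde\Phi'}{\tilde\Phi}d\xi$ equals, up to a constant, $e^{c(\widetilde P)z}\prod_{j=1}^n\sigma(z-\tilde a_j(\widetilde P))/\sigma(z)^n$ with $c(\widetilde P)=\sum_j\zeta(\tilde a_j(\widetilde P))$; $\tilde\sigma_n(\widetilde P)=\sum_j\tilde a_j(\widetilde P)\in E_\tau$ and $\tilde\kappa(\widetilde P)=\zeta(\sum_j\tilde a_j(\widetilde P))-c(\widetilde P)$. *)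

theory Defs
  imports
    "HOL-Complex_Analysis.Complex_Analysis"
    "HOL-Computational_Algebra.Polynomial"
begin

section \<open>The elliptic curve and the Weierstrass functions\<close>

definition period_lattice :: "complex \<Rightarrow> complex set" where
  "period_lattice \<tau> = {of_int a + of_int b * \<tau> | a b. True}"

text \<open>Points of \<open>E\<^sub>\<tau> = \<complex>/\<Lambda>\<^sub>\<tau>\<close> are cosets of the lattice.\<close>

definition lattice_rel :: "complex \<Rightarrow> (complex \<times> complex) set" where
  "lattice_rel \<tau> = {(x, y). x - y \<in> period_lattice \<tau>}"

definition ell_curve :: "complex \<Rightarrow> complex set set" where
  "ell_curve \<tau> = UNIV // lattice_rel \<tau>"

definition ell_point :: "complex \<Rightarrow> complex \<Rightarrow> complex set" where
  "ell_point \<tau> x = lattice_rel \<tau> `` {x}"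

definition two_torsion :: "complex \<Rightarrow> complex set set" where
  "two_torsion \<tau> = {ell_point \<tau> x | x. 2 * x \<in> period_lattice \<tau>}"

definition wp :: "complex \<Rightarrow> complex \<Rightarrow> complex" where
  "wp \<tau> z = 1 / z\<^sup>2 + (\<Sum>\<^sub>\<infinity>\<omega>\<in>period_lattice \<tau> - {0}. 1 / (z - \<omega>)\<^sup>2 - 1 / \<omega>\<^sup>2)"

definition wzeta :: "complex \<Rightarrow> complex \<Rightarrow> complex" where
  "wzeta \<tau> z = 1 / z + (\<Sum>\<^sub>\<infinity>\<omega>\<in>period_lattice \<tau> - {0}. 1 / (z - \<omega>) + 1 / \<omega> + z / \<omega>\<^sup>2)"

text \<open>The product over the lattice is taken as the limit along the directed set of
  finite subsets, the multiplicative counterpart of \<open>infsum\<close>.\<close>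

definition wsigma :: "complex \<Rightarrow> complex \<Rightarrow> complex" where
  "wsigma \<tau> z = z * Lim (finite_subsets_at_top (period_lattice \<tau> - {0}))
     (\<lambda>F. \<Prod>\<omega>\<in>F. (1 - z / \<omega>) * exp (z / \<omega> + z\<^sup>2 / (2 * \<omega>\<^sup>2)))"

text \<open>The values at poles are normalised to 0, so that an elliptic function is determined
  everywhere by its values outside a discrete set.\<close>

definition elliptic :: "complex \<Rightarrow> (complex \<Rightarrow> complex) \<Rightarrow> bool" where
  "elliptic \<tau> f \<longleftrightarrow> f nicely_meromorphic_on UNIV \<and> (\<forall>\<omega>\<in>period_lattice \<tau>. \<forall>z. f (z + \<omega>) = f z)"


section \<open>Products of solutions, spectral polynomials and Baker--Akhiezer functions\<close>

text \<open>In this section \<open>q T z\<close> is a family of potentials with spectral parameter \<open>T\<close>,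
  holomorphic for \<open>z \<in> S\<close>. The function \<open>\<Phi>(z;T)\<close> is encoded as \<open>poly (\<Phi> z) T\<close>, where
  \<open>\<Phi> z\<close> is a polynomial in \<open>T\<close> whose coefficients are elliptic functions of \<open>z\<close>.\<close>

definition monic_elliptic_solution ::
  "complex \<Rightarrow> complex set \<Rightarrow> (complex \<Rightarrow> complex \<Rightarrow> complex) \<Rightarrow> nat \<Rightarrow> (complex \<Rightarrow> complex poly) \<Rightarrow> bool"
where
  "monic_elliptic_solution \<tau> S q d \<Phi> \<longleftrightarrow>
     (\<forall>k. elliptic \<tau> (\<lambda>z. coeff (\<Phi> z) k)) \<and>
     (\<forall>z. degree (\<Phi> z) = d \<and> lead_coeff (\<Phi> z) = 1) \<and>
     (\<forall>T. (\<lambda>z. poly (\<Phi> z) T) holomorphic_on S \<and>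
        (\<forall>z\<in>S. (deriv ^^ 3) (\<lambda>w. poly (\<Phi> w) T) z
                - 4 * q T z * deriv (\<lambda>w. poly (\<Phi> w) T) z
                - 2 * deriv (q T) z * poly (\<Phi> z) T = 0))"

definition Phi_fun ::
  "complex \<Rightarrow> complex set \<Rightarrow> (complex \<Rightarrow> complex \<Rightarrow> complex) \<Rightarrow> nat \<Rightarrow> complex \<Rightarrow> complex poly"
where
  "Phi_fun \<tau> S q d = (THE \<Phi>. monic_elliptic_solution \<tau> S q d \<Phi>)"

definition spectral_poly ::
  "complex set \<Rightarrow> (complex \<Rightarrow> complex \<Rightarrow> complex) \<Rightarrow> (complex \<Rightarrow> complex poly) \<Rightarrow> complex poly"
where
  "spectral_poly S q \<Phi> = (THE Q. \<forall>T. \<forall>z\<in>S. poly Q T =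
     q T z * (poly (\<Phi> z) T)\<^sup>2
     - 1 / 2 * poly (\<Phi> z) T * (deriv ^^ 2) (\<lambda>w. poly (\<Phi> w) T) z
     + 1 / 4 * (deriv (\<lambda>w. poly (\<Phi> w) T) z)\<^sup>2)"

text \<open>\<open>\<psi>\<close> is a branch on \<open>U\<close> of the Baker--Akhiezer function
  \<open>exp \<integral>\<^sup>z (C + \<Phi>'/2) / \<Phi>\<close>; the lower limit of the integral is free, so \<open>\<psi>\<close> is determined up to
  a constant factor. The set \<open>U\<close> avoids the singularities of the equation and the zeros of
  \<open>\<Phi>(\<cdot>;T)\<close>.\<close>

definition baker_akhiezer_on ::
  "complex set \<Rightarrow> complex set \<Rightarrow> (complex \<Rightarrow> complex poly) \<Rightarrow> complex \<times> complex
     \<Rightarrow> (complex \<Rightarrow> complex) \<Rightarrow> bool"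
where
  "baker_akhiezer_on U S \<Phi> = (\<lambda>(T, C) \<psi>.
     open U \<and> connected U \<and> U \<noteq> {} \<and> U \<subseteq> S \<and> (\<forall>z\<in>U. poly (\<Phi> z) T \<noteq> 0) \<and>
     (\<exists>G. (\<forall>z\<in>U. (G has_field_derivative
               (C + 1 / 2 * deriv (\<lambda>w. poly (\<Phi> w) T) z) / poly (\<Phi> z) T) (at z)) \<and>
          (\<forall>z\<in>U. \<psi> z = exp (G z))))"

text \<open>The value \<open>\<zeta>(s) - c \<in> \<complex> \<union> {\<infinity>}\<close>, with \<^term>\<open>None\<close> for \<open>\<infinity>\<close>.\<close>

definition kappa_value :: "complex \<Rightarrow> complex \<Rightarrow> complex \<Rightarrow> complex option" where
  "kappa_value \<tau> s c = (if s \<in> period_lattice \<tau> then None else Some (wzeta \<tau> s - c))"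


section \<open>The non-even equation\<close>

definition gle1_regular :: "complex \<Rightarrow> complex \<Rightarrow> complex set" where
  "gle1_regular p \<tau> =
     {z. z \<notin> period_lattice \<tau> \<and> z + p \<notin> period_lattice \<tau> \<and> z - p \<notin> period_lattice \<tau>}"

definition gle1_B :: "nat \<Rightarrow> complex \<Rightarrow> complex \<Rightarrow> complex \<Rightarrow> complex" where
  "gle1_B n p \<tau> T = T\<^sup>2 + (deriv ^^ 2) (wp \<tau>) p / (2 * deriv (wp \<tau>) p) * wzeta \<tau> p
     - 1 / 2 * (2 * of_nat n ^ 2 + 2 * of_nat n - 3) * wp \<tau> p"

definition gle1_q :: "nat \<Rightarrow> complex \<Rightarrow> complex \<Rightarrow> complex \<Rightarrow> complex \<Rightarrow> complex" where
  "gle1_q n p \<tau> T z =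
     of_nat n * (of_nat n + 1) * wp \<tau> z + 3 / 4 * (wp \<tau> (z + p) + wp \<tau> (z - p))
     + T * (wzeta \<tau> (z + p) + wzeta \<tau> (z - p) - 2 * wzeta \<tau> z)
     - (deriv ^^ 2) (wp \<tau>) p / (4 * deriv (wp \<tau>) p) * (wzeta \<tau> (z + p) - wzeta \<tau> (z - p))
     + gle1_B n p \<tau> T"

definition gle1_Phi :: "nat \<Rightarrow> complex \<Rightarrow> complex \<Rightarrow> complex \<Rightarrow> complex poly" where
  "gle1_Phi n p \<tau> = Phi_fun \<tau> (gle1_regular p \<tau>) (gle1_q n p \<tau>) (2 * n)"

definition gle1_Q :: "nat \<Rightarrow> complex \<Rightarrow> complex \<Rightarrow> complex poly" where
  "gle1_Q n p \<tau> = spectral_poly (gle1_regular p \<tau>) (gle1_q n p \<tau>) (gle1_Phi n p \<tau>)"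

definition gle1_Q_hat :: "nat \<Rightarrow> complex \<Rightarrow> complex \<Rightarrow> complex poly" where
  "gle1_Q_hat n p \<tau> = (THE R. \<forall>T. poly (gle1_Q n p \<tau>) T = poly R (T\<^sup>2))"

definition gle1_curve_hat :: "nat \<Rightarrow> complex \<Rightarrow> complex \<Rightarrow> (complex \<times> complex) set" where
  "gle1_curve_hat n p \<tau> = {(X, C). C\<^sup>2 = poly (gle1_Q_hat n p \<tau>) X}"

text \<open>On the domain \<open>U\<close> the square root in the denominator is a holomorphic branch \<open>r\<close>. By analytic
  continuation the choice of \<open>U\<close> and of the branches \<open>\<psi>\<close>, \<open>r\<close> is immaterial.\<close>

definition gle1_zeros ::
  "nat \<Rightarrow> complex \<Rightarrow> complex \<Rightarrow> complex \<times> complex \<Rightarrow> (nat \<Rightarrow> complex) \<Rightarrow> complex \<Rightarrow> bool"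
where
  "gle1_zeros n p \<tau> P a c \<longleftrightarrow>
     (\<exists>U \<psi> r K. baker_akhiezer_on U (gle1_regular p \<tau>) (gle1_Phi n p \<tau>) P \<psi> \<and>
        r holomorphic_on U \<and> (\<forall>z\<in>U. (r z)\<^sup>2 = wsigma \<tau> (z + p) * wsigma \<tau> (z - p)) \<and> K \<noteq> 0 \<and>
        (\<forall>z\<in>U. \<psi> z = K *
           (exp (c * z) * (\<Prod>i=1..n+1. wsigma \<tau> (z - a i)) / (wsigma \<tau> z ^ n * r z))))"

definition gle1_sigma :: "nat \<Rightarrow> complex \<Rightarrow> complex \<Rightarrow> complex \<times> complex \<Rightarrow> complex set" where
  "gle1_sigma n p \<tau> P =
     (THE s. \<exists>a c. gle1_zeros n p \<tau> P a c \<and> s = ell_point \<tau> (\<Sum>i=1..n+1. a i))"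

definition gle1_kappa :: "nat \<Rightarrow> complex \<Rightarrow> complex \<Rightarrow> complex \<times> complex \<Rightarrow> complex option" where
  "gle1_kappa n p \<tau> P =
     (THE k. \<exists>a c. gle1_zeros n p \<tau> P a c \<and> k = kappa_value \<tau> (\<Sum>i=1..n+1. a i) c)"

text \<open>Descent to the quotient by \<open>(T, C) \<mapsto> (-T, C)\<close>: the common value at all points over
  \<open>(X, C)\<close>.\<close>

definition gle1_sigma_hat :: "nat \<Rightarrow> complex \<Rightarrow> complex \<Rightarrow> complex \<times> complex \<Rightarrow> complex set" where
  "gle1_sigma_hat n p \<tau> = (\<lambda>(X, C). THE s. \<forall>T. T\<^sup>2 = X \<longrightarrow> gle1_sigma n p \<tau> (T, C) = s)"

definition gle1_kappa_hat :: "nat \<Rightarrow> complex \<Rightarrow> complex \<Rightarrow> complex \<times> complex \<Rightarrow> complex option" where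
  "gle1_kappa_hat n p \<tau> = (\<lambda>(X, C). THE k. \<forall>T. T\<^sup>2 = X \<longrightarrow> gle1_kappa n p \<tau> (T, C) = k)"


section \<open>The classical Lame equation\<close>

definition lame_q :: "nat \<Rightarrow> complex \<Rightarrow> complex \<Rightarrow> complex \<Rightarrow> complex" where
  "lame_q n \<tau> B z = of_nat n * (of_nat n + 1) * wp \<tau> z + B"

definition lame_Phi :: "nat \<Rightarrow> complex \<Rightarrow> complex \<Rightarrow> complex poly" where
  "lame_Phi n \<tau> = Phi_fun \<tau> (- period_lattice \<tau>) (lame_q n \<tau>) n"

definition lame_Q :: "nat \<Rightarrow> complex \<Rightarrow> complex poly" where
  "lame_Q n \<tau> = spectral_poly (- period_lattice \<tau>) (lame_q n \<tau>) (lame_Phi n \<tau>)"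

definition lame_curve :: "nat \<Rightarrow> complex \<Rightarrow> (complex \<times> complex) set" where
  "lame_curve n \<tau> = {(B, C). C\<^sup>2 = poly (lame_Q n \<tau>) B}"

definition lame_zeros ::
  "nat \<Rightarrow> complex \<Rightarrow> complex \<times> complex \<Rightarrow> (nat \<Rightarrow> complex) \<Rightarrow> complex \<Rightarrow> bool"
where
  "lame_zeros n \<tau> P a c \<longleftrightarrow> c = (\<Sum>j=1..n. wzeta \<tau> (a j)) \<and>
     (\<exists>U \<psi> K. baker_akhiezer_on U (- period_lattice \<tau>) (lame_Phi n \<tau>) P \<psi> \<and> K \<noteq> 0 \<and>
        (\<forall>z\<in>U. \<psi> z = K * (exp (c * z) * (\<Prod>j=1..n. wsigma \<tau> (z - a j)) / wsigma \<tau> z ^ n)))"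

definition lame_sigma :: "nat \<Rightarrow> complex \<Rightarrow> complex \<times> complex \<Rightarrow> complex set" where
  "lame_sigma n \<tau> P =
     (THE s. \<exists>a c. lame_zeros n \<tau> P a c \<and> s = ell_point \<tau> (\<Sum>j=1..n. a j))"

definition lame_kappa :: "nat \<Rightarrow> complex \<Rightarrow> complex \<times> complex \<Rightarrow> complex option" where
  "lame_kappa n \<tau> P =
     (THE k. \<exists>a c. lame_zeros n \<tau> P a c \<and> k = kappa_value \<tau> (\<Sum>j=1..n. a j) c)"


section \<open>Isomorphisms of affine plane curves\<close>

text \<open>A morphism of closed subvarieties of the affine plane is the restriction of a polynomial map;
  \<^typ>\<open>complex poly poly\<close> serves as the ring of polynomials in two variables.\<close>

definition poly2 :: "complex poly poly \<Rightarrow> complex \<times> complex \<Rightarrow> complex" where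
  "poly2 F = (\<lambda>(x, y). poly (poly F [:y:]) x)"

definition curve_morphism ::
  "(complex \<times> complex) set \<Rightarrow> (complex \<times> complex) set \<Rightarrow> (complex \<times> complex \<Rightarrow> complex \<times> complex) \<Rightarrow> bool"
where
  "curve_morphism V W f \<longleftrightarrow> f ` V \<subseteq> W \<and> (\<exists>F G. \<forall>P\<in>V. f P = (poly2 F P, poly2 G P))"

definition curve_isomorphism ::
  "(complex \<times> complex) set \<Rightarrow> (complex \<times> complex) set \<Rightarrow> (complex \<times> complex \<Rightarrow> complex \<times> complex) \<Rightarrow> bool"
where
  "curve_isomorphism V W f \<longleftrightarrow> curve_morphism V W f \<and>
     (\<exists>g. curve_morphism W V g \<and> (\<forall>P\<in>V. g (f P) = P) \<and> (\<forall>R\<in>W. f (g R) = R))"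

end

theory Submission
  imports Defs
begin

text \<open>If \<open>w\<close> solves the classical Lame equation \<open>w'' = (n(n+1) \<wp>(z) + B) w\<close> and \<open>B = T\<^sup>2 - n(n+1) \<wp>(p)\<close>, then
  \<open>(w' - T w) / sqrt (\<wp>(z) - \<wp>(p))\<close> solves the non-even equation with parameter \<open>T\<close>. Consequently the
  elliptic product of solutions of the non-even equation is an explicit expression in the classical one and its
  derivatives, and its spectral polynomial at \<open>T\<close> is the classical one at \<open>B\<close>; so the isomorphism is the
  translation \<open>(X, C) \<mapsto> (X - n(n+1) \<wp>(p), C)\<close>. On Baker--Akhiezer functions the transformation replaces the
  zeros \<open>a\<^sub>1, \<dots>, a\<^sub>n\<close> of \<open>w\<close> by the \<open>n + 1\<close> zeros of \<open>\<sigma>\<^sup>n\<^sup>+\<^sup>1 (w' - T w)\<close>, which has the same quasi-periods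
  as \<open>\<sigma>\<^sup>n\<^sup>+\<^sup>1 w\<close>. Comparing multipliers with the Legendre relation shows that the sum of the zeros and the
  exponential factor are unchanged modulo the lattice, hence so are the addition map and \<open>\<kappa>\<close>.\<close>

section \<open>The Weierstrass functions\<close>

text \<open>With \<open>B = T^2 - N wp(p)\<close> and \<open>g = wp - wp(p)\<close> the Lame
  potential is \<open>T^2 + N g\<close>, so \<open>y = w' - T w\<close> satisfies
  \<open>y' = N g w - T y\<close>. Eliminating \<open>w\<close> gives an equation for
  \<open>y\<close> with first-order coefficient \<open>g' / g\<close>, which division by
  \<open>sqrt g\<close> removes; this is the origin of the square root. The Wronskian of
  \<open>y1 / sqrt g\<close> and \<open>y2 / sqrt g\<close> is \<open>-N\<close> times that of
  \<open>w1\<close> and \<open>w2\<close>, and the factor \<open>-1/N\<close> of the normalised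
  product undoes this; hence \<open>C\<close> is preserved. The obstacle is that products, spectral
  polynomials, addition maps and \<kappa> are definite descriptions: a formula identifies them only
  once uniqueness is known at every parameter, including branch points and colliding zeros. For the
  products it comes from the local exponents, \<open>-2n, 1, 2n+2\<close> at lattice points and
  \<open>-1, 1, 3\<close> at points congruent to \<open>p\<close> or \<open>-p\<close>. For the
  zeros, none is followed individually; only multipliers under the two periods are compared, and
  their equality yields a congruence of the sums with the matching change of the exponent.\<close>

lemma has_field_derivative_infsum:
  fixes f f' :: "'a \<Rightarrow> complex \<Rightarrow> complex"
  assumes "0 < r"
    and "\<And>i w. i \<in> A \<Longrightarrow> w \<in> cball z r \<Longrightarrow> (f i has_field_derivative f' i w) (at w)"
    and "\<And>i w. i \<in> A \<Longrightarrow> w \<in> cball z r \<Longrightarrow> norm (f i w) \<le> M i"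
    and "M summable_on A"
  shows "((\<lambda>w. \<Sum>\<^sub>\<infinity>i\<in>A. f i w) has_field_derivative (\<Sum>\<^sub>\<infinity>i\<in>A. f' i z)) (at z)"
    and "(\<lambda>i. f' i z) summable_on A"
proof -
  have ul: "uniform_limit (cball z r) (\<lambda>X y. \<Sum>x\<in>X. f x y) (\<lambda>y. \<Sum>\<^sub>\<infinity>x\<in>A. f x y) (finite_subsets_at_top A)"
    by (rule Weierstrass_m_test_general) (use assms in auto)
  have ev: "eventually (\<lambda>X. continuous_on (cball z r) (\<lambda>y. \<Sum>x\<in>X. f x y) \<and>
      (\<forall>w\<in>ball z r. ((\<lambda>y. \<Sum>x\<in>X. f x y) has_field_derivative (\<Sum>x\<in>X. f' x w)) (at w))) (finite_subsets_at_top A)"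
  proof (rule eventually_finite_subsets_at_top_weakI)
    fix X assume X: "finite X" "X \<subseteq> A"
    have d: "((\<lambda>y. \<Sum>x\<in>X. f x y) has_field_derivative (\<Sum>x\<in>X. f' x w)) (at w)" if "w \<in> cball z r" for w
      using assms(2) X(2) that by (intro DERIV_sum) auto
    then show "continuous_on (cball z r) (\<lambda>y. \<Sum>x\<in>X. f x y) \<and>
      (\<forall>w\<in>ball z r. ((\<lambda>y. \<Sum>x\<in>X. f x y) has_field_derivative (\<Sum>x\<in>X. f' x w)) (at w))"
      by (auto intro!: continuous_at_imp_continuous_on DERIV_isCont)
  qed
  obtain g' where g': "\<And>w. w \<in> ball z r \<Longrightarrow> ((\<lambda>y. \<Sum>\<^sub>\<infinity>x\<in>A. f x y) has_field_derivative (g' w)) (at w) \<and>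
      ((\<lambda>X. \<Sum>x\<in>X. f' x w) \<longlongrightarrow> g' w) (finite_subsets_at_top A)"
    using has_complex_derivative_uniform_limit[OF ev ul] assms(1) by auto
  have "((\<lambda>i. f' i z) has_sum g' z) A"
    using g'[of z] assms(1) by (simp add: has_sum_def)
  then show "((\<lambda>w. \<Sum>\<^sub>\<infinity>i\<in>A. f i w) has_field_derivative (\<Sum>\<^sub>\<infinity>i\<in>A. f' i z)) (at z)"
    and "(\<lambda>i. f' i z) summable_on A"
    using g'[of z] assms(1) by (auto simp: infsumI summable_on_def)
qed

lemma summable_on_int_powr:
  fixes s :: real
  assumes "s < -1"
  shows "(\<lambda>a::int. (1 + \<bar>of_int a\<bar>) powr s) summable_on UNIV"
proof -
  have "summable (\<lambda>n. of_nat (Suc n) powr s)"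
    using summable_real_powr_iff[of s] assms by (subst summable_Suc_iff) auto
  then have "(\<lambda>n::nat. (1 + real n) powr s) summable_on UNIV"
    by (intro norm_summable_imp_summable_on) (simp add: add.commute)
  then have n: "((\<lambda>a::int. (1 + \<bar>of_int a\<bar>) powr s) \<circ> int) summable_on UNIV"
    "((\<lambda>a::int. (1 + \<bar>of_int a\<bar>) powr s) \<circ> (\<lambda>n. - int n)) summable_on UNIV"
    by (simp_all add: o_def)
  have "(\<lambda>a::int. (1 + \<bar>of_int a\<bar>) powr s) summable_on (range int \<union> range (\<lambda>n. - int n))"
    using n by (intro summable_on_union) (auto simp: summable_on_reindex inj_on_def)
  moreover have "range int \<union> range (\<lambda>n. - int n) = UNIV"
    by (auto simp: image_iff) (metis int_cases2)
  ultimately show ?thesis by simp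
qed

lemma DERIV_inverse_square:
  fixes z a :: complex
  assumes "z \<noteq> a"
  shows "((\<lambda>z. 1 / (z - a)\<^sup>2) has_field_derivative - 2 / (z - a) ^ 3) (at z)"
proof -
  have "((\<lambda>z. inverse ((z - a)\<^sup>2)) has_field_derivative - (inverse ((z - a)\<^sup>2) * (2 * (z - a)) * inverse ((z - a)\<^sup>2))) (at z)"
    using assms by (auto intro!: derivative_eq_intros)
  moreover have eq: "- (inverse (u\<^sup>2) * (2 * u) * inverse (u\<^sup>2)) = - 2 / u ^ 3" if "u \<noteq> 0" for u :: complex
    using that by (simp add: field_simps power2_eq_square power3_eq_cube)
  ultimately show ?thesis
    using assms eq[of "z - a"] DERIV_cong by (force simp: inverse_eq_divide)
qed

text \<open>The two correction terms remove the part of \<open>1 / (z - \<omega>)\<close> of order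
  at most one in \<open>z\<close>; what is left has size \<open>|\<omega>|^-3\<close>, the rate at
  which the lattice sum converges.\<close>

lemma zeta_term_eq:
  fixes z \<omega> :: complex
  assumes "\<omega> \<noteq> 0" "z \<noteq> \<omega>"
  shows "1 / (z - \<omega>) + 1 / \<omega> + z / \<omega>\<^sup>2 = z\<^sup>2 / (\<omega>\<^sup>2 * (z - \<omega>))"
  using assms by (simp add: divide_simps) (simp add: power2_eq_square algebra_simps)

lemma DERIV_zeta_term:
  fixes z \<omega> :: complex
  assumes "\<omega> \<noteq> 0" "z \<noteq> \<omega>"
  shows "((\<lambda>z. 1 / (z - \<omega>) + 1 / \<omega> + z / \<omega>\<^sup>2) has_field_derivative - (1 / (z - \<omega>)\<^sup>2 - 1 / \<omega>\<^sup>2)) (at z)"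
proof -
  have "((\<lambda>z. inverse (z - \<omega>) + 1 / \<omega> + z / \<omega>\<^sup>2) has_field_derivative - (1 / (z - \<omega>)\<^sup>2 - 1 / \<omega>\<^sup>2)) (at z)"
    using assms by (auto intro!: derivative_eq_intros simp: field_simps power2_eq_square)
  then show ?thesis by (simp add: inverse_eq_divide)
qed

lemma zeta_term_bound:
  fixes w \<omega> :: complex
  assumes "\<omega> \<noteq> 0" "\<delta> > 0" "\<delta> * norm \<omega> \<le> norm (w - \<omega>)" "norm w \<le> R"
  shows "norm (1 / (w - \<omega>) + 1 / \<omega> + w / \<omega>\<^sup>2) \<le> R\<^sup>2 / \<delta> * (1 / norm \<omega> ^ 3)"
proof -
  have "norm (w - \<omega>) > 0" using assms by (metis less_le_trans mult_pos_pos zero_less_norm_iff)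
  then have ne: "w \<noteq> \<omega>" by auto
  have "norm (1 / (w - \<omega>) + 1 / \<omega> + w / \<omega>\<^sup>2) = norm w ^ 2 / (norm \<omega> ^ 2 * norm (w - \<omega>))"
    using assms(1) ne by (simp add: zeta_term_eq norm_divide norm_mult norm_power)
  also have "\<dots> \<le> R\<^sup>2 / (norm \<omega> ^ 2 * (\<delta> * norm \<omega>))"
    using assms by (intro frac_le power_mono mult_left_mono mult_pos_pos) auto
  also have "\<dots> = R\<^sup>2 / \<delta> * (1 / norm \<omega> ^ 3)"
    by (simp add: power2_eq_square power3_eq_cube)
  finally show ?thesis .
qed

section \<open>The period lattice: size of its points, absolute convergence, separation\<close>

locale upper_half =
  fixes \<tau> :: complex
  assumes Im_tau: "0 < Im \<tau>"
begin

abbreviation "\<Lambda> \<equiv> period_lattice \<tau>"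

lemma latticeI: "of_int a + of_int b * \<tau> \<in> \<Lambda>"
  by (auto simp: period_lattice_def)

lemma lattice_0 [simp]: "0 \<in> \<Lambda>"
  using latticeI[of 0 0] by simp

lemma lattice_1 [simp]: "1 \<in> \<Lambda>"
  using latticeI[of 1 0] by simp

lemma lattice_tau [simp]: "\<tau> \<in> \<Lambda>"
  using latticeI[of 0 1] by simp

lemma lattice_add: "x \<in> \<Lambda> \<Longrightarrow> y \<in> \<Lambda> \<Longrightarrow> x + y \<in> \<Lambda>"
proof -
  assume "x \<in> \<Lambda>" "y \<in> \<Lambda>"
  then obtain a b c d where "x = of_int a + of_int b * \<tau>" "y = of_int c + of_int d * \<tau>"
    by (auto simp: period_lattice_def)
  then have "x + y = of_int (a + c) + of_int (b + d) * \<tau>"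
    by (simp add: algebra_simps)
  then show ?thesis by (metis latticeI)
qed

lemma lattice_uminus: "x \<in> \<Lambda> \<Longrightarrow> - x \<in> \<Lambda>"
proof -
  assume "x \<in> \<Lambda>"
  then obtain a b where "x = of_int a + of_int b * \<tau>"
    by (auto simp: period_lattice_def)
  then have "- x = of_int (- a) + of_int (- b) * \<tau>" by simp
  then show ?thesis by (metis latticeI)
qed

lemma lattice_uminus_iff [simp]: "- x \<in> \<Lambda> \<longleftrightarrow> x \<in> \<Lambda>"
  using lattice_uminus[of x] lattice_uminus[of "-x"] by auto

lemma lattice_diff: "x \<in> \<Lambda> \<Longrightarrow> y \<in> \<Lambda> \<Longrightarrow> x - y \<in> \<Lambda>"
  using lattice_add[of x "-y"] by simp

lemma lattice_add_iff [simp]: "x \<in> \<Lambda> \<Longrightarrow> z + x \<in> \<Lambda> \<longleftrightarrow> z \<in> \<Lambda>"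
  using lattice_add[of z x] lattice_diff[of "z + x" x] by auto

lemma lattice_coords_eq:
  assumes "of_int a + of_int b * \<tau> = of_int c + of_int d * \<tau>"
  shows "a = c \<and> b = d"
proof -
  from assms have "Im (of_int a + of_int b * \<tau>) = Im (of_int c + of_int d * \<tau>)" by simp
  then have "b = d" using Im_tau by simp
  with assms show ?thesis by simp
qed

text \<open>The imaginary part controls \<open>b\<close>, and then \<open>a = w - b \<tau>\<close>
  is controlled by the triangle inequality. All counting of lattice points rests on this comparison
  with \<open>|a| + |b|\<close>.\<close>

lemma lattice_norm_ge:
  obtains c where "c > 0" "\<And>a b. c * (\<bar>of_int a\<bar> + \<bar>of_int b\<bar>) \<le> norm (of_int a + of_int b * \<tau>)"
proof -
  define y where "y = Im \<tau>"
  have y: "y > 0" using Im_tau by (simp add: y_def)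
  define K where "K = 1 + (norm \<tau> + 1) / y"
  have K: "K > 0" using y by (auto simp: K_def intro!: add_pos_nonneg)
  show ?thesis
  proof (rule that[of "1 / K"])
    fix a b :: int
    define w where "w = of_int a + of_int b * \<tau>"
    have "\<bar>of_int b\<bar> * y = \<bar>Im w\<bar>" using y by (simp add: w_def y_def abs_mult)
    also have "\<dots> \<le> norm w" by (rule abs_Im_le_cmod)
    finally have b: "\<bar>of_int b\<bar> \<le> norm w / y" using y by (simp add: field_simps)
    have "\<bar>of_int a :: real\<bar> = norm (w - of_int b * \<tau>)" by (simp add: w_def)
    also have "\<dots> \<le> norm w + \<bar>of_int b\<bar> * norm \<tau>"
      using norm_triangle_ineq4[of w "of_int b * \<tau>"] by (simp add: norm_mult)
    also have "\<dots> \<le> norm w + norm w / y * norm \<tau>"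
      using b by (intro add_left_mono mult_right_mono) auto
    finally have "\<bar>of_int a\<bar> + \<bar>of_int b\<bar> \<le> norm w + norm w / y * norm \<tau> + norm w / y"
      using b by linarith
    also have "\<dots> = K * norm w" using y by (simp add: K_def field_simps)
    finally show "1 / K * (\<bar>of_int a\<bar> + \<bar>of_int b\<bar>) \<le> norm (of_int a + of_int b * \<tau>)"
      using K by (simp add: w_def field_simps)
  qed (use K in auto)
qed

lemma finite_lattice_norm_le: "finite {\<omega>\<in>\<Lambda>. norm \<omega> \<le> R}"
proof -
  obtain c where c: "c > 0" "\<And>a b. c * (\<bar>of_int a\<bar> + \<bar>of_int b\<bar>) \<le> norm (of_int a + of_int b * \<tau>)"
    by (rule lattice_norm_ge) blast
  define m where "m = \<lceil>R / c\<rceil>"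
  have "{\<omega>\<in>\<Lambda>. norm \<omega> \<le> R} \<subseteq> (\<lambda>(a,b). of_int a + of_int b * \<tau>) ` ({-m..m} \<times> {-m..m})"
  proof
    fix \<omega> assume "\<omega> \<in> {\<omega>\<in>\<Lambda>. norm \<omega> \<le> R}"
    then obtain a b where w: "\<omega> = of_int a + of_int b * \<tau>" "norm \<omega> \<le> R"
      by (auto simp: period_lattice_def)
    have "c * (\<bar>of_int a\<bar> + \<bar>of_int b\<bar>) \<le> R" using c(2)[of a b] w by simp
    then have "\<bar>of_int a\<bar> + \<bar>of_int b\<bar> \<le> R / c" using c(1) by (simp add: field_simps)
    then have "of_int \<bar>a\<bar> \<le> R / c" "of_int \<bar>b\<bar> \<le> R / c" by auto
    then have "\<bar>a\<bar> \<le> m" "\<bar>b\<bar> \<le> m" unfolding m_def by linarith+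
    then show "\<omega> \<in> (\<lambda>(a,b). of_int a + of_int b * \<tau>) ` ({-m..m} \<times> {-m..m})"
      using w by (auto simp: abs_le_iff)
  qed
  then show ?thesis by (rule finite_subset) auto
qed

text \<open>With \<open>s = |a| + |b|\<close> at least 1, both \<open>1 + |a|\<close> and
  \<open>1 + |b|\<close> are at most \<open>2 s\<close>, so \<open>s^-3\<close> is dominated by a
  constant times the product of their powers with exponent \<open>-3/2\<close>. The double series is
  thereby bounded by a product of two convergent single series.\<close>

lemma lattice_summable: "(\<lambda>\<omega>. 1 / norm \<omega> ^ 3) summable_on (\<Lambda> - {0})"
proof -
  obtain c where c: "c > 0" "\<And>a b. c * (\<bar>of_int a\<bar> + \<bar>of_int b\<bar>) \<le> norm (of_int a + of_int b * \<tau>)"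
    by (rule lattice_norm_ge) blast
  let ?e = "\<lambda>(a::int,b::int). of_int a + of_int b * \<tau>"
  let ?p = "\<lambda>a::int. (1 + \<bar>of_int a\<bar>) powr (-3/2) :: real"
  have inj: "inj ?e"
    using lattice_coords_eq by (auto simp: inj_on_def)
  have img: "\<Lambda> - {0} = ?e ` (UNIV - {(0,0)})"
  proof -
    have "\<Lambda> = range ?e" by (auto simp: period_lattice_def)
    moreover have "?e ` (UNIV - {(0,0)}) = range ?e - ?e ` {(0,0)}"
      by (rule image_set_diff[OF inj])
    ultimately show ?thesis by simp
  qed
  have "(\<lambda>(a,b). ?p a * ?p b) summable_on (UNIV \<times> UNIV)"
  proof (rule summable_on_SigmaI)
    have s: "?p summable_on UNIV" by (rule summable_on_int_powr) simp
    show "((\<lambda>b. case (a, b) of (a,b) \<Rightarrow> ?p a * ?p b) has_sum ?p a * infsum ?p UNIV) UNIV" for a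
      using has_sum_cmult_right[OF has_sum_infsum[OF s]] by simp
    show "(\<lambda>a. ?p a * infsum ?p UNIV) summable_on UNIV"
      using s by (rule summable_on_cmult_left)
  qed auto
  then have "(\<lambda>x. (8 / c^3) * (\<lambda>(a,b). ?p a * ?p b) x) summable_on (UNIV \<times> UNIV)"
    by (rule summable_on_cmult_right)
  then have s2: "(\<lambda>x. (8 / c^3) * (\<lambda>(a,b). ?p a * ?p b) x) summable_on (UNIV - {(0,0)})"
    by (rule summable_on_subset_banach) auto
  have "(\<lambda>x. 1 / norm (?e x) ^ 3) summable_on (UNIV - {(0,0)})"
  proof (rule summable_on_comparison_test[OF s2])
    fix x :: "int \<times> int" assume "x \<in> UNIV - {(0,0)}"
    then obtain a b where x: "x = (a,b)" "(a,b) \<noteq> (0,0)" by (cases x) auto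
    define s :: real where "s = \<bar>of_int a\<bar> + \<bar>of_int b\<bar>"
    have s1: "s \<ge> 1"
    proof -
      have "\<bar>a\<bar> + \<bar>b\<bar> \<ge> 1" using x(2) by auto
      then have "of_int (\<bar>a\<bar> + \<bar>b\<bar>) \<ge> (1::real)" by linarith
      then show ?thesis by (simp add: s_def)
    qed
    have "(1 + \<bar>of_int a\<bar>) \<le> 2 * s" "(1 + \<bar>of_int b\<bar>) \<le> 2 * s"
      using s1 by (auto simp: s_def)
    then have "(2 * s) powr (-3/2) * (2 * s) powr (-3/2) \<le> ?p a * ?p b"
      by (intro mult_mono powr_mono2') auto
    also have "(2 * s) powr (-3/2) * (2 * s) powr (-3/2) = (2 * s) powr (-3)"
      by (simp add: powr_add[symmetric])
    also have "(2 * s) powr (-3) = 1 / (2 * s)^3"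
      using s1 by (simp add: powr_minus_divide powr_numeral)
    finally have p: "1 / (8 * s^3) \<le> ?p a * ?p b" by (simp add: power_mult_distrib)
    have "(c * s)^3 \<le> norm (?e x) ^ 3"
      using c(2)[of a b] c(1) s1 by (intro power_mono) (auto simp: x s_def)
    then have "1 / norm (?e x) ^ 3 \<le> 1 / (c * s)^3"
      using c(1) s1 by (intro frac_le) auto
    also have "\<dots> = (8 / c^3) * (1 / (8 * s^3))" by (simp add: power_mult_distrib)
    also have "\<dots> \<le> (8 / c^3) * (?p a * ?p b)"
      using p c(1) by (intro mult_left_mono) auto
    finally show "1 / norm (?e x) ^ 3 \<le> (8 / c^3) * (\<lambda>(a,b). ?p a * ?p b) x" by (simp add: x)
  qed auto
  then have "((\<lambda>\<omega>. 1 / norm \<omega> ^ 3) \<circ> ?e) summable_on (UNIV - {(0,0)})" by (simp add: o_def)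
  then show ?thesis
    unfolding img using summable_on_reindex[OF inj_on_subset[OF inj], of "UNIV - {(0,0)}" "\<lambda>\<omega>. 1 / norm \<omega> ^ 3"] by simp
qed

lemma closed_lattice_subset:
  assumes "X \<subseteq> \<Lambda>" shows "closed X"
proof -
  have "open (- X)"
  proof (subst open_subopen, rule ballI)
    fix x assume x: "x \<in> - X"
    let ?F = "X \<inter> cball 0 (norm x + 1)"
    have "finite ?F"
      by (rule finite_subset[OF _ finite_lattice_norm_le[of "norm x + 1"]]) (use assms in auto)
    then have "open (ball x 1 - ?F)" by (intro open_Diff finite_imp_closed) auto
    moreover have "x \<in> ball x 1 - ?F" using x by auto
    moreover have "ball x 1 - ?F \<subseteq> - X"
    proof
      fix y assume y: "y \<in> ball x 1 - ?F"
      then have "dist x y < 1" by simp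
      then have "norm y \<le> norm x + 1"
        using norm_triangle_ineq2[of y x] by (simp add: dist_norm norm_minus_commute)
      then show "y \<in> - X" using y by auto
    qed
    ultimately show "\<exists>T. open T \<and> x \<in> T \<and> T \<subseteq> - X" by blast
  qed
  then show ?thesis by (simp add: closed_def)
qed

lemma lattice_sep:
  assumes "z \<notin> \<Lambda> - {0}"
  obtains r \<delta> where "r > 0" "\<delta> > 0"
    "\<And>w \<omega>. w \<in> cball z r \<Longrightarrow> \<omega> \<in> \<Lambda> - {0} \<Longrightarrow> \<delta> * norm \<omega> \<le> norm (w - \<omega>)"
proof -
  have "open (- (\<Lambda> - {0}))" using closed_lattice_subset[of "\<Lambda> - {0}"] by (intro open_Compl) auto
  then obtain d where d: "d > 0" "ball z d \<subseteq> - (\<Lambda> - {0})"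
    using assms by (meson ComplI openE)
  define r where "r = d / 2"
  define R where "R = norm z + r"
  have R: "R > 0" "r > 0" using d by (auto simp: R_def r_def add_nonneg_pos)
  \<comment> \<open>The entry \<open>1/2\<close> serves the lattice points of norm above
    \<open>2 R\<close>, which are at distance at least \<open>|\<omega>| / 2\<close> from the disc;
    the other serves the near ones, which stay at distance at least \<open>r\<close> from
    it.\<close>
  define \<delta> where "\<delta> = min (1/2) (r / (2 * R))"
  show ?thesis
  proof (rule that[of r \<delta>])
    show "\<delta> > 0" using R by (simp add: \<delta>_def)
    fix w \<omega> assume w: "w \<in> cball z r" and om: "\<omega> \<in> \<Lambda> - {0}"
    have wR: "norm w \<le> R"
      using w norm_triangle_ineq2[of w z] by (auto simp: R_def dist_norm norm_minus_commute)
    have "\<omega> \<notin> ball z d" using d om by auto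
    then have "norm (z - \<omega>) \<ge> 2 * r" by (auto simp: r_def dist_norm)
    moreover have "norm (z - \<omega>) \<le> norm (z - w) + norm (w - \<omega>)"
      using norm_triangle_ineq[of "z - w" "w - \<omega>"] by simp
    ultimately have wr: "norm (w - \<omega>) \<ge> r" using w by (auto simp: dist_norm)
    show "\<delta> * norm \<omega> \<le> norm (w - \<omega>)"
    proof (cases "norm \<omega> \<le> 2 * R")
      case True
      have "\<delta> * norm \<omega> \<le> r / (2 * R) * (2 * R)"
        using True R by (intro mult_mono) (auto simp: \<delta>_def)
      also have "\<dots> = r" using R by simp
      finally show ?thesis using wr by simp
    next
      case False
      have "\<delta> * norm \<omega> \<le> 1/2 * norm \<omega>" by (intro mult_right_mono) (auto simp: \<delta>_def)
      also have "\<dots> \<le> norm \<omega> - norm w" using False wR by simp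
      also have "\<dots> \<le> norm (w - \<omega>)" by (metis norm_minus_commute norm_triangle_ineq2)
      finally show ?thesis .
    qed
  qed (use R in auto)
qed

section \<open>Weierstrass zeta and wp: regular parts, derivatives and parity\<close>

definition lreg :: "complex set" where "lreg = - \<Lambda>"

lemma open_lreg: "open lreg"
  using closed_lattice_subset[of \<Lambda>] by (auto simp: lreg_def)

lemma lreg_iff: "z \<in> lreg \<longleftrightarrow> z \<notin> \<Lambda>"
  by (simp add: lreg_def)

text \<open>The zeta function without its pole at 0: it is holomorphic at the origin, where the
  limits and expansions of the later sections are taken. \<open>wp_reg\<close> plays the same role
  for \<open>wp\<close>.\<close>

definition zeta_reg :: "complex \<Rightarrow> complex" where
  "zeta_reg z = (\<Sum>\<^sub>\<infinity>\<omega>\<in>\<Lambda> - {0}. 1 / (z - \<omega>) + 1 / \<omega> + z / \<omega>\<^sup>2)"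

definition wp_reg :: "complex \<Rightarrow> complex" where
  "wp_reg z = (\<Sum>\<^sub>\<infinity>\<omega>\<in>\<Lambda> - {0}. 1 / (z - \<omega>)\<^sup>2 - 1 / \<omega>\<^sup>2)"

lemma wzeta_eq: "wzeta \<tau> z = 1 / z + zeta_reg z"
  by (simp add: wzeta_def zeta_reg_def)

lemma wp_eq: "wp \<tau> z = 1 / z\<^sup>2 + wp_reg z"
  by (simp add: wp_def wp_reg_def)

lemma DERIV_zeta_reg:
  assumes "z \<notin> \<Lambda> - {0}"
  shows "(zeta_reg has_field_derivative - wp_reg z) (at z)"
proof -
  obtain r \<delta> where r: "r > 0" "\<delta> > 0"
    "\<And>w \<omega>. w \<in> cball z r \<Longrightarrow> \<omega> \<in> \<Lambda> - {0} \<Longrightarrow> \<delta> * norm \<omega> \<le> norm (w - \<omega>)"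
    using lattice_sep[OF assms] by metis
  define R where "R = norm z + r"
  have wR: "norm w \<le> R" if "w \<in> cball z r" for w
    using that norm_triangle_ineq2[of w z] by (auto simp: R_def dist_norm norm_minus_commute)
  have ne: "w \<noteq> \<omega>" if "w \<in> cball z r" "\<omega> \<in> \<Lambda> - {0}" for w \<omega>
  proof -
    have "0 < \<delta> * norm \<omega>" using r(2) that(2) by simp
    then show ?thesis using r(3)[OF that] by auto
  qed
  have "((\<lambda>w. \<Sum>\<^sub>\<infinity>\<omega>\<in>\<Lambda> - {0}. 1 / (w - \<omega>) + 1 / \<omega> + w / \<omega>\<^sup>2) has_field_derivative
      (\<Sum>\<^sub>\<infinity>\<omega>\<in>\<Lambda> - {0}. - (1 / (z - \<omega>)\<^sup>2 - 1 / \<omega>\<^sup>2))) (at z)"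
  proof (rule has_field_derivative_infsum(1)[OF r(1)])
    show "((\<lambda>w. 1 / (w - \<omega>) + 1 / \<omega> + w / \<omega>\<^sup>2) has_field_derivative - (1 / (w - \<omega>)\<^sup>2 - 1 / \<omega>\<^sup>2)) (at w)"
      if "\<omega> \<in> \<Lambda> - {0}" "w \<in> cball z r" for \<omega> w
      using that ne[OF that(2,1)] by (intro DERIV_zeta_term) auto
    show "norm (1 / (w - \<omega>) + 1 / \<omega> + w / \<omega>\<^sup>2) \<le> R\<^sup>2 / \<delta> * (1 / norm \<omega> ^ 3)"
      if "\<omega> \<in> \<Lambda> - {0}" "w \<in> cball z r" for \<omega> w
      using that r(2,3) wR by (intro zeta_term_bound) auto
    show "(\<lambda>\<omega>. R\<^sup>2 / \<delta> * (1 / norm \<omega> ^ 3)) summable_on \<Lambda> - {0}"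
      by (rule summable_on_cmult_right[OF lattice_summable])
  qed
  moreover have "(\<Sum>\<^sub>\<infinity>\<omega>\<in>\<Lambda> - {0}. - (1 / (z - \<omega>)\<^sup>2 - 1 / \<omega>\<^sup>2)) = - wp_reg z"
    unfolding wp_reg_def by (rule infsum_uminus)
  ultimately show ?thesis by (simp add: zeta_reg_def[abs_def])
qed

definition wp_reg' :: "complex \<Rightarrow> complex" where
  "wp_reg' z = (\<Sum>\<^sub>\<infinity>\<omega>\<in>\<Lambda> - {0}. - 2 / (z - \<omega>) ^ 3)"

lemma DERIV_wp_reg:
  assumes "z \<notin> \<Lambda> - {0}"
  shows "(wp_reg has_field_derivative wp_reg' z) (at z)"
    and "(\<lambda>\<omega>. - 2 / (z - \<omega>) ^ 3) summable_on \<Lambda> - {0}"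
proof -
  obtain r \<delta> where r: "r > 0" "\<delta> > 0"
    "\<And>w \<omega>. w \<in> cball z r \<Longrightarrow> \<omega> \<in> \<Lambda> - {0} \<Longrightarrow> \<delta> * norm \<omega> \<le> norm (w - \<omega>)"
    using lattice_sep[OF assms] by metis
  define R where "R = norm z + r"
  have wR: "norm w \<le> R" if "w \<in> cball z r" for w
    using that norm_triangle_ineq2[of w z] by (auto simp: R_def dist_norm norm_minus_commute)
  have R: "R > 0" using r by (simp add: R_def add_nonneg_pos)
  have ne: "w \<noteq> \<omega>" if "w \<in> cball z r" "\<omega> \<in> \<Lambda> - {0}" for w \<omega>
  proof -
    have "0 < \<delta> * norm \<omega>" using r(2) that(2) by simp
    then show ?thesis using r(3)[OF that] by auto
  qed
  have bound: "norm (1 / (w - \<omega>)\<^sup>2 - 1 / \<omega>\<^sup>2) \<le> (R / \<delta> + R / \<delta>\<^sup>2) * (1 / norm \<omega> ^ 3)"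
    if "\<omega> \<in> \<Lambda> - {0}" "w \<in> cball z r" for \<omega> w
  proof -
    have o: "\<omega> \<noteq> 0" "w \<noteq> \<omega>" using that ne by auto
    have b: "\<delta> * norm \<omega> \<le> norm (w - \<omega>)" using r that by auto
    have po: "norm \<omega> > 0" "\<delta> * norm \<omega> > 0" using o r by auto
    have eq: "1 / (w - \<omega>)\<^sup>2 - 1 / \<omega>\<^sup>2 = w / (\<omega> * (w - \<omega>)\<^sup>2) - w / (\<omega>\<^sup>2 * (w - \<omega>))"
      using o by (simp add: divide_simps) (simp add: power2_eq_square algebra_simps)
    have "norm (1 / (w - \<omega>)\<^sup>2 - 1 / \<omega>\<^sup>2) \<le> norm w / (norm \<omega> * norm (w - \<omega>) ^ 2) + norm w / (norm \<omega> ^ 2 * norm (w - \<omega>))"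
      unfolding eq by (rule order.trans[OF norm_triangle_ineq4]) (simp add: norm_divide norm_mult norm_power)
    also have "\<dots> \<le> R / (norm \<omega> * (\<delta> * norm \<omega>) ^ 2) + R / (norm \<omega> ^ 2 * (\<delta> * norm \<omega>))"
      using wR[OF that(2)] R b po r(2)
      by (intro add_mono frac_le mult_left_mono power_mono mult_pos_pos zero_less_power) auto
    also have "\<dots> = (R / \<delta> + R / \<delta>\<^sup>2) * (1 / norm \<omega> ^ 3)"
      using po r(2) by (simp add: divide_simps) (simp add: power2_eq_square power3_eq_cube algebra_simps)
    finally show ?thesis .
  qed
  have d: "((\<lambda>w. 1 / (w - \<omega>)\<^sup>2 - 1 / \<omega>\<^sup>2) has_field_derivative - 2 / (w - \<omega>) ^ 3) (at w)"
    if "\<omega> \<in> \<Lambda> - {0}" "w \<in> cball z r" for \<omega> w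
    using DERIV_diff[OF DERIV_inverse_square[OF ne[OF that(2,1)]] DERIV_const] by simp
  note * = has_field_derivative_infsum[where M = "\<lambda>\<omega>. (R / \<delta> + R / \<delta>\<^sup>2) * (1 / norm \<omega> ^ 3)"
      and A = "\<Lambda> - {0}", OF r(1) d bound summable_on_cmult_right[OF lattice_summable]]
  show "(wp_reg has_field_derivative wp_reg' z) (at z)"
    using *(1) by (simp add: wp_reg_def[abs_def] wp_reg'_def)
  show "(\<lambda>\<omega>. - 2 / (z - \<omega>) ^ 3) summable_on \<Lambda> - {0}"
    using *(2) by simp
qed

lemma infsum_lattice_uminus: "(\<Sum>\<^sub>\<infinity>\<omega>\<in>\<Lambda> - {0}. f (- \<omega>)) = (\<Sum>\<^sub>\<infinity>\<omega>\<in>\<Lambda> - {0}. f \<omega>)" for f :: "complex \<Rightarrow> complex"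
  by (rule infsum_reindex_bij_witness[where i = uminus and j = uminus]) auto

lemma zeta_reg_odd: "zeta_reg (- z) = - zeta_reg z"
proof -
  have "zeta_reg (- z) = (\<Sum>\<^sub>\<infinity>\<omega>\<in>\<Lambda> - {0}. 1 / (- z - (- \<omega>)) + 1 / (- \<omega>) + - z / (- \<omega>)\<^sup>2)"
    unfolding zeta_reg_def using infsum_lattice_uminus[of "\<lambda>\<omega>. 1 / (- z - \<omega>) + 1 / \<omega> + - z / \<omega>\<^sup>2"] by simp
  also have "\<dots> = (\<Sum>\<^sub>\<infinity>\<omega>\<in>\<Lambda> - {0}. - (1 / (z - \<omega>) + 1 / \<omega> + z / \<omega>\<^sup>2))"
  proof (rule infsum_cong)
    fix \<omega> show "1 / (- z - (- \<omega>)) + 1 / (- \<omega>) + - z / (- \<omega>)\<^sup>2 = - (1 / (z - \<omega>) + 1 / \<omega> + z / \<omega>\<^sup>2)"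
      using minus_divide_right[of 1 "z - \<omega>"] by simp
  qed
  finally show ?thesis by (simp only: infsum_uminus zeta_reg_def)
qed

lemma wp_reg_even: "wp_reg (- z) = wp_reg z"
proof -
  have "wp_reg (- z) = (\<Sum>\<^sub>\<infinity>\<omega>\<in>\<Lambda> - {0}. 1 / (- z - (- \<omega>))\<^sup>2 - 1 / (- \<omega>)\<^sup>2)"
    unfolding wp_reg_def using infsum_lattice_uminus[of "\<lambda>\<omega>. 1 / (- z - \<omega>)\<^sup>2 - 1 / \<omega>\<^sup>2"] by simp
  also have "\<dots> = wp_reg z"
    unfolding wp_reg_def by (rule infsum_cong) (simp add: power2_commute)
  finally show ?thesis .
qed

lemma wzeta_odd: "wzeta \<tau> (- z) = - wzeta \<tau> z"
  by (simp add: wzeta_eq zeta_reg_odd)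

lemma wp_even: "wp \<tau> (- z) = wp \<tau> z"
  by (simp add: wp_eq wp_reg_even)

lemma zeta_reg_0 [simp]: "zeta_reg 0 = 0"
  using zeta_reg_odd[of 0] by simp

lemma wp_reg_0 [simp]: "wp_reg 0 = 0"
  by (simp add: wp_reg_def)

definition wp' :: "complex \<Rightarrow> complex" where
  "wp' z = - 2 / z ^ 3 + wp_reg' z"

lemma DERIV_wzeta:
  assumes "z \<notin> \<Lambda>" shows "(wzeta \<tau> has_field_derivative - wp \<tau> z) (at z)"
proof -
  have "z \<noteq> 0" using assms by auto
  then have "((\<lambda>z. 1 / z + zeta_reg z) has_field_derivative - (1 / z\<^sup>2) + - wp_reg z) (at z)"
    using assms by (intro DERIV_add DERIV_zeta_reg) (auto intro!: derivative_eq_intros simp: power2_eq_square)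
  then show ?thesis by (simp add: wzeta_eq[abs_def] wp_eq)
qed

lemma DERIV_wp:
  assumes "z \<notin> \<Lambda>" shows "(wp \<tau> has_field_derivative wp' z) (at z)"
proof -
  have z: "z \<noteq> 0" using assms by auto
  have "((\<lambda>z. 1 / z\<^sup>2) has_field_derivative - 2 / z ^ 3) (at z)"
    using DERIV_inverse_square[OF z] by simp
  then have "((\<lambda>z. 1 / z\<^sup>2 + wp_reg z) has_field_derivative - 2 / z ^ 3 + wp_reg' z) (at z)"
    using assms by (intro DERIV_add DERIV_wp_reg) auto
  then show ?thesis by (simp add: wp_eq[abs_def] wp'_def)
qed

text \<open>The cubes converge absolutely without correction terms, so the sum may run over the
  whole lattice and translation by a period becomes a mere reindexing. Periodicity of
  \<open>wp\<close> and quasi-periodicity of zeta and sigma are all integrated up from here.\<close>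

lemma wp'_sum:
  assumes "z \<notin> \<Lambda>" shows "wp' z = (\<Sum>\<^sub>\<infinity>\<omega>\<in>\<Lambda>. - 2 / (z - \<omega>) ^ 3)"
proof -
  have "(\<Sum>\<^sub>\<infinity>\<omega>\<in>insert 0 (\<Lambda> - {0}). - 2 / (z - \<omega>) ^ 3) = - 2 / z ^ 3 + wp_reg' z"
    unfolding wp_reg'_def using DERIV_wp_reg(2)[of z] assms by (subst infsum_insert) auto
  then show ?thesis by (simp add: wp'_def insert_absorb)
qed

lemma wp'_periodic:
  assumes "l \<in> \<Lambda>" "z \<notin> \<Lambda>" shows "wp' (z + l) = wp' z"
proof -
  have "wp' (z + l) = (\<Sum>\<^sub>\<infinity>\<omega>\<in>\<Lambda>. - 2 / (z + l - \<omega>) ^ 3)"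
    using assms by (intro wp'_sum) auto
  also have "\<dots> = (\<Sum>\<^sub>\<infinity>\<omega>\<in>\<Lambda>. - 2 / (z - \<omega>) ^ 3)"
    by (rule infsum_reindex_bij_witness[where i = "\<lambda>\<omega>. \<omega> + l" and j = "\<lambda>\<omega>. \<omega> - l"])
       (use assms in \<open>auto simp: lattice_diff lattice_add algebra_simps\<close>)
  finally show ?thesis using assms by (simp add: wp'_sum)
qed

end

section \<open>The sigma function: convergence of the product and logarithmic derivative\<close>

lemma has_field_derivative_prod_log:
  fixes f L :: "'a \<Rightarrow> complex \<Rightarrow> complex"
  assumes "finite A" "\<And>i. i \<in> A \<Longrightarrow> (f i has_field_derivative L i z * f i z) (at z)"
  shows "((\<lambda>w. \<Prod>i\<in>A. f i w) has_field_derivative (\<Sum>i\<in>A. L i z) * (\<Prod>i\<in>A. f i z)) (at z)"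
  using assms
proof (induction A rule: finite_induct)
  case (insert x F)
  have "((\<lambda>w. f x w * (\<Prod>i\<in>F. f i w)) has_field_derivative
     (L x z * f x z) * (\<Prod>i\<in>F. f i z) + ((\<Sum>i\<in>F. L i z) * (\<Prod>i\<in>F. f i z)) * f x z) (at z)"
    by (intro DERIV_mult insert) (use insert in auto)
  then show ?case using insert.hyps by (simp add: algebra_simps)
qed auto

definition sigma_factor :: "complex \<Rightarrow> complex \<Rightarrow> complex" where
  "sigma_factor \<omega> z = (1 - z / \<omega>) * exp (z / \<omega> + z\<^sup>2 / (2 * \<omega>\<^sup>2))"

definition sigma_log :: "complex \<Rightarrow> complex \<Rightarrow> complex" where
  "sigma_log \<omega> z = Ln (1 - z / \<omega>) + (z / \<omega> + z\<^sup>2 / (2 * \<omega>\<^sup>2))"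

lemma DERIV_sigma_factor:
  assumes "\<omega> \<noteq> 0" "z \<noteq> \<omega>"
  shows "(sigma_factor \<omega> has_field_derivative (1 / (z - \<omega>) + 1 / \<omega> + z / \<omega>\<^sup>2) * sigma_factor \<omega> z) (at z)"
proof -
  define e where "e = (\<lambda>z. exp (z / \<omega> + z\<^sup>2 / (2 * \<omega>\<^sup>2)))"
  have e: "(e has_field_derivative (1 / \<omega> + z / \<omega>\<^sup>2) * e z) (at z)"
    unfolding e_def using assms by (auto intro!: derivative_eq_intros simp: field_simps power2_eq_square)
  have "((\<lambda>z. 1 - z / \<omega>) has_field_derivative - (1 / \<omega>)) (at z)"
    using assms by (auto intro!: derivative_eq_intros)
  from DERIV_mult[OF this e]
  have "((\<lambda>z. (1 - z / \<omega>) * e z) has_field_derivative - (1 / \<omega>) * e z + (1 / \<omega> + z / \<omega>\<^sup>2) * e z * (1 - z / \<omega>)) (at z)" .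
  moreover have q: "- (1 / \<omega>) = 1 / (z - \<omega>) * (1 - z / \<omega>)"
    using assms by (simp add: field_simps)
  have alg: "(m * q) * e z + (a + b) * e z * q = (m + a + b) * (q * e z)" for m q a b
    by (simp add: algebra_simps)
  have "- (1 / \<omega>) * e z + (1 / \<omega> + z / \<omega>\<^sup>2) * e z * (1 - z / \<omega>) = (1 / (z - \<omega>) + 1 / \<omega> + z / \<omega>\<^sup>2) * ((1 - z / \<omega>) * e z)"
    unfolding q by (rule alg)
  ultimately have "((\<lambda>z. (1 - z / \<omega>) * e z) has_field_derivative (1 / (z - \<omega>) + 1 / \<omega> + z / \<omega>\<^sup>2) * ((1 - z / \<omega>) * e z)) (at z)"
    by (simp only:)
  then show ?thesis by (simp add: sigma_factor_def[abs_def] e_def)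
qed

lemma sigma_factor_eq_0: "\<omega> \<noteq> 0 \<Longrightarrow> sigma_factor \<omega> z = 0 \<longleftrightarrow> z = \<omega>"
  by (auto simp: sigma_factor_def)

lemma sigma_factor_0 [simp]: "sigma_factor \<omega> 0 = 1"
  by (simp add: sigma_factor_def)

lemma exp_sigma_log: "1 - z / \<omega> \<noteq> 0 \<Longrightarrow> exp (sigma_log \<omega> z) = sigma_factor \<omega> z"
  by (simp add: sigma_log_def sigma_factor_def exp_add)

text \<open>For \<open>|\<omega>| > 2 R\<close> the quotient \<open>w / \<omega>\<close> has modulus
  below 1, so \<open>1 - w / \<omega>\<close> stays in the right half-plane and the principal
  logarithm is holomorphic on the disc. Its derivative is the term of the zeta series, and
  integration from 0, where the logarithm vanishes, yields the cubic bound.\<close>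

lemma sigma_log_small:
  assumes "0 < R" "2 * R < norm \<omega>" "norm w \<le> R"
  shows "1 - w / \<omega> \<noteq> 0"
    and "(sigma_log \<omega> has_field_derivative (1 / (w - \<omega>) + 1 / \<omega> + w / \<omega>\<^sup>2)) (at w)"
    and "norm (sigma_log \<omega> w) \<le> (2 * R ^ 3) * (1 / norm \<omega> ^ 3)"
proof -
  have o: "\<omega> \<noteq> 0" using assms by auto
  have re: "Re (1 - u / \<omega>) > 0" if "norm u \<le> R" for u
  proof -
    have "norm (u / \<omega>) < 1"
      using that assms o by (simp add: norm_divide divide_simps)
    then have "Re (u / \<omega>) < 1" using complex_Re_le_cmod[of "u / \<omega>"] by linarith
    then show ?thesis by simp
  qed
  show "1 - w / \<omega> \<noteq> 0" using re[of w] assms by (metis less_irrefl zero_complex.sel(1))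
  have d: "(sigma_log \<omega> has_field_derivative (1 / (u - \<omega>) + 1 / \<omega> + u / \<omega>\<^sup>2)) (at u)"
    if u: "norm u \<le> R" for u
  proof -
    have nn: "1 - u / \<omega> \<notin> \<real>\<^sub>\<le>\<^sub>0" using re[OF u] by (auto simp: complex_nonpos_Reals_iff)
    have une: "u \<noteq> \<omega>" using u assms by auto
    have "((\<lambda>z. Ln (1 - z / \<omega>)) has_field_derivative inverse (1 - u / \<omega>) * - (1 / \<omega>)) (at u)"
      by (rule DERIV_chain2[where f = Ln and g = "\<lambda>z. 1 - z / \<omega>", OF has_field_derivative_Ln[OF nn]])
         (use o in \<open>auto intro!: derivative_eq_intros\<close>)
    then have L: "((\<lambda>z. Ln (1 - z / \<omega>)) has_field_derivative 1 / (u - \<omega>)) (at u)"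
      by (rule DERIV_cong) (use o une in \<open>simp add: divide_simps\<close>)
    have "((\<lambda>z. z / \<omega> + z\<^sup>2 / (2 * \<omega>\<^sup>2)) has_field_derivative (1 / \<omega> + u / \<omega>\<^sup>2)) (at u)"
      using o by (auto intro!: derivative_eq_intros simp: field_simps power2_eq_square)
    with L have "((\<lambda>z. Ln (1 - z / \<omega>) + (z / \<omega> + z\<^sup>2 / (2 * \<omega>\<^sup>2))) has_field_derivative 1 / (u - \<omega>) + (1 / \<omega> + u / \<omega>\<^sup>2)) (at u)"
      by (rule DERIV_add)
    then show ?thesis by (simp add: sigma_log_def[abs_def] add.assoc)
  qed
  then show "(sigma_log \<omega> has_field_derivative (1 / (w - \<omega>) + 1 / \<omega> + w / \<omega>\<^sup>2)) (at w)"
    using assms by blast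
  have "norm (sigma_log \<omega> w - sigma_log \<omega> 0) \<le> (R\<^sup>2 / (1/2) * (1 / norm \<omega> ^ 3)) * norm (w - 0)"
  proof (rule field_differentiable_bound[of "cball 0 R"])
    fix u :: complex assume "u \<in> cball 0 R"
    then have u: "norm u \<le> R" by simp
    show "(sigma_log \<omega> has_field_derivative (1 / (u - \<omega>) + 1 / \<omega> + u / \<omega>\<^sup>2)) (at u within cball 0 R)"
      using d[OF u] by (rule has_field_derivative_at_within)
    have "norm \<omega> - norm u \<le> norm (u - \<omega>)" by (metis norm_minus_commute norm_triangle_ineq2)
    then show "norm (1 / (u - \<omega>) + 1 / \<omega> + u / \<omega>\<^sup>2) \<le> R\<^sup>2 / (1/2) * (1 / norm \<omega> ^ 3)"
      using o u assms by (intro zeta_term_bound) auto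
  qed (use assms in auto)
  also have "\<dots> \<le> (R\<^sup>2 / (1/2) * (1 / norm \<omega> ^ 3)) * R"
    using assms by (intro mult_left_mono) auto
  finally show "norm (sigma_log \<omega> w) \<le> (2 * R ^ 3) * (1 / norm \<omega> ^ 3)"
    by (simp add: sigma_log_def power2_eq_square power3_eq_cube mult_ac)
qed

context upper_half begin

lemma zeta_term_summable:
  assumes "z \<notin> \<Lambda> - {0}"
  shows "(\<lambda>\<omega>. 1 / (z - \<omega>) + 1 / \<omega> + z / \<omega>\<^sup>2) summable_on (\<Lambda> - {0})"
proof -
  obtain r \<delta> where r: "r > 0" "\<delta> > 0"
    "\<And>w \<omega>. w \<in> cball z r \<Longrightarrow> \<omega> \<in> \<Lambda> - {0} \<Longrightarrow> \<delta> * norm \<omega> \<le> norm (w - \<omega>)"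
    using lattice_sep[OF assms] by metis
  have "(\<lambda>\<omega>. norm (1 / (z - \<omega>) + 1 / \<omega> + z / \<omega>\<^sup>2)) summable_on (\<Lambda> - {0})"
  proof (rule Infinite_Sum.abs_summable_on_comparison_test')
    show "(\<lambda>\<omega>. (norm z)\<^sup>2 / \<delta> * (1 / norm \<omega> ^ 3)) summable_on \<Lambda> - {0}"
      by (rule summable_on_cmult_right[OF lattice_summable])
    show "norm (1 / (z - \<omega>) + 1 / \<omega> + z / \<omega>\<^sup>2) \<le> (norm z)\<^sup>2 / \<delta> * (1 / norm \<omega> ^ 3)" if "\<omega> \<in> \<Lambda> - {0}" for \<omega>
      using that r by (intro zeta_term_bound) auto
  qed
  then show ?thesis by (rule Infinite_Sum.abs_summable_summable)
qed

text \<open>Only finitely many factors can vanish in the disc; these stay a product over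
  \<open>A\<close>, and all others are replaced by their logarithms, whose absolutely convergent sum
  is \<open>LL\<close>. As soon as a finite set contains \<open>A\<close>, its partial product is
  the product over \<open>A\<close> times the exponential of a partial sum.\<close>

lemma wsigma_local:
  assumes "0 < R"
  defines "A \<equiv> {\<omega>\<in>\<Lambda>. norm \<omega> \<le> 2 * R} - {0}"
  defines "LL \<equiv> (\<lambda>z. \<Sum>\<^sub>\<infinity>\<omega>\<in>\<Lambda> - {0} - A. sigma_log \<omega> z)"
  assumes "norm z < R"
  shows "wsigma \<tau> z = z * ((\<Prod>\<omega>\<in>A. sigma_factor \<omega> z) * exp (LL z))"
    and "(LL has_field_derivative (\<Sum>\<^sub>\<infinity>\<omega>\<in>\<Lambda> - {0} - A. 1 / (z - \<omega>) + 1 / \<omega> + z / \<omega>\<^sup>2)) (at z)"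
proof -
  let ?B = "\<Lambda> - {0} - A"
  have big: "2 * R < norm \<omega>" if "\<omega> \<in> ?B" for \<omega> using that by (auto simp: A_def)
  have finA: "finite A" unfolding A_def using finite_lattice_norm_le[of "2 * R"] by simp
  have sB: "(\<lambda>\<omega>. (2 * R ^ 3) * (1 / norm \<omega> ^ 3)) summable_on ?B"
    by (rule summable_on_cmult_right[OF summable_on_subset_banach[OF lattice_summable]]) auto
  define r where "r = (R - norm z) / 2"
  have r: "r > 0" using assms by (simp add: r_def)
  have wR: "norm w \<le> R" if "w \<in> cball z r" for w
  proof -
    have "norm (w - z) \<le> r" using that by (simp add: dist_norm norm_minus_commute)
    then show ?thesis using norm_triangle_ineq2[of w z] r assms(4) by (auto simp: r_def)
  qed
  show "(LL has_field_derivative (\<Sum>\<^sub>\<infinity>\<omega>\<in>?B. 1 / (z - \<omega>) + 1 / \<omega> + z / \<omega>\<^sup>2)) (at z)"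
    unfolding LL_def
  proof (rule has_field_derivative_infsum(1)[OF r _ _ sB])
    fix \<omega> w assume a: "\<omega> \<in> ?B" "w \<in> cball z r"
    show "(sigma_log \<omega> has_field_derivative 1 / (w - \<omega>) + 1 / \<omega> + w / \<omega>\<^sup>2) (at w)"
      by (rule sigma_log_small(2)[OF assms(1) big[OF a(1)] wR[OF a(2)]])
    show "norm (sigma_log \<omega> w) \<le> 2 * R ^ 3 * (1 / norm \<omega> ^ 3)"
      by (rule sigma_log_small(3)[OF assms(1) big[OF a(1)] wR[OF a(2)]])
  qed
  define ell where "ell \<omega> = (if \<omega> \<in> A then 0 else sigma_log \<omega> z)" for \<omega>
  have "(\<lambda>\<omega>. norm (sigma_log \<omega> z)) summable_on ?B"
  proof (rule Infinite_Sum.abs_summable_on_comparison_test'[OF sB])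
    fix \<omega> assume "\<omega> \<in> ?B"
    then show "norm (sigma_log \<omega> z) \<le> 2 * R ^ 3 * (1 / norm \<omega> ^ 3)"
      using assms by (intro sigma_log_small(3)[OF assms(1) big]) auto
  qed
  from Infinite_Sum.abs_summable_summable[OF this]
  have "(\<lambda>\<omega>. sigma_log \<omega> z) summable_on ?B" .
  from has_sum_infsum[OF this]
  have "((\<lambda>\<omega>. sigma_log \<omega> z) has_sum LL z) ?B" by (simp only: LL_def)
  then have "(ell has_sum LL z) (\<Lambda> - {0})"
    by (subst has_sum_cong_neutral[where T = ?B and g = "\<lambda>\<omega>. sigma_log \<omega> z"]) (auto simp: ell_def)
  then have "((\<lambda>F. (\<Prod>\<omega>\<in>A. sigma_factor \<omega> z) * exp (sum ell F)) \<longlongrightarrow> (\<Prod>\<omega>\<in>A. sigma_factor \<omega> z) * exp (LL z)) (finite_subsets_at_top (\<Lambda> - {0}))"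
    unfolding has_sum_def by (intro tendsto_intros)
  moreover have "\<forall>\<^sub>F F in finite_subsets_at_top (\<Lambda> - {0}).
      (\<Prod>\<omega>\<in>A. sigma_factor \<omega> z) * exp (sum ell F) = (\<Prod>\<omega>\<in>F. (1 - z / \<omega>) * exp (z / \<omega> + z\<^sup>2 / (2 * \<omega>\<^sup>2)))"
    unfolding eventually_finite_subsets_at_top
  proof (intro exI[of _ A] conjI allI impI finA)
    show "A \<subseteq> \<Lambda> - {0}" by (auto simp: A_def)
    fix F assume F: "finite F \<and> A \<subseteq> F \<and> F \<subseteq> \<Lambda> - {0}"
    have "sum ell F = sum ell (F - A) + sum ell A"
      by (rule sum.subset_diff) (use F in auto)
    also have "sum ell A = 0" by (rule sum.neutral) (auto simp: ell_def)
    also have "sum ell (F - A) = (\<Sum>\<omega>\<in>F - A. sigma_log \<omega> z)"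
      by (rule sum.cong) (auto simp: ell_def)
    finally have "exp (sum ell F) = (\<Prod>\<omega>\<in>F - A. exp (sigma_log \<omega> z))"
      using F by (simp add: exp_sum)
    also have "\<dots> = (\<Prod>\<omega>\<in>F - A. sigma_factor \<omega> z)"
      by (rule prod.cong[OF refl], rule exp_sigma_log, rule sigma_log_small(1)[OF assms(1) big])
         (use F assms in auto)
    finally have "(\<Prod>\<omega>\<in>A. sigma_factor \<omega> z) * exp (sum ell F) = (\<Prod>\<omega>\<in>F. sigma_factor \<omega> z)"
      using prod.subset_diff[of A F "\<lambda>\<omega>. sigma_factor \<omega> z"] F by (simp add: mult.commute)
    then show "(\<Prod>\<omega>\<in>A. sigma_factor \<omega> z) * exp (sum ell F) = (\<Prod>\<omega>\<in>F. (1 - z / \<omega>) * exp (z / \<omega> + z\<^sup>2 / (2 * \<omega>\<^sup>2)))"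
      by (simp add: sigma_factor_def)
  qed
  ultimately have "((\<lambda>F. \<Prod>\<omega>\<in>F. (1 - z / \<omega>) * exp (z / \<omega> + z\<^sup>2 / (2 * \<omega>\<^sup>2))) \<longlongrightarrow> (\<Prod>\<omega>\<in>A. sigma_factor \<omega> z) * exp (LL z)) (finite_subsets_at_top (\<Lambda> - {0}))"
    by (rule Lim_transform_eventually)
  then show "wsigma \<tau> z = z * ((\<Prod>\<omega>\<in>A. sigma_factor \<omega> z) * exp (LL z))"
    unfolding wsigma_def by (subst tendsto_Lim) auto
qed

text \<open>Dividing by \<open>z\<close> keeps the origin accessible: there the logarithmic
  derivative of sigma has a pole, that of \<open>G\<close> does not. For \<open>R <= 0\<close> the
  claims about the disc are vacuous.\<close>

lemma wsigma_quotient: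
  obtains G where "G holomorphic_on ball 0 R" "G 0 = 1" "\<And>z. norm z < R \<Longrightarrow> wsigma \<tau> z = z * G z"
    "\<And>z. norm z < R \<Longrightarrow> G z = 0 \<longleftrightarrow> z \<in> \<Lambda> - {0}"
    "\<And>z. norm z < R \<Longrightarrow> z \<notin> \<Lambda> - {0} \<Longrightarrow> (G has_field_derivative zeta_reg z * G z) (at z)"
proof (cases "R > 0")
  case True
  define A where "A = {\<omega>\<in>\<Lambda>. norm \<omega> \<le> 2 * R} - {0}"
  define LL where "LL = (\<lambda>z. \<Sum>\<^sub>\<infinity>\<omega>\<in>\<Lambda> - {0} - A. sigma_log \<omega> z)"
  define G where "G = (\<lambda>z. (\<Prod>\<omega>\<in>A. sigma_factor \<omega> z) * exp (LL z))"
  note loc = wsigma_local[OF True, folded A_def, folded LL_def]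
  have finA: "finite A" unfolding A_def using finite_lattice_norm_le[of "2 * R"] by simp
  have LLh: "LL holomorphic_on ball 0 R"
  proof (subst holomorphic_on_open, simp, intro ballI exI)
    fix x assume "x \<in> ball (0::complex) R"
    then show "(LL has_field_derivative (\<Sum>\<^sub>\<infinity>\<omega>\<in>\<Lambda> - {0} - A. 1 / (x - \<omega>) + 1 / \<omega> + x / \<omega>\<^sup>2)) (at x)"
      by (intro loc(2)) simp
  qed
  show ?thesis
  proof (rule that[of G])
    show "G holomorphic_on ball 0 R"
      unfolding G_def sigma_factor_def by (intro holomorphic_intros LLh) (auto simp: A_def)
    have "LL 0 = 0" by (simp add: LL_def sigma_log_def)
    then show "G 0 = 1" by (simp add: G_def)
    fix z :: complex assume z: "norm z < R"
    show "wsigma \<tau> z = z * G z" using loc(1)[OF z] by (simp only: G_def LL_def)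
    have "(\<Prod>\<omega>\<in>A. sigma_factor \<omega> z) = 0 \<longleftrightarrow> (\<exists>\<omega>\<in>A. z = \<omega>)"
      using finA by (auto simp: sigma_factor_eq_0 A_def)
    also have "\<dots> \<longleftrightarrow> z \<in> \<Lambda> - {0}" using z True by (auto simp: A_def)
    finally show "G z = 0 \<longleftrightarrow> z \<in> \<Lambda> - {0}" by (simp add: G_def)
    assume zn: "z \<notin> \<Lambda> - {0}"
    let ?t = "\<lambda>\<omega>. 1 / (z - \<omega>) + 1 / \<omega> + z / \<omega>\<^sup>2"
    have "((\<lambda>w. \<Prod>\<omega>\<in>A. sigma_factor \<omega> w) has_field_derivative (\<Sum>\<omega>\<in>A. ?t \<omega>) * (\<Prod>\<omega>\<in>A. sigma_factor \<omega> z)) (at z)"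
      by (rule has_field_derivative_prod_log[OF finA, where L = "\<lambda>\<omega> z. 1 / (z - \<omega>) + 1 / \<omega> + z / \<omega>\<^sup>2"])
         (rule DERIV_sigma_factor, use zn in \<open>auto simp: A_def\<close>)
    note d1 = this
    have d2: "((\<lambda>w. exp (LL w)) has_field_derivative exp (LL z) * (\<Sum>\<^sub>\<infinity>\<omega>\<in>\<Lambda> - {0} - A. ?t \<omega>)) (at z)"
      by (rule DERIV_chain2[where f = exp and g = LL, OF DERIV_exp loc(2)[OF z]])
    note d12 = DERIV_mult[OF d1 d2]
    have alg: "(a :: complex) * P * e + e * b * P = (a + b) * (P * e)" for a b P e
      by (simp add: algebra_simps)
    have z3: "(\<Sum>\<omega>\<in>A. ?t \<omega>) + (\<Sum>\<^sub>\<infinity>\<omega>\<in>\<Lambda> - {0} - A. ?t \<omega>) = zeta_reg z"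
    proof -
      have "A \<union> (\<Lambda> - {0} - A) = \<Lambda> - {0}" by (auto simp: A_def)
      moreover have "infsum ?t (A \<union> (\<Lambda> - {0} - A)) = infsum ?t A + infsum ?t (\<Lambda> - {0} - A)"
        by (rule infsum_Un_disjoint[OF summable_on_finite[OF finA]
            summable_on_subset_banach[OF zeta_term_summable[OF zn]]]) auto
      ultimately show ?thesis using finA by (simp add: zeta_reg_def)
    qed
    show "(G has_field_derivative zeta_reg z * G z) (at z)"
      using d12 unfolding alg z3 G_def by (simp only: mult.assoc)
  qed
next
  case False
  then have "\<not> norm z < R" for z :: complex using norm_ge_zero[of z] by linarith
  then show ?thesis by (intro that[of "\<lambda>_. 1"]) auto
qed

lemma wsigma_holomorphic: "wsigma \<tau> holomorphic_on UNIV"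
proof -
  have "wsigma \<tau> field_differentiable at z" for z
  proof -
    obtain G where G: "G holomorphic_on ball 0 (norm z + 1)" "\<And>w. norm w < norm z + 1 \<Longrightarrow> wsigma \<tau> w = w * G w"
      by (rule wsigma_quotient[where R = "norm z + 1"]) blast
    have "(\<lambda>w. w * G w) holomorphic_on ball 0 (norm z + 1)"
      by (intro holomorphic_intros G)
    then have "wsigma \<tau> holomorphic_on ball 0 (norm z + 1)"
      by (rule holomorphic_transform) (use G in auto)
    then show ?thesis
      by (rule holomorphic_on_imp_differentiable_at) auto
  qed
  then show ?thesis by (simp add: holomorphic_on_def field_differentiable_at_within)
qed

lemma wsigma_eq_0_iff [simp]: "wsigma \<tau> z = 0 \<longleftrightarrow> z \<in> \<Lambda>"
proof -
  obtain G where "\<And>w. norm w < norm z + 1 \<Longrightarrow> wsigma \<tau> w = w * G w"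
     "\<And>w. norm w < norm z + 1 \<Longrightarrow> G w = 0 \<longleftrightarrow> w \<in> \<Lambda> - {0}"
    by (rule wsigma_quotient[where R = "norm z + 1"]) blast
  then show ?thesis by auto
qed

lemma DERIV_wsigma:
  assumes "z \<notin> \<Lambda>" shows "(wsigma \<tau> has_field_derivative wzeta \<tau> z * wsigma \<tau> z) (at z)"
proof -
  obtain G where G: "\<And>w. norm w < norm z + 1 \<Longrightarrow> wsigma \<tau> w = w * G w"
     "\<And>w. norm w < norm z + 1 \<Longrightarrow> w \<notin> \<Lambda> - {0} \<Longrightarrow> (G has_field_derivative zeta_reg w * G w) (at w)"
    by (rule wsigma_quotient[where R = "norm z + 1"]) blast
  have z: "z \<noteq> 0" using assms by auto
  have "((\<lambda>w. w * G w) has_field_derivative 1 * G z + zeta_reg z * G z * z) (at z)"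
    by (intro DERIV_mult DERIV_ident G(2)) (use assms in auto)
  also have "1 * G z + zeta_reg z * G z * z = wzeta \<tau> z * wsigma \<tau> z"
    using z by (simp add: wzeta_eq G(1)[of z] field_simps)
  finally show ?thesis
    by (rule has_field_derivative_transform_within_open[where S = "ball 0 (norm z + 1)"])
       (use G(1) in auto)
qed

lemma wsigma_div_tendsto: "((\<lambda>z. wsigma \<tau> z / z) \<longlongrightarrow> 1) (at 0)"
proof -
  obtain G where G: "G holomorphic_on ball 0 1" "G 0 = 1" "\<And>w. norm w < 1 \<Longrightarrow> wsigma \<tau> w = w * G w"
    by (rule wsigma_quotient[where R = "1"]) blast
  have "isCont G 0"
    using holomorphic_on_imp_continuous_on[OF G(1)] by (simp add: continuous_on_eq_continuous_at)
  then have "(G \<longlongrightarrow> 1) (at 0)" using G(2) by (simp add: isCont_def)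
  moreover have "eventually (\<lambda>z. G z = wsigma \<tau> z / z) (at 0)"
    using eventually_at_in_open[of "ball 0 1" "0::complex"] by (rule eventually_mono) (auto simp: G(3))
  ultimately show ?thesis by (rule Lim_transform_eventually)
qed

lemma sparse_lattice_subset: "X \<subseteq> \<Lambda> \<Longrightarrow> X sparse_in UNIV"
proof -
  assume X: "X \<subseteq> \<Lambda>"
  have "\<not> y islimpt X" for y
  proof
    assume "y islimpt X"
    then have "y islimpt (X - {y})" unfolding islimpt_def by blast
    moreover have "closed (X - {y})" by (rule closed_lattice_subset) (use X in auto)
    ultimately show False by (auto simp: closed_limpt)
  qed
  then show ?thesis by (simp add: sparse_in_open)
qed

lemma connected_lreg: "connected lreg"
  unfolding lreg_def Compl_eq_Diff_UNIV
  by (rule sparse_imp_connected) (auto intro: sparse_lattice_subset)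

section \<open>Periodicity of wp, quasi-periods of zeta, multipliers of sigma\<close>

lemma half_notin_lattice: "1 / 2 \<notin> \<Lambda>" "\<tau> / 2 \<notin> \<Lambda>"
proof -
  have "\<not> 1 / 2 \<in> \<Lambda>"
  proof
    assume "1 / 2 \<in> \<Lambda>"
    then obtain a b where "1 / 2 = of_int a + of_int b * \<tau>" by (auto simp: period_lattice_def)
    then have "of_int 1 + of_int 0 * \<tau> = of_int (2 * a) + of_int (2 * b) * \<tau>"
      by (simp add: field_simps)
    from lattice_coords_eq[OF this] show False by presburger
  qed
  moreover have "\<not> \<tau> / 2 \<in> \<Lambda>"
  proof
    assume "\<tau> / 2 \<in> \<Lambda>"
    then obtain a b where "\<tau> / 2 = of_int a + of_int b * \<tau>" by (auto simp: period_lattice_def)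
    then have "of_int 0 + of_int 1 * \<tau> = of_int (2 * a) + of_int (2 * b) * \<tau>"
      by (simp add: field_simps)
    from lattice_coords_eq[OF this] show False by presburger
  qed
  ultimately show "1 / 2 \<notin> \<Lambda>" "\<tau> / 2 \<notin> \<Lambda>" by auto
qed

text \<open>Closure under differences yields 0, negatives and sums at once, so a translation
  property has to be verified only for 1, for \<tau> and for one kind of combination.\<close>

lemma lattice_induct [consumes 1, case_names one tau diff]:
  assumes "l \<in> \<Lambda>" "P 1" "P \<tau>" "\<And>x y. x \<in> \<Lambda> \<Longrightarrow> y \<in> \<Lambda> \<Longrightarrow> P x \<Longrightarrow> P y \<Longrightarrow> P (x - y)"
  shows "P l"
proof -
  have P0: "P 0" using assms(4)[of 1 1] assms(2) by simp
  have Pm: "P (- y)" if "y \<in> \<Lambda>" "P y" for y using assms(4)[of 0 y] P0 that by simp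
  have Pa: "P (x + y)" if "x \<in> \<Lambda>" "y \<in> \<Lambda>" "P x" "P y" for x y
    using assms(4)[of x "-y"] Pm[of y] that by simp
  have Pi: "of_int a * w \<in> \<Lambda> \<and> P (of_int a * w)" if "w \<in> \<Lambda>" "P w" for a w
  proof (induction a rule: int_induct[of _ 0])
    case base then show ?case using P0 by simp
  next
    case (step1 i) then show ?case using Pa[of "of_int i * w" w] lattice_add[of "of_int i * w" w] that by (simp add: algebra_simps)
  next
    case (step2 i) then show ?case using assms(4)[of "of_int i * w" w] lattice_diff[of "of_int i * w" w] that by (simp add: algebra_simps)
  qed
  obtain a b where l: "l = of_int a + of_int b * \<tau>" using assms(1) by (auto simp: period_lattice_def)
  show ?thesis using Pa[of "of_int a" "of_int b * \<tau>"] Pi[of 1 a] Pi[of \<tau> b] assms(2,3) l by simp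
qed

lemma lattice_add_iff' [simp]: "x \<in> \<Lambda> \<Longrightarrow> x + z \<in> \<Lambda> \<longleftrightarrow> z \<in> \<Lambda>"
  using lattice_add_iff[of x z] by (simp add: add.commute)

lemma lattice_diff_iff [simp]: "x \<in> \<Lambda> \<Longrightarrow> z - x \<in> \<Lambda> \<longleftrightarrow> z \<in> \<Lambda>"
  using lattice_add_iff[of "-x" z] by simp

lemma DERIV_wp_shift: "z + l \<notin> \<Lambda> \<Longrightarrow> ((\<lambda>z. wp \<tau> (z + l)) has_field_derivative wp' (z + l)) (at z)"
  using DERIV_wp[of "z + l"] by (simp add: DERIV_shift)

lemma DERIV_wzeta_shift: "z + l \<notin> \<Lambda> \<Longrightarrow> ((\<lambda>z. wzeta \<tau> (z + l)) has_field_derivative - wp \<tau> (z + l)) (at z)"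
  using DERIV_wzeta[of "z + l"] by (simp add: DERIV_shift)

text \<open>The difference of the two sides has derivative zero on the connected complement of the
  lattice. Its constant value is read off at \<open>-l/2\<close>, where evenness makes it vanish;
  this requires that \<open>l/2\<close> is no period, as for 1 and \<tau>, and the other periods
  follow by generation.\<close>

lemma wp_periodic:
  assumes "l \<in> \<Lambda>" "z \<notin> \<Lambda>" shows "wp \<tau> (z + l) = wp \<tau> z"
proof -
  have half: "\<forall>z. z \<notin> \<Lambda> \<longrightarrow> wp \<tau> (z + l) = wp \<tau> z" if l: "l \<in> \<Lambda>" "l / 2 \<notin> \<Lambda>" for l
  proof -
    have "((\<lambda>z. wp \<tau> (z + l) - wp \<tau> z) has_field_derivative 0) (at z)" if "z \<in> lreg" for z
    proof -
      have "((\<lambda>z. wp \<tau> (z + l) - wp \<tau> z) has_field_derivative wp' (z + l) - wp' z) (at z)"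
        using that l by (intro DERIV_diff DERIV_wp DERIV_wp_shift) (auto simp: lreg_iff)
      then show ?thesis using wp'_periodic[of l z] that l by (simp add: lreg_iff)
    qed
    then have "(\<lambda>z. wp \<tau> (z + l) - wp \<tau> z) constant_on lreg"
      by (rule has_field_derivative_0_imp_constant_on[OF _ connected_lreg open_lreg])
    then obtain c where c: "\<And>z. z \<in> lreg \<Longrightarrow> wp \<tau> (z + l) - wp \<tau> z = c"
      by (auto simp: constant_on_def)
    have "- l / 2 \<in> lreg" using l lattice_uminus_iff[of "l / 2"] by (simp add: lreg_iff)
    from c[OF this] have "c = 0" using wp_even[of "l / 2"] by simp
    then show ?thesis using c by (auto simp: lreg_iff)
  qed
  have "\<forall>z. z \<notin> \<Lambda> \<longrightarrow> wp \<tau> (z + l) = wp \<tau> z"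
    using assms(1)
  proof (induction rule: lattice_induct)
    case (diff x y)
    show ?case
    proof (intro allI impI)
      fix z assume z: "z \<notin> \<Lambda>"
      have zy: "z - y \<notin> \<Lambda>" using z diff by simp
      have "wp \<tau> (z + (x - y)) = wp \<tau> ((z - y) + x)" by (simp add: algebra_simps)
      also have "\<dots> = wp \<tau> (z - y)" using diff zy by blast
      also have "\<dots> = wp \<tau> (z - y + y)" by (rule diff(4)[rule_format, OF zy, symmetric])
      finally show "wp \<tau> (z + (x - y)) = wp \<tau> z" by simp
    qed
  qed (use half half_notin_lattice in auto)
  then show ?thesis using assms by blast
qed

text \<open>The quasi-period of zeta belonging to an arbitrary period, read off at the base point
  \<open>1/2\<close>, which is never a lattice point.\<close>

definition eta :: "complex \<Rightarrow> complex" where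
  "eta l = wzeta \<tau> (1 / 2 + l) - wzeta \<tau> (1 / 2)"

lemma wzeta_quasi:
  assumes "l \<in> \<Lambda>" "z \<notin> \<Lambda>" shows "wzeta \<tau> (z + l) = wzeta \<tau> z + eta l"
proof -
  have "((\<lambda>z. wzeta \<tau> (z + l) - wzeta \<tau> z) has_field_derivative 0) (at z)" if "z \<in> lreg" for z
  proof -
    have "((\<lambda>z. wzeta \<tau> (z + l) - wzeta \<tau> z) has_field_derivative - wp \<tau> (z + l) - - wp \<tau> z) (at z)"
      using that assms by (intro DERIV_diff DERIV_wzeta DERIV_wzeta_shift) (auto simp: lreg_iff)
    then show ?thesis using wp_periodic[of l z] that assms by (simp add: lreg_iff)
  qed
  then have "(\<lambda>z. wzeta \<tau> (z + l) - wzeta \<tau> z) constant_on lreg"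
    by (rule has_field_derivative_0_imp_constant_on[OF _ connected_lreg open_lreg])
  then obtain c where c: "\<And>z. z \<in> lreg \<Longrightarrow> wzeta \<tau> (z + l) - wzeta \<tau> z = c"
    by (auto simp: constant_on_def)
  have "c = eta l" using c[of "1/2"] half_notin_lattice by (simp add: lreg_iff eta_def)
  then show ?thesis using c[of z] assms by (simp add: lreg_iff algebra_simps)
qed

lemma eta_add:
  assumes "x \<in> \<Lambda>" "y \<in> \<Lambda>" shows "eta (x + y) = eta x + eta y"
  using wzeta_quasi[of y "1/2 + x"] wzeta_quasi[of x "1/2"] wzeta_quasi[of "x + y" "1/2"] assms
    half_notin_lattice lattice_add[of x y] by (simp add: add.assoc)

lemma eta_0 [simp]: "eta 0 = 0" by (simp add: eta_def)

lemma eta_uminus: "x \<in> \<Lambda> \<Longrightarrow> eta (- x) = - eta x"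
  using eta_add[of x "-x"] by (simp add: eq_neg_iff_add_eq_0 add.commute)

lemma eta_of_int:
  "eta (of_int a + of_int b * \<tau>) = of_int a * eta 1 + of_int b * eta \<tau>"
proof -
  have *: "of_int a * w \<in> \<Lambda> \<and> eta (of_int a * w) = of_int a * eta w" if w: "w \<in> \<Lambda>" for a w
  proof (induction a rule: int_induct[of _ 0])
    case base then show ?case by simp
  next
    case (step1 i) then show ?case using eta_add[of "of_int i * w" w] lattice_add[of "of_int i * w" w] w by (simp add: algebra_simps)
  next
    case (step2 i) then show ?case
      using eta_add[of "of_int i * w" "-w"] eta_uminus[of w] lattice_diff[of "of_int i * w" w] w by (simp add: algebra_simps)
  qed
  show ?thesis using *[of 1 a] *[of \<tau> b] eta_add[of "of_int a" "of_int b * \<tau>"] by simp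
qed

text \<open>The constant part of the multiplier of sigma, classically
  \<open>exp (eta l * l / 2)\<close> up to sign. It is kept as an opaque nonzero number, since it
  cancels whenever products with equally many sigma factors are compared.\<close>

definition sigma_mult :: "complex \<Rightarrow> complex" where
  "sigma_mult l = wsigma \<tau> (1 / 2 + l) / (exp (eta l / 2) * wsigma \<tau> (1 / 2))"

lemma sigma_mult_nonzero: "l \<in> \<Lambda> \<Longrightarrow> sigma_mult l \<noteq> 0"
  using half_notin_lattice by (simp add: sigma_mult_def)

lemma wsigma_quasi:
  assumes "l \<in> \<Lambda>" shows "wsigma \<tau> (z + l) = sigma_mult l * exp (eta l * z) * wsigma \<tau> z"
proof (cases "z \<in> \<Lambda>")
  case False
  have "((\<lambda>z. wsigma \<tau> (z + l) / (exp (eta l * z) * wsigma \<tau> z)) has_field_derivative 0) (at z)" if "z \<in> lreg" for z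
  proof -
    have z: "z \<notin> \<Lambda>" "z + l \<notin> \<Lambda>" using that assms by (auto simp: lreg_iff)
    have 1: "((\<lambda>z. wsigma \<tau> (z + l)) has_field_derivative wzeta \<tau> (z + l) * wsigma \<tau> (z + l)) (at z)"
      using DERIV_wsigma[OF z(2)] by (simp add: DERIV_shift)
    have 2: "((\<lambda>z. exp (eta l * z)) has_field_derivative eta l * exp (eta l * z)) (at z)"
      by (auto intro!: derivative_eq_intros)
    have 3: "((\<lambda>z. exp (eta l * z) * wsigma \<tau> z) has_field_derivative eta l * exp (eta l * z) * wsigma \<tau> z + wzeta \<tau> z * wsigma \<tau> z * exp (eta l * z)) (at z)"
      by (rule DERIV_mult[OF 2 DERIV_wsigma[OF z(1)]])
    have ne: "exp (eta l * z) * wsigma \<tau> z \<noteq> 0" using z by simp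
    show ?thesis
      by (rule DERIV_cong[OF DERIV_divide[OF 1 3 ne]])
         (use wzeta_quasi[OF assms z(1)] in \<open>simp add: algebra_simps\<close>)
  qed
  then have "(\<lambda>z. wsigma \<tau> (z + l) / (exp (eta l * z) * wsigma \<tau> z)) constant_on lreg"
    by (rule has_field_derivative_0_imp_constant_on[OF _ connected_lreg open_lreg])
  then obtain c where c: "\<And>z. z \<in> lreg \<Longrightarrow> wsigma \<tau> (z + l) / (exp (eta l * z) * wsigma \<tau> z) = c"
    by (auto simp: constant_on_def)
  have "c = sigma_mult l" using c[of "1/2"] half_notin_lattice by (simp add: lreg_iff sigma_mult_def)
  then show ?thesis using c[of z] False by (simp add: lreg_iff field_simps)
next
  case True
  then have "wsigma \<tau> (z + l) = 0" "wsigma \<tau> z = 0" using assms by auto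
  then show ?thesis by (simp only: mult_zero_right)
qed

lemma lattice_reduce:
  obtains l where "l \<in> \<Lambda>" "norm (z - l) \<le> 1 + norm \<tau>"
proof -
  define b where "b = \<lfloor>Im z / Im \<tau>\<rfloor>"
  define u where "u = Im z / Im \<tau> - of_int b"
  define a where "a = \<lfloor>Re z - (Im z / Im \<tau>) * Re \<tau>\<rfloor>"
  define s where "s = Re z - (Im z / Im \<tau>) * Re \<tau> - of_int a"
  have us: "0 \<le> u" "u \<le> 1" "0 \<le> s" "s \<le> 1"
    unfolding u_def s_def a_def b_def by linarith+
  have eq: "z - (of_int a + of_int b * \<tau>) = of_real s + of_real u * \<tau>"
    using Im_tau by (auto simp: complex_eq_iff s_def u_def algebra_simps)
  have "norm (z - (of_int a + of_int b * \<tau>)) \<le> norm (of_real s :: complex) + norm (of_real u * \<tau>)"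
    unfolding eq by (rule norm_triangle_ineq)
  also have "\<dots> \<le> 1 + 1 * norm \<tau>"
    using us by (intro add_mono) (auto simp: norm_mult intro!: mult_left_le_one_le)
  finally show ?thesis using that[OF latticeI] by simp
qed

text \<open>Only the modulus is assumed periodic, so that the bound also covers functions whose
  multipliers are merely unimodular.\<close>

lemma norm_periodic_bounded:
  fixes f :: "complex \<Rightarrow> complex"
  assumes "continuous_on UNIV f" "\<And>l z. l \<in> \<Lambda> \<Longrightarrow> norm (f (z + l)) = norm (f z)"
  shows "bounded (range f)"
proof -
  have "compact (f ` cball 0 (1 + norm \<tau>))"
    by (intro compact_continuous_image continuous_on_subset[OF assms(1)]) auto
  then obtain B where B: "\<And>z. z \<in> cball 0 (1 + norm \<tau>) \<Longrightarrow> norm (f z) \<le> B"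
    by (meson bounded_iff compact_imp_bounded imageI)
  have "norm (f z) \<le> B" for z
  proof -
    obtain l where l: "l \<in> \<Lambda>" "norm (z - l) \<le> 1 + norm \<tau>" by (rule lattice_reduce)
    have "norm (f z) = norm (f (z - l))" using assms(2)[OF l(1), of "z - l"] by simp
    also have "\<dots> \<le> B" using l by (intro B) simp
    finally show ?thesis .
  qed
  then show ?thesis by (auto simp: bounded_iff)
qed

lemma entire_periodic_constant:
  assumes "f holomorphic_on UNIV" "\<And>l z. l \<in> \<Lambda> \<Longrightarrow> f (z + l) = f z"
  obtains c where "\<And>z. f z = c"
proof -
  have "bounded (range f)"
    using assms by (intro norm_periodic_bounded holomorphic_on_imp_continuous_on) auto
  then show ?thesis using Liouville_theorem[OF assms(1)] that
    by (auto simp: constant_on_def)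
qed

end

section \<open>Quasi-periodic entire functions\<close>

lemma holomorphic_on_UNIV_extend:
  assumes X: "X sparse_in UNIV"
    and d: "\<And>z. z \<notin> X \<Longrightarrow> f field_differentiable (at z)"
    and c: "\<And>z. z \<in> X \<Longrightarrow> (f \<longlongrightarrow> f z) (at z)"
  shows "f holomorphic_on UNIV"
proof -
  have "f field_differentiable at z" for z
  proof (cases "z \<in> X")
    case True
    obtain B where B: "open B" "z \<in> B" "\<And>y. y \<in> B \<Longrightarrow> y \<noteq> z \<Longrightarrow> y \<notin> X"
      by (rule sparse_in_not_in[OF X, of z]) auto
    have "f holomorphic_on B"
    proof (rule no_isolated_singularity'[where K = "{z}"])
      show "f holomorphic_on B - {z}"
        using B d by (auto simp: holomorphic_on_def intro: field_differentiable_at_within)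
      show "(f \<longlongrightarrow> f w) (at w within B)" if "w \<in> {z}" for w
        using c[OF True] that by (auto intro: tendsto_within_subset)
    qed (use B in auto)
    then show ?thesis using B by (auto intro: holomorphic_on_imp_differentiable_at)
  qed (use d in auto)
  then show ?thesis by (auto simp: holomorphic_on_def field_differentiable_at_within)
qed

lemma continuous_eq_off_sparse:
  fixes f g :: "complex \<Rightarrow> complex"
  assumes "continuous_on UNIV f" "continuous_on UNIV g" "X sparse_in UNIV"
    and "\<And>z. z \<notin> X \<Longrightarrow> f z = g z"
  shows "f z = g z"
proof -
  obtain B where B: "open B" "z \<in> B" "\<And>y. y \<in> B \<Longrightarrow> y \<noteq> z \<Longrightarrow> y \<notin> X"
    by (rule sparse_in_not_in[OF assms(3), of z]) auto
  have ev: "eventually (\<lambda>w. f w = g w) (at z)"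
    using eventually_at_in_open[OF B(1,2)] by (rule eventually_mono) (use B assms(4) in auto)
  have "(f \<longlongrightarrow> f z) (at z)" "(g \<longlongrightarrow> g z) (at z)"
    using assms(1,2) by (auto simp: continuous_on_eq_continuous_at isCont_def)
  then show ?thesis
    using Lim_transform_eventually[OF _ ev] tendsto_unique[of "at z" g] by (metis trivial_limit_at)
qed

lemma DERIV_0_imp_tendsto:
  assumes "(f has_field_derivative D) (at a)" "f a = 0"
  shows "((\<lambda>z. f z / (z - a)) \<longlongrightarrow> D) (at (a::complex))"
  using assms by (simp add: has_field_derivative_iff)

text \<open>Denominators with simple zeros suffice for sigma factors: at such a zero the quotient
  has the limit \<open>f' / g'\<close>, so every singularity is removable.\<close>

lemma entire_quotient:
  fixes f g :: "complex \<Rightarrow> complex"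
  assumes f: "f holomorphic_on UNIV" and g: "g holomorphic_on UNIV"
    and sp: "{z. g z = 0} sparse_in UNIV"
    and z: "\<And>z. g z = 0 \<Longrightarrow> f z = 0 \<and> deriv g z \<noteq> 0"
  obtains h where "h holomorphic_on UNIV" "\<And>z. f z = g z * h z"
proof -
  define h where "h z = (if g z = 0 then deriv f z / deriv g z else f z / g z)" for z
  have df: "(f has_field_derivative deriv f z) (at z)" "(g has_field_derivative deriv g z) (at z)" for z
    using f g by (auto intro: holomorphic_derivI)
  have "h holomorphic_on UNIV"
  proof (rule holomorphic_on_UNIV_extend[OF sp])
    fix a assume a: "a \<notin> {z. g z = 0}"
    have "eventually (\<lambda>z. g z \<noteq> 0) (nhds a)"
    proof -
      have "isCont g a" using df(2) by (rule DERIV_isCont)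
      then show ?thesis
        using a by (intro tendsto_imp_eventually_ne[of g "g a"]) (auto simp: isCont_def continuous_at tendsto_at_iff_tendsto_nhds)
    qed
    then have "eventually (\<lambda>z. f z / g z = h z) (nhds a)"
      by (rule eventually_mono) (auto simp: h_def)
    moreover have "((\<lambda>z. f z / g z) has_field_derivative (deriv f a * g a - f a * deriv g a) / (g a * g a)) (at a)"
      using a by (intro DERIV_divide df) auto
    ultimately have "(h has_field_derivative (deriv f a * g a - f a * deriv g a) / (g a * g a)) (at a)"
      by (subst (asm) DERIV_cong_ev[OF refl _ refl]) auto
    then show "h field_differentiable at a" by (auto simp: field_differentiable_def)
  next
    fix a assume "a \<in> {z. g z = 0}"
    then have a: "g a = 0" "f a = 0" "deriv g a \<noteq> 0" using z by auto
    have "((\<lambda>z. (f z / (z - a)) / (g z / (z - a))) \<longlongrightarrow> deriv f a / deriv g a) (at a)"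
      by (intro tendsto_divide DERIV_0_imp_tendsto df a)
    moreover have "eventually (\<lambda>z. (f z / (z - a)) / (g z / (z - a)) = h z) (at a)"
    proof -
      have "((\<lambda>z. g z / (z - a)) \<longlongrightarrow> deriv g a) (at a)" by (intro DERIV_0_imp_tendsto df a)
      then have "eventually (\<lambda>z. g z / (z - a) \<noteq> 0) (at a)" using a by (intro tendsto_imp_eventually_ne) auto
      then show ?thesis by eventually_elim (auto simp: h_def)
    qed
    ultimately show "(h \<longlongrightarrow> h a) (at a)"
      using a by (simp add: h_def Lim_transform_eventually)
  qed
  moreover have "f z = g z * h z" for z using z[of z] by (auto simp: h_def)
  ultimately show ?thesis using that by blast
qed

text \<open>Relates opposite sides of a period parallelogram: there the values of zeta differ by a
  quasi-period \<open>c\<close>, which contributes \<open>c\<close> times the side vector.\<close>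

lemma contour_integral_linepath_translate:
  assumes "continuous_on (closed_segment a b) f" "\<And>z. z \<in> closed_segment a b \<Longrightarrow> g (z + t) = f z + c"
  shows "contour_integral (linepath (a + t) (b + t)) g = contour_integral (linepath a b) f + c * (b - a)"
proof -
  define I where "I = contour_integral (linepath a b) f"
  have "(f has_contour_integral I) (linepath a b)"
    unfolding I_def by (intro has_contour_integral_integral contour_integrable_continuous_linepath assms)
  moreover have "((\<lambda>_. c) has_contour_integral (c * (b - a))) (linepath a b)"
    by (rule has_contour_integral_const_linepath)
  ultimately have "((\<lambda>z. f z + c) has_contour_integral (I + c * (b - a))) (linepath a b)"
    by (rule has_contour_integral_add)
  then have "((\<lambda>x. (f (linepath a b x) + c) * (b - a)) has_integral (I + c * (b - a))) {0..1}"
    by (simp add: has_contour_integral_linepath)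
  then have "((\<lambda>x. g (linepath (a + t) (b + t) x) * ((b + t) - (a + t))) has_integral (I + c * (b - a))) {0..1}"
  proof (rule has_integral_eq[rotated])
    fix x :: real assume x: "x \<in> {0..1}"
    have "linepath (a + t) (b + t) x = linepath a b x + t"
      by (simp add: linepath_def algebra_simps scaleR_conv_of_real)
    moreover have "linepath a b x \<in> closed_segment a b" using x by (auto simp: linepath_in_path)
    ultimately show "(f (linepath a b x) + c) * (b - a) = g (linepath (a + t) (b + t) x) * ((b + t) - (a + t))"
      using assms(2) by simp
  qed
  then show ?thesis unfolding I_def[symmetric]
    by (intro contour_integral_unique) (simp add: has_contour_integral_linepath)
qed

section \<open>The Legendre relation\<close>

context upper_half begin

lemma real_coords_eq:
  assumes "of_real x + of_real y * \<tau> = of_int m + of_int n * \<tau>"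
  shows "x = of_int m \<and> y = of_int n"
proof -
  from assms have "Im (of_real x + of_real y * \<tau>) = Im (of_int m + of_int n * \<tau>)" by simp
  then have y: "y = of_int n" using Im_tau by simp
  have "Re (of_real x + of_real y * \<tau>) = Re (of_int m + of_int n * \<tau>)" using assms by simp
  then show ?thesis using y by simp
qed

lemma lattice_small_coords:
  assumes "of_real x + of_real y * \<tau> \<in> \<Lambda>" "\<bar>x\<bar> < 1" "\<bar>y\<bar> < 1"
  shows "x = 0 \<and> y = 0"
proof -
  obtain m n where mn: "of_real x + of_real y * \<tau> = of_int m + of_int n * \<tau>"
    using assms(1) by (auto simp: period_lattice_def)
  have "x = of_int m" "y = of_int n" using real_coords_eq[OF mn] by auto
  then show ?thesis using assms by auto
qed

lemma wzeta_continuous: "X \<inter> \<Lambda> = {} \<Longrightarrow> continuous_on X (wzeta \<tau>)"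
  by (rule continuous_at_imp_continuous_on) (use DERIV_wzeta DERIV_isCont in blast)

lemma wzeta_holomorphic: "X \<inter> \<Lambda> = {} \<Longrightarrow> wzeta \<tau> holomorphic_on X"
  unfolding holomorphic_on_def field_differentiable_def using DERIV_wzeta has_field_derivative_at_within by blast

text \<open>The period parallelogram with corner \<open>-2/3 - \<tau>/3\<close> is cut along its diagonal, so that the
  only pole of the zeta function lies inside one of the two triangles.\<close>

theorem legendre_relation: "eta 1 * \<tau> - eta \<tau> = 2 * of_real pi * \<i>"
proof -
  define a where "a = - of_real (2/3) - of_real (1/3) * \<tau>"
  define b where "b = a + 1"
  define c where "c = a + 1 + \<tau>"
  define d where "d = a + \<tau>"
  let ?H1 = "convex hull {a,b,c}" and ?H2 = "convex hull {c,d,a}"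
  have H1: "\<exists>u v. z = of_real (u + v - 2/3) + of_real (v - 1/3) * \<tau> \<and> 0 \<le> u \<and> 0 \<le> v \<and> u + v \<le> 1" if "z \<in> ?H1" for z
  proof -
    from that obtain u v where "z = a + u *\<^sub>R (b - a) + v *\<^sub>R (c - a)" "0 \<le> u" "0 \<le> v" "u + v \<le> 1"
      unfolding convex_hull_3_alt by blast
    then show ?thesis
      by (intro exI[of _ u] exI[of _ v]) (simp add: a_def b_def c_def scaleR_conv_of_real algebra_simps)
  qed
  have H2: "\<exists>u v. z = of_real (v - 2/3) + of_real (u + v - 1/3) * \<tau> \<and> 0 \<le> u \<and> 0 \<le> v \<and> u + v \<le> 1" if "z \<in> ?H2" for z
  proof -
    have e: "{c,d,a} = {a,d,c}" by auto
    have "z \<in> convex hull {a,d,c}" using that by (simp only: e)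
    then obtain u v where "z = a + u *\<^sub>R (d - a) + v *\<^sub>R (c - a)" "0 \<le> u" "0 \<le> v" "u + v \<le> 1"
      unfolding convex_hull_3_alt by blast
    then show ?thesis
      by (intro exI[of _ u] exI[of _ v]) (simp add: a_def d_def c_def scaleR_conv_of_real algebra_simps)
  qed
  \<comment> \<open>Both real coordinates have modulus below 1 on the triangle, so a lattice point
    in it has both equal to zero; \<open>u = v = 1/3\<close> is the origin.\<close>
  have L1: "u = 1/3 \<and> v = 1/3" if "of_real (u + v - 2/3) + of_real (v - 1/3) * \<tau> \<in> \<Lambda>" "0 \<le> u" "0 \<le> v" "u + v \<le> 1" for u v
  proof -
    have "u + v - 2/3 = 0 \<and> v - 1/3 = 0"
      by (rule lattice_small_coords[OF that(1)]) (use that(2-4) in \<open>simp_all add: abs_less_iff\<close>)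
    then show ?thesis by auto
  qed
  have lat1: "z = 0" if zH: "z \<in> ?H1" "z \<in> \<Lambda>" for z
  proof -
    obtain u v where uv: "z = of_real (u + v - 2/3) + of_real (v - 1/3) * \<tau>" "0 \<le> u" "0 \<le> v" "u + v \<le> 1"
      using H1[OF zH(1)] by blast
    have "u = 1/3 \<and> v = 1/3"
      by (rule L1) (use uv zH in simp_all)
    then have e: "u + v - 2/3 = 0" "v - 1/3 = 0" by simp_all
    show ?thesis unfolding uv(1) e by simp
  qed
  have lat2: "z \<notin> \<Lambda>" if zH: "z \<in> ?H2" for z
  proof
    assume "z \<in> \<Lambda>"
    obtain u v where uv: "z = of_real (v - 2/3) + of_real (u + v - 1/3) * \<tau>" "0 \<le> u" "0 \<le> v" "u + v \<le> 1"
      using H2[OF zH] by blast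
    have "v - 2/3 = 0 \<and> u + v - 1/3 = 0"
      by (rule lattice_small_coords) (use uv \<open>z \<in> \<Lambda>\<close> in auto)
    then show False using uv by auto
  qed
  have in1: "0 \<in> ?H1"
    unfolding convex_hull_3_alt
    by (intro CollectI exI[of _ "1/3::real"]) (simp add: a_def b_def c_def scaleR_conv_of_real algebra_simps)
  have seg_lat: "z \<notin> \<Lambda>" if zseg: "z \<in> closed_segment a b \<union> closed_segment b c \<union> closed_segment c a" for z
  proof
    assume z: "z \<in> \<Lambda>"
    consider t where "0 \<le> t" "t \<le> 1" "z = (1 - t) *\<^sub>R a + t *\<^sub>R b"
      | t where "0 \<le> t" "t \<le> 1" "z = (1 - t) *\<^sub>R b + t *\<^sub>R c"
      | t where "0 \<le> t" "t \<le> 1" "z = (1 - t) *\<^sub>R c + t *\<^sub>R a"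
      using zseg by (auto simp: closed_segment_def)
    then show False
    proof cases
      case 1
      have "z = a + of_real t"
        unfolding 1(3) b_def by (simp add: scaleR_conv_of_real algebra_simps)
      then have "z = of_real (t - 2/3) + of_real (- 1/3) * \<tau>"
        by (simp add: a_def)
      then have "t - 2/3 = 0 \<and> (- 1/3 :: real) = 0" using z 1 by (intro lattice_small_coords) auto
      then show False by simp
    next
      case 2
      have "z = a + 1 + of_real t * \<tau>"
        unfolding 2(3) b_def c_def by (simp add: scaleR_conv_of_real algebra_simps)
      then have "z = of_real (1/3) + of_real (t - 1/3) * \<tau>"
        by (simp add: a_def algebra_simps)
      then have "(1/3 :: real) = 0 \<and> t - 1/3 = 0" using z 2 by (intro lattice_small_coords) auto
      then show False by simp
    next
      case 3
      have "z = a + (1 - of_real t) * (1 + \<tau>)"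
        unfolding 3(3) c_def by (simp add: scaleR_conv_of_real algebra_simps)
      then have "z = of_real (1/3 - t) + of_real (2/3 - t) * \<tau>"
        by (simp add: a_def algebra_simps)
      then have "1/3 - t = 0 \<and> 2/3 - t = 0" using z 3 by (intro lattice_small_coords) auto
      then show False by linarith
    qed
  qed
  let ?p1 = "linepath a b +++ linepath b c +++ linepath c a"
  have path1: "valid_path ?p1" "path_image ?p1 = closed_segment a b \<union> closed_segment b c \<union> closed_segment c a"
    by (auto simp: path_image_join)
  have n0: "0 \<notin> path_image ?p1" using seg_lat[of 0] path1 by auto
  have int: "0 \<in> interior ?H1"
    using interior_of_triangle[of a b c] in1 n0 path1 by simp
  \<comment> \<open>\<open>Im \<tau> > 0\<close> makes the triangle \<open>a, b, c\<close>
    positively oriented, which fixes the sign in the relation.\<close>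
  have "winding_number ?p1 0 = 1"
    using winding_number_triangle[OF int] Im_tau by (simp add: a_def b_def)
  with has_contour_integral_winding_number[OF path1(1) n0]
  have "((\<lambda>w. 1 / w) has_contour_integral 2 * of_real pi * \<i>) ?p1" by simp
  moreover have "(zeta_reg has_contour_integral 0) ?p1"
  proof (rule Cauchy_theorem_triangle)
    show "zeta_reg holomorphic_on ?H1"
      unfolding holomorphic_on_def field_differentiable_def
      using lat1 DERIV_zeta_reg has_field_derivative_at_within by blast
  qed
  ultimately have "((\<lambda>w. 1 / w + zeta_reg w) has_contour_integral (2 * of_real pi * \<i> + 0)) ?p1"
    by (rule has_contour_integral_add)
  then have T1: "(wzeta \<tau> has_contour_integral (2 * of_real pi * \<i>)) ?p1"
    by (simp add: wzeta_eq[abs_def])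
  have T2: "(wzeta \<tau> has_contour_integral 0) (linepath c d +++ linepath d a +++ linepath a c)"
    by (rule Cauchy_theorem_triangle, rule wzeta_holomorphic) (use lat2 in auto)
  define I where "I x y = contour_integral (linepath x y) (wzeta \<tau>)" for x y
  have s1: "I a b + I b c + I c a = 2 * of_real pi * \<i>"
    using has_chain_integral_chain_integral3[OF T1] by (simp add: I_def)
  have s2: "I c d + I d a + I a c = 0"
    using has_chain_integral_chain_integral3[OF T2] by (simp add: I_def)
  have seg2: "closed_segment c d \<subseteq> ?H2" "closed_segment d a \<subseteq> ?H2" "closed_segment a c \<subseteq> ?H2"
    by (auto simp: segment_convex_hull intro!: hull_mono)
  then have cont: "continuous_on (closed_segment c d) (wzeta \<tau>)" "continuous_on (closed_segment d a) (wzeta \<tau>)"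
     "continuous_on (closed_segment a c) (wzeta \<tau>)"
    using lat2 by (auto intro!: wzeta_continuous)
  have cont': "continuous_on (closed_segment a b) (wzeta \<tau>)" "continuous_on (closed_segment a d) (wzeta \<tau>)"
    using seg_lat cont(2) by (auto intro!: wzeta_continuous simp: closed_segment_commute)
  have r: "I a c = - I c a" "I d a = - I a d" "I c d = - I d c"
    unfolding I_def using cont by (auto intro!: contour_integral_reverse_linepath simp: closed_segment_commute)
  have e1: "I d c = I a b + eta \<tau> * (b - a)"
  proof -
    have "I d c = contour_integral (linepath (a + \<tau>) (b + \<tau>)) (wzeta \<tau>)"
      by (simp add: I_def d_def c_def b_def)
    also have "\<dots> = contour_integral (linepath a b) (wzeta \<tau>) + eta \<tau> * (b - a)"
      by (rule contour_integral_linepath_translate[OF cont'(1)]) (use seg_lat wzeta_quasi in auto)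
    finally show ?thesis by (simp add: I_def)
  qed
  have e2: "I b c = I a d + eta 1 * (d - a)"
  proof -
    have "I b c = contour_integral (linepath (a + 1) (d + 1)) (wzeta \<tau>)"
      by (simp add: I_def d_def c_def b_def add_ac)
    also have "\<dots> = contour_integral (linepath a d) (wzeta \<tau>) + eta 1 * (d - a)"
    proof (rule contour_integral_linepath_translate[OF cont'(2)])
      fix z assume "z \<in> closed_segment a d"
      then have "z \<notin> \<Lambda>" using lat2 seg2(2) by (auto simp: closed_segment_commute)
      then show "wzeta \<tau> (z + 1) = wzeta \<tau> z + eta 1" by (intro wzeta_quasi) auto
    qed
    finally show ?thesis by (simp add: I_def)
  qed
  \<comment> \<open>The diagonal is traversed once in each direction and cancels; each pair of
    opposite sides leaves one quasi-period times a side of the parallelogram.\<close>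
  have "eta 1 * \<tau> - eta \<tau> = (I a b + I b c + I c a) + (I c d + I d a + I a c)"
    unfolding r e1 e2 by (simp add: b_def d_def)
  then show ?thesis unfolding s1 s2 by simp
qed

section \<open>Entire functions with prescribed behaviour under the periods\<close>

lemma entire_periodic_constant':
  assumes "f holomorphic_on UNIV" "\<And>z. f (z + 1) = f z" "\<And>z. f (z + \<tau>) = f z"
  obtains c where "\<And>z. f z = c"
proof -
  have "\<forall>z. f (z + l) = f z" if "l \<in> \<Lambda>" for l
    using that
  proof (induction rule: lattice_induct)
    case (diff x y)
    show ?case
    proof
      fix z
      have "f (z + (x - y)) = f ((z - y) + x)" by (simp add: algebra_simps)
      also have "\<dots> = f (z - y)" using diff by blast
      also have "\<dots> = f (z - y + y)" using diff(4)[rule_format, of "z - y"] by simp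
      finally show "f (z + (x - y)) = f z" by simp
    qed
  qed (use assms in auto)
  then show ?thesis using entire_periodic_constant[OF assms(1)] that by blast
qed

text \<open>The derivative of \<open>E\<close> is entire and periodic, hence constant, so
  \<open>E\<close> is affine. Matching its slope with both quasi-periods contradicts the Legendre
  relation unless \<open>M = 0\<close>. For logarithmic derivatives \<open>M\<close> counts zeros
  and poles, so this takes the place of the argument principle.\<close>

lemma entire_additive_constant:
  assumes E: "E holomorphic_on UNIV"
    and p: "\<And>z. E (z + 1) = E z + M * eta 1" "\<And>z. E (z + \<tau>) = E z + M * eta \<tau>"
  shows "M = 0" "\<And>z w. E z = E w"
proof -
  have dE: "(E has_field_derivative deriv E z) (at z)" for z
    using E by (auto intro: holomorphic_derivI)
  have "deriv E (z + l) = deriv E z" if "\<And>z. E (z + l) = E z + M * eta l" for z l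
  proof -
    have "((\<lambda>z. E (z + l)) has_field_derivative deriv E (z + l)) (at z)"
      using dE[of "z + l"] by (simp add: DERIV_shift)
    then have "((\<lambda>z. E z + M * eta l) has_field_derivative deriv E (z + l)) (at z)"
      using that by simp
    moreover have "((\<lambda>z. E z + M * eta l) has_field_derivative deriv E z + 0) (at z)"
      by (intro DERIV_add dE DERIV_const)
    ultimately show ?thesis using DERIV_unique by fastforce
  qed
  then have "deriv E (z + 1) = deriv E z" "deriv E (z + \<tau>) = deriv E z" for z
    using p by blast+
  then obtain \<delta> where \<delta>: "\<And>z. deriv E z = \<delta>"
    using entire_periodic_constant'[of "deriv E"] E by (metis holomorphic_deriv open_UNIV)
  have "((\<lambda>z. E z - \<delta> * z) has_field_derivative \<delta> - \<delta>) (at z)" for z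
    using dE[of z] \<delta> by (auto intro!: derivative_eq_intros)
  then have "(\<lambda>z. E z - \<delta> * z) constant_on UNIV"
    by (intro has_field_derivative_0_imp_constant_on) auto
  then obtain \<gamma> where \<gamma>: "\<And>z. E z = \<delta> * z + \<gamma>" by (auto simp: constant_on_def algebra_simps)
  have 1: "\<delta> = M * eta 1" using p(1)[of 0] \<gamma> by simp
  have 2: "\<delta> * \<tau> = M * eta \<tau>" using p(2)[of 0] \<gamma> by simp
  have "M * (eta 1 * \<tau> - eta \<tau>) = \<delta> * \<tau> - \<delta> * \<tau>"
    unfolding right_diff_distrib 2[symmetric] using 1 by simp
  then have "M * (2 * of_real pi * \<i>) = 0" by (simp add: legendre_relation)
  then show "M = 0" by simp
  then have "\<delta> = 0" using 1 by simp
  then show "E z = E w" for z w using \<gamma> by simp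
qed

text \<open>Both exponents are integer multiples of \<open>2 pi i\<close>. The resulting linear
  system for \<open>\<gamma>\<close> and \<open>s\<close> has determinant \<open>2 pi i\<close> up
  to sign by the Legendre relation, and solving it shows \<open>s\<close> to be a period and
  \<open>\<gamma>\<close> its quasi-period.\<close>

lemma lattice_multiplier:
  assumes "exp (\<gamma> * 1 - eta 1 * s) = 1" "exp (\<gamma> * \<tau> - eta \<tau> * s) = 1"
  shows "s \<in> \<Lambda> \<and> \<gamma> = eta s"
proof -
  let ?P = "2 * of_real pi * \<i>"
  have e1: "\<exists>k::int. z = of_int k * ?P" if ez: "exp z = 1" for z
  proof -
    obtain k :: int where "Re z = 0" "Im z = of_int (2 * k) * pi"
      using exp_eq_1[THEN iffD1, OF ez] by blast
    then have "z = of_int k * ?P" by (simp add: complex_eq_iff)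
    then show ?thesis ..
  qed
  obtain k1 where k1: "\<gamma> * 1 - eta 1 * s = of_int k1 * ?P" using e1[OF assms(1)] by blast
  obtain k2 where k2: "\<gamma> * \<tau> - eta \<tau> * s = of_int k2 * ?P" using e1[OF assms(2)] by blast
  have "(eta 1 * \<tau> - eta \<tau>) * s = (\<gamma> * \<tau> - eta \<tau> * s) - (\<gamma> * 1 - eta 1 * s) * \<tau>"
    by (simp add: algebra_simps)
  also have "\<dots> = ?P * (of_int k2 - of_int k1 * \<tau>)" unfolding k1 k2 by (simp add: algebra_simps)
  finally have "?P * s = ?P * (of_int k2 - of_int k1 * \<tau>)" by (simp add: legendre_relation)
  then have s: "s = of_int k2 + of_int (- k1) * \<tau>" by simp
  have "\<gamma> = eta 1 * s + of_int k1 * (eta 1 * \<tau> - eta \<tau>)"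
    unfolding legendre_relation using k1 by (simp add: algebra_simps)
  also have "\<dots> = eta s" unfolding s eta_of_int by (simp add: algebra_simps)
  finally show ?thesis using latticeI[of k2 "-k1"] s by metis
qed

section \<open>Factorisation of theta functions into sigma factors\<close>

lemma wsigma_0 [simp]: "wsigma \<tau> 0 = 0" by simp

lemma wsigma_shift_holomorphic: "(\<lambda>z. wsigma \<tau> (z - a)) holomorphic_on S"
proof -
  have "(\<lambda>z. z - a) holomorphic_on S" by (intro holomorphic_intros)
  from holomorphic_on_compose_gen[OF this wsigma_holomorphic]
  show ?thesis by (simp add: o_def)
qed

lemma DERIV_wsigma_0: "(wsigma \<tau> has_field_derivative 1) (at 0)"
  using wsigma_div_tendsto by (simp add: has_field_derivative_iff)

lemma DERIV_wsigma_lattice: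
  assumes "l \<in> \<Lambda>" shows "(wsigma \<tau> has_field_derivative sigma_mult l) (at l)"
proof -
  have "((\<lambda>z. sigma_mult l * exp (eta l * z) * wsigma \<tau> z) has_field_derivative sigma_mult l) (at 0)"
    by (auto intro!: derivative_eq_intros DERIV_wsigma_0)
  then have "((\<lambda>z. wsigma \<tau> (z + l)) has_field_derivative sigma_mult l) (at 0)"
    by (simp add: wsigma_quasi[OF assms])
  then show ?thesis using DERIV_shift[of "wsigma \<tau>" "sigma_mult l" 0 l] by simp
qed

lemma sparse_lattice_translate: "{z. z - a \<in> \<Lambda>} sparse_in UNIV"
proof -
  have "z \<in> (+) a ` \<Lambda>" if "z - a \<in> \<Lambda>" for z
    using that by (intro image_eqI[of _ _ "z - a"]) auto
  then have "{z. z - a \<in> \<Lambda>} = (+) a ` \<Lambda>" by auto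
  then show ?thesis by (simp add: sparse_in_translate_UNIV sparse_lattice_subset)
qed

text \<open>Sections of a line bundle of degree \<open>m\<close> on the curve: the exponential part
  of the multipliers is that of the \<open>m\<close>-th power of sigma, while the constants
  \<open>u\<close> are left free, so that every sum of zeros is covered.\<close>

definition theta_like :: "nat \<Rightarrow> (complex \<Rightarrow> complex) \<Rightarrow> bool" where
  "theta_like m f \<longleftrightarrow> f holomorphic_on UNIV \<and>
     (\<forall>l\<in>{1,\<tau>}. \<exists>u. u \<noteq> 0 \<and> (\<forall>z. f (z + l) = u * exp (of_nat m * eta l * z) * f z))"

text \<open>Two real conditions on the real and imaginary part of \<open>\<gamma>\<close> make both
  multipliers of \<open>f z * exp (- \<gamma> * z)\<close> unimodular; they are solvable because
  \<open>Im \<tau> > 0\<close>. The modulus is then periodic and Liouville's theorem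
  applies.\<close>

lemma theta_like_0:
  assumes "theta_like 0 f"
  obtains K \<gamma> where "\<And>z. f z = K * exp (\<gamma> * z)"
proof -
  obtain u1 u2 where chi: "u1 \<noteq> 0" "\<And>z. f (z + 1) = u1 * f z" "u2 \<noteq> 0" "\<And>z. f (z + \<tau>) = u2 * f z"
    using assms by (auto simp: theta_like_def)
  define x where "x = ln (norm u1)"
  define y where "y = (x * Re \<tau> - ln (norm u2)) / Im \<tau>"
  define \<gamma> where "\<gamma> = Complex x y"
  define F where "F z = f z * exp (- \<gamma> * z)" for z
  have F: "norm (F (z + l)) = norm (F z)"
    if "\<And>z. f (z + l) = u * f z" "u \<noteq> 0" "Re (\<gamma> * l) = ln (norm u)" for u l z
  proof -
    have "exp (- \<gamma> * (z + l)) = exp (- \<gamma> * l) * exp (- \<gamma> * z)"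
      by (simp add: exp_add[symmetric] algebra_simps)
    then have "F (z + l) = (u * exp (- \<gamma> * l)) * F z" using that(1) by (simp add: F_def)
    moreover have "norm (u * exp (- \<gamma> * l)) = 1"
    proof -
      have "norm (exp (- \<gamma> * l)) = exp (- Re (\<gamma> * l))" by simp
      also have "\<dots> = inverse (norm u)" unfolding that(3) using that(2) by (simp add: exp_minus)
      finally show ?thesis using that(2) by (simp add: norm_mult)
    qed
    ultimately show ?thesis by (simp only: norm_mult)
  qed
  have n1: "norm (F (z + 1)) = norm (F z)" for z
    by (rule F[OF chi(2,1)]) (simp add: \<gamma>_def x_def)
  have n2: "norm (F (z + \<tau>)) = norm (F z)" for z
    by (rule F[OF chi(4,3)]) (use Im_tau in \<open>simp add: \<gamma>_def y_def field_simps\<close>)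
  have per: "\<forall>z. norm (F (z + l)) = norm (F z)" if "l \<in> \<Lambda>" for l
    using that
  proof (induction rule: lattice_induct)
    case (diff x y)
    show ?case
    proof
      fix z
      have "norm (F (z + (x - y))) = norm (F ((z - y) + x))" by (simp add: algebra_simps)
      also have "\<dots> = norm (F (z - y))" using diff by blast
      also have "\<dots> = norm (F (z - y + y))" using diff(4)[rule_format, of "z - y"] by simp
      finally show "norm (F (z + (x - y))) = norm (F z)" by simp
    qed
  qed (use n1 n2 in auto)
  have hol: "F holomorphic_on UNIV"
    using assms unfolding F_def by (auto intro!: holomorphic_intros simp: theta_like_def)
  have "bounded (range F)"
    using per by (intro norm_periodic_bounded holomorphic_on_imp_continuous_on[OF hol]) auto
  then obtain K where "\<And>z. F z = K" using Liouville_theorem[OF hol] by (auto simp: constant_on_def)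
  then have "f z = K * exp (\<gamma> * z)" for z by (metis F_def exp_minus_inverse mult.assoc mult.right_neutral mult.commute mult_minus_left)
  then show ?thesis using that by blast
qed

text \<open>Otherwise the logarithmic derivative would be entire with additive quasi-periods
  \<open>(m + 1) eta l\<close>, which \<open>entire_additive_constant\<close> excludes.\<close>

lemma theta_like_has_zero:
  assumes "theta_like (Suc m) f" obtains a where "f a = 0"
proof (rule ccontr)
  assume "\<not> thesis"
  then have nz: "f z \<noteq> 0" for z using that by blast
  have hol: "f holomorphic_on UNIV" using assms by (simp add: theta_like_def)
  have df: "(f has_field_derivative deriv f z) (at z)" for z
    using hol by (auto intro: holomorphic_derivI)
  define E where "E z = deriv f z / f z" for z
  have hE: "E holomorphic_on UNIV"
    unfolding E_def using hol nz by (auto intro!: holomorphic_intros)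
  have "E (z + l) = E z + of_nat (Suc m) * eta l" if l: "l \<in> {1,\<tau>}" for z l
  proof -
    let ?M = "of_nat (Suc m) * eta l :: complex"
    obtain u where chi: "u \<noteq> 0" "\<And>z. f (z + l) = u * exp (?M * z) * f z"
      using assms l by (auto simp: theta_like_def)
    have "((\<lambda>z. f (z + l)) has_field_derivative deriv f (z + l)) (at z)"
      using df[of "z + l"] by (simp add: DERIV_shift)
    moreover have "((\<lambda>z. u * exp (?M * z) * f z) has_field_derivative (u * (?M * exp (?M * z))) * f z + deriv f z * (u * exp (?M * z))) (at z)"
      by (intro DERIV_mult df) (auto intro!: derivative_eq_intros)
    ultimately have "deriv f (z + l) = (u * (?M * exp (?M * z))) * f z + deriv f z * (u * exp (?M * z))"
      using chi(2) DERIV_unique by (metis (no_types, lifting) ext)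
    then show ?thesis
      using nz[of z] chi(1) unfolding E_def chi(2) by (simp add: field_simps)
  qed
  then have "of_nat (Suc m) = (0::complex)"
    by (intro entire_additive_constant(1)[OF hE]) auto
  then show False by (metis of_nat_eq_0_iff nat.distinct(1))
qed

text \<open>One zero is divided out at a time. The zero set is invariant under the lattice and sigma
  has simple zeros, so the quotient by the sigma factor at \<open>a\<close> is entire, with degree
  lowered by one; multiple zeros just come up repeatedly. The point \<open>z0\<close> keeps
  \<open>K\<close> from vanishing.\<close>

lemma theta_like_factor:
  assumes "theta_like m f" "f z0 \<noteq> 0"
  obtains K \<gamma> a where "K \<noteq> 0" "\<And>z. f z = K * exp (\<gamma> * z) * (\<Prod>i=1..m. wsigma \<tau> (z - a i))"
proof -
  have "\<exists>K \<gamma> a. K \<noteq> 0 \<and> (\<forall>z. f z = K * exp (\<gamma> * z) * (\<Prod>i=1..m. wsigma \<tau> (z - a i)))"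
    using assms
  proof (induction m arbitrary: f)
    case 0
    obtain K \<gamma> where K: "\<And>z. f z = K * exp (\<gamma> * z)" using theta_like_0[OF 0(1)] by blast
    then have "K \<noteq> 0" using 0 by auto
    then show ?case using K by auto
  next
    case (Suc m)
    obtain a where a: "f a = 0" using theta_like_has_zero[OF Suc.prems(1)] by blast
    define g where "g z = wsigma \<tau> (z - a)" for z
    have f: "f holomorphic_on UNIV" using Suc.prems by (simp add: theta_like_def)
    have g: "g holomorphic_on UNIV"
      unfolding g_def by (rule wsigma_shift_holomorphic)
    have fl: "\<forall>z. f (z + l) = 0 \<longleftrightarrow> f z = 0" if "l \<in> \<Lambda>" for l
      using that
    proof (induction rule: lattice_induct)
      case one
      obtain u where "u \<noteq> 0" "\<And>z. f (z + 1) = u * exp (of_nat (Suc m) * eta 1 * z) * f z"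
        using Suc.prems(1) unfolding theta_like_def by blast
      then show ?case by simp
    next
      case tau
      obtain u where "u \<noteq> 0" "\<And>z. f (z + \<tau>) = u * exp (of_nat (Suc m) * eta \<tau> * z) * f z"
        using Suc.prems(1) unfolding theta_like_def by blast
      then show ?case by simp
    next
      case (diff x y)
      show ?case
      proof
        fix z
        have "f (z + (x - y)) = f ((z - y) + x)" by (simp add: algebra_simps)
        then have "f (z + (x - y)) = 0 \<longleftrightarrow> f (z - y) = 0" using diff(3) by simp
        also have "\<dots> \<longleftrightarrow> f (z - y + y) = 0" using diff(4)[rule_format, of "z - y"] by simp
        finally show "f (z + (x - y)) = 0 \<longleftrightarrow> f z = 0" by simp
      qed
    qed
    have gz: "g z = 0 \<longleftrightarrow> z - a \<in> \<Lambda>" for z by (simp add: g_def)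
    have sp: "{z. g z = 0} sparse_in UNIV" unfolding gz by (rule sparse_lattice_translate)
    have "f z = 0 \<and> deriv g z \<noteq> 0" if g0: "g z = 0" for z
    proof -
      from g0
      have l: "z - a \<in> \<Lambda>" by (simp add: gz)
      have "f z = 0" using fl[OF l] a by (metis add.commute diff_add_cancel)
      moreover have "(g has_field_derivative sigma_mult (z - a)) (at z)"
        unfolding g_def[abs_def] using DERIV_wsigma_lattice[OF l]
          DERIV_shift[of "wsigma \<tau>" "sigma_mult (z - a)" z "- a"] by simp
      ultimately show "f z = 0 \<and> deriv g z \<noteq> 0"
        using DERIV_imp_deriv sigma_mult_nonzero[OF l] by metis
    qed
    from entire_quotient[OF f g sp this]
    obtain h where h: "h holomorphic_on UNIV" "\<And>z. f z = g z * h z" by metis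
    have "theta_like m h"
      unfolding theta_like_def
    proof (intro conjI ballI)
      fix l assume l: "l \<in> {1,\<tau>}"
      then have lL: "l \<in> \<Lambda>" by auto
      obtain u where chi: "u \<noteq> 0" "\<And>z. f (z + l) = u * exp (of_nat (Suc m) * eta l * z) * f z"
        using Suc.prems(1) l unfolding theta_like_def by blast
      define c where "c = sigma_mult l * exp (- eta l * a)"
      have c: "c \<noteq> 0" using sigma_mult_nonzero[OF lL] by (simp add: c_def)
      have gl: "g (z + l) = c * exp (eta l * z) * g z" for z
        using wsigma_quasi[OF lL, of "z - a"]
        by (simp add: g_def c_def algebra_simps exp_add exp_diff exp_minus divide_simps)
      have "h (z + l) = (u / c) * exp (of_nat m * eta l * z) * h z" for z
      proof (rule continuous_eq_off_sparse[where f = "\<lambda>z. h (z + l)" and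
          g = "\<lambda>z. (u / c) * exp (of_nat m * eta l * z) * h z", OF _ _ sparse_lattice_translate[of a]])
        fix z assume z: "z \<notin> {z. z - a \<in> \<Lambda>}"
        have "c * exp (eta l * z) * g z * h (z + l) = u * exp (of_nat (Suc m) * eta l * z) * (g z * h z)"
          using chi(2)[of z] h(2)[of "z + l"] h(2)[of z] gl[of z] by simp
        moreover have "exp (of_nat (Suc m) * eta l * z) = exp (eta l * z) * exp (of_nat m * eta l * z)"
          by (simp add: exp_add[symmetric] algebra_simps)
        ultimately show "h (z + l) = (u / c) * exp (of_nat m * eta l * z) * h z"
          using z c gz[of z] by (simp add: field_simps)
      next
        have "continuous_on UNIV h" by (rule holomorphic_on_imp_continuous_on[OF h(1)])
        then show "continuous_on UNIV (\<lambda>z. h (z + l))"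
          by (rule continuous_on_compose2) (auto intro!: continuous_intros)
        show "continuous_on UNIV (\<lambda>z. u / c * exp (of_nat m * eta l * z) * h z)"
          by (intro continuous_intros holomorphic_on_imp_continuous_on h(1))
      qed
      then show "\<exists>u. u \<noteq> 0 \<and> (\<forall>z. h (z + l) = u * exp (of_nat m * eta l * z) * h z)"
        using chi(1) c by (intro exI[of _ "u / c"]) auto
    qed (rule h(1))
    moreover have "h z0 \<noteq> 0" using Suc.prems(2) h(2) by auto
    ultimately obtain K \<gamma> b where b: "K \<noteq> 0" "\<And>z. h z = K * exp (\<gamma> * z) * (\<Prod>i=1..m. wsigma \<tau> (z - b i))"
      using Suc.IH by blast
    have "f z = K * exp (\<gamma> * z) * (\<Prod>i=1..Suc m. wsigma \<tau> (z - (b(Suc m := a)) i))" for z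
    proof -
      have "(\<Prod>i=1..m. wsigma \<tau> (z - (b(Suc m := a)) i)) = (\<Prod>i=1..m. wsigma \<tau> (z - b i))"
        by (rule prod.cong) auto
      then show ?thesis using h(2)[of z] b(2)[of z] by (simp add: g_def)
    qed
    then show ?case using b(1) by blast
  qed
  then show ?thesis using that by blast
qed

lemma sigma_prod_quasi:
  assumes "l \<in> \<Lambda>"
  shows "exp (c * (z + l)) * (\<Prod>i\<in>I. wsigma \<tau> (z + l - a i)) =
    sigma_mult l ^ card I * exp (of_nat (card I) * eta l * z) * exp (c * l - eta l * (\<Sum>i\<in>I. a i)) *
      (exp (c * z) * (\<Prod>i\<in>I. wsigma \<tau> (z - a i)))"
proof (cases "finite I")
  case True
  have "wsigma \<tau> (z + l - a i) = sigma_mult l * exp (eta l * (z - a i)) * wsigma \<tau> (z - a i)" for i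
    using wsigma_quasi[OF assms, of "z - a i"] by (simp add: algebra_simps)
  then have "(\<Prod>i\<in>I. wsigma \<tau> (z + l - a i)) = sigma_mult l ^ card I * exp (\<Sum>i\<in>I. eta l * (z - a i)) * (\<Prod>i\<in>I. wsigma \<tau> (z - a i))"
    using True by (simp add: prod.distrib exp_sum)
  moreover have "(\<Sum>i\<in>I. eta l * (z - a i)) = of_nat (card I) * eta l * z - eta l * (\<Sum>i\<in>I. a i)"
    by (simp add: sum_subtractf sum_distrib_left[symmetric] right_diff_distrib)
  ultimately show ?thesis
    by (simp add: exp_add exp_diff distrib_left)
next
  case False
  then show ?thesis by (simp add: exp_add distrib_left)
qed

end

section \<open>Differential equation of the Weierstrass function\<close>

lemma even_deriv_0:
  fixes f :: "complex \<Rightarrow> complex"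
  assumes "(f has_field_derivative D) (at 0)" "\<And>z. f (- z) = f z"
  shows "D = 0"
proof -
  have "((\<lambda>z. f (- z)) has_field_derivative D * (-1)) (at 0)"
    by (rule DERIV_chain2[where f = f and g = uminus]) (use assms(1) in \<open>auto intro!: derivative_eq_intros\<close>)
  then have "(f has_field_derivative - D) (at 0)" by (simp add: assms(2))
  with assms(1) have "D = - D" by (rule DERIV_unique)
  then show ?thesis by simp
qed

context upper_half begin

lemma eventually_notin_lattice: "eventually (\<lambda>z. z \<notin> \<Lambda>) (at a)"
proof -
  obtain B where B: "open B" "a \<in> B" "\<And>y. y \<in> B \<Longrightarrow> y \<noteq> a \<Longrightarrow> y \<notin> \<Lambda>"
    by (rule sparse_in_not_in[OF sparse_lattice_subset[of \<Lambda>], of a]) auto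
  show ?thesis
    using eventually_at_in_open[OF B(1,2)] by (rule eventually_mono) (use B in auto)
qed

text \<open>An entire extension exists because the limit at 0 is carried by periodicity to every
  lattice point; it is then an elliptic function without poles.\<close>

lemma lattice_regular_periodic_constant:
  assumes d: "\<And>z. z \<notin> \<Lambda> \<Longrightarrow> f field_differentiable (at z)"
    and per: "\<And>l z. l \<in> \<Lambda> \<Longrightarrow> z \<notin> \<Lambda> \<Longrightarrow> f (z + l) = f z"
    and lim: "(f \<longlongrightarrow> L) (at 0)"
    and z: "z \<notin> \<Lambda>"
  shows "f z = L"
proof -
  define F where "F z = (if z \<in> \<Lambda> then L else f z)" for z
  have "F holomorphic_on UNIV"
  proof (rule holomorphic_on_UNIV_extend[OF sparse_lattice_subset[of \<Lambda>]])
    fix z assume z: "z \<notin> \<Lambda>"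
    obtain D where "(f has_field_derivative D) (at z)" using d[OF z] by (auto simp: field_differentiable_def)
    then have "(F has_field_derivative D) (at z)"
      by (rule has_field_derivative_transform_within_open[OF _ open_lreg]) (use z in \<open>auto simp: lreg_iff F_def\<close>)
    then show "F field_differentiable at z" by (auto simp: field_differentiable_def)
  next
    fix l assume l: "l \<in> \<Lambda>"
    have "((\<lambda>h. F (l + h)) \<longlongrightarrow> L) (at 0)"
    proof (rule Lim_transform_eventually[OF lim])
      show "\<forall>\<^sub>F h in at 0. f h = F (l + h)"
        using eventually_notin_lattice[of 0]
      proof (rule eventually_mono)
        fix h assume h: "h \<notin> \<Lambda>"
        show "f h = F (l + h)"
          using per[OF l h] l h by (simp add: F_def add.commute[of l h])
      qed
    qed
    then show "(F \<longlongrightarrow> F l) (at l)"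
      using l LIM_offset_zero_cancel[of F l L] by (simp add: F_def)
  qed simp
  moreover have "F (z + l) = F z" if "l \<in> \<Lambda>" for z l
    using that per by (auto simp: F_def)
  ultimately obtain c where c: "\<And>z. F z = c" using entire_periodic_constant by metis
  have "F 0 = L" by (simp add: F_def)
  moreover have "F z = f z" using z by (simp add: F_def)
  ultimately show ?thesis using c by metis
qed

lemma wp_holomorphic: "wp \<tau> holomorphic_on lreg"
  unfolding holomorphic_on_def field_differentiable_def
  using DERIV_wp has_field_derivative_at_within lreg_iff by blast

definition preg :: "complex set" where "preg = - (\<Lambda> - {0})"

lemma open_preg: "open preg"
  unfolding preg_def by (intro open_Compl closed_lattice_subset) auto

lemma zero_in_preg [simp]: "0 \<in> preg" by (simp add: preg_def)

lemma wp_reg_holomorphic: "wp_reg holomorphic_on preg"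
  unfolding holomorphic_on_def field_differentiable_def preg_def
  using DERIV_wp_reg(1) has_field_derivative_at_within by blast

lemma zeta_reg_holomorphic: "zeta_reg holomorphic_on preg"
  unfolding holomorphic_on_def field_differentiable_def preg_def
  using DERIV_zeta_reg has_field_derivative_at_within by blast

lemma deriv_wp_reg_0: "deriv wp_reg 0 = 0"
  by (rule even_deriv_0[OF holomorphic_derivI[OF wp_reg_holomorphic open_preg] wp_reg_even]) simp

text \<open>The regular part is even and zero at the origin, hence divisible by \<open>z^2\<close>.
  This keeps the mixed term \<open>2 wp_reg z / z^2\<close> in the square of \<open>wp\<close>
  bounded.\<close>

lemma wp_reg_quotient:
  obtains k where "k holomorphic_on preg" "\<And>z. z \<in> preg \<Longrightarrow> wp_reg z = z\<^sup>2 * k z"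
proof -
  define e1 where "e1 z = (if z = 0 then deriv wp_reg 0 else wp_reg z / z)" for z
  define k where "k z = (if z = 0 then deriv e1 0 else e1 z / z)" for z
  have e1h: "e1 holomorphic_on preg"
    by (rule pole_theorem_open_0[OF wp_reg_holomorphic open_preg, where a = 0]) (auto simp: e1_def)
  have e10: "e1 0 = 0" by (simp add: e1_def deriv_wp_reg_0)
  have "k holomorphic_on preg"
    by (rule pole_theorem_open_0[OF e1h open_preg, where a = 0]) (auto simp: k_def e10)
  moreover have "wp_reg z = z\<^sup>2 * k z" for z
    by (auto simp: k_def e1_def power2_eq_square)
  ultimately show ?thesis using that by blast
qed

lemma deriv_wp_reg: "z \<in> preg \<Longrightarrow> deriv wp_reg z = wp_reg' z"
  by (intro DERIV_imp_deriv DERIV_wp_reg) (auto simp: preg_def)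

lemma DERIV_inverse_cube:
  fixes z :: complex
  assumes "z \<noteq> 0"
  shows "((\<lambda>z. - 2 / z ^ 3) has_field_derivative 6 / z ^ 4) (at z)"
proof -
  have "((\<lambda>z. - 2 * inverse (z ^ 3)) has_field_derivative - 2 * (- (inverse (z ^ 3) * (3 * z\<^sup>2) * inverse (z ^ 3)))) (at z)"
    using assms by (auto intro!: derivative_eq_intros)
  moreover have "- 2 * (- (inverse (z ^ 3) * (3 * z\<^sup>2) * inverse (z ^ 3))) = 6 / z ^ 4"
    using assms by (simp add: field_simps eval_nat_numeral)
  ultimately show ?thesis by (simp only: divide_inverse)
qed

lemma wp'_holomorphic: "wp' holomorphic_on lreg"
proof -
  have "deriv (wp \<tau>) holomorphic_on lreg" by (rule holomorphic_deriv[OF wp_holomorphic open_lreg])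
  then show ?thesis
    by (rule holomorphic_transform) (auto simp: lreg_iff intro!: DERIV_imp_deriv DERIV_wp)
qed

lemma deriv_wp'_local:
  assumes "z \<notin> \<Lambda>" shows "deriv wp' z = 6 / z ^ 4 + deriv (deriv wp_reg) z"
proof (rule DERIV_imp_deriv)
  have z: "z \<in> preg" "z \<noteq> 0" using assms by (auto simp: preg_def)
  have "(deriv wp_reg has_field_derivative deriv (deriv wp_reg) z) (at z)"
    by (rule holomorphic_derivI[OF holomorphic_deriv[OF wp_reg_holomorphic open_preg] open_preg z(1)])
  from DERIV_add[OF DERIV_inverse_cube[OF z(2)] this]
  show "(wp' has_field_derivative 6 / z ^ 4 + deriv (deriv wp_reg) z) (at z)"
    by (rule has_field_derivative_transform_within_open[OF _ open_preg z(1)]) (auto simp: wp'_def deriv_wp_reg)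
qed

lemma DERIV_wp'_deriv: "z \<notin> \<Lambda> \<Longrightarrow> (wp' has_field_derivative deriv wp' z) (at z)"
  by (rule holomorphic_derivI[OF wp'_holomorphic open_lreg]) (simp add: lreg_iff)

lemma deriv_wp'_periodic:
  assumes "l \<in> \<Lambda>" "z \<notin> \<Lambda>" shows "deriv wp' (z + l) = deriv wp' z"
proof -
  have "((\<lambda>z. wp' (z + l)) has_field_derivative deriv wp' (z + l)) (at z)"
    using DERIV_wp'_deriv[of "z + l"] assms by (simp add: DERIV_shift)
  then have "(wp' has_field_derivative deriv wp' (z + l)) (at z)"
    by (rule has_field_derivative_transform_within_open[OF _ open_lreg]) (use assms wp'_periodic in \<open>auto simp: lreg_iff\<close>)
  then show ?thesis using DERIV_imp_deriv by metis
qed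

text \<open>The classical invariants, introduced as the constants in the equations for
  \<open>wp''\<close> and \<open>wp'^2\<close> and evaluated at \<open>1/2\<close>, instead of as
  Eisenstein sums.\<close>

definition inv_g2 :: complex where
  "inv_g2 = 12 * (wp \<tau> (1 / 2))\<^sup>2 - 2 * deriv wp' (1 / 2)"

definition inv_g3 :: complex where
  "inv_g3 = 4 * wp \<tau> (1 / 2) ^ 3 - inv_g2 * wp \<tau> (1 / 2) - (wp' (1 / 2))\<^sup>2"

text \<open>The poles \<open>6 / z^4\<close> of \<open>wp''\<close> and of \<open>6 wp^2\<close>
  cancel, and the mixed term is regular by \<open>wp_reg_quotient\<close>; what remains is periodic
  with a finite limit at 0, hence constant.\<close>

lemma deriv_wp':
  assumes "z \<notin> \<Lambda>" shows "deriv wp' z = 6 * (wp \<tau> z)\<^sup>2 - inv_g2 / 2"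
proof -
  define f where "f z = deriv wp' z - 6 * (wp \<tau> z)\<^sup>2" for z
  obtain k where k: "k holomorphic_on preg" "\<And>z. z \<in> preg \<Longrightarrow> wp_reg z = z\<^sup>2 * k z"
    using wp_reg_quotient by blast
  define F where "F z = deriv (deriv wp_reg) z - 12 * k z - 6 * (wp_reg z)\<^sup>2" for z
  have "F holomorphic_on preg"
    unfolding F_def by (intro holomorphic_intros holomorphic_deriv wp_reg_holomorphic open_preg k)
  then have "isCont F 0"
    using holomorphic_on_imp_continuous_on open_preg by (metis continuous_on_eq_continuous_at zero_in_preg)
  then have lim: "(F \<longlongrightarrow> F 0) (at 0)" by (simp add: isCont_def)
  have eq: "F z = f z" if z: "z \<notin> \<Lambda>" for z
  proof -
    have z0: "z \<noteq> 0" "z \<in> preg" using z by (auto simp: preg_def)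
    have "f z = 6 / z ^ 4 + deriv (deriv wp_reg) z - 6 * (1 / z\<^sup>2 + wp_reg z)\<^sup>2"
      by (simp add: f_def deriv_wp'_local[OF z] wp_eq)
    also have "(1 / z\<^sup>2 + wp_reg z)\<^sup>2 = 1 / z ^ 4 + 2 * k z + (wp_reg z)\<^sup>2"
      unfolding power2_sum using z0 by (simp add: k(2)[OF z0(2)] power_divide power_mult[symmetric])
    finally show ?thesis by (simp add: F_def algebra_simps)
  qed
  have "eventually (\<lambda>z. F z = f z) (at 0)"
    using eventually_notin_lattice[of 0] by (rule eventually_mono) (use eq in auto)
  from Lim_transform_eventually[OF lim this] have lim': "(f \<longlongrightarrow> F 0) (at 0)" .
  have "f holomorphic_on lreg"
    unfolding f_def by (intro holomorphic_intros holomorphic_deriv wp_holomorphic wp'_holomorphic open_lreg)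
  then have d: "f field_differentiable at z" if "z \<notin> \<Lambda>" for z
    using that open_lreg by (auto intro: holomorphic_on_imp_differentiable_at simp: lreg_iff)
  have per: "f (z + l) = f z" if "l \<in> \<Lambda>" "z \<notin> \<Lambda>" for l z
    using that by (simp add: f_def deriv_wp'_periodic wp_periodic)
  have "f z = F 0" "f (1 / 2) = F 0"
    using lattice_regular_periodic_constant[OF d per lim'] assms half_notin_lattice by auto
  then show ?thesis by (simp add: f_def inv_g2_def field_simps)
qed

lemma DERIV_wp': "z \<notin> \<Lambda> \<Longrightarrow> (wp' has_field_derivative 6 * (wp \<tau> z)\<^sup>2 - inv_g2 / 2) (at z)"
  using DERIV_wp'_deriv deriv_wp' by simp

lemma wp'_sq:
  assumes "z \<notin> \<Lambda>" shows "(wp' z)\<^sup>2 = 4 * wp \<tau> z ^ 3 - inv_g2 * wp \<tau> z - inv_g3"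
proof -
  define f where "f z = 4 * wp \<tau> z ^ 3 - inv_g2 * wp \<tau> z - (wp' z)\<^sup>2" for z
  have "(f has_field_derivative 0) (at z)" if "z \<in> lreg" for z
  proof -
    have z: "z \<notin> \<Lambda>" using that by (simp add: lreg_iff)
    have "(f has_field_derivative 4 * (3 * (wp \<tau> z)\<^sup>2 * wp' z) - inv_g2 * wp' z - 2 * wp' z * (6 * (wp \<tau> z)\<^sup>2 - inv_g2 / 2)) (at z)"
      unfolding f_def by (rule derivative_eq_intros DERIV_wp[OF z] DERIV_wp'[OF z] refl | simp)+
    then show ?thesis by (simp add: algebra_simps)
  qed
  then have "f constant_on lreg"
    by (rule has_field_derivative_0_imp_constant_on[OF _ connected_lreg open_lreg])
  then have "f z = f (1 / 2)" using assms half_notin_lattice by (auto simp: constant_on_def lreg_iff)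
  then show ?thesis by (simp add: f_def inv_g3_def algebra_simps)
qed

lemma wp_tendsto: "((\<lambda>z. z\<^sup>2 * wp \<tau> z) \<longlongrightarrow> 1) (at 0)"
proof -
  have "isCont wp_reg 0"
    using holomorphic_on_imp_continuous_on[OF wp_reg_holomorphic] open_preg by (metis continuous_on_eq_continuous_at zero_in_preg)
  then have 1: "((\<lambda>z. 1 + z\<^sup>2 * wp_reg z) \<longlongrightarrow> 1 + 0\<^sup>2 * wp_reg 0) (at 0)"
    unfolding isCont_def by (intro tendsto_intros)
  have 2: "eventually (\<lambda>z. 1 + z\<^sup>2 * wp_reg z = z\<^sup>2 * wp \<tau> z) (at 0)"
    unfolding eventually_at_filter by (rule always_eventually) (simp add: wp_eq distrib_left)
  show ?thesis using Lim_transform_eventually[OF 1 2] by simp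
qed

section \<open>Sums of zeros modulo the lattice and the invariant kappa\<close>

lemma ell_point_eq_iff: "ell_point \<tau> s = ell_point \<tau> s' \<longleftrightarrow> s - s' \<in> \<Lambda>"
proof
  assume "ell_point \<tau> s = ell_point \<tau> s'"
  moreover have "s' \<in> ell_point \<tau> s'" by (auto simp: ell_point_def lattice_rel_def)
  ultimately have "s' \<in> ell_point \<tau> s" by simp
  then show "s - s' \<in> \<Lambda>" by (simp add: ell_point_def lattice_rel_def)
next
  assume a: "s - s' \<in> \<Lambda>"
  have "s - y \<in> \<Lambda> \<longleftrightarrow> s' - y \<in> \<Lambda>" for y
    using lattice_add_iff[OF a, of "s' - y"] by (simp add: algebra_simps)
  then show "ell_point \<tau> s = ell_point \<tau> s'" by (auto simp: ell_point_def lattice_rel_def)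
qed

text \<open>Moving the sum by a period changes zeta by the quasi-period of that period, which is
  exactly the change allowed for the exponent; whether the value is infinite depends on the class
  alone.\<close>

lemma kappa_value_cong:
  assumes "s - s' \<in> \<Lambda>" "c - c' = eta (s - s')"
  shows "kappa_value \<tau> s c = kappa_value \<tau> s' c'"
proof -
  have "s \<in> \<Lambda> \<longleftrightarrow> s' \<in> \<Lambda>" using lattice_add_iff[OF assms(1), of s'] by simp
  moreover have "wzeta \<tau> s - c = wzeta \<tau> s' - c'" if "s' \<notin> \<Lambda>"
    using wzeta_quasi[OF assms(1) that] assms(2) by (simp add: algebra_simps)
  ultimately show ?thesis by (auto simp: kappa_value_def)
qed

text \<open>\<open>X\<close> and \<open>Y\<close> are elliptic, so under a period only the sigma
  products change. With equally many factors the common part of the multipliers cancels and leaves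
  \<open>exp ((c - c') l - eta l (sum a I - sum b J)) = 1\<close> for every period, which
  \<open>lattice_multiplier\<close> resolves. The identity is demanded only on a small open set
  because analytic continuation spreads it over the complement of the lattice.\<close>

lemma sigma_quotient_periodic:
  assumes card: "card I = card J"
    and X: "X holomorphic_on lreg" "\<And>l z. l \<in> \<Lambda> \<Longrightarrow> z \<notin> \<Lambda> \<Longrightarrow> X (z + l) = X z"
    and Y: "Y holomorphic_on lreg" "\<And>l z. l \<in> \<Lambda> \<Longrightarrow> z \<notin> \<Lambda> \<Longrightarrow> Y (z + l) = Y z"
    and V: "open V" "V \<subseteq> lreg" "v \<in> V"
    and eq: "\<And>z. z \<in> V \<Longrightarrow> exp (c * z) * (\<Prod>i\<in>I. wsigma \<tau> (z - a i)) * Y z =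
        k * (exp (c' * z) * (\<Prod>j\<in>J. wsigma \<tau> (z - b j)) * X z)"
    and nz: "exp (c * v) * (\<Prod>i\<in>I. wsigma \<tau> (v - a i)) * Y v \<noteq> 0"
  shows "sum a I - sum b J \<in> \<Lambda> \<and> c - c' = eta (sum a I - sum b J)"
proof -
  define A where "A z = exp (c * z) * (\<Prod>i\<in>I. wsigma \<tau> (z - a i))" for z
  define B where "B z = exp (c' * z) * (\<Prod>j\<in>J. wsigma \<tau> (z - b j))" for z
  have AB: "A holomorphic_on lreg" "B holomorphic_on lreg"
    unfolding A_def B_def by (intro holomorphic_intros wsigma_shift_holomorphic)+
  have all: "A z * Y z = k * (B z * X z)" if "z \<in> lreg" for z
  proof (rule analytic_continuation_open[of V lreg "\<lambda>z. A z * Y z" "\<lambda>z. k * (B z * X z)"])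
    show "(\<lambda>z. A z * Y z) holomorphic_on lreg" "(\<lambda>z. k * (B z * X z)) holomorphic_on lreg"
      by (intro holomorphic_intros AB X Y)+
    show "A z * Y z = k * (B z * X z)" if "z \<in> V" for z
      using eq[OF that] by (simp add: A_def B_def)
  qed (use V open_lreg connected_lreg that in auto)
  have v: "v \<in> lreg" "v \<notin> \<Lambda>" using V by (auto simp: lreg_iff)
  have "exp ((c - c') * l - eta l * (sum a I - sum b J)) = 1" if l: "l \<in> \<Lambda>" for l
  proof -
    let ?m = "sigma_mult l ^ card J * exp (of_nat (card J) * eta l * v)"
    have m: "?m \<noteq> 0" using sigma_mult_nonzero[OF l] by simp
    have "A (v + l) = ?m * exp (c * l - eta l * sum a I) * A v"
      unfolding A_def sigma_prod_quasi[OF l] card ..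
    moreover have "B (v + l) = ?m * exp (c' * l - eta l * sum b J) * B v"
      unfolding B_def sigma_prod_quasi[OF l] ..
    moreover have "A (v + l) * Y v = k * (B (v + l) * X v)"
      using all[of "v + l"] v l X(2)[of l v] Y(2)[of l v] by (simp add: lreg_iff)
    ultimately have "?m * (exp (c * l - eta l * sum a I) * (A v * Y v)) = ?m * (exp (c' * l - eta l * sum b J) * (k * (B v * X v)))"
      by (simp add: mult_ac)
    then have "exp (c * l - eta l * sum a I) * (A v * Y v) = exp (c' * l - eta l * sum b J) * (A v * Y v)"
      unfolding mult_left_cancel[OF m] all[OF v(1)] .
    then have "exp (c * l - eta l * sum a I) = exp (c' * l - eta l * sum b J)"
      using nz by (simp add: A_def)
    moreover have "(c - c') * l - eta l * (sum a I - sum b J) = (c * l - eta l * sum a I) - (c' * l - eta l * sum b J)"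
      by (simp add: algebra_simps)
    ultimately show ?thesis by (simp add: exp_diff)
  qed
  from this[of 1] this[of \<tau>] show ?thesis using lattice_multiplier by simp
qed

end

section \<open>The function wp - wp(p) and the potential of the non-even equation\<close>

locale upper_half_point = upper_half +
  fixes p :: complex
  assumes double_notin: "2 * p \<notin> \<Lambda>"
begin

abbreviation S :: "complex set" where "S \<equiv> gle1_regular p \<tau>"

definition g :: "complex \<Rightarrow> complex" where "g z = wp \<tau> z - wp \<tau> p"

lemma p_notin: "p \<notin> \<Lambda>"
  using double_notin lattice_add[of p p] by auto

lemma S_iff: "z \<in> S \<longleftrightarrow> z \<notin> \<Lambda> \<and> z + p \<notin> \<Lambda> \<and> z - p \<notin> \<Lambda>"
  by (simp add: gle1_regular_def)

lemma sparse_Compl_S: "- S sparse_in UNIV"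
proof -
  have "- S = \<Lambda> \<union> ({z. z - p \<in> \<Lambda>} \<union> {z. z - (- p) \<in> \<Lambda>})" by (auto simp: S_iff)
  then show ?thesis
    using sparse_lattice_translate[of p] sparse_lattice_translate[of "-p"] sparse_lattice_subset[of \<Lambda>]
    by (simp add: sparse_in_union')
qed

lemma open_S: "open S"
  using sparse_in_UNIV_imp_closed[OF sparse_Compl_S] by (simp add: closed_def)

lemma connected_S: "connected S"
proof -
  have "connected (UNIV - - S)" by (rule sparse_imp_connected) (use sparse_Compl_S in auto)
  then show ?thesis by (simp add: Compl_eq_Diff_UNIV[symmetric])
qed

lemma S_nonempty: "S \<noteq> {}"
proof
  assume "S = {}"
  then have "UNIV sparse_in (UNIV :: complex set)" using sparse_Compl_S by simp
  then show False by (simp add: sparse_in_open islimpt_UNIV)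
qed

text \<open>The product of \<open>wsigma^2\<close> and \<open>g\<close> is entire, has the
  multipliers of \<open>wsigma (z - p) * wsigma (z + p)\<close> and vanishes where that product
  does. Because \<open>2 p\<close> is no period, the zeros \<open>p\<close> and \<open>-p\<close>
  are distinct modulo the lattice, hence simple, and the quotient is entire and periodic.\<close>

lemma wp_diff_sigma:
  obtains K where "K \<noteq> 0" "\<And>z. z \<notin> \<Lambda> \<Longrightarrow> g z = K * (wsigma \<tau> (z - p) * wsigma \<tau> (z - - p)) / (wsigma \<tau> z)\<^sup>2"
proof -
  \<comment> \<open>At a lattice point the value is the limit of \<open>wsigma^2 * wp\<close>, since
    \<open>z^2 wp\<close> and \<open>wsigma z / z\<close> both tend to 1 at the origin.\<close>
  define f where "f z = (if z \<in> \<Lambda> then (sigma_mult z)\<^sup>2 else (wsigma \<tau> z)\<^sup>2 * g z)" for z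
  define w where "w z = wsigma \<tau> (z - p) * wsigma \<tau> (z - - p)" for z
  have f: "f holomorphic_on UNIV"
  proof (rule holomorphic_on_UNIV_extend[OF sparse_lattice_subset[of \<Lambda>]])
    fix z assume z: "z \<notin> \<Lambda>"
    have "((\<lambda>z. (wsigma \<tau> z)\<^sup>2 * g z) has_field_derivative
       2 * wsigma \<tau> z * (wzeta \<tau> z * wsigma \<tau> z) * g z + wp' z * (wsigma \<tau> z)\<^sup>2) (at z)"
      unfolding g_def by (rule derivative_eq_intros DERIV_wsigma[OF z] DERIV_wp[OF z] refl | simp)+
    then have "(f has_field_derivative 2 * wsigma \<tau> z * (wzeta \<tau> z * wsigma \<tau> z) * g z + wp' z * (wsigma \<tau> z)\<^sup>2) (at z)"
      by (rule has_field_derivative_transform_within_open[OF _ open_lreg]) (use z in \<open>auto simp: lreg_iff f_def\<close>)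
    then show "f field_differentiable at z" by (auto simp: field_differentiable_def)
  next
    fix l assume l: "l \<in> \<Lambda>"
    have "((\<lambda>h. (sigma_mult l * exp (eta l * h) * (wsigma \<tau> h / h))\<^sup>2 * (h\<^sup>2 * wp \<tau> h - h\<^sup>2 * wp \<tau> p)) \<longlongrightarrow>
        (sigma_mult l * exp (eta l * 0) * 1)\<^sup>2 * (1 - 0\<^sup>2 * wp \<tau> p)) (at 0)"
      by (intro tendsto_intros wsigma_div_tendsto wp_tendsto)
    moreover have "\<forall>\<^sub>F h in at 0. (sigma_mult l * exp (eta l * h) * (wsigma \<tau> h / h))\<^sup>2 * (h\<^sup>2 * wp \<tau> h - h\<^sup>2 * wp \<tau> p) = f (l + h)"
      using eventually_notin_lattice[of 0]
    proof (rule eventually_mono)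
      fix h assume h: "h \<notin> \<Lambda>"
      then have h0: "h \<noteq> 0" by auto
      have "f (l + h) = (wsigma \<tau> (h + l))\<^sup>2 * (wp \<tau> (h + l) - wp \<tau> p)"
        using h l by (simp add: f_def g_def add.commute)
      also have "\<dots> = (sigma_mult l * exp (eta l * h) * wsigma \<tau> h)\<^sup>2 * (wp \<tau> h - wp \<tau> p)"
        unfolding wsigma_quasi[OF l] wp_periodic[OF l h] ..
      finally have fe: "f (l + h) = (sigma_mult l * exp (eta l * h) * wsigma \<tau> h)\<^sup>2 * (wp \<tau> h - wp \<tau> p)" .
      have "(x * (y / h))\<^sup>2 * (h\<^sup>2 * u - h\<^sup>2 * v) = (x * y)\<^sup>2 * (u - v)" for x y u v :: complex
        using h0 by (simp add: field_simps power2_eq_square)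
      then show "(sigma_mult l * exp (eta l * h) * (wsigma \<tau> h / h))\<^sup>2 * (h\<^sup>2 * wp \<tau> h - h\<^sup>2 * wp \<tau> p) = f (l + h)"
        unfolding fe by (simp only:)
    qed
    ultimately have "((\<lambda>h. f (l + h)) \<longlongrightarrow> (sigma_mult l)\<^sup>2) (at 0)"
      using Lim_transform_eventually by fastforce
    then show "(f \<longlongrightarrow> f l) (at l)"
      using l LIM_offset_zero_cancel[of f l "(sigma_mult l)\<^sup>2"] by (simp add: f_def)
  qed simp
  have w: "w holomorphic_on UNIV"
    unfolding w_def by (intro holomorphic_intros wsigma_shift_holomorphic)
  have w0: "w z = 0 \<longleftrightarrow> z - p \<in> \<Lambda> \<or> z + p \<in> \<Lambda>" for z by (simp add: w_def)
  have wz: "{z. w z = 0} = {z. z - p \<in> \<Lambda>} \<union> {z. z - - p \<in> \<Lambda>}" by (auto simp: w0)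
  have sp: "{z. w z = 0} sparse_in UNIV"
    unfolding wz by (intro sparse_in_union' sparse_lattice_translate)
  have "f z = 0 \<and> deriv w z \<noteq> 0" if wz: "w z = 0" for z
  proof -
    have dsh: "((\<lambda>z. wsigma \<tau> (z - a)) has_field_derivative sigma_mult (z - a)) (at z)" if "z - a \<in> \<Lambda>" for a
      using DERIV_wsigma_lattice[OF that] DERIV_shift[of "wsigma \<tau>" "sigma_mult (z - a)" z "- a"] by simp
    have dho: "((\<lambda>z. wsigma \<tau> (z - a)) has_field_derivative deriv (\<lambda>z. wsigma \<tau> (z - a)) z) (at z)" for a
      by (rule holomorphic_derivI[OF wsigma_shift_holomorphic open_UNIV]) simp
    consider "z - p \<in> \<Lambda>" | "z - - p \<in> \<Lambda>" using wz w0 by auto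
    then show ?thesis
    proof cases
      case 1
      have zp: "z - - p \<notin> \<Lambda>"
        using lattice_add_iff[OF 1, of "2 * p"] double_notin by (simp add: algebra_simps)
      have zL: "z \<notin> \<Lambda>" using lattice_add_iff[OF 1, of p] p_notin by simp
      have "(w has_field_derivative sigma_mult (z - p) * wsigma \<tau> (z - - p) + deriv (\<lambda>z. wsigma \<tau> (z - - p)) z * wsigma \<tau> (z - p)) (at z)"
        unfolding w_def by (rule DERIV_mult[OF dsh[OF 1] dho])
      moreover have "wsigma \<tau> (z - p) = 0" using 1 by simp
      ultimately have "deriv w z = sigma_mult (z - p) * wsigma \<tau> (z - - p)"
        using DERIV_imp_deriv by fastforce
      moreover have "wp \<tau> z = wp \<tau> p" using wp_periodic[OF 1 p_notin] by simp
      ultimately show ?thesis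
        using zp zL sigma_mult_nonzero[OF 1] by (simp add: f_def g_def)
    next
      case 2
      have zp: "z - p \<notin> \<Lambda>"
        using lattice_diff_iff[OF 2, of "2 * p"] double_notin lattice_uminus_iff[of "z - p"] by (simp add: algebra_simps)
      have zL: "z \<notin> \<Lambda>" using lattice_add_iff[OF 2, of "-p"] p_notin by simp
      have "(w has_field_derivative deriv (\<lambda>z. wsigma \<tau> (z - p)) z * wsigma \<tau> (z - - p) + sigma_mult (z - - p) * wsigma \<tau> (z - p)) (at z)"
        unfolding w_def by (rule DERIV_mult[OF dho dsh[OF 2]])
      moreover have "wsigma \<tau> (z - - p) = 0" using 2 by simp
      ultimately have "deriv w z = sigma_mult (z - - p) * wsigma \<tau> (z - p)"
        using DERIV_imp_deriv by fastforce
      moreover have "wp \<tau> z = wp \<tau> p" using wp_periodic[OF 2, of "-p"] p_notin wp_even[of p] by simp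
      ultimately show ?thesis
        using zp zL sigma_mult_nonzero[OF 2] by (simp add: f_def g_def)
    qed
  qed
  from entire_quotient[OF f w sp this]
  obtain h where h: "h holomorphic_on UNIV" "\<And>z. f z = w z * h z" by metis
  have hc: "continuous_on UNIV h" by (rule holomorphic_on_imp_continuous_on[OF h(1)])
  have "h (z + l) = h z" if l: "l \<in> \<Lambda>" for l z
  proof (rule continuous_eq_off_sparse[where f = "\<lambda>z. h (z + l)" and g = h and X = "- S"])
    show "continuous_on UNIV (\<lambda>z. h (z + l))"
      by (rule continuous_on_compose2[OF hc]) (auto intro!: continuous_intros)
    fix z assume "z \<notin> - S"
    then have z: "z \<notin> \<Lambda>" "w z \<noteq> 0" by (auto simp: S_iff w0)
    let ?m = "(sigma_mult l)\<^sup>2 * (exp (eta l * z))\<^sup>2"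
    have m: "?m \<noteq> 0" using sigma_mult_nonzero[OF l] by simp
    have "f (z + l) = ?m * f z"
      using z l by (simp add: f_def g_def wsigma_quasi wp_periodic power_mult_distrib)
    moreover have "w (z + l) = ?m * w z"
    proof -
      have "w (z + l) = wsigma \<tau> ((z - p) + l) * wsigma \<tau> ((z - - p) + l)" by (simp add: w_def algebra_simps)
      also have "\<dots> = (sigma_mult l)\<^sup>2 * (exp (eta l * (z - p)) * exp (eta l * (z - - p))) * w z"
        unfolding wsigma_quasi[OF l] by (simp add: w_def power2_eq_square mult_ac)
      also have "exp (eta l * (z - p)) * exp (eta l * (z - - p)) = (exp (eta l * z))\<^sup>2"
        by (simp add: exp_add[symmetric] power2_eq_square algebra_simps)
      finally show ?thesis .
    qed
    ultimately have "?m * w z * h (z + l) = ?m * (w z * h z)" using h(2)[of "z + l"] h(2)[of z] by simp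
    then show "h (z + l) = h z" using m z by simp
  qed (use hc sparse_Compl_S in auto)
  then obtain K where K: "\<And>z. h z = K" using entire_periodic_constant[OF h(1)] by metis
  have "f 0 \<noteq> 0" using sigma_mult_nonzero[of 0] by (simp add: f_def)
  then have "K \<noteq> 0" using h(2)[of 0] K by auto
  moreover have "g z = K * (wsigma \<tau> (z - p) * wsigma \<tau> (z - - p)) / (wsigma \<tau> z)\<^sup>2" if "z \<notin> \<Lambda>" for z
  proof -
    have "(wsigma \<tau> z)\<^sup>2 * g z = w z * K" using h(2)[of z] K that by (simp add: f_def)
    then show ?thesis using that by (simp add: w_def field_simps)
  qed
  ultimately show ?thesis using that by blast
qed

lemma g_nonzero: "z \<in> S \<Longrightarrow> g z \<noteq> 0"
  by (rule wp_diff_sigma) (auto simp: S_iff)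

text \<open>In the sigma factorisation \<open>p\<close> is a simple zero of \<open>g\<close>,
  because \<open>wsigma (2 p)\<close> does not vanish. The potential divides by
  \<open>wp' p\<close>.\<close>

lemma wp'_p_nonzero: "wp' p \<noteq> 0"
proof -
  obtain K where K: "K \<noteq> 0" "\<And>z. z \<notin> \<Lambda> \<Longrightarrow> g z = K * (wsigma \<tau> (z - p) * wsigma \<tau> (z - - p)) / (wsigma \<tau> z)\<^sup>2"
    by (rule wp_diff_sigma) blast
  let ?R = "\<lambda>z. K * (wsigma \<tau> (z - p) * wsigma \<tau> (z - - p)) / (wsigma \<tau> z)\<^sup>2"
  have d1: "((\<lambda>z. wsigma \<tau> (z - p)) has_field_derivative 1) (at p)"
    using DERIV_wsigma_0 DERIV_shift[of "wsigma \<tau>" 1 p "- p"] by simp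
  have d2: "((\<lambda>z. wsigma \<tau> (z - - p)) has_field_derivative deriv (\<lambda>z. wsigma \<tau> (z - - p)) p) (at p)"
    by (rule holomorphic_derivI[OF wsigma_shift_holomorphic open_UNIV]) simp
  have ne: "(wsigma \<tau> p)\<^sup>2 \<noteq> 0" using p_notin by simp
  have "((\<lambda>z. (K * (wsigma \<tau> (z - p) * wsigma \<tau> (z - - p))) / (wsigma \<tau> z)\<^sup>2) has_field_derivative
     K * wsigma \<tau> (p - - p) / (wsigma \<tau> p)\<^sup>2) (at p)"
    by (rule derivative_eq_intros d1 d2 DERIV_wsigma[OF p_notin] refl ne | simp add: power2_eq_square field_simps)+
  then have "(g has_field_derivative K * wsigma \<tau> (p - - p) / (wsigma \<tau> p)\<^sup>2) (at p)"
    by (rule has_field_derivative_transform_within_open[OF _ open_lreg]) (use K p_notin in \<open>auto simp: lreg_iff\<close>)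
  moreover have "(g has_field_derivative wp' p) (at p)"
    unfolding g_def using DERIV_diff[OF DERIV_wp[OF p_notin] DERIV_const] by simp
  ultimately have "wp' p = K * wsigma \<tau> (p - - p) / (wsigma \<tau> p)\<^sup>2" by (rule DERIV_unique[symmetric])
  moreover have "wsigma \<tau> (p - - p) \<noteq> 0" using double_notin by simp
  ultimately show ?thesis using K(1) ne by simp
qed

lemma DERIV_g: "z \<notin> \<Lambda> \<Longrightarrow> (g has_field_derivative wp' z) (at z)"
  unfolding g_def using DERIV_diff[OF DERIV_wp DERIV_const] by simp

lemma log_deriv_g:
  assumes "z \<in> S"
  shows "wp' z / g z = wzeta \<tau> (z + p) + wzeta \<tau> (z - p) - 2 * wzeta \<tau> z"
proof -
  obtain K where K: "K \<noteq> 0" "\<And>z. z \<notin> \<Lambda> \<Longrightarrow> g z = K * (wsigma \<tau> (z - p) * wsigma \<tau> (z - - p)) / (wsigma \<tau> z)\<^sup>2"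
    by (rule wp_diff_sigma) blast
  have z: "z \<notin> \<Lambda>" "z - p \<notin> \<Lambda>" "z - - p \<notin> \<Lambda>" using assms by (auto simp: S_iff)
  have d: "((\<lambda>z. wsigma \<tau> (z - a)) has_field_derivative wzeta \<tau> (z - a) * wsigma \<tau> (z - a)) (at z)" if "z - a \<notin> \<Lambda>" for a
    using DERIV_wsigma[OF that] DERIV_shift[of "wsigma \<tau>" _ z "- a"] by simp
  define s0 s1 s2 where "s0 = wsigma \<tau> z" "s1 = wsigma \<tau> (z - p)" "s2 = wsigma \<tau> (z - - p)"
  have s: "s0 \<noteq> 0" "s1 \<noteq> 0" "s2 \<noteq> 0" using z by (auto simp: s0_s1_s2_def)
  have d0: "((\<lambda>z. (wsigma \<tau> z)\<^sup>2) has_field_derivative 2 * wzeta \<tau> z * s0\<^sup>2) (at z)"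
    using DERIV_power[OF DERIV_wsigma[OF z(1)], of 2] by (simp add: s0_s1_s2_def power2_eq_square mult_ac)
  have "((\<lambda>z. K * (wsigma \<tau> (z - p) * wsigma \<tau> (z - - p)) / (wsigma \<tau> z)\<^sup>2) has_field_derivative
     (K * (wzeta \<tau> (z - p) * s1 * s2 + wzeta \<tau> (z - - p) * s2 * s1) * s0\<^sup>2 - K * (s1 * s2) * (2 * wzeta \<tau> z * s0\<^sup>2)) / (s0\<^sup>2 * s0\<^sup>2)) (at z)"
    using DERIV_divide[OF DERIV_cmult[OF DERIV_mult[OF d[OF z(2)] d[OF z(3)]], of K] d0] s
    by (simp add: s0_s1_s2_def)
  then have "(g has_field_derivative (K * (wzeta \<tau> (z - p) * s1 * s2 + wzeta \<tau> (z - - p) * s2 * s1) * s0\<^sup>2 - K * (s1 * s2) * (2 * wzeta \<tau> z * s0\<^sup>2)) / (s0\<^sup>2 * s0\<^sup>2)) (at z)"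
    by (rule has_field_derivative_transform_within_open[OF _ open_lreg]) (use K z in \<open>auto simp: lreg_iff\<close>)
  then have "wp' z = (K * (wzeta \<tau> (z - p) * s1 * s2 + wzeta \<tau> (z - - p) * s2 * s1) * s0\<^sup>2 - K * (s1 * s2) * (2 * wzeta \<tau> z * s0\<^sup>2)) / (s0\<^sup>2 * s0\<^sup>2)"
    using DERIV_g[OF z(1)] DERIV_unique by blast
  also have "\<dots> = (wzeta \<tau> (z + p) + wzeta \<tau> (z - p) - 2 * wzeta \<tau> z) * (K * (s1 * s2) / s0\<^sup>2)"
    using s by (simp add: field_simps)
  also have "K * (s1 * s2) / s0\<^sup>2 = g z" using K(2)[OF z(1)] by (simp add: s0_s1_s2_def)
  finally show ?thesis using g_nonzero[OF assms] by simp
qed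

lemma S_holomorphic:
  "wp \<tau> holomorphic_on S" "wp' holomorphic_on S" "wzeta \<tau> holomorphic_on S"
  "(\<lambda>z. wzeta \<tau> (z + p)) holomorphic_on S" "(\<lambda>z. wzeta \<tau> (z - p)) holomorphic_on S"
proof -
  have sub: "S \<subseteq> lreg" by (auto simp: S_iff lreg_iff)
  show "wp \<tau> holomorphic_on S" "wzeta \<tau> holomorphic_on S"
    unfolding holomorphic_on_def field_differentiable_def
    using DERIV_wp DERIV_wzeta has_field_derivative_at_within S_iff by blast+
  show "wp' holomorphic_on S" by (rule holomorphic_on_subset[OF wp'_holomorphic sub])
  show "(\<lambda>z. wzeta \<tau> (z + p)) holomorphic_on S"
    unfolding holomorphic_on_def field_differentiable_def
    using DERIV_wzeta_shift[of _ p] has_field_derivative_at_within S_iff by blast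
  have "((\<lambda>z. wzeta \<tau> (z - p)) has_field_derivative - wp \<tau> (z - p)) (at z)" if "z \<in> S" for z
    using DERIV_wzeta_shift[of z "-p"] that by (simp add: S_iff)
  then show "(\<lambda>z. wzeta \<tau> (z - p)) holomorphic_on S"
    unfolding holomorphic_on_def field_differentiable_def
    using has_field_derivative_at_within by blast
qed

text \<open>This is \<open>log_deriv_g\<close> with the roles of \<open>z\<close> and
  \<open>p\<close> exchanged. The exchange requires that \<open>2 z\<close> is no period, so it is
  made on an open set and extended by analytic continuation.\<close>

lemma zeta_diff_p:
  assumes "z \<in> S"
  shows "wzeta \<tau> (z + p) - wzeta \<tau> (z - p) - 2 * wzeta \<tau> p = - wp' p / g z"
proof -
  let ?l = "\<lambda>z. wzeta \<tau> (z + p) - wzeta \<tau> (z - p) - 2 * wzeta \<tau> p" and ?r = "\<lambda>z. - wp' p / g z"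
  let ?V = "S \<inter> {z. 2 * z \<notin> \<Lambda>}"
  have eq: "?l z = ?r z" if z: "z \<in> ?V" for z
  proof -
    interpret z: upper_half_point \<tau> z by unfold_locales (use z in auto)
    have "p - z \<notin> \<Lambda>" using z lattice_uminus_iff[of "p - z"] by (simp add: S_iff)
    then have pS: "p \<in> z.S" using z p_notin by (simp add: z.S_iff S_iff add.commute)
    have "wp' p / z.g p = wzeta \<tau> (p + z) + wzeta \<tau> (p - z) - 2 * wzeta \<tau> p"
      by (rule z.log_deriv_g[OF pS])
    moreover have "z.g p = - g z" by (simp add: z.g_def g_def)
    moreover have "wzeta \<tau> (p - z) = - wzeta \<tau> (z - p)" using wzeta_odd[of "z - p"] by simp
    ultimately show ?thesis by (simp add: add.commute)
  qed
  have half: "{z. 2 * z \<in> \<Lambda>} sparse_in UNIV"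
  proof -
    have "\<not> y islimpt {z. 2 * z \<in> \<Lambda>}" for y
    proof
      assume "y islimpt {z. 2 * z \<in> \<Lambda>}"
      then have "(2 * y) islimpt (\<lambda>z. 2 * z) ` {z. 2 * z \<in> \<Lambda>}"
        by (rule islimpt_isCont_image) (auto simp: eventually_at_filter)
      then have "(2 * y) islimpt \<Lambda>" by (rule islimpt_subset) auto
      then show False using sparse_lattice_subset[of \<Lambda>] by (simp add: sparse_in_open)
    qed
    then show ?thesis by (simp add: sparse_in_open)
  qed
  have sp: "- S \<union> {z. 2 * z \<in> \<Lambda>} sparse_in UNIV"
    by (intro sparse_in_union' sparse_Compl_S half)
  have Veq: "?V = - (- S \<union> {z. 2 * z \<in> \<Lambda>})" by auto
  have oV: "open ?V"
    unfolding Veq using sparse_in_UNIV_imp_closed[OF sp] by (rule open_Compl)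
  have neV: "?V \<noteq> {}"
  proof
    assume "?V = {}"
    then have "- S \<union> {z. 2 * z \<in> \<Lambda>} = UNIV" by auto
    then have "UNIV sparse_in (UNIV :: complex set)" using sp by simp
    then show False by (simp add: sparse_in_open islimpt_UNIV)
  qed
  show ?thesis
  proof (rule analytic_continuation_open[of ?V S ?l ?r])
    show "?l holomorphic_on S" by (intro holomorphic_intros S_holomorphic)
    show "?r holomorphic_on S" using g_nonzero unfolding g_def
      by (intro holomorphic_intros S_holomorphic) (auto simp: g_def)
  qed (use oV open_S neV connected_S eq assms in auto)
qed

lemma DERIV_log_deriv_g:
  assumes "z \<in> S"
  shows "((\<lambda>z. wp' z / g z) has_field_derivative (6 * (wp \<tau> z)\<^sup>2 - inv_g2 / 2) / g z - (wp' z / g z)\<^sup>2) (at z)"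
proof -
  have z: "z \<notin> \<Lambda>" using assms by (simp add: S_iff)
  show ?thesis
    by (rule DERIV_cong[OF DERIV_divide[OF DERIV_wp'[OF z] DERIV_g[OF z] g_nonzero[OF assms]]])
       (use g_nonzero[OF assms] in \<open>simp add: field_simps power2_eq_square\<close>)
qed

lemma wp_shift_sum:
  assumes "z \<in> S"
  shows "wp \<tau> (z + p) + wp \<tau> (z - p) = 2 * wp \<tau> z - (6 * (wp \<tau> z)\<^sup>2 - inv_g2 / 2) / g z + (wp' z / g z)\<^sup>2"
proof -
  have z: "z \<notin> \<Lambda>" "z + p \<notin> \<Lambda>" "z + - p \<notin> \<Lambda>" using assms by (auto simp: S_iff)
  have "((\<lambda>z. wzeta \<tau> (z + p) + wzeta \<tau> (z + - p) - 2 * wzeta \<tau> z) has_field_derivative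
      - wp \<tau> (z + p) + - wp \<tau> (z + - p) - 2 * - wp \<tau> z) (at z)"
    by (intro DERIV_diff DERIV_add DERIV_cmult DERIV_wzeta_shift DERIV_wzeta z)
  then have "((\<lambda>z. wp' z / g z) has_field_derivative - wp \<tau> (z + p) + - wp \<tau> (z + - p) - 2 * - wp \<tau> z) (at z)"
    by (rule has_field_derivative_transform_within_open[OF _ open_S assms]) (simp add: log_deriv_g)
  from DERIV_unique[OF this DERIV_log_deriv_g[OF assms]] show ?thesis by (simp add: algebra_simps)
qed

text \<open>With \<open>h = g'/g\<close> the right-hand side is
  \<open>N g + T^2 + T h + 3/4 h^2 - g''/(2 g)\<close>, the potential that arises from
  \<open>y' = N g w - T y\<close> on eliminating \<open>w\<close> and passing to
  \<open>y / sqrt g\<close>. The shifted functions disappear through \<open>log_deriv_g\<close>,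
  \<open>zeta_diff_p\<close> and \<open>wp_shift_sum\<close>, and the constant \<open>B\<close>
  absorbs the terms in \<open>zeta(p)\<close> and \<open>wp(p)\<close>.\<close>

lemma gle1_q_eq:
  assumes "z \<in> S"
  shows "gle1_q n p \<tau> T z = of_nat n * (of_nat n + 1) * g z + T\<^sup>2 + T * (wp' z / g z)
    + 3 / 4 * (wp' z / g z)\<^sup>2 - 1 / 2 * ((6 * (wp \<tau> z)\<^sup>2 - inv_g2 / 2) / g z)"
proof -
  define N where "N = (of_nat n * (of_nat n + 1) :: complex)"
  define P G where "P = wp \<tau> z" and "G = g z"
  define Pp where "Pp = wp \<tau> p"
  have G: "G \<noteq> 0" "P = G + Pp" using g_nonzero[OF assms] by (auto simp: G_def P_def Pp_def g_def)
  have d1: "deriv (wp \<tau>) p = wp' p" by (rule DERIV_imp_deriv[OF DERIV_wp[OF p_notin]])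
  have d2: "(deriv ^^ 2) (wp \<tau>) p = 6 * Pp\<^sup>2 - inv_g2 / 2"
  proof -
    have "deriv (deriv (wp \<tau>)) p = deriv wp' p"
    proof (rule deriv_cong_ev[OF _ refl])
      show "\<forall>\<^sub>F x in nhds p. deriv (wp \<tau>) x = wp' x"
        using eventually_nhds_in_open[OF open_lreg, of p] p_notin
        by (auto elim!: eventually_mono simp: lreg_iff intro!: DERIV_imp_deriv DERIV_wp)
    qed
    then show ?thesis using deriv_wp'[OF p_notin] by (simp add: numeral_2_eq_2 Pp_def)
  qed
  define W where "W = wp' p"
  define Q where "Q = 6 * Pp\<^sup>2 - inv_g2 / 2"
  define h where "h = wp' z / g z"
  have W: "W \<noteq> 0" using wp'_p_nonzero by (simp add: W_def)
  have zd: "wzeta \<tau> (z + p) - wzeta \<tau> (z - p) = 2 * wzeta \<tau> p - W / G"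
    using zeta_diff_p[OF assms] by (simp add: W_def G_def algebra_simps)
  have sum: "wp \<tau> (z + p) + wp \<tau> (z - p) = 2 * P - (6 * P\<^sup>2 - inv_g2 / 2) / G + h\<^sup>2"
    using wp_shift_sum[OF assms] by (simp add: P_def G_def h_def)
  have B: "gle1_B n p \<tau> T = T\<^sup>2 + Q / (2 * W) * wzeta \<tau> p - N * Pp + 3 / 2 * Pp"
    unfolding gle1_B_def d1 d2 W_def[symmetric] Q_def[symmetric] Pp_def[symmetric] N_def
    by (simp add: algebra_simps power2_eq_square)
  have zs: "wzeta \<tau> (z + p) + wzeta \<tau> (z - p) - 2 * wzeta \<tau> z = h"
    using log_deriv_g[OF assms] by (simp add: h_def)
  have Wc: "Q / (4 * W) * (2 * wzeta \<tau> p - W / G) = Q / (2 * W) * wzeta \<tau> p - Q / (4 * G)"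
    using W G by (simp add: field_simps)
  have "gle1_q n p \<tau> T z = N * P + 3 / 4 * (2 * P - (6 * P\<^sup>2 - inv_g2 / 2) / G + h\<^sup>2) + T * h
      - Q / (4 * W) * (2 * wzeta \<tau> p - W / G) + (T\<^sup>2 + Q / (2 * W) * wzeta \<tau> p - N * Pp + 3 / 2 * Pp)"
    unfolding gle1_q_def d1 d2 W_def[symmetric] Q_def[symmetric] zd zs B N_def[symmetric] P_def[symmetric] sum by simp
  also have "\<dots> = N * P + 3 / 4 * (2 * P - (6 * P\<^sup>2 - inv_g2 / 2) / G + h\<^sup>2) + T * h
      + Q / (4 * G) + T\<^sup>2 - N * Pp + 3 / 2 * Pp"
    unfolding Wc by simp
  also have "\<dots> = N * G + T\<^sup>2 + T * h + 3 / 4 * h\<^sup>2 - 1 / 2 * ((6 * P\<^sup>2 - inv_g2 / 2) / G)"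
    using G(1) unfolding Q_def G(2) by (simp add: field_simps power2_eq_square)
  finally show ?thesis by (simp add: N_def P_def G_def h_def)
qed

end

section \<open>Local exponents\<close>

lemma meromorphic_local_form:
  assumes "f meromorphic_on {a}"
  obtains (zero) "eventually (\<lambda>z. f z = 0) (at a)"
  | (form) u s r where "r > 0" "u holomorphic_on ball a r" "u a \<noteq> 0"
      "\<And>z. z \<in> ball a r - {a} \<Longrightarrow> f z = u z * (z - a) powi s"
proof (cases "eventually (\<lambda>z. f z = 0) (at a)")
  case False
  then have "\<exists>\<^sub>F z in at a. f z \<noteq> 0" by (simp add: frequently_def)
  moreover have "isolated_singularity_at f a" "not_essential f a"
    using assms by (auto simp: meromorphic_at_iff)
  ultimately obtain r where r: "zor_poly f a a \<noteq> 0" "r > 0" "zor_poly f a holomorphic_on cball a r"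
     "\<And>w. w \<in> cball a r - {a} \<Longrightarrow> f w = zor_poly f a w * (w - a) powi zorder f a"
    using zorder_exist[of f a] by blast
  show ?thesis
    by (rule form[of r "zor_poly f a" "zorder f a"]) (use r in \<open>auto intro: holomorphic_on_subset[OF r(3)]\<close>)
qed

lemma holomorphic_isCont: "f holomorphic_on A \<Longrightarrow> open A \<Longrightarrow> a \<in> A \<Longrightarrow> isCont f a"
  using holomorphic_on_imp_continuous_on continuous_on_eq_continuous_at by blast

lemma deriv_eq_on_open:
  assumes "open A" "z \<in> A" "\<And>w. w \<in> A \<Longrightarrow> f w = g w" "(g has_field_derivative D) (at z)"
  shows "deriv f z = D"
  by (rule DERIV_imp_deriv, rule has_field_derivative_transform_within_open[OF assms(4,1,2)]) (use assms in auto)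

lemma DERIV_mult_powi:
  assumes "u holomorphic_on ball a r" "z \<in> ball a r - {a}"
  shows "((\<lambda>w. u w * (w - a) powi s) has_field_derivative
    (deriv u z * (z - a) + of_int s * u z) * (z - a) powi (s - 1)) (at z)"
proof -
  have z: "z - a \<noteq> 0" using assms by auto
  have "(u has_field_derivative deriv u z) (at z)"
    using assms by (auto intro: holomorphic_derivI)
  moreover have "((\<lambda>w. (w - a) powi s) has_field_derivative of_int s * (z - a) powi (s - 1)) (at z)"
    using DERIV_power_int[of "\<lambda>w. w - a" 1 z UNIV s] z by (auto intro!: derivative_eq_intros)
  ultimately have "((\<lambda>w. u w * (w - a) powi s) has_field_derivative
     deriv u z * (z - a) powi s + of_int s * (z - a) powi (s - 1) * u z) (at z)"
    by (rule DERIV_mult)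
  moreover have "(z - a) powi s = (z - a) * (z - a) powi (s - 1)"
    using z by (simp add: power_int_diff)
  ultimately show ?thesis by (simp add: algebra_simps)
qed

text \<open>The lowest power of \<open>z - a\<close> in the equation has exponent
  \<open>s - 3\<close>, and its coefficient is \<open>s (s-1) (s-2) - 4 v(a) (s - 1)\<close> times
  \<open>u(a)\<close>. The root 1 is the sum of the two exponents of the second-order equation, the
  other two roots are their doubles.\<close>

lemma indicial_equation:
  assumes u: "u holomorphic_on ball a r" "u a \<noteq> 0" and v: "v holomorphic_on ball a r" and r: "r > 0"
    and f: "\<And>z. z \<in> ball a r - {a} \<Longrightarrow> f z = u z * (z - a) powi s"
    and q: "\<And>z. z \<in> ball a r - {a} \<Longrightarrow> q z = v z / (z - a)\<^sup>2"
    and ode: "\<And>z. z \<in> ball a r - {a} \<Longrightarrow> (deriv ^^ 3) f z - 4 * q z * deriv f z - 2 * deriv q z * f z = 0"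
  shows "(of_int s - 1) * ((of_int s)\<^sup>2 - 2 * of_int s - 4 * v a) = (0 :: complex)"
proof -
  let ?B = "ball a r - {a}"
  have oB: "open ?B" by auto
  \<comment> \<open>Differentiating \<open>u z * (z - a)^s\<close> gives
    \<open>nxt u s z * (z - a)^(s - 1)\<close>; iterating it keeps all powers of
    \<open>z - a\<close> factored out.\<close>
  define nxt where "nxt u s = (\<lambda>z. deriv u z * (z - a) + of_int s * u z)" for u :: "complex \<Rightarrow> complex" and s :: int
  have nxt_h: "nxt u s holomorphic_on ball a r" if "u holomorphic_on ball a r" for u s
    unfolding nxt_def using that by (auto intro!: holomorphic_intros)
  have nxt_d: "deriv h z = nxt u s z * (z - a) powi (s - 1)"
    if "u holomorphic_on ball a r" "\<And>z. z \<in> ?B \<Longrightarrow> h z = u z * (z - a) powi s" "z \<in> ?B" for u h s z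
    unfolding nxt_def by (rule deriv_eq_on_open[OF oB that(3,2) DERIV_mult_powi[OF that(1,3)]])
  define u1 where "u1 = nxt u s"
  define u2 where "u2 = nxt u1 (s - 1)"
  define u3 where "u3 = nxt u2 (s - 2)"
  define v1 where "v1 = nxt v (-2)"
  have hol: "u1 holomorphic_on ball a r" "u2 holomorphic_on ball a r" "u3 holomorphic_on ball a r" "v1 holomorphic_on ball a r"
    unfolding u3_def u2_def u1_def v1_def by (intro nxt_h u v)+
  have d1: "deriv f z = u1 z * (z - a) powi (s - 1)" if "z \<in> ?B" for z
    using nxt_d[OF u(1) f that] by (simp add: u1_def)
  have d2: "deriv (deriv f) z = u2 z * (z - a) powi (s - 2)" if "z \<in> ?B" for z
    using nxt_d[OF hol(1) d1 that] by (simp add: u2_def)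
  have d3: "deriv (deriv (deriv f)) z = u3 z * (z - a) powi (s - 3)" if "z \<in> ?B" for z
    using nxt_d[OF hol(2) d2 that] by (simp add: u3_def)
  have q': "q z = v z * (z - a) powi (-2)" if "z \<in> ?B" for z
    using q[OF that] by (simp add: power_int_minus divide_inverse)
  have dq: "deriv q z = v1 z * (z - a) powi (-3)" if "z \<in> ?B" for z
    using nxt_d[OF v q' that] by (simp add: v1_def)
  define W where "W z = u3 z - 4 * v z * u1 z - 2 * v1 z * u z" for z
  have W0: "W z = 0" if z: "z \<in> ?B" for z
  proof -
    have h: "z - a \<noteq> 0" using z by auto
    have e: "(z - a) powi (-2) * (z - a) powi (s - 1) = (z - a) powi (s - 3)"
      "(z - a) powi (-3) * (z - a) powi s = (z - a) powi (s - 3)"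
      using h by (simp_all add: power_int_add[symmetric])
    have "0 = u3 z * (z - a) powi (s - 3) - 4 * v z * u1 z * ((z - a) powi (-2) * (z - a) powi (s - 1))
        - 2 * v1 z * u z * ((z - a) powi (-3) * (z - a) powi s)"
      using ode[OF z] unfolding numeral_3_eq_3 by (simp add: d1[OF z] d3[OF z] q'[OF z] dq[OF z] f[OF z] mult_ac)
    also have "\<dots> = W z * (z - a) powi (s - 3)"
      unfolding e W_def by (simp add: algebra_simps)
    finally show ?thesis using h by simp
  qed
  have "W holomorphic_on ball a r" unfolding W_def by (intro holomorphic_intros hol u v)
  then have "isCont W a"
    by (rule holomorphic_isCont) (use r in auto)
  then have "(W \<longlongrightarrow> W a) (at a)" by (simp add: isCont_def)
  moreover have "eventually (\<lambda>z. W z = 0) (at a)"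
    using eventually_at_in_open[of "ball a r" a] r by (auto elim!: eventually_mono intro: W0)
  ultimately have "W a = 0"
    using tendsto_unique[OF _ _ tendsto_eventually, of "at a" W "W a" 0] by auto
  moreover have "W a = u a * ((of_int s - 1) * ((of_int s)\<^sup>2 - 2 * of_int s - 4 * v a))"
    by (simp add: W_def u3_def u2_def u1_def v1_def nxt_def algebra_simps power2_eq_square)
  ultimately show ?thesis using u(2) by simp
qed

text \<open>\<open>F\<close> stands for \<open>w' / w\<close>, and \<open>q\<close> is regular at
  \<open>b\<close>. A pole of order \<open>k + 1\<close> gives \<open>F^2\<close> order
  \<open>2 k + 2\<close> against order \<open>k + 2\<close> for \<open>F'\<close>, so
  \<open>k = 0\<close>; the leading coefficient then satisfies \<open>u^2 = u\<close> and equals 1.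
  In other words, a solution has only simple zeros at regular points.\<close>

lemma riccati_local:
  assumes F: "F meromorphic_on {b}" and r: "r > 0" and q: "q holomorphic_on ball b r"
    and ric: "eventually (\<lambda>z. (F has_field_derivative q z - (F z)\<^sup>2) (at z)) (at b)"
  obtains (regular) L where "(F \<longlongrightarrow> L) (at b)"
  | (pole) L where "((\<lambda>z. F z - 1 / (z - b)) \<longlongrightarrow> L) (at b)" "filterlim F at_infinity (at b)"
  using F
proof (cases rule: meromorphic_local_form)
  case zero
  then show ?thesis using regular[of 0] tendsto_eventually by blast
next
  case (form u s r')
  have cu: "(u \<longlongrightarrow> u b) (at b)" "(deriv u \<longlongrightarrow> deriv u b) (at b)" "(q \<longlongrightarrow> q b) (at b)"
  proof -
    have *: "(h \<longlongrightarrow> h b) (at b)" if "h holomorphic_on ball b t" "t > 0" for h t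
      using holomorphic_on_imp_continuous_on[OF that(1)] that(2)
      by (metis centre_in_ball continuous_on_eq_continuous_at isContD open_ball)
    show "(u \<longlongrightarrow> u b) (at b)" "(deriv u \<longlongrightarrow> deriv u b) (at b)" "(q \<longlongrightarrow> q b) (at b)"
      using *[OF form(2,1)] *[OF holomorphic_deriv[OF form(2)]] *[OF q r] form(1) by auto
  qed
  have evB: "eventually (\<lambda>z. z \<in> ball b r' - {b}) (at b)"
    by (rule eventually_at_in_open) (use form(1) in auto)
  show ?thesis
  proof (cases "s \<ge> 0")
    case True
    have "((\<lambda>z. u z * (z - b) ^ nat s) \<longlongrightarrow> u b * (b - b) ^ nat s) (at b)"
      by (intro tendsto_intros cu)
    moreover have "eventually (\<lambda>z. u z * (z - b) ^ nat s = F z) (at b)"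
      using evB by (rule eventually_mono) (use form(4) True in \<open>auto simp: power_int_def\<close>)
    ultimately show ?thesis using regular Lim_transform_eventually by blast
  next
    case False
    \<comment> \<open>The pole has order \<open>k + 1\<close>; multiplying the Riccati equation by
      the power \<open>2 (k + 1)\<close> of \<open>z - b\<close> clears every denominator.\<close>
    define k where "k = nat (- s - 1)"
    have s: "s = - int (Suc k)" using False by (simp add: k_def)
    have ev: "eventually (\<lambda>z. deriv u z * (z - b) ^ Suc k - of_nat (Suc k) * u z * (z - b) ^ k + (u z)\<^sup>2 = q z * (z - b) ^ (2 * Suc k)) (at b)"
      using evB ric
    proof eventually_elim
      case (elim z)
      then have h: "z - b \<noteq> 0" and z: "z \<in> ball b r' - {b}" by auto
      have "(F has_field_derivative (deriv u z * (z - b) + of_int s * u z) * (z - b) powi (s - 1)) (at z)"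
        by (rule has_field_derivative_transform_within_open[OF DERIV_mult_powi[OF form(2) z], where S = "ball b r' - {b}"])
           (use z form(4) in auto)
      with elim(2) have "q z - (F z)\<^sup>2 = (deriv u z * (z - b) + of_int s * u z) * (z - b) powi (s - 1)"
        using DERIV_unique by blast
      moreover have "(z - b) powi (s - 1) = inverse ((z - b) ^ (k + 2))"
      proof -
        have "s - 1 = - int (k + 2)" by (simp add: s)
        then show ?thesis by (simp only: power_int_minus power_int_of_nat)
      qed
      moreover have "F z = u z * inverse ((z - b) ^ Suc k)"
        using form(4)[OF z] unfolding s by (simp only: power_int_minus power_int_of_nat)
      ultimately have "q z = (deriv u z * (z - b) + of_int s * u z) * inverse ((z - b) ^ (k + 2)) + (u z * inverse ((z - b) ^ Suc k))\<^sup>2"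
        by (simp add: algebra_simps)
      moreover have "(D * X + (U * Y)\<^sup>2) * W\<^sup>2 = D * (X * W\<^sup>2) + U\<^sup>2 * (Y * W)\<^sup>2" for D X U Y W :: complex
        by (simp add: algebra_simps power2_eq_square)
      moreover have "(z - b) ^ (2 * Suc k) = ((z - b) ^ Suc k)\<^sup>2"
        by (simp only: power_mult[symmetric] mult.commute)
      ultimately have "q z * (z - b) ^ (2 * Suc k) = (deriv u z * (z - b) + of_int s * u z) * (inverse ((z - b) ^ (k + 2)) * (z - b) ^ (2 * Suc k))
         + (u z)\<^sup>2 * (inverse ((z - b) ^ Suc k) * (z - b) ^ Suc k)\<^sup>2"
        by (simp only:)
      also have "inverse ((z - b) ^ (k + 2)) * (z - b) ^ (2 * Suc k) = (z - b) ^ k"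
      proof -
        have "(z - b) ^ (2 * Suc k) = (z - b) ^ (k + 2) * (z - b) ^ k" by (simp add: power_add[symmetric] mult_2)
        note e = this
        have ne: "(z - b) ^ (k + 2) \<noteq> 0" using h by simp
        have gen: "inverse X * (X * Y) = Y" if "X \<noteq> 0" for X Y :: complex using that by simp
        show ?thesis unfolding e by (rule gen[OF ne])
      qed
      also have "inverse ((z - b) ^ Suc k) * (z - b) ^ Suc k = 1" by (rule left_inverse) (use h in simp)
      finally show ?case unfolding s by (simp add: algebra_simps)
    qed
    have "((\<lambda>z. deriv u z * (z - b) ^ Suc k - of_nat (Suc k) * u z * (z - b) ^ k + (u z)\<^sup>2) \<longlongrightarrow>
        deriv u b * (b - b) ^ Suc k - of_nat (Suc k) * u b * (b - b) ^ k + (u b)\<^sup>2) (at b)"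
      by (intro tendsto_intros cu)
    note l1 = Lim_transform_eventually[OF this ev]
    have l2: "((\<lambda>z. q z * (z - b) ^ (2 * Suc k)) \<longlongrightarrow> q b * (b - b) ^ (2 * Suc k)) (at b)"
      by (intro tendsto_intros cu)
    have l12: "deriv u b * (b - b) ^ Suc k - of_nat (Suc k) * u b * (b - b) ^ k + (u b)\<^sup>2 = q b * (b - b) ^ (2 * Suc k)"
      by (rule tendsto_unique[OF trivial_limit_at l1 l2])
    have k0: "k = 0" using l12 form(3) by (cases k) auto
    have ub: "u b = 1" using l12 form(3) unfolding k0 by (simp add: power2_eq_square)
    have Fz: "F z = u z / (z - b)" if "z \<in> ball b r' - {b}" for z
      using form(4)[OF that] unfolding s k0 by (simp add: power_int_def divide_inverse)
    have "(u has_field_derivative deriv u b) (at b)"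
      by (rule holomorphic_derivI[OF form(2)]) (use form(1) in auto)
    then have "((\<lambda>z. (u z - u b) / (z - b)) \<longlongrightarrow> deriv u b) (at b)" by (simp add: has_field_derivative_iff)
    moreover have "eventually (\<lambda>z. (u z - u b) / (z - b) = F z - 1 / (z - b)) (at b)"
      using evB by (rule eventually_mono) (use Fz ub in \<open>auto simp: diff_divide_distrib\<close>)
    ultimately have L: "((\<lambda>z. F z - 1 / (z - b)) \<longlongrightarrow> deriv u b) (at b)" by (rule Lim_transform_eventually)
    have "filterlim (\<lambda>z. u z / (z - b)) at_infinity (at b)"
      by (rule filterlim_divide_at_infinity[OF cu(1)])
         (use ub in \<open>auto simp: filterlim_at eventually_at_filter intro!: tendsto_eq_intros\<close>)
    then have "filterlim F at_infinity (at b)"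
      by (rule filterlim_mono_eventually[OF _ order_refl order_refl])
         (use evB Fz in \<open>auto elim!: eventually_mono\<close>)
    then show ?thesis using pole L by blast
  qed
qed

section \<open>The elliptic product as a polynomial in wp\<close>

definition lame_ind :: "nat \<Rightarrow> nat \<Rightarrow> complex" where
  "lame_ind n m = 2 * (2 * of_nat m + 1) * (of_nat m - of_nat n) * (of_nat m + of_nat n + 1)"

lemma lame_ind_nonzero: "m < n \<Longrightarrow> lame_ind n m \<noteq> 0"
proof -
  assume "m < n"
  have "of_nat (2 * m + 1) \<noteq> (0::complex)" "of_nat (m + n + 1) \<noteq> (0::complex)"
    by (simp_all only: of_nat_eq_0_iff)
  moreover have "of_nat m \<noteq> (of_nat n :: complex)" using \<open>m < n\<close> by simp
  moreover have "lame_ind n m = 2 * of_nat (2 * m + 1) * (of_nat m - of_nat n) * of_nat (m + n + 1)"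
    by (simp add: lame_ind_def add_ac)
  ultimately show ?thesis by (simp only: mult_eq_0_iff right_minus_eq) simp
qed

text \<open>The coefficient of \<open>\<wp>\<^sup>n\<^sup>-\<^sup>j\<close> in the elliptic solution, as a polynomial in the spectral
  parameter; the factors \<open>2(2m+1)(m-n)(m+n+1)\<close> come from the indicial polynomial at the pole.\<close>

fun lame_rec :: "nat \<Rightarrow> complex \<Rightarrow> complex \<Rightarrow> nat \<Rightarrow> complex poly" where
  "lame_rec n a b 0 = 1"
| "lame_rec n a b (Suc j) = smult (1 / lame_ind n (n - Suc j))
     ([:0, 4 * (of_nat (n - Suc j) + 1):] * lame_rec n a b j
      + (if 1 \<le> j then smult (a * (of_nat (n - Suc j) + 2) * (of_nat (n - Suc j) + 1) * (of_nat (n - Suc j) + 3 / 2)) (lame_rec n a b (j - 1)) else 0)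
      + (if 2 \<le> j then smult (b * (of_nat (n - Suc j) + 3) * (of_nat (n - Suc j) + 2) * (of_nat (n - Suc j) + 1)) (lame_rec n a b (j - 2)) else 0))"

text \<open>Only the first term of the recursion raises the degree in the spectral parameter, by
  exactly one and with nonzero factor \<open>4 (m + 1)\<close>; the others reach back at least two
  steps. The last coefficient therefore has exact degree \<open>n\<close>, which the normalisation
  to a monic polynomial requires.\<close>

lemma lame_rec_degree:
  assumes "j \<le> n" shows "degree (lame_rec n a b j) \<le> j \<and> coeff (lame_rec n a b j) j \<noteq> 0"
  using assms
proof (induction j rule: less_induct)
  case (less j)
  show ?case
  proof (cases j)
    case (Suc i)
    let ?m = "n - Suc i"
    define p1 where "p1 = lame_rec n a b i"
    define p2 where "p2 = (if 1 \<le> i then smult (a * (of_nat ?m + 2) * (of_nat ?m + 1) * (of_nat ?m + 3 / 2)) (lame_rec n a b (i - 1)) else 0)"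
    define p3 where "p3 = (if 2 \<le> i then smult (b * (of_nat ?m + 3) * (of_nat ?m + 2) * (of_nat ?m + 1)) (lame_rec n a b (i - 2)) else 0)"
    have p1: "degree p1 \<le> i" "coeff p1 i \<noteq> 0" using less.IH[of i] less.prems Suc by (auto simp: p1_def)
    have p2: "degree p2 \<le> i"
    proof -
      have "degree (lame_rec n a b (i - 1)) \<le> i - 1" using less.IH[of "i - 1"] less.prems Suc by simp
      then have "degree (lame_rec n a b (i - 1)) \<le> i" by linarith
      then show ?thesis by (auto simp: p2_def intro: order.trans[OF degree_smult_le])
    qed
    have p3: "degree p3 \<le> i"
    proof -
      have "degree (lame_rec n a b (i - 2)) \<le> i - 2" using less.IH[of "i - 2"] less.prems Suc by simp
      then have "degree (lame_rec n a b (i - 2)) \<le> i" by linarith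
      then show ?thesis by (auto simp: p3_def intro: order.trans[OF degree_smult_le])
    qed
    define c where "c = (4 * (of_nat ?m + 1) :: complex)"
    have "of_nat (Suc ?m) \<noteq> (0::complex)" by (simp only: of_nat_eq_0_iff)
    moreover have "c = 4 * of_nat (Suc ?m)" by (simp add: c_def add.commute)
    ultimately have c: "c \<noteq> 0" by (simp only: mult_eq_0_iff) simp
    have eq: "lame_rec n a b j = smult (1 / lame_ind n ?m) ([:0, c:] * p1 + p2 + p3)"
      by (simp only: Suc lame_rec.simps p1_def p2_def p3_def c_def)
    have s: "[:0, c:] * p1 = pCons 0 (smult c p1)" by simp
    have "degree ([:0, c:] * p1 + p2 + p3) \<le> Suc i"
      unfolding s using p1 p2 p3 by (intro degree_add_le) (auto simp: degree_pCons_eq_if)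
    moreover have "coeff ([:0, c:] * p1 + p2 + p3) (Suc i) = c * coeff p1 i"
      unfolding s using p2 p3 by (simp add: coeff_eq_0)
    moreover have "lame_ind n ?m \<noteq> 0" using less.prems Suc by (intro lame_ind_nonzero) auto
    ultimately have "degree (lame_rec n a b j) \<le> Suc i" "coeff (lame_rec n a b j) (Suc i) \<noteq> 0"
      unfolding eq using c p1 by (auto intro: order.trans[OF degree_smult_le] simp del: mult_pCons_left)
    then show ?thesis using Suc by simp
  qed simp
qed

text \<open>Indexed by the power of \<open>wp\<close>. The scaling divides by the coefficient of
  \<open>B^n\<close>, which occurs only for \<open>m = 0\<close>.\<close>

definition lame_coeff :: "nat \<Rightarrow> complex \<Rightarrow> complex \<Rightarrow> nat \<Rightarrow> complex poly" where
  "lame_coeff n a b m = (if m \<le> n then smult (1 / coeff (lame_rec n a b n) n) (lame_rec n a b (n - m)) else 0)"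

lemma lame_coeff_degree: "degree (lame_coeff n a b m) \<le> n - m"
  using lame_rec_degree[of "n - m" n a b] order.trans[OF degree_smult_le] by (auto simp: lame_coeff_def)

lemma lame_coeff_monic: "coeff (lame_coeff n a b 0) n = 1"
  using lame_rec_degree[of n n a b] by (simp add: lame_coeff_def)

lemma lame_coeff_top: "lame_coeff n a b n = [:1 / coeff (lame_rec n a b n) n:]" "coeff (lame_rec n a b n) n \<noteq> 0"
  using lame_rec_degree[of n n a b] by (auto simp: lame_coeff_def one_pCons)

text \<open>Valid for every \<open>m\<close>: at \<open>m = n\<close> the factor
  \<open>lame_ind\<close> vanishes, and beyond \<open>n\<close> all coefficients are zero.\<close>

lemma lame_coeff_rec:
  "smult (lame_ind n m) (lame_coeff n a b m) = [:0, 4 * (of_nat m + 1):] * lame_coeff n a b (m + 1)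
    + smult (a * (of_nat m + 2) * (of_nat m + 1) * (of_nat m + 3 / 2)) (lame_coeff n a b (m + 2))
    + smult (b * (of_nat m + 3) * (of_nat m + 2) * (of_nat m + 1)) (lame_coeff n a b (m + 3))"
proof (cases "m < n")
  case True
  define j where "j = n - m - 1"
  have j: "n - m = Suc j" "n - Suc j = m" "n - (m + 1) = j" "n - (m + 2) = j - 1" "n - (m + 3) = j - 2"
    "m + 2 \<le> n \<longleftrightarrow> 1 \<le> j" "m + 3 \<le> n \<longleftrightarrow> 2 \<le> j" "m + 1 \<le> n" "m \<le> n"
    using True by (auto simp: j_def)
  define k where "k = 1 / coeff (lame_rec n a b n) n"
  have "smult (lame_ind n m) (lame_rec n a b (Suc j)) =
     [:0, 4 * (of_nat m + 1):] * lame_rec n a b j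
      + (if 1 \<le> j then smult (a * (of_nat m + 2) * (of_nat m + 1) * (of_nat m + 3 / 2)) (lame_rec n a b (j - 1)) else 0)
      + (if 2 \<le> j then smult (b * (of_nat m + 3) * (of_nat m + 2) * (of_nat m + 1)) (lame_rec n a b (j - 2)) else 0)"
    using lame_ind_nonzero[OF True] unfolding lame_rec.simps j(2) by simp
  then have "smult k (smult (lame_ind n m) (lame_rec n a b (Suc j))) = smult k (
     [:0, 4 * (of_nat m + 1):] * lame_rec n a b j
      + (if 1 \<le> j then smult (a * (of_nat m + 2) * (of_nat m + 1) * (of_nat m + 3 / 2)) (lame_rec n a b (j - 1)) else 0)
      + (if 2 \<le> j then smult (b * (of_nat m + 3) * (of_nat m + 2) * (of_nat m + 1)) (lame_rec n a b (j - 2)) else 0))" by simp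
  note R = this
  have L: "lame_coeff n a b m = smult k (lame_rec n a b (Suc j))" "lame_coeff n a b (m + 1) = smult k (lame_rec n a b j)"
    "lame_coeff n a b (m + 2) = smult k (if 1 \<le> j then lame_rec n a b (j - 1) else 0)"
    "lame_coeff n a b (m + 3) = smult k (if 2 \<le> j then lame_rec n a b (j - 2) else 0)"
    unfolding lame_coeff_def k_def[symmetric] by (simp_all only: j if_True refl if_distrib[of "smult k"] smult_0_right)
  have "smult (lame_ind n m) (lame_coeff n a b m) = smult k (smult (lame_ind n m) (lame_rec n a b (Suc j)))"
    unfolding L by (simp add: mult.commute)
  also note R
  also have "smult k ([:0, 4 * (of_nat m + 1):] * lame_rec n a b j
      + (if 1 \<le> j then smult (a * (of_nat m + 2) * (of_nat m + 1) * (of_nat m + 3 / 2)) (lame_rec n a b (j - 1)) else 0)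
      + (if 2 \<le> j then smult (b * (of_nat m + 3) * (of_nat m + 2) * (of_nat m + 1)) (lame_rec n a b (j - 2)) else 0))
    = [:0, 4 * (of_nat m + 1):] * lame_coeff n a b (m + 1)
    + smult (a * (of_nat m + 2) * (of_nat m + 1) * (of_nat m + 3 / 2)) (lame_coeff n a b (m + 2))
    + smult (b * (of_nat m + 3) * (of_nat m + 2) * (of_nat m + 1)) (lame_coeff n a b (m + 3))"
    unfolding L by (simp add: smult_add_right mult.commute)
  finally show ?thesis .
next
  case False
  then show ?thesis by (cases "m = n") (auto simp: lame_coeff_def lame_ind_def)
qed

definition lame_xpoly :: "nat \<Rightarrow> complex \<Rightarrow> complex \<Rightarrow> complex \<Rightarrow> complex poly" where
  "lame_xpoly n a b B = (\<Sum>m\<le>n. monom (poly (lame_coeff n a b m) B) m)"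

lemma coeff_lame_xpoly: "coeff (lame_xpoly n a b B) m = poly (lame_coeff n a b m) B"
proof -
  have "coeff (lame_xpoly n a b B) m = (\<Sum>i\<le>n. if i = m then poly (lame_coeff n a b i) B else 0)"
    by (simp add: lame_xpoly_def coeff_sum)
  then show ?thesis by (auto simp: lame_coeff_def)
qed

lemma poly_lame_xpoly: "poly (lame_xpoly n a b B) x = (\<Sum>m\<le>n. poly (lame_coeff n a b m) B * x ^ m)"
  by (simp add: lame_xpoly_def poly_sum poly_monom)

text \<open>The third-order product equation for \<open>f (wp z)\<close>, divided by
  \<open>wp' z\<close> and rewritten with \<open>wp'^2 = 4 x^3 - a x - b\<close>. Comparing
  coefficients of \<open>x^k\<close> turns it into \<open>lame_coeff_rec\<close>.\<close>

lemma lame_xpoly_ode: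
  fixes n :: nat and a b B x :: complex
  defines "f \<equiv> lame_xpoly n a b B" and "N \<equiv> of_nat n * (of_nat n + 1)"
  shows "(4 * x ^ 3 - a * x - b) * poly (pderiv (pderiv (pderiv f))) x + 3 / 2 * (12 * x\<^sup>2 - a) * poly (pderiv (pderiv f)) x
    + 12 * x * poly (pderiv f) x - 4 * (N * x + B) * poly (pderiv f) x - 2 * N * poly f x = 0"
proof -
  define c where "c m = coeff f m" for m
  have rec: "lame_ind n m * c m = 4 * (of_nat m + 1) * B * c (m + 1)
     + a * (of_nat m + 2) * (of_nat m + 1) * (of_nat m + 3 / 2) * c (m + 2) + b * (of_nat m + 3) * (of_nat m + 2) * (of_nat m + 1) * c (m + 3)" for m
  proof -
    have "poly (smult (lame_ind n m) (lame_coeff n a b m)) B = poly ([:0, 4 * (of_nat m + 1):] * lame_coeff n a b (m + 1)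
    + smult (a * (of_nat m + 2) * (of_nat m + 1) * (of_nat m + 3 / 2)) (lame_coeff n a b (m + 2))
    + smult (b * (of_nat m + 3) * (of_nat m + 2) * (of_nat m + 1)) (lame_coeff n a b (m + 3))) B"
      by (simp only: lame_coeff_rec)
    then show ?thesis
      unfolding c_def f_def coeff_lame_xpoly by (simp add: algebra_simps)
  qed
  define f1 f2 f3 where "f1 = pderiv f" and "f2 = pderiv f1" and "f3 = pderiv f2"
  define R where "R = [:- b, - a, 0, 4:] * f3 + smult (3 / 2) ([:- a, 0, 12:] * f2) + [:0, 12:] * f1
      - smult 4 ([:B, N:] * f1) - smult (2 * N) f"
  have "coeff R k = 0" for k
  proof -
    have cf: "coeff f1 m = of_nat (Suc m) * c (Suc m)" "coeff f2 m = of_nat (Suc m) * (of_nat (Suc (Suc m)) * c (Suc (Suc m)))"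
       "coeff f3 m = of_nat (Suc m) * (of_nat (Suc (Suc m)) * (of_nat (Suc (Suc (Suc m))) * c (Suc (Suc (Suc m)))))" "coeff f m = c m" for m
      by (simp_all add: f1_def f2_def f3_def coeff_pderiv c_def)
    have "coeff R k = lame_ind n k * c k - 4 * (of_nat k + 1) * B * c (k + 1)
     - a * (of_nat k + 2) * (of_nat k + 1) * (of_nat k + 3 / 2) * c (k + 2) - b * (of_nat k + 3) * (of_nat k + 2) * (of_nat k + 1) * c (k + 3)"
    proof -
      \<comment> \<open>The multipliers have degree up to 3, so the coefficients with
        \<open>k = 0, 1, 2\<close> lack some of the shifted terms and are treated apart.\<close>
      consider "k = 0" | "k = 1" | "k = 2" | i where "k = Suc (Suc (Suc i))"
        by (metis One_nat_def Suc_1 not0_implies_Suc)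
      then show ?thesis
        by cases (simp_all add: R_def cf coeff_pCons N_def lame_ind_def numeral_2_eq_2 numeral_3_eq_3 algebra_simps)
    qed
    then show ?thesis using rec[of k] by simp
  qed
  then have "poly R x = 0" by (simp add: poly_eqI[of R 0])
  then show ?thesis unfolding f1_def[symmetric] f2_def[symmetric] f3_def[symmetric]
    by (simp add: R_def algebra_simps power2_eq_square power3_eq_cube)
qed

section \<open>The classical Lame equation\<close>

text \<open>Off poles the value is the limit and at poles it is 0 by convention, so every value is
  determined by a punctured neighbourhood. This makes the elliptic coefficients unique as functions
  on the whole plane.\<close>

lemma nicely_meromorphic_eq_off_sparse:
  assumes "f nicely_meromorphic_on UNIV" "g nicely_meromorphic_on UNIV" "X sparse_in UNIV"
    and "\<And>z. z \<notin> X \<Longrightarrow> f z = g z"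
  shows "f z = g z"
proof -
  obtain B where B: "open B" "z \<in> B" "\<And>y. y \<in> B \<Longrightarrow> y \<noteq> z \<Longrightarrow> y \<notin> X"
    by (rule sparse_in_not_in[OF assms(3), of z]) auto
  have ev: "eventually (\<lambda>w. f w = g w) (at z)"
    using eventually_at_in_open[OF B(1,2)] by (rule eventually_mono) (use B assms(4) in auto)
  have p: "is_pole f z \<longleftrightarrow> is_pole g z" by (rule is_pole_cong[OF ev refl])
  have f: "is_pole f z \<and> f z = 0 \<or> (f \<longlongrightarrow> f z) (at z)"
  proof -
    have "\<forall>z\<in>UNIV. (is_pole f z \<and> f z = 0) \<or> (f \<longlongrightarrow> f z) (at z)"
      using assms(1) unfolding nicely_meromorphic_on_def by (rule conjunct2)
    then show ?thesis by (rule bspec) (rule UNIV_I)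
  qed
  have g: "is_pole g z \<and> g z = 0 \<or> (g \<longlongrightarrow> g z) (at z)"
  proof -
    have "\<forall>z\<in>UNIV. (is_pole g z \<and> g z = 0) \<or> (g \<longlongrightarrow> g z) (at z)"
      using assms(2) unfolding nicely_meromorphic_on_def by (rule conjunct2)
    then show ?thesis by (rule bspec) (rule UNIV_I)
  qed
  show ?thesis
  proof (cases "is_pole f z")
    case True
    then have "\<not> (f \<longlongrightarrow> f z) (at z)" "\<not> (g \<longlongrightarrow> g z) (at z)"
      using p not_tendsto_and_filterlim_at_infinity[OF at_neq_bot] unfolding is_pole_def by blast+
    then show ?thesis using f g by auto
  next
    case False
    then have "(f \<longlongrightarrow> f z) (at z)" "(g \<longlongrightarrow> g z) (at z)" using f g p by auto
    then show ?thesis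
      using Lim_transform_eventually[OF _ ev] tendsto_unique[OF trivial_limit_at] by blast
  qed
qed

section \<open>Existence and uniqueness of the monic elliptic solution\<close>

context upper_half begin

text \<open>Covers both equations at once: the complement of the lattice, and the same set without
  the translates of \<open>p\<close> and \<open>-p\<close>.\<close>

definition periodic_domain :: "complex set \<Rightarrow> bool" where
  "periodic_domain S \<longleftrightarrow> open S \<and> - S sparse_in UNIV \<and> (\<forall>z l. l \<in> \<Lambda> \<longrightarrow> z \<in> S \<longrightarrow> z + l \<in> S)"

lemma remove_sings_periodic:
  assumes "periodic_domain S" "l \<in> \<Lambda>" "\<And>z. z \<in> S \<Longrightarrow> f (z + l) = f z"
  shows "remove_sings f (z + l) = remove_sings f z"
proof -
  obtain B where B: "open B" "z \<in> B" "\<And>y. y \<in> B \<Longrightarrow> y \<noteq> z \<Longrightarrow> y \<notin> - S"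
  proof -
    have sp: "- S sparse_in UNIV" using assms(1) by (simp add: periodic_domain_def)
    from sparse_in_not_in[OF sp UNIV_I, of z] show ?thesis using that by metis
  qed
  have ev: "eventually (\<lambda>w. f (w + l) = f w) (at z)"
    using eventually_at_in_open[OF B(1,2)] by (rule eventually_mono) (use B assms(3) in auto)
  have "(f \<longlongrightarrow> c) (at (z + l)) \<longleftrightarrow> ((\<lambda>w. f (w + l)) \<longlongrightarrow> c) (at z)" for c
    using filterlim_shift_iff[where f = f and d = l and F = "nhds c" and a = "z + l"] by (simp add: o_def add.commute)
  also have "\<And>c. \<dots> c \<longleftrightarrow> (f \<longlongrightarrow> c) (at z)"
    by (rule tendsto_cong[OF ev])
  finally have iff: "(f \<longlongrightarrow> c) (at (z + l)) \<longleftrightarrow> (f \<longlongrightarrow> c) (at z)" for c .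
  show ?thesis
    unfolding remove_sings_def Topological_Spaces.Lim_def iff by simp
qed

text \<open>An explicit formula is trustworthy only on \<open>S\<close>, whereas the definition
  prescribes values at the poles too. Removing singularities coefficientwise supplies these values,
  and monicity survives because the top coefficient is constantly 1 off a sparse set.\<close>

lemma monic_solution_regularize:
  assumes S: "periodic_domain S"
    and deg: "\<And>z. z \<in> S \<Longrightarrow> degree (\<Psi> z) = d \<and> lead_coeff (\<Psi> z) = 1"
    and mero: "\<And>k. (\<lambda>z. coeff (\<Psi> z) k) meromorphic_on UNIV"
    and hol: "\<And>k. (\<lambda>z. coeff (\<Psi> z) k) holomorphic_on S"
    and per: "\<And>z l. z \<in> S \<Longrightarrow> l \<in> \<Lambda> \<Longrightarrow> \<Psi> (z + l) = \<Psi> z"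
    and ode: "\<And>T z. z \<in> S \<Longrightarrow> (deriv ^^ 3) (\<lambda>w. poly (\<Psi> w) T) z
                - 4 * q T z * deriv (\<lambda>w. poly (\<Psi> w) T) z - 2 * deriv (q T) z * poly (\<Psi> z) T = 0"
  obtains \<Phi> where "monic_elliptic_solution \<tau> S q d \<Phi>" "\<And>z. z \<in> S \<Longrightarrow> \<Phi> z = \<Psi> z"
proof -
  have oS: "open S" and sS: "- S sparse_in UNIV" using S by (auto simp: periodic_domain_def)
  define r where "r k = remove_sings (\<lambda>w. coeff (\<Psi> w) k)" for k
  define \<Phi> where "\<Phi> z = (\<Sum>k\<le>d. monom (r k z) k)" for z
  have rS: "r k z = coeff (\<Psi> z) k" if "z \<in> S" for z k
    unfolding r_def by (rule remove_sings_at_analytic) (use hol oS that in \<open>auto intro: holomorphic_on_imp_analytic_at\<close>)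
  have co: "coeff (\<Phi> z) k = (if k \<le> d then r k z else 0)" for z k
  proof -
    have "coeff (\<Phi> z) k = (\<Sum>i\<le>d. if i = k then r i z else 0)"
      by (simp add: \<Phi>_def coeff_sum)
    then show ?thesis by simp
  qed
  have eq: "\<Phi> z = \<Psi> z" if "z \<in> S" for z
  proof (rule poly_eqI)
    fix k show "coeff (\<Phi> z) k = coeff (\<Psi> z) k"
      using that deg[OF that] by (auto simp: co rS coeff_eq_0)
  qed
  have rn: "r k nicely_meromorphic_on UNIV" for k
    unfolding r_def by (rule remove_sings_nicely_meromorphic[OF mero])
  have one: "(\<lambda>_. 1 :: complex) nicely_meromorphic_on UNIV" by auto
  have rd: "r d z = 1" for z
    by (rule nicely_meromorphic_eq_off_sparse[OF rn one sS]) (use rS deg in force)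
  have dlc: "degree (\<Phi> z) = d \<and> lead_coeff (\<Phi> z) = 1" for z
  proof -
    have "degree (\<Phi> z) \<le> d" by (rule degree_le) (simp add: co)
    moreover have "coeff (\<Phi> z) d = 1" by (simp add: co rd)
    ultimately show ?thesis by (metis le_antisym le_degree zero_neq_one)
  qed
  have "monic_elliptic_solution \<tau> S q d \<Phi>"
    unfolding monic_elliptic_solution_def
  proof (intro conjI allI ballI)
    fix k show "elliptic \<tau> (\<lambda>z. coeff (\<Phi> z) k)"
    proof (cases "k \<le> d")
      case True
      have "r k (z + l) = r k z" if "l \<in> \<Lambda>" for l z
        unfolding r_def by (rule remove_sings_periodic[OF S that]) (simp add: per that)
      then show ?thesis using True rn by (simp add: elliptic_def co)
    next
      case False
      then show ?thesis by (auto simp: elliptic_def co)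
    qed
  next
    fix T
    have "(\<lambda>z. poly (\<Psi> z) T) holomorphic_on S"
    proof (rule holomorphic_transform)
      show "(\<lambda>z. \<Sum>k\<le>d. coeff (\<Psi> z) k * T ^ k) holomorphic_on S"
        by (intro holomorphic_intros hol)
      show "(\<Sum>k\<le>d. coeff (\<Psi> z) k * T ^ k) = poly (\<Psi> z) T" if "z \<in> S" for z
        using deg[OF that] by (simp add: poly_altdef)
    qed
    then show "(\<lambda>z. poly (\<Phi> z) T) holomorphic_on S"
      by (rule holomorphic_transform) (simp add: eq)
  next
    fix T z assume z: "z \<in> S"
    have ev: "eventually (\<lambda>w. poly (\<Phi> w) T = poly (\<Psi> w) T) (nhds z)"
      using eventually_nhds_in_open[OF oS z] by (rule eventually_mono) (simp add: eq)
    show "(deriv ^^ 3) (\<lambda>w. poly (\<Phi> w) T) z - 4 * q T z * deriv (\<lambda>w. poly (\<Phi> w) T) z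
                - 2 * deriv (q T) z * poly (\<Phi> z) T = 0"
      unfolding higher_deriv_cong_ev[OF ev refl] deriv_cong_ev[OF ev refl] eq[OF z] by (rule ode[OF z])
  qed (rule dlc[THEN conjunct1] dlc[THEN conjunct2])+
  then show ?thesis using that eq by blast
qed

text \<open>The ratio of two solutions is an entire function of the spectral parameter which tends to 1
  at infinity, hence it is identically 1.\<close>

lemma Phi_fun_eqI:
  assumes S: "periodic_domain S"
    and sol: "monic_elliptic_solution \<tau> S q d \<Phi>"
    and nz: "\<And>T. \<exists>z\<in>S. poly (\<Phi> z) T \<noteq> 0"
    and uniq: "\<And>T f. f holomorphic_on S \<Longrightarrow> f meromorphic_on UNIV \<Longrightarrow> (\<And>z l. z \<in> S \<Longrightarrow> l \<in> \<Lambda> \<Longrightarrow> f (z + l) = f z) \<Longrightarrow>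
       (\<And>z. z \<in> S \<Longrightarrow> (deriv ^^ 3) f z - 4 * q T z * deriv f z - 2 * deriv (q T) z * f z = 0) \<Longrightarrow>
       \<exists>c. \<forall>z\<in>S. f z = c * poly (\<Phi> z) T"
  shows "Phi_fun \<tau> S q d = \<Phi>"
  unfolding Phi_fun_def
proof (rule the_equality)
  show "monic_elliptic_solution \<tau> S q d \<Phi>" by (rule sol)
next
  fix \<Psi> assume \<Psi>: "monic_elliptic_solution \<tau> S q d \<Psi>"
  have d: "degree (\<Phi> z) = d" "lead_coeff (\<Phi> z) = 1" "degree (\<Psi> z) = d" "lead_coeff (\<Psi> z) = 1" for z
    using sol \<Psi> by (auto simp: monic_elliptic_solution_def)
  have el: "elliptic \<tau> (\<lambda>z. coeff (\<Phi> z) k)" "elliptic \<tau> (\<lambda>z. coeff (\<Psi> z) k)" for k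
    using sol \<Psi> by (auto simp: monic_elliptic_solution_def)
  have "\<exists>c. \<forall>z\<in>S. poly (\<Psi> z) T = c * poly (\<Phi> z) T" for T
  proof (rule uniq)
    show "(\<lambda>z. poly (\<Psi> z) T) holomorphic_on S" using \<Psi> by (simp add: monic_elliptic_solution_def)
    have p: "poly (\<Psi> z) T = (\<Sum>k\<le>d. coeff (\<Psi> z) k * T ^ k)" for z using d(3) by (simp add: poly_altdef)
    show "(\<lambda>z. poly (\<Psi> z) T) meromorphic_on UNIV"
      unfolding p using el(2) by (auto intro!: meromorphic_intros simp: elliptic_def nicely_meromorphic_on_def)
    show "poly (\<Psi> (z + l)) T = poly (\<Psi> z) T" if "l \<in> \<Lambda>" for z l
      unfolding p using el(2) that by (simp add: elliptic_def)
    show "(deriv ^^ 3) (\<lambda>z. poly (\<Psi> z) T) z - 4 * q T z * deriv (\<lambda>z. poly (\<Psi> z) T) z - 2 * deriv (q T) z * poly (\<Psi> z) T = 0" if "z \<in> S" for z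
      using \<Psi> that by (simp add: monic_elliptic_solution_def)
  qed
  then obtain c where c: "\<And>T z. z \<in> S \<Longrightarrow> poly (\<Psi> z) T = c T * poly (\<Phi> z) T" by metis
  \<comment> \<open>A point \<open>z\<close> at which the solution for \<open>T0\<close> is nonzero
    serves all nearby parameters as well, so there \<open>c\<close> is a quotient of two
    polynomials.\<close>
  have "c field_differentiable at T0" for T0
  proof -
    obtain z where z: "z \<in> S" "poly (\<Phi> z) T0 \<noteq> 0" using nz by blast
    have "isCont (poly (\<Phi> z)) T0" by (rule poly_isCont)
    then have "eventually (\<lambda>T. poly (\<Phi> z) T \<noteq> 0) (nhds T0)"
      using z(2) by (intro tendsto_imp_eventually_ne[of _ "poly (\<Phi> z) T0"]) (auto simp: continuous_at tendsto_at_iff_tendsto_nhds isCont_def)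
    then have ev: "eventually (\<lambda>T. poly (\<Psi> z) T / poly (\<Phi> z) T = c T) (nhds T0)"
      by (rule eventually_mono) (use c z in auto)
    have "((\<lambda>T. poly (\<Psi> z) T / poly (\<Phi> z) T) has_field_derivative
      (poly (pderiv (\<Psi> z)) T0 * poly (\<Phi> z) T0 - poly (\<Psi> z) T0 * poly (pderiv (\<Phi> z)) T0) / (poly (\<Phi> z) T0 * poly (\<Phi> z) T0)) (at T0)"
      by (intro DERIV_divide poly_DERIV z)
    then show ?thesis
      unfolding DERIV_cong_ev[OF refl ev refl] by (auto simp: field_differentiable_def)
  qed
  then have ch: "c holomorphic_on UNIV" by (auto simp: holomorphic_on_def field_differentiable_at_within)
  obtain z0 where z0: "z0 \<in> S" using nz by blast
  have "((\<lambda>T. (poly (\<Psi> z0) T / T ^ d) / (poly (\<Phi> z0) T / T ^ d)) \<longlongrightarrow> 1 / 1) at_infinity"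
    using poly_divide_tendsto_aux[of "\<Psi> z0"] poly_divide_tendsto_aux[of "\<Phi> z0"] d[of z0]
    by (intro tendsto_divide) auto
  moreover have "eventually (\<lambda>T. (poly (\<Psi> z0) T / T ^ d) / (poly (\<Phi> z0) T / T ^ d) = c T) at_infinity"
  proof -
    have "((\<lambda>T. poly (\<Phi> z0) T / T ^ d) \<longlongrightarrow> 1) at_infinity"
      using poly_divide_tendsto_aux[of "\<Phi> z0"] d[of z0] by simp
    then have "eventually (\<lambda>T. poly (\<Phi> z0) T / T ^ d \<noteq> 0) at_infinity"
      by (rule tendsto_imp_eventually_ne) simp
    then show ?thesis by (rule eventually_mono) (use c z0 in auto)
  qed
  ultimately have "(c \<longlongrightarrow> 1) at_infinity" using Lim_transform_eventually by fastforce
  then have c1: "c T = 1" for T by (rule Liouville_weak[OF ch])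
  have eqS: "\<Psi> z = \<Phi> z" if "z \<in> S" for z
    using c[OF that] c1 by (simp add: poly_eq_poly_eq_iff[symmetric] fun_eq_iff)
  have sS: "- S sparse_in UNIV" using S by (auto simp: periodic_domain_def)
  show "\<Psi> = \<Phi>"
  proof (intro ext poly_eqI)
    fix z k
    show "coeff (\<Psi> z) k = coeff (\<Phi> z) k"
      by (rule nicely_meromorphic_eq_off_sparse[OF _ _ sS, where f = "\<lambda>z. coeff (\<Psi> z) k" and g = "\<lambda>z. coeff (\<Phi> z) k"])
         (use el eqS in \<open>auto simp: elliptic_def\<close>)
  qed
qed

lemma periodic_domain_lreg: "periodic_domain lreg"
  using open_lreg sparse_lattice_subset[of \<Lambda>] by (simp add: periodic_domain_def lreg_iff) (simp add: lreg_def)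

end

section \<open>The product of solutions of the Lame equation in closed form\<close>

locale lame_setting = upper_half +
  fixes n :: nat
  assumes n_pos: "0 < n"
begin

abbreviation N :: complex where "N \<equiv> of_nat n * (of_nat n + 1)"

lemma N_nonzero: "N \<noteq> 0"
proof -
  have "N = of_nat (n * (n + 1))" by (simp add: algebra_simps)
  moreover have "of_nat (n * (n + 1)) \<noteq> (0::complex)" using n_pos by (simp only: of_nat_eq_0_iff) simp
  ultimately show ?thesis by simp
qed

definition lc :: "nat \<Rightarrow> complex poly" where "lc m = lame_coeff n inv_g2 inv_g3 m"

definition lx :: "complex \<Rightarrow> complex poly" where "lx B = lame_xpoly n inv_g2 inv_g3 B"

definition wp'' :: "complex \<Rightarrow> complex" where "wp'' z = 6 * (wp \<tau> z)\<^sup>2 - inv_g2 / 2"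

text \<open>\<open>LP0\<close>, \<open>LP1\<close> and \<open>LP2\<close> are the product and its
  first two derivatives in \<open>z\<close>, kept as polynomials in the spectral parameter because a
  quadratic polynomial in \<open>T\<close> will be substituted for it. The exponents
  \<open>m - 1\<close> and \<open>m - 2\<close> are truncated only where their factor
  vanishes.\<close>

definition LP0 :: "complex \<Rightarrow> complex poly" where
  "LP0 z = (\<Sum>m\<le>n. smult (wp \<tau> z ^ m) (lc m))"

definition LP1 :: "complex \<Rightarrow> complex poly" where
  "LP1 z = (\<Sum>m\<le>n. smult (of_nat m * wp \<tau> z ^ (m - 1) * wp' z) (lc m))"

definition LP2 :: "complex \<Rightarrow> complex poly" where
  "LP2 z = (\<Sum>m\<le>n. smult (of_nat m * (of_nat (m - 1) * wp \<tau> z ^ (m - 2) * (wp' z)\<^sup>2 + wp \<tau> z ^ (m - 1) * wp'' z)) (lc m))"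

definition F0 :: "complex \<Rightarrow> complex \<Rightarrow> complex" where "F0 B z = poly (LP0 z) B"
definition F1 :: "complex \<Rightarrow> complex \<Rightarrow> complex" where "F1 B z = poly (LP1 z) B"
definition F2 :: "complex \<Rightarrow> complex \<Rightarrow> complex" where "F2 B z = poly (LP2 z) B"

lemma lx_eq: "lx B = (\<Sum>m\<le>n. monom (poly (lc m) B) m)"
  by (simp add: lx_def lame_xpoly_def lc_def)

lemma F0_eq: "F0 B z = poly (lx B) (wp \<tau> z)"
  by (simp add: F0_def LP0_def lx_eq poly_sum poly_monom mult.commute)

lemma pderiv_sum: "pderiv (\<Sum>i\<in>A. f i) = (\<Sum>i\<in>A. pderiv (f i))"
  by (induction A rule: infinite_finite_induct) (auto simp: pderiv_add)

lemma pderiv_monom': "pderiv (monom (a::complex) m) = monom (of_nat m * a) (m - 1)"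
  by (cases m) (auto simp: pderiv_monom)

lemma F1_eq: "F1 B z = poly (pderiv (lx B)) (wp \<tau> z) * wp' z"
  by (simp add: F1_def LP1_def lx_eq poly_sum poly_monom pderiv_sum pderiv_monom' sum_distrib_left sum_distrib_right mult_ac)

lemma F2_eq: "F2 B z = poly (pderiv (pderiv (lx B))) (wp \<tau> z) * (wp' z)\<^sup>2 + poly (pderiv (lx B)) (wp \<tau> z) * wp'' z"
  by (simp add: F2_def LP2_def lx_eq poly_sum poly_monom pderiv_sum pderiv_monom' sum_distrib_left sum_distrib_right
     sum.distrib[symmetric] algebra_simps numeral_2_eq_2)

lemma DERIV_F0: "z \<notin> \<Lambda> \<Longrightarrow> (F0 B has_field_derivative F1 B z) (at z)"
  unfolding F0_eq[abs_def] F1_eq by (rule DERIV_chain2[where f = "poly (lx B)"]) (auto intro: poly_DERIV DERIV_wp)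

lemma DERIV_wp'2: "z \<notin> \<Lambda> \<Longrightarrow> (wp' has_field_derivative wp'' z) (at z)"
  using DERIV_wp' by (simp add: wp''_def)

lemma DERIV_wp'': "z \<notin> \<Lambda> \<Longrightarrow> (wp'' has_field_derivative 12 * wp \<tau> z * wp' z) (at z)"
proof -
  assume z: "z \<notin> \<Lambda>"
  show ?thesis unfolding wp''_def[abs_def]
    by (rule derivative_eq_intros DERIV_wp[OF z] refl | simp)+
qed

lemma DERIV_F1:
  assumes z: "z \<notin> \<Lambda>" shows "(F1 B has_field_derivative F2 B z) (at z)"
proof -
  have p: "((\<lambda>z. poly f (wp \<tau> z)) has_field_derivative poly (pderiv f) (wp \<tau> z) * wp' z) (at z)" for f
    by (rule DERIV_chain2[where f = "poly f", OF poly_DERIV DERIV_wp[OF z]])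
  have "((\<lambda>z. poly (pderiv (lx B)) (wp \<tau> z) * wp' z) has_field_derivative
     poly (pderiv (pderiv (lx B))) (wp \<tau> z) * wp' z * wp' z + wp'' z * poly (pderiv (lx B)) (wp \<tau> z)) (at z)"
    by (rule DERIV_mult[OF p DERIV_wp'2[OF z]])
  then show ?thesis unfolding F1_eq[abs_def] F2_eq by (simp add: power2_eq_square mult_ac)
qed

text \<open>The third-order equation for \<open>F0\<close> in solved form; the equation in
  \<open>x = wp z\<close> and the cubic relation for \<open>wp'^2\<close> meet here.\<close>

lemma DERIV_F2:
  assumes z: "z \<notin> \<Lambda>"
  shows "(F2 B has_field_derivative 4 * (N * wp \<tau> z + B) * F1 B z + 2 * N * wp' z * F0 B z) (at z)"
proof -
  have p: "((\<lambda>z. poly f (wp \<tau> z)) has_field_derivative poly (pderiv f) (wp \<tau> z) * wp' z) (at z)" for f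
    by (rule DERIV_chain2[where f = "poly f", OF poly_DERIV DERIV_wp[OF z]])
  define x where "x = wp \<tau> z"
  define y where "y = wp' z"
  define f0 f1 f2 f3 where "f0 = poly (lx B) x" and "f1 = poly (pderiv (lx B)) x"
    and "f2 = poly (pderiv (pderiv (lx B))) x" and "f3 = poly (pderiv (pderiv (pderiv (lx B)))) x"
  have d: "(F2 B has_field_derivative f3 * y * y\<^sup>2 + 2 * y * wp'' z * f2 + (f2 * y * wp'' z + 12 * x * y * f1)) (at z)"
    unfolding F2_eq[abs_def] x_def y_def f0_def f1_def f2_def f3_def
    by (rule derivative_eq_intros p DERIV_wp'2[OF z] DERIV_wp''[OF z] refl | simp add: algebra_simps)+
  have ode: "(4 * x ^ 3 - inv_g2 * x - inv_g3) * f3 + 3 / 2 * (12 * x\<^sup>2 - inv_g2) * f2 + 12 * x * f1 - 4 * (N * x + B) * f1 - 2 * N * f0 = 0"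
    unfolding f0_def f1_def f2_def f3_def lx_def by (rule lame_xpoly_ode)
  have y2: "y\<^sup>2 = 4 * x ^ 3 - inv_g2 * x - inv_g3" using wp'_sq[OF z] by (simp add: x_def y_def)
  have "f3 * y * y\<^sup>2 + 2 * y * wp'' z * f2 + (f2 * y * wp'' z + 12 * x * y * f1)
     = y * (y\<^sup>2 * f3 + 3 / 2 * (12 * x\<^sup>2 - inv_g2) * f2 + 12 * x * f1)"
    by (simp add: wp''_def x_def[symmetric] algebra_simps power2_eq_square)
  also have "\<dots> = y * (4 * (N * x + B) * f1 + 2 * N * f0)"
    using ode unfolding y2 by (simp add: algebra_simps)
  also have "\<dots> = 4 * (N * wp \<tau> z + B) * F1 B z + 2 * N * wp' z * F0 B z"
    by (simp add: F0_eq F1_eq x_def[symmetric] y_def[symmetric] f0_def[symmetric] f1_def[symmetric] algebra_simps)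
  finally show ?thesis using d by simp
qed

lemma wp_meromorphic: "wp \<tau> meromorphic_on UNIV"
proof (subst meromorphic_on_meromorphic_at, intro ballI)
  fix z
  show "wp \<tau> meromorphic_on {z}"
  proof (cases "z \<in> \<Lambda>")
    case False
    have "wp \<tau> analytic_on {z}"
      using False open_lreg wp_holomorphic by (intro holomorphic_on_imp_analytic_at[of _ lreg]) (auto simp: lreg_iff)
    then show ?thesis by (rule analytic_on_imp_meromorphic_on)
  next
    case True
    have "wp_reg meromorphic_on {0}"
      using wp_reg_holomorphic open_preg
      by (intro analytic_on_imp_meromorphic_on holomorphic_on_imp_analytic_at[of _ preg]) auto
    then have "(\<lambda>w. 1 / w\<^sup>2 + wp_reg w) meromorphic_on {0}"
      by (intro meromorphic_intros)
    then have "wp \<tau> meromorphic_on {0}" by (simp add: wp_eq[abs_def])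
    then have "(\<lambda>w. wp \<tau> (w - z)) meromorphic_on {z}"
      by (rule meromorphic_on_compose) (auto intro!: analytic_intros)
    then show ?thesis
    proof (subst (asm) meromorphic_on_cong)
      fix w assume "w \<in> {z}"
      show "\<forall>\<^sub>F x in at w. wp \<tau> (x - z) = wp \<tau> x"
        using eventually_notin_lattice[of w]
        by (rule eventually_mono) (use wp_periodic[of "- z"] True in auto)
    qed auto
  qed
qed

lemma wp'_meromorphic: "wp' meromorphic_on UNIV"
proof -
  have "deriv (wp \<tau>) meromorphic_on UNIV" by (intro meromorphic_intros wp_meromorphic)
  then show ?thesis
  proof (subst (asm) meromorphic_on_cong)
    show "\<forall>\<^sub>F x in at w. deriv (wp \<tau>) x = wp' x" for w
      using eventually_notin_lattice[of w] by (rule eventually_mono) (auto intro: DERIV_imp_deriv DERIV_wp)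
  qed auto
qed

lemma LP_coeff_meromorphic:
  "(\<lambda>z. coeff (LP0 z) k) meromorphic_on UNIV" "(\<lambda>z. coeff (LP1 z) k) meromorphic_on UNIV" "(\<lambda>z. coeff (LP2 z) k) meromorphic_on UNIV"
  unfolding LP0_def LP1_def LP2_def wp''_def coeff_sum coeff_smult
  by (intro meromorphic_intros wp_meromorphic wp'_meromorphic)+

lemma LP_coeff_holomorphic:
  "(\<lambda>z. coeff (LP0 z) k) holomorphic_on lreg" "(\<lambda>z. coeff (LP1 z) k) holomorphic_on lreg" "(\<lambda>z. coeff (LP2 z) k) holomorphic_on lreg"
  unfolding LP0_def LP1_def LP2_def wp''_def coeff_sum coeff_smult
  by (intro holomorphic_intros wp_holomorphic wp'_holomorphic)+

lemma LP_periodic: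
  assumes "l \<in> \<Lambda>" "z \<notin> \<Lambda>"
  shows "LP0 (z + l) = LP0 z" "LP1 (z + l) = LP1 z" "LP2 (z + l) = LP2 z"
  using assms by (simp_all add: LP0_def LP1_def LP2_def wp''_def wp_periodic wp'_periodic)

lemma lc_degree: "degree (lc m) \<le> n - m"
  by (simp add: lc_def lame_coeff_degree)

lemma LP0_monic: "degree (LP0 z) = n" "lead_coeff (LP0 z) = 1"
proof -
  have le: "degree (LP0 z) \<le> n"
    unfolding LP0_def
    by (intro degree_sum_le order.trans[OF degree_smult_le] order.trans[OF lc_degree]) auto
  have "coeff (LP0 z) n = (\<Sum>m\<le>n. if m = 0 then 1 else 0)"
    unfolding LP0_def coeff_sum
  proof (rule sum.cong)
    fix m assume "m \<in> {..n}"
    then have "coeff (lc m) n = 0" if "m \<noteq> 0"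
      using lc_degree[of m] that n_pos by (intro coeff_eq_0) auto
    then show "coeff (smult (wp \<tau> z ^ m) (lc m)) n = (if m = 0 then 1 else 0)"
      using lame_coeff_monic[of n] by (auto simp: lc_def)
  qed simp
  then have "coeff (LP0 z) n = 1" by simp
  with le show "degree (LP0 z) = n" "lead_coeff (LP0 z) = 1"
    by (metis le_antisym le_degree zero_neq_one)+
qed

text \<open>Degree \<open>n\<close> in the spectral parameter is attained only by the coefficient of
  \<open>wp^0\<close>, which differentiation in \<open>z\<close> removes.\<close>

lemma LP12_degree: "degree (LP1 z) \<le> n - 1" "degree (LP2 z) \<le> n - 1"
proof -
  have s: "degree (smult (of_nat m * c) (lc m)) \<le> n - 1" for m c
    using lc_degree[of m] by (cases "m = 0") (auto intro!: order.trans[OF degree_smult_le])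
  show "degree (LP1 z) \<le> n - 1" "degree (LP2 z) \<le> n - 1"
    unfolding LP1_def LP2_def mult.assoc by (rule degree_sum_le, simp, rule s)+
qed

text \<open>The coefficient of the top power of \<open>wp\<close>; it does not depend on
  \<open>B\<close> and governs the pole of order \<open>2 n\<close> at the origin.\<close>

definition lead :: complex where "lead = 1 / coeff (lame_rec n inv_g2 inv_g3 n) n"

lemma lead_nonzero: "lead \<noteq> 0"
  using lame_coeff_top(2) by (simp add: lead_def)

lemma coeff_lx: "coeff (lx B) m = poly (lc m) B" "coeff (lx B) n = lead"
proof -
  show "coeff (lx B) m = poly (lc m) B" by (simp add: lx_def coeff_lame_xpoly lc_def)
  show "coeff (lx B) n = lead" unfolding lx_def coeff_lame_xpoly lame_coeff_top(1) lead_def by simp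
qed

text \<open>This is \<open>z^(2 n) * F0\<close> continued holomorphically across the origin, with
  \<open>wp\<close> replaced by \<open>(1 + z^2 wp_reg z) / z^2\<close>.\<close>

definition F0_num :: "complex \<Rightarrow> complex \<Rightarrow> complex" where
  "F0_num B z = (\<Sum>m\<le>n. coeff (lx B) m * (1 + z\<^sup>2 * wp_reg z) ^ m * (z\<^sup>2) ^ (n - m))"

lemma F0_num_holomorphic: "F0_num B holomorphic_on preg"
  unfolding F0_num_def by (intro holomorphic_intros wp_reg_holomorphic)

lemma F0_num_0: "F0_num B 0 = lead"
proof -
  have "F0_num B 0 = (\<Sum>m\<le>n. if m = n then lead else 0)"
    unfolding F0_num_def by (rule sum.cong) (auto simp: coeff_lx(2))
  then show ?thesis by simp
qed

lemma F0_num_eq: "z \<noteq> 0 \<Longrightarrow> F0 B z = F0_num B z / z ^ (2 * n)"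
proof -
  assume z: "z \<noteq> 0"
  have w: "1 + z\<^sup>2 * wp_reg z = z\<^sup>2 * wp \<tau> z" using z by (simp add: wp_eq distrib_left)
  have "F0_num B z = (\<Sum>m\<le>n. coeff (lx B) m * wp \<tau> z ^ m * z ^ (2 * n))"
    unfolding F0_num_def w
  proof (rule sum.cong)
    fix m assume "m \<in> {..n}"
    then have "2 * m + 2 * (n - m) = 2 * n" by auto
    then have "(z\<^sup>2) ^ m * (z\<^sup>2) ^ (n - m) = z ^ (2 * n)"
      by (simp only: power_add[symmetric] power_mult[symmetric])
    then show "coeff (lx B) m * (z\<^sup>2 * wp \<tau> z) ^ m * (z\<^sup>2) ^ (n - m) = coeff (lx B) m * wp \<tau> z ^ m * z ^ (2 * n)"
      by (simp add: power_mult_distrib mult_ac)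
  qed simp
  also have "\<dots> = F0 B z * z ^ (2 * n)"
    by (simp add: F0_eq lx_def poly_lame_xpoly coeff_lame_xpoly sum_distrib_right)
  finally show ?thesis using z by simp
qed

lemma F0_tendsto: "((\<lambda>z. z ^ (2 * n) * F0 B z) \<longlongrightarrow> lead) (at 0)"
proof -
  have "isCont (F0_num B) 0" by (rule holomorphic_isCont[OF F0_num_holomorphic open_preg]) simp
  then have l: "(F0_num B \<longlongrightarrow> lead) (at 0)" by (simp add: isCont_def F0_num_0)
  have "eventually (\<lambda>z. F0_num B z = z ^ (2 * n) * F0 B z) (at 0)"
    unfolding eventually_at_filter by (rule always_eventually) (simp add: F0_num_eq)
  from Lim_transform_eventually[OF l this] show ?thesis .
qed

text \<open>With double-pole coefficient \<open>n (n + 1)\<close> the exponents are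
  \<open>-2 n\<close>, \<open>1\<close> and \<open>2 n + 2\<close>. If the term of order
  \<open>-2 n\<close> is absent, \<open>f\<close> vanishes at the origin to order 1 or
  \<open>2 n + 2\<close>, or identically, and so never to order exactly 2; this last clause is what
  excludes the multiples of \<open>1 / g\<close> in the non-even case.\<close>

lemma lame_pole_alternative:
  assumes f: "f meromorphic_on {0}" and r: "r > 0" and v: "v holomorphic_on ball 0 r" "v 0 = N"
    and q: "\<And>z. z \<in> ball 0 r - {0} \<Longrightarrow> q z = v z / z\<^sup>2"
    and ode: "\<And>z. z \<in> ball 0 r - {0} \<Longrightarrow> (deriv ^^ 3) f z - 4 * q z * deriv f z - 2 * deriv q z * f z = 0"
  obtains l where "((\<lambda>z. z ^ (2 * n) * f z) \<longlongrightarrow> l) (at 0)" "l = 0 \<Longrightarrow> (f \<longlongrightarrow> 0) (at 0)"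
    "\<And>d. l = 0 \<Longrightarrow> d \<noteq> 0 \<Longrightarrow> \<not> ((\<lambda>z. f z / z\<^sup>2) \<longlongrightarrow> d) (at 0)"
  using f
proof (cases rule: meromorphic_local_form)
  case zero
  have "((\<lambda>z. z ^ (2 * n) * f z) \<longlongrightarrow> 0) (at 0)"
    by (rule tendsto_eventually) (use zero in \<open>auto elim: eventually_mono\<close>)
  moreover have "(f \<longlongrightarrow> 0) (at 0)" by (rule tendsto_eventually[OF zero])
  moreover have "((\<lambda>z. f z / z\<^sup>2) \<longlongrightarrow> 0) (at 0)"
    by (rule tendsto_eventually) (use zero in \<open>auto elim: eventually_mono\<close>)
  then have "\<not> ((\<lambda>z. f z / z\<^sup>2) \<longlongrightarrow> d) (at 0)" if "d \<noteq> 0" for d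
    using tendsto_unique[OF trivial_limit_at] that by blast
  ultimately show ?thesis using that by blast
next
  case (form u s t)
  let ?r = "min r t"
  have sub: "ball 0 ?r \<subseteq> ball (0::complex) r" "ball 0 ?r \<subseteq> ball (0::complex) t" by auto
  have "(of_int s - 1) * ((of_int s)\<^sup>2 - 2 * of_int s - 4 * v 0) = (0 :: complex)"
  proof (rule indicial_equation[where u = u and r = ?r and f = f and q = q and v = v and a = 0])
    show "u holomorphic_on ball 0 ?r" "v holomorphic_on ball 0 ?r"
      using holomorphic_on_subset[OF form(2) sub(2)] holomorphic_on_subset[OF v(1) sub(1)] by auto
  qed (use form q ode r in auto)
  moreover have "(of_int s - 1) * ((of_int s)\<^sup>2 - 2 * of_int s - 4 * v 0) = (of_int ((s - 1) * ((s + 2 * int n) * (s - 2 * int n - 2))) :: complex)"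
    unfolding v(2) by (simp add: algebra_simps power2_eq_square)
  ultimately have "(s - 1) * ((s + 2 * int n) * (s - 2 * int n - 2)) = 0"
    by (simp only: of_int_eq_0_iff)
  then have s: "s = 1 \<or> s = - int (2 * n) \<or> s = int (2 * n + 2)" by auto
  have u0: "(u \<longlongrightarrow> u 0) (at 0)"
    using holomorphic_isCont[OF form(2) open_ball] form(1) by (simp add: isCont_def)
  have ev: "eventually (\<lambda>z. z \<in> ball 0 t - {0}) (at (0::complex))"
    by (rule eventually_at_in_open) (use form(1) in auto)
  consider "s = - int (2 * n)" | k where "s = int k" "k = 1 \<or> k = 2 * n + 2"
    using s by force
  then show ?thesis
  proof cases
    case 1
    have "f z = u z * inverse (z ^ (2 * n))" if "z \<in> ball 0 t - {0}" for z
      using form(4)[OF that] unfolding 1 power_int_minus power_int_of_nat by simp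
    then have "eventually (\<lambda>z. u z = z ^ (2 * n) * f z) (at 0)"
      using ev by (auto elim!: eventually_mono)
    note lim = Lim_transform_eventually[OF u0 this]
    show ?thesis
      by (rule that[OF lim]) (use form(3) in auto)
  next
    case 2
    have fz: "f z = u z * z ^ k" if "z \<in> ball 0 t - {0}" for z
      using form(4)[OF that] by (simp add: 2(1))
    have k: "k > 0" using 2(2) by auto
    have l1: "((\<lambda>z. u z * z ^ k) \<longlongrightarrow> u 0 * 0 ^ k) (at 0)" by (intro tendsto_intros u0)
    have l2: "eventually (\<lambda>z. u z * z ^ k = f z) (at 0)"
      using ev by (rule eventually_mono) (simp add: fz)
    have f0: "(f \<longlongrightarrow> 0) (at 0)"
      using Lim_transform_eventually[OF l1 l2] unfolding zero_power[OF k] mult_zero_right .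
    have "((\<lambda>z. z ^ (2 * n) * f z) \<longlongrightarrow> 0 ^ (2 * n) * 0) (at 0)" by (intro tendsto_intros f0)
    then have l0: "((\<lambda>z. z ^ (2 * n) * f z) \<longlongrightarrow> 0) (at 0)" by simp
    have "\<not> ((\<lambda>z. f z / z\<^sup>2) \<longlongrightarrow> d) (at 0)" if d: "d \<noteq> 0" for d
    proof
      assume fd: "((\<lambda>z. f z / z\<^sup>2) \<longlongrightarrow> d) (at 0)"
      show False
      proof (cases "k = 1")
        case True
        have l3: "((\<lambda>z. f z / z\<^sup>2 * z) \<longlongrightarrow> d * 0) (at 0)" by (intro tendsto_intros fd)
        have l4: "eventually (\<lambda>z. f z / z\<^sup>2 * z = u z) (at 0)"
          using ev by (rule eventually_mono) (auto simp: fz True power2_eq_square)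
        have "(u \<longlongrightarrow> 0) (at 0)" using Lim_transform_eventually[OF l3 l4] by simp
        then show False using tendsto_unique[OF trivial_limit_at u0] form(3) by blast
      next
        case False
        then have kn: "k = 2 * n + 2" using 2 by auto
        have l3: "((\<lambda>z. u z * z ^ (2 * n)) \<longlongrightarrow> u 0 * 0 ^ (2 * n)) (at 0)" by (intro tendsto_intros u0)
        have l4: "eventually (\<lambda>z. u z * z ^ (2 * n) = f z / z\<^sup>2) (at 0)"
          using ev by (rule eventually_mono) (auto simp: fz kn power_add power2_eq_square)
        have n2: "0 < 2 * n" using n_pos by simp
        have "((\<lambda>z. f z / z\<^sup>2) \<longlongrightarrow> 0) (at 0)"
          using Lim_transform_eventually[OF l3 l4] unfolding zero_power[OF n2] mult_zero_right .
        then show False using tendsto_unique[OF trivial_limit_at fd] d by blast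
      qed
    qed
    with l0 f0 show ?thesis using that by blast
  qed
qed

lemma F_ode:
  assumes "z \<notin> \<Lambda>"
  shows "deriv (F0 B) z = F1 B z" "(deriv ^^ 2) (F0 B) z = F2 B z"
    "(deriv ^^ 3) (F0 B) z = 4 * (N * wp \<tau> z + B) * F1 B z + 2 * N * wp' z * F0 B z"
    "deriv (lame_q n \<tau> B) z = N * wp' z"
proof -
  have z: "z \<in> lreg" using assms by (simp add: lreg_iff)
  have d1: "deriv (F0 B) z = F1 B z" if "z \<in> lreg" for z
    using DERIV_F0 that by (intro DERIV_imp_deriv) (simp add: lreg_iff)
  have d2: "deriv (deriv (F0 B)) z = F2 B z" if "z \<in> lreg" for z
    by (rule deriv_eq_on_open[OF open_lreg that d1]) (use that DERIV_F1 in \<open>auto simp: lreg_iff\<close>)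
  have d3: "deriv (deriv (deriv (F0 B))) z = 4 * (N * wp \<tau> z + B) * F1 B z + 2 * N * wp' z * F0 B z" if "z \<in> lreg" for z
    by (rule deriv_eq_on_open[OF open_lreg that d2]) (use that DERIV_F2 in \<open>auto simp: lreg_iff\<close>)
  show "deriv (F0 B) z = F1 B z" "(deriv ^^ 2) (F0 B) z = F2 B z"
    "(deriv ^^ 3) (F0 B) z = 4 * (N * wp \<tau> z + B) * F1 B z + 2 * N * wp' z * F0 B z"
    using d1[OF z] d2[OF z] d3[OF z] by (simp_all add: numeral_2_eq_2 numeral_3_eq_3)
  show "deriv (lame_q n \<tau> B) z = N * wp' z"
    unfolding lame_q_def[abs_def] using DERIV_wp[OF assms]
    by (intro DERIV_imp_deriv) (auto intro!: derivative_eq_intros)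
qed

lemma F0_lame_ode:
  "z \<notin> \<Lambda> \<Longrightarrow> (deriv ^^ 3) (F0 B) z - 4 * lame_q n \<tau> B z * deriv (F0 B) z - 2 * deriv (lame_q n \<tau> B) z * F0 B z = 0"
  by (simp add: F_ode) (simp add: lame_q_def)

lemma F0_holomorphic: "F0 B holomorphic_on lreg"
  unfolding holomorphic_on_def field_differentiable_def
  using DERIV_F0 has_field_derivative_at_within lreg_iff by blast

lemma F0_meromorphic: "F0 B meromorphic_on UNIV"
  unfolding F0_eq[abs_def] lx_def poly_lame_xpoly by (intro meromorphic_intros wp_meromorphic)

lemma F_periodic:
  "l \<in> \<Lambda> \<Longrightarrow> z \<notin> \<Lambda> \<Longrightarrow> F0 B (z + l) = F0 B z" "l \<in> \<Lambda> \<Longrightarrow> z \<notin> \<Lambda> \<Longrightarrow> F1 B (z + l) = F1 B z"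
  by (simp_all add: F0_def F1_def LP_periodic)

lemma preg_ball: obtains r where "r > 0" "ball 0 r \<subseteq> preg" "ball 0 r - {0} \<subseteq> lreg"
proof -
  obtain r where "r > 0" "ball 0 r \<subseteq> preg" using open_preg zero_in_preg by (meson openE)
  then show ?thesis using that[of r] by (auto simp: preg_def lreg_def)
qed

text \<open>Subtracting the multiple of \<open>F0\<close> that cancels the term of order
  \<open>-2 n\<close> leaves a periodic function whose only possible singularities are lattice
  points and which tends to 0 there; it is constant, hence zero.\<close>

lemma F0_unique:
  assumes f: "f holomorphic_on lreg" "f meromorphic_on UNIV"
    and per: "\<And>z l. z \<in> lreg \<Longrightarrow> l \<in> \<Lambda> \<Longrightarrow> f (z + l) = f z"
    and ode: "\<And>z. z \<in> lreg \<Longrightarrow> (deriv ^^ 3) f z - 4 * lame_q n \<tau> B z * deriv f z - 2 * deriv (lame_q n \<tau> B) z * f z = 0"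
  shows "\<exists>c. \<forall>z\<in>lreg. f z = c * F0 B z"
proof -
  obtain r where r: "r > 0" "ball 0 r \<subseteq> preg" "ball 0 r - {0} \<subseteq> lreg" by (rule preg_ball)
  define v where "v z = N * (1 + z\<^sup>2 * wp_reg z) + B * z\<^sup>2" for z
  have v: "v holomorphic_on ball 0 r"
    unfolding v_def by (intro holomorphic_intros holomorphic_on_subset[OF wp_reg_holomorphic r(2)])
  have v0: "v 0 = N" by (simp add: v_def)
  have q: "lame_q n \<tau> B z = v z / z\<^sup>2" if "z \<in> ball 0 r - {0}" for z
    using that by (simp add: lame_q_def v_def wp_eq field_simps)
  have ode': "(deriv ^^ 3) f z - 4 * lame_q n \<tau> B z * deriv f z - 2 * deriv (lame_q n \<tau> B) z * f z = 0" if "z \<in> ball 0 r - {0}" for z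
    using ode r(3) that by blast
  obtain l where l: "((\<lambda>z. z ^ (2 * n) * f z) \<longlongrightarrow> l) (at 0)"
    using lame_pole_alternative[OF meromorphic_on_subset[OF f(2)] r(1) v v0 q ode'] by blast
  define c where "c = l / lead"
  define h where "h z = f z - c * F0 B z" for z
  have hm: "h meromorphic_on {0}"
    unfolding h_def by (intro meromorphic_intros meromorphic_on_subset[OF f(2)] meromorphic_on_subset[OF F0_meromorphic]) auto
  have hode: "(deriv ^^ 3) h z - 4 * lame_q n \<tau> B z * deriv h z - 2 * deriv (lame_q n \<tau> B) z * h z = 0" if z: "z \<in> lreg" for z
  proof -
    have cF: "(\<lambda>z. c * F0 B z) holomorphic_on lreg" by (intro holomorphic_intros F0_holomorphic)
    have d: "(deriv ^^ k) h z = (deriv ^^ k) f z - c * (deriv ^^ k) (F0 B) z" for k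
      unfolding h_def[abs_def] higher_deriv_diff[OF f(1) cF open_lreg z] higher_deriv_cmult[OF F0_holomorphic z open_lreg] ..
    have e1: "deriv h z = deriv f z - c * deriv (F0 B) z" using d[of 1] by simp
    have F: "(deriv ^^ 3) (F0 B) z = 4 * lame_q n \<tau> B z * deriv (F0 B) z + 2 * deriv (lame_q n \<tau> B) z * F0 B z"
      using F0_lame_ode[of z B] z by (simp add: lreg_iff algebra_simps)
    have G: "(deriv ^^ 3) f z = 4 * lame_q n \<tau> B z * deriv f z + 2 * deriv (lame_q n \<tau> B) z * f z"
      using ode[OF z] by (simp add: algebra_simps)
    show ?thesis unfolding d e1 F G h_def by (simp add: algebra_simps)
  qed
  have hode': "(deriv ^^ 3) h z - 4 * lame_q n \<tau> B z * deriv h z - 2 * deriv (lame_q n \<tau> B) z * h z = 0" if "z \<in> ball 0 r - {0}" for z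
    using hode r(3) that by blast
  obtain l' where l': "((\<lambda>z. z ^ (2 * n) * h z) \<longlongrightarrow> l') (at 0)" "l' = 0 \<Longrightarrow> (h \<longlongrightarrow> 0) (at 0)"
    using lame_pole_alternative[OF hm r(1) v v0 q hode'] by blast
  have "((\<lambda>z. z ^ (2 * n) * f z - c * (z ^ (2 * n) * F0 B z)) \<longlongrightarrow> l - c * lead) (at 0)"
    by (intro tendsto_intros l F0_tendsto)
  then have "((\<lambda>z. z ^ (2 * n) * h z) \<longlongrightarrow> 0) (at 0)"
    using lead_nonzero by (simp add: h_def c_def algebra_simps)
  then have "l' = 0" using tendsto_unique[OF trivial_limit_at l'(1)] by blast
  then have h0: "(h \<longlongrightarrow> 0) (at 0)" by (rule l'(2))
  have hh: "h holomorphic_on lreg" unfolding h_def by (intro holomorphic_intros f F0_holomorphic)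
  have "h z = 0" if z: "z \<notin> \<Lambda>" for z
  proof (rule lattice_regular_periodic_constant[OF _ _ h0 z])
    show "h field_differentiable at z" if "z \<notin> \<Lambda>" for z
      using hh open_lreg that by (auto intro: holomorphic_on_imp_differentiable_at simp: lreg_iff)
    show "h (z + l) = h z" if "l \<in> \<Lambda>" "z \<notin> \<Lambda>" for l z
      using that per by (simp add: h_def F_periodic lreg_iff)
  qed
  then show ?thesis by (intro exI[of _ c]) (auto simp: h_def lreg_iff)
qed

lemma eventually_F0_nonzero_0: "eventually (\<lambda>z. F0 B z \<noteq> 0) (at 0)"
proof -
  have "eventually (\<lambda>z. z ^ (2 * n) * F0 B z \<noteq> 0) (at 0)"
    by (rule tendsto_imp_eventually_ne[OF F0_tendsto lead_nonzero])
  then show ?thesis by (rule eventually_mono) auto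
qed

lemma F0_not_zero: "\<exists>z\<in>lreg. F0 B z \<noteq> 0"
proof -
  have "eventually (\<lambda>z. F0 B z \<noteq> 0 \<and> z \<notin> \<Lambda>) (at 0)"
    using eventually_F0_nonzero_0 eventually_notin_lattice by (rule eventually_conj)
  from eventually_happens'[OF at_neq_bot this] show ?thesis by (auto simp: lreg_iff)
qed

lemma lame_Phi_eq: "z \<notin> \<Lambda> \<Longrightarrow> lame_Phi n \<tau> z = LP0 z"
proof -
  obtain \<Phi> where \<Phi>: "monic_elliptic_solution \<tau> lreg (lame_q n \<tau>) n \<Phi>" "\<And>z. z \<in> lreg \<Longrightarrow> \<Phi> z = LP0 z"
  proof (rule monic_solution_regularize[OF periodic_domain_lreg, of LP0 n "lame_q n \<tau>"])
    show "(deriv ^^ 3) (\<lambda>w. poly (LP0 w) T) z - 4 * lame_q n \<tau> T z * deriv (\<lambda>w. poly (LP0 w) T) z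
       - 2 * deriv (lame_q n \<tau> T) z * poly (LP0 z) T = 0" if "z \<in> lreg" for z T
      using F0_lame_ode[of z T] that by (simp add: F0_def[abs_def] lreg_iff)
    show "degree (LP0 z) = n \<and> lead_coeff (LP0 z) = 1" for z using LP0_monic by blast
  qed (simp_all add: LP_coeff_meromorphic LP_coeff_holomorphic LP_periodic lreg_iff)
  have "Phi_fun \<tau> lreg (lame_q n \<tau>) n = \<Phi>"
  proof (rule Phi_fun_eqI[OF periodic_domain_lreg \<Phi>(1)])
    show "\<exists>z\<in>lreg. poly (\<Phi> z) T \<noteq> 0" for T using F0_not_zero[of T] \<Phi>(2) by (auto simp: F0_def)
    show "\<exists>c. \<forall>z\<in>lreg. f z = c * poly (\<Phi> z) T"
      if "f holomorphic_on lreg" "f meromorphic_on UNIV" "\<And>z l. z \<in> lreg \<Longrightarrow> l \<in> \<Lambda> \<Longrightarrow> f (z + l) = f z"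
        "\<And>z. z \<in> lreg \<Longrightarrow> (deriv ^^ 3) f z - 4 * lame_q n \<tau> T z * deriv f z - 2 * deriv (lame_q n \<tau> T) z * f z = 0" for f T
      using F0_unique[OF that] \<Phi>(2) by (auto simp: F0_def)
  qed
  then show "z \<notin> \<Lambda> \<Longrightarrow> lame_Phi n \<tau> z = LP0 z"
    using \<Phi>(2)[of z] by (simp add: lame_Phi_def lreg_def)
qed

lemma spectral_constant:
  fixes B z w :: complex
  assumes "z \<notin> \<Lambda>" "w \<notin> \<Lambda>"
  defines "E \<equiv> \<lambda>z. (N * wp \<tau> z + B) * (F0 B z)\<^sup>2 - 1 / 2 * F0 B z * F2 B z + 1 / 4 * (F1 B z)\<^sup>2"
  shows "E z = E w"
proof -
  have "(E has_field_derivative 0) (at z)" if "z \<in> lreg" for z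
  proof -
    have z: "z \<notin> \<Lambda>" using that by (simp add: lreg_iff)
    have "(E has_field_derivative N * wp' z * (F0 B z)\<^sup>2 + (N * wp \<tau> z + B) * (2 * F0 B z * F1 B z)
      - (1 / 2 * F1 B z * F2 B z + 1 / 2 * F0 B z * (4 * (N * wp \<tau> z + B) * F1 B z + 2 * N * wp' z * F0 B z))
      + 1 / 4 * (2 * F1 B z * F2 B z)) (at z)"
      unfolding E_def
      by (rule derivative_eq_intros DERIV_wp[OF z] DERIV_F0[OF z] DERIV_F1[OF z] DERIV_F2[OF z] refl | simp add: algebra_simps)+
    then show ?thesis by (simp add: algebra_simps power2_eq_square)
  qed
  then have "E constant_on lreg"
    by (rule has_field_derivative_0_imp_constant_on[OF _ connected_lreg open_lreg])
  then show ?thesis using assms by (auto simp: constant_on_def lreg_iff)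
qed

lemma poly_lame_Q:
  assumes "z \<notin> \<Lambda>"
  shows "poly (lame_Q n \<tau>) B = (N * wp \<tau> z + B) * (F0 B z)\<^sup>2 - 1 / 2 * F0 B z * F2 B z + 1 / 4 * (F1 B z)\<^sup>2"
proof -
  \<comment> \<open>The expression is independent of \<open>z\<close>; freezing it at
    \<open>z = 1/2\<close> exhibits it as a polynomial in the spectral parameter.\<close>
  define Q where "Q = [:N * wp \<tau> (1 / 2), 1:] * (LP0 (1 / 2))\<^sup>2 - smult (1 / 2) (LP0 (1 / 2) * LP2 (1 / 2)) + smult (1 / 4) ((LP1 (1 / 2))\<^sup>2)"
  have Q: "poly Q B = (N * wp \<tau> z + B) * (F0 B z)\<^sup>2 - 1 / 2 * F0 B z * F2 B z + 1 / 4 * (F1 B z)\<^sup>2" if "z \<notin> \<Lambda>" for z B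
    using spectral_constant[OF that half_notin_lattice(1), of B]
    by (simp add: Q_def F0_def F1_def F2_def algebra_simps power2_eq_square)
  have ex: "lame_q n \<tau> T z * (poly (lame_Phi n \<tau> z) T)\<^sup>2 - 1 / 2 * poly (lame_Phi n \<tau> z) T * (deriv ^^ 2) (\<lambda>w. poly (lame_Phi n \<tau> w) T) z
     + 1 / 4 * (deriv (\<lambda>w. poly (lame_Phi n \<tau> w) T) z)\<^sup>2 = poly Q T" if z: "z \<in> - \<Lambda>" for z T
  proof -
    have ev: "eventually (\<lambda>w. poly (lame_Phi n \<tau> w) T = F0 T w) (nhds z)"
      using eventually_nhds_in_open[OF open_lreg, of z] z
      by (auto elim!: eventually_mono simp: lreg_iff lame_Phi_eq F0_def)
    have zL: "z \<notin> \<Lambda>" using z by simp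
    show ?thesis
      unfolding higher_deriv_cong_ev[OF ev refl] deriv_cong_ev[OF ev refl] F_ode[OF zL] lame_Phi_eq[OF zL] F0_def[symmetric] Q[OF zL] lame_q_def ..
  qed
  have "lame_Q n \<tau> = Q"
    unfolding lame_Q_def spectral_poly_def
  proof (rule the_equality)
    show "\<forall>T. \<forall>z\<in>- \<Lambda>. poly Q T = lame_q n \<tau> T z * (poly (lame_Phi n \<tau> z) T)\<^sup>2
       - 1 / 2 * poly (lame_Phi n \<tau> z) T * (deriv ^^ 2) (\<lambda>w. poly (lame_Phi n \<tau> w) T) z + 1 / 4 * (deriv (\<lambda>w. poly (lame_Phi n \<tau> w) T) z)\<^sup>2"
      using ex by simp
    fix R assume R: "\<forall>T. \<forall>z\<in>- \<Lambda>. poly R T = lame_q n \<tau> T z * (poly (lame_Phi n \<tau> z) T)\<^sup>2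
       - 1 / 2 * poly (lame_Phi n \<tau> z) T * (deriv ^^ 2) (\<lambda>w. poly (lame_Phi n \<tau> w) T) z + 1 / 4 * (deriv (\<lambda>w. poly (lame_Phi n \<tau> w) T) z)\<^sup>2"
    have "poly R T = poly Q T" for T
      using R ex[of "1 / 2" T] half_notin_lattice(1) by simp
    then show "R = Q" by (simp add: poly_eq_poly_eq_iff[symmetric] fun_eq_iff)
  qed
  then show ?thesis using Q[OF assms] by simp
qed

end

section \<open>Baker--Akhiezer functions of the Lame equation\<close>

text \<open>Lets functions be compared through their logarithmic derivatives without choosing
  branches of logarithms.\<close>

lemma same_log_derivative:
  fixes f g L :: "complex \<Rightarrow> complex"
  assumes "open U" "connected U"
    and "\<And>z. z \<in> U \<Longrightarrow> (f has_field_derivative L z * f z) (at z)"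
    and "\<And>z. z \<in> U \<Longrightarrow> (g has_field_derivative L z * g z) (at z)"
    and "\<And>z. z \<in> U \<Longrightarrow> g z \<noteq> 0"
  obtains K where "\<And>z. z \<in> U \<Longrightarrow> f z = K * g z"
proof -
  have "((\<lambda>z. f z / g z) has_field_derivative 0) (at z)" if "z \<in> U" for z
    by (rule DERIV_cong[OF DERIV_divide[OF assms(3,4,5)]]) (use that in auto)
  then have "(\<lambda>z. f z / g z) constant_on U"
    by (rule has_field_derivative_0_imp_constant_on[OF _ assms(2,1)])
  then obtain K where "\<And>z. z \<in> U \<Longrightarrow> f z / g z = K" by (auto simp: constant_on_def)
  then show ?thesis using assms(5) by (intro that[of K]) (auto simp: field_simps)
qed

lemma sparse_in_UNIV_I:
  assumes "\<And>b. eventually (\<lambda>z. z \<notin> X) (at b)" shows "X sparse_in UNIV"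
  using assms by (simp add: sparse_in_open islimpt_iff_eventually)

lemma holomorphic_extension_by_limits:
  fixes E :: "complex \<Rightarrow> complex"
  assumes X: "X sparse_in UNIV" and d: "\<And>z. z \<notin> X \<Longrightarrow> E field_differentiable (at z)"
    and lim: "\<And>x. x \<in> X \<Longrightarrow> \<exists>L. (E \<longlongrightarrow> L) (at x)"
  obtains H where "H holomorphic_on UNIV" "\<And>z. z \<notin> X \<Longrightarrow> H z = E z" "\<And>x L. (E \<longlongrightarrow> L) (at x) \<Longrightarrow> H x = L"
proof -
  define H where "H z = (if z \<in> X then Lim (at z) E else E z)" for z
  have ev: "eventually (\<lambda>w. E w = H w) (at z)" for z
  proof -
    obtain B where B: "open B" "z \<in> B" "\<And>y. y \<in> B \<Longrightarrow> y \<noteq> z \<Longrightarrow> y \<notin> X"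
      by (rule sparse_in_not_in[OF X UNIV_I, of z]) auto
    show ?thesis
      using eventually_at_in_open[OF B(1,2)] by (rule eventually_mono) (use B in \<open>auto simp: H_def\<close>)
  qed
  have HL: "H x = L" if "(E \<longlongrightarrow> L) (at x)" for x L
  proof (cases "x \<in> X")
    case True
    then show ?thesis using that by (simp add: H_def tendsto_Lim)
  next
    case False
    then have "isCont E x" using d field_differentiable_imp_continuous_at by blast
    then show ?thesis using that False tendsto_unique[OF trivial_limit_at] by (auto simp: H_def isCont_def)
  qed
  have "H holomorphic_on UNIV"
  proof (rule holomorphic_on_UNIV_extend[OF X])
    fix z assume z: "z \<notin> X"
    obtain D where "(E has_field_derivative D) (at z)" using d[OF z] by (auto simp: field_differentiable_def)
    then have "(H has_field_derivative D) (at z)"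
      by (rule has_field_derivative_transform_within_open[where S = "- X"])
         (use z sparse_in_UNIV_imp_closed[OF X] in \<open>auto simp: H_def\<close>)
    then show "H field_differentiable at z" by (auto simp: field_differentiable_def)
  next
    fix x assume "x \<in> X"
    then obtain L where L: "(E \<longlongrightarrow> L) (at x)" using lim by blast
    have "(H \<longlongrightarrow> L) (at x)" using Lim_transform_eventually[OF L ev] .
    then show "(H \<longlongrightarrow> H x) (at x)" using HL[OF L] by simp
  qed
  then show ?thesis using that HL by (auto simp: H_def)
qed

context upper_half begin

lemma DERIV_sigma_prod:
  assumes "finite I" "\<And>i. i \<in> I \<Longrightarrow> z - a i \<notin> \<Lambda>"
  shows "((\<lambda>z. exp (c * z) * (\<Prod>i\<in>I. wsigma \<tau> (z - a i))) has_field_derivative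
     (c + (\<Sum>i\<in>I. wzeta \<tau> (z - a i))) * (exp (c * z) * (\<Prod>i\<in>I. wsigma \<tau> (z - a i)))) (at z)"
proof -
  have "((\<lambda>z. \<Prod>i\<in>I. wsigma \<tau> (z - a i)) has_field_derivative (\<Sum>i\<in>I. wzeta \<tau> (z - a i)) * (\<Prod>i\<in>I. wsigma \<tau> (z - a i))) (at z)"
  proof (rule has_field_derivative_prod_log[OF assms(1), where L = "\<lambda>i z. wzeta \<tau> (z - a i)"])
    fix i assume i: "i \<in> I"
    show "((\<lambda>z. wsigma \<tau> (z - a i)) has_field_derivative wzeta \<tau> (z - a i) * wsigma \<tau> (z - a i)) (at z)"
      using DERIV_wsigma[OF assms(2)[OF i]]
        DERIV_shift[of "wsigma \<tau>" "wzeta \<tau> (z - a i) * wsigma \<tau> (z - a i)" z "- a i"] by simp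
  qed
  moreover have "((\<lambda>z. exp (c * z)) has_field_derivative c * exp (c * z)) (at z)"
    by (auto intro!: derivative_eq_intros)
  ultimately have "((\<lambda>z. exp (c * z) * (\<Prod>i\<in>I. wsigma \<tau> (z - a i))) has_field_derivative
     c * exp (c * z) * (\<Prod>i\<in>I. wsigma \<tau> (z - a i)) + (\<Sum>i\<in>I. wzeta \<tau> (z - a i)) * (\<Prod>i\<in>I. wsigma \<tau> (z - a i)) * exp (c * z)) (at z)"
    by (intro DERIV_mult)
  then show ?thesis by (simp add: algebra_simps)
qed

lemma DERIV_wsigma_power:
  assumes "z \<notin> \<Lambda>"
  shows "((\<lambda>z. wsigma \<tau> z ^ k) has_field_derivative of_nat k * wzeta \<tau> z * wsigma \<tau> z ^ k) (at z)"
proof (cases k)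
  case (Suc m)
  show ?thesis
    by (rule DERIV_cong[OF DERIV_power[OF DERIV_wsigma[OF assms]]]) (simp add: Suc mult_ac)
qed simp

lemma isCont_wzeta_shift: "x - r \<notin> \<Lambda> \<Longrightarrow> isCont (\<lambda>z. wzeta \<tau> (z - r)) x"
  using DERIV_wzeta_shift[of x "- r"] DERIV_isCont by fastforce

end

section \<open>Zeros of the Lame Baker-Akhiezer function\<close>

context lame_setting begin

text \<open>The logarithmic derivative \<open>w' / w\<close> of the Baker-Akhiezer function
  \<open>w\<close> at \<open>(B, C)\<close>.\<close>

definition FF :: "complex \<Rightarrow> complex \<Rightarrow> complex \<Rightarrow> complex" where
  "FF B C z = (C + F1 B z / 2) / F0 B z"

definition badset :: "complex \<Rightarrow> complex set" where
  "badset B = {z. z \<in> \<Lambda> \<or> F0 B z = 0}"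

lemma FF_meromorphic: "FF B C meromorphic_on UNIV"
proof -
  have "F1 B meromorphic_on UNIV"
    unfolding F1_def[abs_def] LP1_def poly_sum poly_smult
    by (intro meromorphic_intros wp_meromorphic wp'_meromorphic)
  then show ?thesis unfolding FF_def[abs_def] by (intro meromorphic_intros F0_meromorphic)
qed

lemma FF_periodic: "l \<in> \<Lambda> \<Longrightarrow> z \<notin> \<Lambda> \<Longrightarrow> FF B C (z + l) = FF B C z"
  by (simp add: FF_def F_periodic)

lemma eventually_not_bad: "eventually (\<lambda>z. z \<notin> badset B) (at b)"
proof -
  have "eventually (\<lambda>z. F0 B z \<noteq> 0) (at b)"
  proof (cases "b \<in> \<Lambda>")
    case False
    obtain \<beta> where "\<beta> \<in> lreg" "F0 B \<beta> \<noteq> 0" using F0_not_zero by blast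
    then have "eventually (\<lambda>z. F0 B z \<noteq> 0 \<and> z \<in> lreg) (at b)"
      using non_zero_neighbour_alt[OF F0_holomorphic open_lreg connected_lreg] False by (simp add: lreg_iff)
    then show ?thesis by (rule eventually_mono) simp
  next
    case True
    have "eventually (\<lambda>z. F0 B z \<noteq> 0 \<and> z \<notin> \<Lambda>) (at 0)"
      using eventually_F0_nonzero_0 eventually_notin_lattice by (rule eventually_conj)
    then have "eventually (\<lambda>z. F0 B (z + b) \<noteq> 0) (at 0)"
      by (rule eventually_mono) (use True F_periodic(1) in auto)
    then show ?thesis by (subst eventually_at_to_0)
  qed
  then have "eventually (\<lambda>z. F0 B z \<noteq> 0 \<and> z \<notin> \<Lambda>) (at b)"
    using eventually_notin_lattice by (rule eventually_conj)
  then show ?thesis by (rule eventually_mono) (simp add: badset_def)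
qed

lemma sparse_badset: "badset B sparse_in UNIV"
  by (rule sparse_in_UNIV_I) (rule eventually_not_bad)

lemma open_not_bad: "open (- badset B)"
  using sparse_in_UNIV_imp_closed[OF sparse_badset] by (rule open_Compl)

lemma bad_periodic: "l \<in> \<Lambda> \<Longrightarrow> z + l \<in> badset B \<longleftrightarrow> z \<in> badset B"
  by (cases "z \<in> \<Lambda>") (simp_all add: badset_def F_periodic(1))

text \<open>Substituting the spectral expression for \<open>C^2\<close> turns the quotient rule into
  the Riccati equation; the curve equation is precisely the condition for the exponential of a
  primitive to solve the Lame equation.\<close>

lemma DERIV_FF:
  assumes curve: "C\<^sup>2 = poly (lame_Q n \<tau>) B" and z: "z \<notin> badset B"
  shows "(FF B C has_field_derivative lame_q n \<tau> B z - (FF B C z)\<^sup>2) (at z)"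
proof -
  have zL: "z \<notin> \<Lambda>" and nz: "F0 B z \<noteq> 0" using z by (auto simp: badset_def)
  have "((\<lambda>z. C + F1 B z / 2) has_field_derivative F2 B z / 2) (at z)"
    using DERIV_F1[OF zL, of B] by (auto intro!: derivative_eq_intros)
  from DERIV_divide[OF this DERIV_F0[OF zL] nz]
  have "(FF B C has_field_derivative (F2 B z / 2 * F0 B z - (C + F1 B z / 2) * F1 B z) / (F0 B z * F0 B z)) (at z)"
    by (simp add: FF_def[abs_def])
  moreover have "(F2 B z / 2 * F0 B z - (C + F1 B z / 2) * F1 B z) / (F0 B z * F0 B z) = lame_q n \<tau> B z - (FF B C z)\<^sup>2"
  proof -
    define q where "q = lame_q n \<tau> B z"
    have c: "C\<^sup>2 = q * (F0 B z)\<^sup>2 - 1 / 2 * F0 B z * F2 B z + 1 / 4 * (F1 B z)\<^sup>2"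
      unfolding curve poly_lame_Q[OF zL] q_def lame_q_def ..
    have "F2 B z / 2 * F0 B z - (C + F1 B z / 2) * F1 B z = q * (F0 B z)\<^sup>2 - (C + F1 B z / 2)\<^sup>2"
      using c by (simp add: power2_eq_square algebra_simps)
    then show ?thesis
      using nz by (simp add: FF_def q_def power_divide diff_divide_distrib power2_eq_square)
  qed
  ultimately show ?thesis by simp
qed

lemma F0_num_even: "F0_num B (- z) = F0_num B z"
  by (simp add: F0_num_def wp_reg_even)

text \<open>\<open>z^(2 n) * F0\<close> is even with nonzero value at 0, so its logarithmic
  derivative vanishes there, and \<open>C / F0\<close> vanishes to order at least
  \<open>2 n\<close>. The absence of a constant term is the source of the normalisation of
  \<open>c\<close> as the sum of the \<open>zeta(a_j)\<close>.\<close>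

lemma FF_at_0: "((\<lambda>z. FF B C z + of_nat n * wzeta \<tau> z) \<longlongrightarrow> 0) (at 0)"
proof -
  obtain r where r: "r > 0" "ball 0 r \<subseteq> preg" "ball 0 r - {0} \<subseteq> lreg" by (rule preg_ball)
  let ?u = "F0_num B"
  have uh: "?u holomorphic_on ball 0 r" by (rule holomorphic_on_subset[OF F0_num_holomorphic r(2)])
  have du: "(?u has_field_derivative deriv ?u z) (at z)" if "z \<in> ball 0 r" for z
    using holomorphic_derivI[OF uh _ that] by simp
  have du0: "deriv ?u 0 = 0" by (rule even_deriv_0[OF du F0_num_even]) (use r in auto)
  have c1: "(?u \<longlongrightarrow> lead) (at 0)"
    using holomorphic_isCont[OF uh open_ball, of 0] r by (simp add: isCont_def F0_num_0)
  have c2: "(deriv ?u \<longlongrightarrow> 0) (at 0)"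
    using holomorphic_isCont[OF holomorphic_deriv[OF uh open_ball] open_ball, of 0] r by (simp add: isCont_def du0)
  have c3: "(zeta_reg \<longlongrightarrow> 0) (at 0)"
    using DERIV_isCont[OF DERIV_zeta_reg, of 0] by (simp add: isCont_def)
  have "((\<lambda>z. C * z ^ (2 * n) / ?u z + deriv ?u z / (2 * ?u z) + of_nat n * zeta_reg z) \<longlongrightarrow>
      C * 0 ^ (2 * n) / lead + 0 / (2 * lead) + of_nat n * 0) (at 0)"
    by (intro tendsto_intros c1 c2 c3) (use lead_nonzero in auto)
  then have l: "((\<lambda>z. C * z ^ (2 * n) / ?u z + deriv ?u z / (2 * ?u z) + of_nat n * zeta_reg z) \<longlongrightarrow> 0) (at 0)"
    using n_pos by (simp add: power_0_left)
  have evb: "eventually (\<lambda>z. z \<in> ball 0 r - {0}) (at (0::complex))"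
    by (rule eventually_at_in_open) (use r in auto)
  have "eventually (\<lambda>z. C * z ^ (2 * n) / ?u z + deriv ?u z / (2 * ?u z) + of_nat n * zeta_reg z = FF B C z + of_nat n * wzeta \<tau> z) (at 0)"
    using evb eventually_not_bad[of B 0]
  proof eventually_elim
    case (elim z)
    then have z: "z \<in> ball 0 r" "z \<noteq> 0" "z \<notin> \<Lambda>" "F0 B z \<noteq> 0" by (auto simp: badset_def)
    then have u: "?u z \<noteq> 0" using F0_num_eq[of z B] by auto
    have zp: "((\<lambda>z. z ^ (2 * n)) has_field_derivative of_nat (2 * n) * z ^ (2 * n) / z) (at z)"
    proof -
      have "((\<lambda>z. z ^ (2 * n)) has_field_derivative of_nat (2 * n) * z ^ (2 * n - 1)) (at z)"
        by (auto intro!: derivative_eq_intros)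
      moreover have "z ^ (2 * n - 1) = z ^ (2 * n) / z" using z(2) n_pos by (simp add: power_diff)
      ultimately show ?thesis by simp
    qed
    have "((\<lambda>z. ?u z / z ^ (2 * n)) has_field_derivative
       (deriv ?u z * z ^ (2 * n) - ?u z * (of_nat (2 * n) * z ^ (2 * n) / z)) / (z ^ (2 * n) * z ^ (2 * n))) (at z)"
      by (rule DERIV_divide[OF du[OF z(1)] zp]) (use z(2) in simp)
    then have "(F0 B has_field_derivative
       (deriv ?u z * z ^ (2 * n) - ?u z * (of_nat (2 * n) * z ^ (2 * n) / z)) / (z ^ (2 * n) * z ^ (2 * n))) (at z)"
      by (rule has_field_derivative_transform_within_open[where S = "- {0}"]) (use z(2) F0_num_eq in auto)
    then have F1: "F1 B z = (deriv ?u z * z ^ (2 * n) - ?u z * (of_nat (2 * n) * z ^ (2 * n) / z)) / (z ^ (2 * n) * z ^ (2 * n))"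
      using DERIV_F0[OF z(3)] DERIV_unique by blast
    define w where "w = z ^ (2 * n)"
    have w: "w \<noteq> 0" using z(2) by (simp add: w_def)
    have "FF B C z = (C + (deriv ?u z * w - ?u z * (2 * of_nat n * w / z)) / (w * w) / 2) / (?u z / w)"
      by (simp add: FF_def F1 F0_num_eq[OF z(2)] w_def)
    also have "\<dots> = C * w / ?u z + deriv ?u z / (2 * ?u z) - of_nat n / z"
      using w u z(2) by (simp add: field_simps)
    finally show ?case by (simp add: w_def wzeta_eq algebra_simps)
  qed
  from Lim_transform_eventually[OF l this] show ?thesis .
qed

text \<open>By the Riccati equation \<open>F\<close> has residue 1 at each pole off the lattice, and
  it has residue \<open>-n\<close> at lattice points. Subtracting the matching zeta functions leaves
  an entire function with quasi-periods \<open>M eta l\<close>, where \<open>M = n - card R\<close>,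
  so \<open>entire_additive_constant\<close> delivers at once the number of zeros and the constancy
  of the remainder.\<close>

lemma lame_representation:
  assumes curve: "C\<^sup>2 = poly (lame_Q n \<tau>) B"
  obtains a c where "\<And>j. j \<in> {1..n} \<Longrightarrow> a j \<notin> \<Lambda> \<and> F0 B (a j) = 0"
    "\<And>z. z \<notin> badset B \<Longrightarrow> FF B C z = c + (\<Sum>j=1..n. wzeta \<tau> (z - a j)) - of_nat n * wzeta \<tau> z"
    "c = (\<Sum>j=1..n. wzeta \<tau> (a j))"
proof -
  define F where "F = FF B C"
  have dF: "(F has_field_derivative lame_q n \<tau> B z - (F z)\<^sup>2) (at z)" if "z \<notin> badset B" for z
    unfolding F_def by (rule DERIV_FF[OF curve that])
  define P where "P = {b. b \<notin> \<Lambda> \<and> \<not> (\<exists>L. (F \<longlongrightarrow> L) (at b))}"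
  have shift: "(F \<longlongrightarrow> L) (at (z + l)) \<longleftrightarrow> (F \<longlongrightarrow> L) (at z)" if l: "l \<in> \<Lambda>" for z l L
  proof -
    have "(F \<longlongrightarrow> L) (at (z + l)) \<longleftrightarrow> ((\<lambda>w. F (w + l)) \<longlongrightarrow> L) (at z)"
      using filterlim_shift_iff[where f = F and d = l and F = "nhds L" and a = "z + l"] by (simp add: o_def add.commute)
    also have "\<dots> \<longleftrightarrow> (F \<longlongrightarrow> L) (at z)"
      by (rule tendsto_cong) (rule eventually_mono[OF eventually_notin_lattice], use l FF_periodic in \<open>auto simp: F_def\<close>)
    finally show ?thesis .
  qed
  have Pper: "b + l \<in> P \<longleftrightarrow> b \<in> P" if "l \<in> \<Lambda>" for b l
    using shift[OF that] that by (simp add: P_def)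
  have Pbad: "b \<in> badset B" if "b \<in> P" for b
  proof (rule ccontr)
    assume "b \<notin> badset B"
    then have "isCont F b" using dF DERIV_isCont by blast
    then show False using that by (auto simp: P_def isCont_def)
  qed
  have Ppole: "\<exists>L. ((\<lambda>z. F z - 1 / (z - b)) \<longlongrightarrow> L) (at b)" if b: "b \<in> P" for b
  proof -
    have bL: "b \<in> lreg" using b by (simp add: P_def lreg_iff)
    then obtain r where r: "r > 0" "ball b r \<subseteq> lreg" using open_lreg by (meson openE)
    have q: "lame_q n \<tau> B holomorphic_on ball b r"
      unfolding lame_q_def[abs_def]
      by (intro holomorphic_intros holomorphic_on_subset[OF wp_holomorphic r(2)])
    have ev: "eventually (\<lambda>z. (F has_field_derivative lame_q n \<tau> B z - (F z)\<^sup>2) (at z)) (at b)"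
      using eventually_not_bad by (rule eventually_mono) (rule dF)
    have mF: "F meromorphic_on {b}" unfolding F_def by (rule meromorphic_on_subset[OF FF_meromorphic]) simp
    show ?thesis
      by (rule riccati_local[OF mF r(1) q ev]) (use b in \<open>auto simp: P_def\<close>)
  qed
  \<comment> \<open>The choice depends only on the class of \<open>b\<close>, so \<open>rep\<close>
    selects one representative per coset inside a fixed disc; this makes \<open>R\<close>
    finite.\<close>
  define rep where "rep b = (SOME w. w - b \<in> \<Lambda> \<and> norm w \<le> 1 + norm \<tau>)" for b
  have rep: "rep b - b \<in> \<Lambda>" "norm (rep b) \<le> 1 + norm \<tau>" for b
  proof -
    obtain l where "l \<in> \<Lambda>" "norm (b - l) \<le> 1 + norm \<tau>" by (rule lattice_reduce)
    then have "\<exists>w. w - b \<in> \<Lambda> \<and> norm w \<le> 1 + norm \<tau>" by (intro exI[of _ "b - l"]) simp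
    from someI_ex[OF this] show "rep b - b \<in> \<Lambda>" "norm (rep b) \<le> 1 + norm \<tau>" by (auto simp: rep_def)
  qed
  have rep_eq: "rep b = rep b'" if "b - b' \<in> \<Lambda>" for b b'
  proof -
    have "w - b \<in> \<Lambda> \<longleftrightarrow> w - b' \<in> \<Lambda>" for w
      using lattice_add_iff[OF that, of "w - b"] by simp
    then show ?thesis by (simp add: rep_def)
  qed
  define R where "R = rep ` P"
  have RP: "r \<in> P" if rR: "r \<in> R" for r
  proof -
    obtain b where b: "b \<in> P" "r = rep b" using rR by (auto simp: R_def)
    show ?thesis using Pper[OF rep(1)[of b], of b] b by simp
  qed
  have Runiq: "r = r'" if rr: "r \<in> R" "r' \<in> R" "r - r' \<in> \<Lambda>" for r r'
  proof -
    obtain b b' where b: "r = rep b" "r' = rep b'" using rr by (auto simp: R_def)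
    have "b - b' = (r - r') - (rep b - b) + (rep b' - b')" using b by simp
    then have "b - b' \<in> \<Lambda>"
      using lattice_add[OF lattice_diff[OF rr(3) rep(1)[of b]] rep(1)[of b']] by (simp only:)
    then show ?thesis using rep_eq b by simp
  qed
  have finR: "finite R"
  proof (rule finite_subset)
    show "R \<subseteq> cball 0 (1 + norm \<tau>) \<inter> badset B" using RP Pbad rep(2) by (auto simp: R_def)
    show "finite (cball 0 (1 + norm \<tau>) \<inter> badset B)"
      by (rule sparse_in_compact_finite[OF sparse_in_subset[OF sparse_badset]]) auto
  qed
  have notP: "x - r \<notin> \<Lambda>" if "r \<in> R" "x \<notin> P" for x r
  proof
    assume "x - r \<in> \<Lambda>"
    from Pper[OF this, of r] RP[OF that(1)] that(2) show False by simp
  qed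
  define E where "E z = F z - (\<Sum>r\<in>R. wzeta \<tau> (z - r)) + of_nat n * wzeta \<tau> z" for z
  have lim_l: "(E \<longlongrightarrow> of_nat n * eta l - (\<Sum>r\<in>R. wzeta \<tau> (l - r))) (at l)" if l: "l \<in> \<Lambda>" for l
  proof -
    have "((\<lambda>h. (FF B C h + of_nat n * wzeta \<tau> h) + of_nat n * eta l - (\<Sum>r\<in>R. wzeta \<tau> (l + h - r))) \<longlongrightarrow>
       0 + of_nat n * eta l - (\<Sum>r\<in>R. wzeta \<tau> (l - r))) (at 0)"
    proof (intro tendsto_intros FF_at_0)
      fix r assume "r \<in> R"
      then have "l - r \<notin> \<Lambda>" using notP[of r l] l by (auto simp: P_def)
      then have "((\<lambda>z. wzeta \<tau> (z - r)) \<longlongrightarrow> wzeta \<tau> (l - r)) (at l)"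
        using isCont_wzeta_shift by (simp add: isCont_def)
      then show "((\<lambda>h. wzeta \<tau> (l + h - r)) \<longlongrightarrow> wzeta \<tau> (l - r)) (at 0)" by (rule LIM_offset_zero)
    qed
    moreover have "eventually (\<lambda>h. (FF B C h + of_nat n * wzeta \<tau> h) + of_nat n * eta l - (\<Sum>r\<in>R. wzeta \<tau> (l + h - r)) = E (l + h)) (at 0)"
      using eventually_notin_lattice
    proof (rule eventually_mono)
      fix h assume h: "h \<notin> \<Lambda>"
      have "F (l + h) = FF B C h" "wzeta \<tau> (l + h) = wzeta \<tau> h + eta l"
        using FF_periodic[OF l h] wzeta_quasi[OF l h] by (simp_all add: F_def add.commute)
      then show "(FF B C h + of_nat n * wzeta \<tau> h) + of_nat n * eta l - (\<Sum>r\<in>R. wzeta \<tau> (l + h - r)) = E (l + h)"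
        by (simp add: E_def algebra_simps)
    qed
    ultimately have "((\<lambda>h. E (l + h)) \<longlongrightarrow> 0 + of_nat n * eta l - (\<Sum>r\<in>R. wzeta \<tau> (l - r))) (at 0)"
      by (rule Lim_transform_eventually)
    then show ?thesis using LIM_offset_zero_cancel by fastforce
  qed
  have isc: "((\<lambda>z. wzeta \<tau> (z - r)) \<longlongrightarrow> wzeta \<tau> (x - r)) (at x)" if "x - r \<notin> \<Lambda>" for x r
    using isCont_wzeta_shift[OF that] by (simp add: isCont_def)
  have limE: "\<exists>L. (E \<longlongrightarrow> L) (at x)" for x
  proof (cases "x \<in> \<Lambda>")
    case True then show ?thesis using lim_l by blast
  next
    case xL: False
    have z0: "(wzeta \<tau> \<longlongrightarrow> wzeta \<tau> x) (at x)" using isc[of x 0] xL by simp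
    show ?thesis
    proof (cases "x \<in> P")
      case False
      then obtain L where L: "(F \<longlongrightarrow> L) (at x)" using xL by (auto simp: P_def)
      have "(E \<longlongrightarrow> L - (\<Sum>r\<in>R. wzeta \<tau> (x - r)) + of_nat n * wzeta \<tau> x) (at x)"
        unfolding E_def by (intro tendsto_intros L isc z0 notP False)
      then show ?thesis by blast
    next
      case True
      obtain L where L: "((\<lambda>z. F z - 1 / (z - x)) \<longlongrightarrow> L) (at x)" using Ppole[OF True] by blast
      \<comment> \<open>Of the subtracted zeta functions only the one at the representative
        \<open>r0\<close> of the class of \<open>x\<close> is singular at \<open>x\<close>; it is
        expanded there with the help of \<open>eta (x - r0)\<close>.\<close>
      define r0 where "r0 = rep x"
      have r0: "r0 \<in> R" "x - r0 \<in> \<Lambda>"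
        using True rep(1)[of x] lattice_uminus[OF rep(1)[of x]] by (auto simp: R_def r0_def)
      have oth: "x - r \<notin> \<Lambda>" if "r \<in> R - {r0}" for r
      proof
        assume "x - r \<in> \<Lambda>"
        then have "r - r0 \<in> \<Lambda>" using lattice_diff[OF r0(2) \<open>x - r \<in> \<Lambda>\<close>] by simp
        then show False using Runiq[of r r0] that r0(1) by auto
      qed
      have zr: "((\<lambda>z. zeta_reg (z - x)) \<longlongrightarrow> 0) (at x)"
      proof -
        have "(zeta_reg \<longlongrightarrow> 0) (at 0)" using DERIV_isCont[OF DERIV_zeta_reg, of 0] by (simp add: isCont_def)
        then show ?thesis by (subst filterlim_at_to_0) simp
      qed
      have "((\<lambda>z. (F z - 1 / (z - x)) - zeta_reg (z - x) - eta (x - r0) - (\<Sum>r\<in>R - {r0}. wzeta \<tau> (z - r)) + of_nat n * wzeta \<tau> z) \<longlongrightarrow>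
         L - 0 - eta (x - r0) - (\<Sum>r\<in>R - {r0}. wzeta \<tau> (x - r)) + of_nat n * wzeta \<tau> x) (at x)"
        by (intro tendsto_intros L isc z0 zr oth)
      moreover have "eventually (\<lambda>z. (F z - 1 / (z - x)) - zeta_reg (z - x) - eta (x - r0) - (\<Sum>r\<in>R - {r0}. wzeta \<tau> (z - r)) + of_nat n * wzeta \<tau> z = E z) (at x)"
      proof -
        have "eventually (\<lambda>z. z - x \<notin> \<Lambda>) (at x)"
          by (subst eventually_at_to_0) (use eventually_notin_lattice[of 0] in simp)
        then show ?thesis
        proof (rule eventually_mono)
          fix z assume "z - x \<notin> \<Lambda>"
          then have "wzeta \<tau> (z - r0) = 1 / (z - x) + zeta_reg (z - x) + eta (x - r0)"
            using wzeta_quasi[OF r0(2), of "z - x"] by (simp add: wzeta_eq)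
          moreover have "(\<Sum>r\<in>R. wzeta \<tau> (z - r)) = wzeta \<tau> (z - r0) + (\<Sum>r\<in>R - {r0}. wzeta \<tau> (z - r))"
            by (rule sum.remove[OF finR r0(1)])
          ultimately show "(F z - 1 / (z - x)) - zeta_reg (z - x) - eta (x - r0) - (\<Sum>r\<in>R - {r0}. wzeta \<tau> (z - r)) + of_nat n * wzeta \<tau> z = E z"
            by (simp add: E_def algebra_simps)
        qed
      qed
      ultimately show ?thesis using Lim_transform_eventually by blast
    qed
  qed
  have notbadR: "z - r \<notin> \<Lambda>" if "z \<notin> badset B" "r \<in> R" for z r
    using notP[OF that(2), of z] Pbad that by blast
  have dE: "E field_differentiable at z" if z: "z \<notin> badset B" for z
  proof -
    have zL: "z \<notin> \<Lambda>" using z by (simp add: badset_def)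
    have "((\<lambda>z. wzeta \<tau> (z - r)) has_field_derivative - wp \<tau> (z - r)) (at z)" if "r \<in> R" for r
      using DERIV_wzeta_shift[of z "- r"] notbadR[OF z that] by simp
    then have "(E has_field_derivative (lame_q n \<tau> B z - (F z)\<^sup>2) - (\<Sum>r\<in>R. - wp \<tau> (z - r)) + of_nat n * - wp \<tau> z) (at z)"
      unfolding E_def by (intro DERIV_add DERIV_diff DERIV_cmult DERIV_sum dF z DERIV_wzeta zL)
    then show ?thesis by (auto simp: field_differentiable_def)
  qed
  obtain H where H: "H holomorphic_on UNIV" "\<And>z. z \<notin> badset B \<Longrightarrow> H z = E z" "\<And>x L. (E \<longlongrightarrow> L) (at x) \<Longrightarrow> H x = L"
    using holomorphic_extension_by_limits[OF sparse_badset dE limE] by blast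
  define M :: complex where "M = of_nat n - of_nat (card R)"
  have Hc: "continuous_on UNIV H" by (rule holomorphic_on_imp_continuous_on[OF H(1)])
  have Hper: "H (z + l) = H z + M * eta l" if l: "l \<in> \<Lambda>" for z l
  proof (rule continuous_eq_off_sparse[where f = "\<lambda>z. H (z + l)" and g = "\<lambda>z. H z + M * eta l", OF _ _ sparse_badset])
    show "continuous_on UNIV (\<lambda>z. H (z + l))"
      by (rule continuous_on_compose2[OF Hc]) (auto intro!: continuous_intros)
    show "continuous_on UNIV (\<lambda>z. H z + M * eta l)" by (intro continuous_intros Hc)
    fix z assume z: "z \<notin> badset B"
    then have zL: "z \<notin> \<Lambda>" by (simp add: badset_def)
    have "(\<Sum>r\<in>R. wzeta \<tau> (z + l - r)) = (\<Sum>r\<in>R. wzeta \<tau> (z - r) + eta l)"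
    proof (rule sum.cong)
      fix r assume "r \<in> R"
      then show "wzeta \<tau> (z + l - r) = wzeta \<tau> (z - r) + eta l"
        using wzeta_quasi[OF l notbadR[OF z]] by (simp add: algebra_simps)
    qed simp
    also have "\<dots> = (\<Sum>r\<in>R. wzeta \<tau> (z - r)) + of_nat (card R) * eta l" by (simp add: sum.distrib)
    finally have s: "(\<Sum>r\<in>R. wzeta \<tau> (z + l - r)) = (\<Sum>r\<in>R. wzeta \<tau> (z - r)) + of_nat (card R) * eta l" .
    have "E (z + l) = E z + M * eta l"
      unfolding E_def s using FF_periodic[OF l zL] wzeta_quasi[OF l zL] by (simp add: F_def M_def algebra_simps)
    then show "H (z + l) = H z + M * eta l" using H(2) z bad_periodic[OF l] by simp
  qed
  note add = entire_additive_constant[OF H(1), of M]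
  have M0: "M = 0" by (rule add(1)) (rule Hper, simp)+
  have Hconst: "H z = H w" for z w by (rule add(2)) (rule Hper, simp)+
  have card: "card R = n" using M0 by (simp add: M_def)
  obtain a where a: "bij_betw a {1..n} R" using ex_bij_betw_nat_finite_1[OF finR] card by auto
  have sum_a: "(\<Sum>r\<in>R. f r) = (\<Sum>j=1..n. f (a j))" for f :: "complex \<Rightarrow> complex"
    by (rule sum.reindex_bij_betw[OF a, symmetric])
  have aR: "a j \<in> R" if "j \<in> {1..n}" for j using a that by (auto simp: bij_betw_def)
  define c where "c = H 0"
  have "F z = c + (\<Sum>j=1..n. wzeta \<tau> (z - a j)) - of_nat n * wzeta \<tau> z" if "z \<notin> badset B" for z
    using H(2)[OF that] Hconst[of z 0] sum_a[of "\<lambda>r. wzeta \<tau> (z - r)"] by (simp add: c_def E_def algebra_simps)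
  \<comment> \<open>The remainder is evaluated at the lattice point 0, where
    \<open>FF + n zeta\<close> tends to 0 and only the terms \<open>- zeta (- a j)\<close>
    survive.\<close>
  moreover have "c = (\<Sum>j=1..n. wzeta \<tau> (a j))"
    using H(3)[OF lim_l[of 0]] sum_a[of "wzeta \<tau>"] by (simp add: c_def wzeta_odd sum_negf)
  moreover have "a j \<notin> \<Lambda> \<and> F0 B (a j) = 0" if "j \<in> {1..n}" for j
    using RP[OF aR[OF that]] Pbad[OF RP[OF aR[OF that]]] by (auto simp: P_def badset_def)
  ultimately show ?thesis using that[of a c] by (simp add: F_def)
qed

lemma lame_Phi_F:
  assumes "z \<notin> \<Lambda>"
  shows "poly (lame_Phi n \<tau> z) B = F0 B z" "deriv (\<lambda>w. poly (lame_Phi n \<tau> w) B) z = F1 B z"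
proof -
  show "poly (lame_Phi n \<tau> z) B = F0 B z" using assms by (simp add: lame_Phi_eq F0_def)
  have zl: "z \<in> lreg" using assms by (simp add: lreg_iff)
  show "deriv (\<lambda>w. poly (lame_Phi n \<tau> w) B) z = F1 B z"
    by (rule deriv_eq_on_open[OF open_lreg zl _ DERIV_F0[OF assms]]) (simp add: lame_Phi_eq F0_def lreg_iff)
qed

text \<open>The representation found above holds off \<open>badset B\<close>, hence on every
  admissible domain \<open>U\<close>. Any other representation has a proportional sigma product on
  its own \<open>U\<close>, so \<open>sigma_quotient_periodic\<close> makes the sums congruent and
  lets the exponents differ by the matching quasi-period. Both definite descriptions thereby acquire
  a value.\<close>

lemma lame_values:
  assumes curve: "C\<^sup>2 = poly (lame_Q n \<tau>) B"
  obtains a c where "\<And>j. j \<in> {1..n} \<Longrightarrow> a j \<notin> \<Lambda> \<and> F0 B (a j) = 0"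
    "\<And>z. z \<notin> badset B \<Longrightarrow> FF B C z = c + (\<Sum>j=1..n. wzeta \<tau> (z - a j)) - of_nat n * wzeta \<tau> z"
    "lame_sigma n \<tau> (B, C) = ell_point \<tau> (\<Sum>j=1..n. a j)"
    "lame_kappa n \<tau> (B, C) = kappa_value \<tau> (\<Sum>j=1..n. a j) c"
proof -
  obtain a c where a: "\<And>j. j \<in> {1..n} \<Longrightarrow> a j \<notin> \<Lambda> \<and> F0 B (a j) = 0"
    and rep: "\<And>z. z \<notin> badset B \<Longrightarrow> FF B C z = c + (\<Sum>j=1..n. wzeta \<tau> (z - a j)) - of_nat n * wzeta \<tau> z"
    and c: "c = (\<Sum>j=1..n. wzeta \<tau> (a j))"
    by (rule lame_representation[OF curve]) blast
  have za: "z - a j \<notin> \<Lambda>" if "z \<notin> badset B" "j \<in> {1..n}" for z j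
  proof
    assume l: "z - a j \<in> \<Lambda>"
    have "a j \<in> badset B" using a[OF that(2)] by (simp add: badset_def)
    then show False using bad_periodic[OF l, of "a j" B] that(1) by simp
  qed
  define W where "W c a z = exp (c * z) * (\<Prod>j=1..n. wsigma \<tau> (z - a j))" for c z and a :: "nat \<Rightarrow> complex"
  have dW: "((\<lambda>z. W c a z / wsigma \<tau> z ^ n) has_field_derivative
     (c + (\<Sum>j=1..n. wzeta \<tau> (z - a j)) - of_nat n * wzeta \<tau> z) * (W c a z / wsigma \<tau> z ^ n)) (at z)"
    if "z \<notin> \<Lambda>" "\<And>j. j \<in> {1..n} \<Longrightarrow> z - a j \<notin> \<Lambda>" for c a z
  proof -
    have "(W c a has_field_derivative (c + (\<Sum>j=1..n. wzeta \<tau> (z - a j))) * W c a z) (at z)"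
      unfolding W_def[abs_def] by (rule DERIV_sigma_prod) (use that in auto)
    from DERIV_divide[OF this DERIV_wsigma_power[OF that(1), of n]]
    show ?thesis by (rule DERIV_cong) (use that(1) in \<open>simp_all add: field_simps\<close>)
  qed
  have ex: "lame_zeros n \<tau> (B, C) a c"
  proof -
    obtain v where v: "v \<notin> badset B"
      using eventually_happens'[OF at_neq_bot eventually_not_bad[of B 0]] by blast
    obtain r where r: "r > 0" "ball v r \<subseteq> - badset B" using open_not_bad v by (meson ComplI openE)
    have hF: "FF B C holomorphic_on ball v r"
      unfolding holomorphic_on_def field_differentiable_def
      using DERIV_FF[OF curve] r(2) has_field_derivative_at_within by blast
    obtain G where G: "\<And>z. z \<in> ball v r \<Longrightarrow> (G has_field_derivative FF B C z) (at z within ball v r)"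
      using holomorphic_convex_primitive'[OF convex_ball open_ball hF] by blast
    then have G': "(G has_field_derivative FF B C z) (at z)" if "z \<in> ball v r" for z
      using that at_within_open[OF that open_ball] by metis
    have nb: "z \<notin> badset B" "z \<notin> \<Lambda>" if "z \<in> ball v r" for z using r(2) that by (auto simp: badset_def)
    have ba: "baker_akhiezer_on (ball v r) (- \<Lambda>) (lame_Phi n \<tau>) (B, C) (\<lambda>z. exp (G z))"
      unfolding baker_akhiezer_on_def prod.case
    proof (intro conjI exI[of _ G] ballI)
      fix z assume z: "z \<in> ball v r"
      show "poly (lame_Phi n \<tau> z) B \<noteq> 0" using nb[OF z] by (simp add: lame_Phi_F badset_def)
      show "(G has_field_derivative (C + 1 / 2 * deriv (\<lambda>w. poly (lame_Phi n \<tau> w) B) z) / poly (lame_Phi n \<tau> z) B) (at z)"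
        using G'[OF z] nb[OF z] by (simp add: lame_Phi_F FF_def)
    qed (use r nb in auto)
    have 1: "((\<lambda>z. exp (G z)) has_field_derivative FF B C z * exp (G z)) (at z)" if "z \<in> ball v r" for z
      using DERIV_chain2[where f = exp, OF DERIV_exp G'[OF that]] by (simp add: mult.commute)
    have 2: "((\<lambda>z. W c a z / wsigma \<tau> z ^ n) has_field_derivative FF B C z * (W c a z / wsigma \<tau> z ^ n)) (at z)"
      if "z \<in> ball v r" for z
      using dW[of z a c] nb[OF that] za rep by simp
    have 3: "W c a z / wsigma \<tau> z ^ n \<noteq> 0" if "z \<in> ball v r" for z
      using nb[OF that] za by (simp add: W_def)
    obtain K where K: "\<And>z. z \<in> ball v r \<Longrightarrow> exp (G z) = K * (W c a z / wsigma \<tau> z ^ n)"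
      using same_log_derivative[OF open_ball connected_ball 1 2 3] by blast
    have "K \<noteq> 0" using K[of v] r(1) by auto
    then show ?thesis
      unfolding lame_zeros_def prod.case using ba K c by (intro conjI exI) (auto simp: W_def)
  qed
  have uniq: "(\<Sum>j=1..n. a' j) - (\<Sum>j=1..n. a j) \<in> \<Lambda> \<and> c' - c = eta ((\<Sum>j=1..n. a' j) - (\<Sum>j=1..n. a j))"
    if lz: "lame_zeros n \<tau> (B, C) a' c'" for a' c'
  proof -
    obtain U \<psi> K where U: "baker_akhiezer_on U (- \<Lambda>) (lame_Phi n \<tau>) (B, C) \<psi>" "K \<noteq> 0"
      "\<And>z. z \<in> U \<Longrightarrow> \<psi> z = K * (W c' a' z / wsigma \<tau> z ^ n)"
      using lz unfolding lame_zeros_def W_def by blast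
    obtain G where G: "open U" "connected U" "U \<noteq> {}" "U \<subseteq> - \<Lambda>" "\<And>z. z \<in> U \<Longrightarrow> poly (lame_Phi n \<tau> z) B \<noteq> 0"
      "\<And>z. z \<in> U \<Longrightarrow> (G has_field_derivative (C + 1 / 2 * deriv (\<lambda>w. poly (lame_Phi n \<tau> w) B) z) / poly (lame_Phi n \<tau> z) B) (at z)"
      "\<And>z. z \<in> U \<Longrightarrow> \<psi> z = exp (G z)"
      using U(1) unfolding baker_akhiezer_on_def prod.case by blast
    have nb: "z \<notin> badset B" "z \<notin> \<Lambda>" if "z \<in> U" for z
      using G(4,5) that lame_Phi_F(1)[of z B] by (auto simp: badset_def)
    \<comment> \<open>A zero of the product inside \<open>U\<close> is impossible because
      \<open>\<psi>\<close> is an exponential there.\<close>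
    have za': "z - a' j \<notin> \<Lambda>" if "z \<in> U" "j \<in> {1..n}" for z j
    proof
      assume "z - a' j \<in> \<Lambda>"
      then have "W c' a' z = 0" using that(2) by (auto simp: W_def)
      then show False using U(3)[OF that(1)] G(7)[OF that(1)] by simp
    qed
    have FFU: "FF B C z = c' + (\<Sum>j=1..n. wzeta \<tau> (z - a' j)) - of_nat n * wzeta \<tau> z" if z: "z \<in> U" for z
    proof -
      have "((\<lambda>z. exp (G z)) has_field_derivative exp (G z) * FF B C z) (at z)"
        using DERIV_chain2[where f = exp, OF DERIV_exp G(6)[OF z]] nb[OF z] by (simp add: lame_Phi_F FF_def)
      then have "((\<lambda>z. K * (W c' a' z / wsigma \<tau> z ^ n)) has_field_derivative exp (G z) * FF B C z) (at z)"
        by (rule has_field_derivative_transform_within_open[OF _ G(1) z]) (use U(3) G(7) in auto)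
      moreover have "((\<lambda>z. K * (W c' a' z / wsigma \<tau> z ^ n)) has_field_derivative
         K * ((c' + (\<Sum>j=1..n. wzeta \<tau> (z - a' j)) - of_nat n * wzeta \<tau> z) * (W c' a' z / wsigma \<tau> z ^ n))) (at z)"
        by (intro DERIV_cmult dW nb z za')
      ultimately have "exp (G z) * FF B C z = K * ((c' + (\<Sum>j=1..n. wzeta \<tau> (z - a' j)) - of_nat n * wzeta \<tau> z) * (W c' a' z / wsigma \<tau> z ^ n))"
        by (rule DERIV_unique)
      also have "\<dots> = exp (G z) * (c' + (\<Sum>j=1..n. wzeta \<tau> (z - a' j)) - of_nat n * wzeta \<tau> z)"
        using U(3)[OF z] G(7)[OF z] by simp
      finally show ?thesis by simp
    qed
    have 1: "(W c' a' has_field_derivative (FF B C z + of_nat n * wzeta \<tau> z) * W c' a' z) (at z)" if "z \<in> U" for z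
      using DERIV_sigma_prod[of "{1..n}" z a' c'] za'[OF that] FFU[OF that] by (simp add: W_def[abs_def])
    have 2: "(W c a has_field_derivative (FF B C z + of_nat n * wzeta \<tau> z) * W c a z) (at z)" if "z \<in> U" for z
      using DERIV_sigma_prod[of "{1..n}" z a c] za[OF nb(1)[OF that]] rep[OF nb(1)[OF that]] by (simp add: W_def[abs_def])
    have 3: "W c a z \<noteq> 0" if "z \<in> U" for z using za[OF nb(1)[OF that]] by (simp add: W_def)
    obtain k where k: "\<And>z. z \<in> U \<Longrightarrow> W c' a' z = k * W c a z"
      using same_log_derivative[OF G(1,2) 1 2 3] by blast
    obtain v where v: "v \<in> U" using G(3) by blast
    have "sum a' {1..n} - sum a {1..n} \<in> \<Lambda> \<and> c' - c = eta (sum a' {1..n} - sum a {1..n})"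
    proof (rule sigma_quotient_periodic[where X = "\<lambda>_. 1" and Y = "\<lambda>_. 1" and V = U and v = v and k = k])
      show "exp (c' * z) * (\<Prod>i\<in>{1..n}. wsigma \<tau> (z - a' i)) * 1 = k * (exp (c * z) * (\<Prod>j\<in>{1..n}. wsigma \<tau> (z - a j)) * 1)"
        if "z \<in> U" for z using k[OF that] by (simp add: W_def)
      show "exp (c' * v) * (\<Prod>i\<in>{1..n}. wsigma \<tau> (v - a' i)) * 1 \<noteq> 0" using za'[OF v] by simp
    qed (use G v nb in \<open>auto simp: lreg_iff\<close>)
    then show ?thesis .
  qed
  have "lame_sigma n \<tau> (B, C) = ell_point \<tau> (\<Sum>j=1..n. a j)"
    unfolding lame_sigma_def
  proof (rule the_equality)
    show "\<exists>a' c'. lame_zeros n \<tau> (B, C) a' c' \<and> ell_point \<tau> (\<Sum>j=1..n. a j) = ell_point \<tau> (\<Sum>j=1..n. a' j)"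
      using ex by blast
    fix s assume "\<exists>a c. lame_zeros n \<tau> (B, C) a c \<and> s = ell_point \<tau> (\<Sum>j=1..n. a j)"
    then show "s = ell_point \<tau> (\<Sum>j=1..n. a j)" using uniq ell_point_eq_iff by blast
  qed
  moreover have "lame_kappa n \<tau> (B, C) = kappa_value \<tau> (\<Sum>j=1..n. a j) c"
    unfolding lame_kappa_def
  proof (rule the_equality)
    show "\<exists>a' c'. lame_zeros n \<tau> (B, C) a' c' \<and> kappa_value \<tau> (\<Sum>j=1..n. a j) c = kappa_value \<tau> (\<Sum>j=1..n. a' j) c'"
      using ex by blast
    fix s assume "\<exists>a c. lame_zeros n \<tau> (B, C) a c \<and> s = kappa_value \<tau> (\<Sum>j=1..n. a j) c"
    then show "s = kappa_value \<tau> (\<Sum>j=1..n. a j) c" using uniq kappa_value_cong by blast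
  qed
  ultimately show ?thesis using that a rep by blast
qed

end

section \<open>The non-even equation\<close>

locale gle_setting = lame_setting \<tau> n + upper_half_point \<tau> p for \<tau> n p
begin

text \<open>Up to the factor \<open>-1 / N\<close>, \<open>P0\<close> is the product of the solutions \<open>(w' - T w) / sqrt g\<close> for the two Baker--Akhiezer functions \<open>w\<close>,
  expressed through the product \<open>F0\<close> of the latter; \<open>P1\<close>, \<open>P2\<close> are its derivatives.\<close>

definition bpar :: "complex \<Rightarrow> complex" where "bpar T = T\<^sup>2 - N * wp \<tau> p"

definition bpoly :: "complex poly" where "bpoly = [:- N * wp \<tau> p, 0, 1:]"

text \<open>Substituting \<open>bpoly\<close> for the spectral parameter doubles degrees, and
  \<open>pCons 0\<close> is multiplication by \<open>T\<close>. The division by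
  \<open>N * g z\<close> makes the polynomial monic in \<open>T\<close>.\<close>

definition gPhi :: "complex \<Rightarrow> complex poly" where
  "gPhi z = pcompose (LP0 z) bpoly
     + smult (1 / (N * g z)) (pCons 0 (pcompose (LP1 z) bpoly) - smult (1 / 2) (pcompose (LP2 z) bpoly))"

text \<open>For \<open>w1 w2 = F0\<close> one has \<open>w1' w2' = F2 / 2 - (T^2 + N g) F0\<close>,
  so \<open>V0\<close> is \<open>-(w1' - T w1) (w2' - T w2)\<close>. Its derivatives
  \<open>V1\<close> and \<open>V2\<close> are expressed through \<open>F0, F1, F2\<close> again by
  means of the third-order equation.\<close>

definition V0 :: "complex \<Rightarrow> complex \<Rightarrow> complex" where
  "V0 T z = N * g z * F0 (bpar T) z + T * F1 (bpar T) z - F2 (bpar T) z / 2"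

definition V1 :: "complex \<Rightarrow> complex \<Rightarrow> complex" where
  "V1 T z = T * F2 (bpar T) z - (2 * T\<^sup>2 + N * g z) * F1 (bpar T) z"

definition V2 :: "complex \<Rightarrow> complex \<Rightarrow> complex" where
  "V2 T z = T * (4 * (T\<^sup>2 + N * g z) * F1 (bpar T) z + 2 * N * wp' z * F0 (bpar T) z)
     - (2 * T\<^sup>2 + N * g z) * F2 (bpar T) z - N * wp' z * F1 (bpar T) z"

definition P0 :: "complex \<Rightarrow> complex \<Rightarrow> complex" where "P0 T z = V0 T z / (N * g z)"

definition P1 :: "complex \<Rightarrow> complex \<Rightarrow> complex" where
  "P1 T z = (V1 T z - wp' z / g z * V0 T z) / (N * g z)"

definition P2 :: "complex \<Rightarrow> complex \<Rightarrow> complex" where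
  "P2 T z = (V2 T z - 2 * (wp' z / g z) * V1 T z + (2 * (wp' z / g z)\<^sup>2 - wp'' z / g z) * V0 T z) / (N * g z)"

lemma poly_bpoly: "poly bpoly T = bpar T"
  by (simp add: bpoly_def bpar_def power2_eq_square)

lemma S_not_lattice: "z \<in> S \<Longrightarrow> z \<notin> \<Lambda>"
  by (simp add: S_iff)

lemma poly_gPhi:
  assumes "z \<in> S" shows "poly (gPhi z) T = P0 T z"
proof -
  define G where "G = N * g z"
  have "G \<noteq> 0" using g_nonzero[OF assms] N_nonzero by (simp add: G_def)
  then have "x + 1 / G * (T * y - w / 2) = (G * x + T * y - w / 2) / G" for x y w
    by (simp add: field_simps)
  then show ?thesis
    unfolding gPhi_def P0_def V0_def F0_def F1_def F2_def G_def[symmetric]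
    by (simp add: poly_pcompose poly_bpoly)
qed

lemma lame_q_bpar: "N * wp \<tau> z + bpar T = T\<^sup>2 + N * g z"
  by (simp add: bpar_def g_def algebra_simps)

lemma DERIV_V0: assumes z: "z \<notin> \<Lambda>" shows "(V0 T has_field_derivative V1 T z) (at z)"
proof -
  let ?B = "bpar T"
  have "(V0 T has_field_derivative (N * wp' z * F0 ?B z + N * g z * F1 ?B z) + T * F2 ?B z
      - (4 * (N * wp \<tau> z + ?B) * F1 ?B z + 2 * N * wp' z * F0 ?B z) / 2) (at z)"
    unfolding V0_def[abs_def]
    by (rule derivative_eq_intros DERIV_g[OF z] DERIV_F0[OF z] DERIV_F1[OF z] DERIV_F2[OF z] refl | simp)+
  then show ?thesis unfolding lame_q_bpar by (rule DERIV_cong) (simp add: V1_def algebra_simps)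
qed

lemma DERIV_V1: assumes z: "z \<notin> \<Lambda>" shows "(V1 T has_field_derivative V2 T z) (at z)"
proof -
  let ?B = "bpar T"
  have "(V1 T has_field_derivative T * (4 * (N * wp \<tau> z + ?B) * F1 ?B z + 2 * N * wp' z * F0 ?B z)
      - (N * wp' z * F1 ?B z + (2 * T\<^sup>2 + N * g z) * F2 ?B z)) (at z)"
    unfolding V1_def[abs_def]
    by (rule derivative_eq_intros DERIV_g[OF z] DERIV_F1[OF z] DERIV_F2[OF z] refl | simp)+
  then show ?thesis unfolding lame_q_bpar by (rule DERIV_cong) (simp add: V2_def algebra_simps)
qed

lemma DERIV_div_g:
  assumes "z \<in> S" "(X has_field_derivative D) (at z)"
  shows "((\<lambda>z. X z / (N * g z)) has_field_derivative (D - wp' z / g z * X z) / (N * g z)) (at z)"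
proof -
  have ne: "N * g z \<noteq> 0" using g_nonzero[OF assms(1)] N_nonzero by simp
  have dg: "((\<lambda>z. N * g z) has_field_derivative N * wp' z) (at z)"
    by (rule DERIV_cmult[OF DERIV_g[OF S_not_lattice[OF assms(1)]]])
  have alg: "(D * (M * y) - x * (M * w)) / ((M * y) * (M * y)) = (D - w / y * x) / (M * y)"
    if "M * y \<noteq> 0" for M x y w :: complex
    using that by (simp add: field_simps)
  show ?thesis by (rule DERIV_cong[OF DERIV_divide[OF assms(2) dg ne] alg[OF ne]])
qed

lemma DERIV_P0: "z \<in> S \<Longrightarrow> (P0 T has_field_derivative P1 T z) (at z)"
  unfolding P0_def[abs_def] P1_def by (rule DERIV_div_g[OF _ DERIV_V0[OF S_not_lattice]])

lemma DERIV_P1: assumes z: "z \<in> S" shows "(P1 T has_field_derivative P2 T z) (at z)"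
proof -
  have zL: "z \<notin> \<Lambda>" using z by (rule S_not_lattice)
  define h where "h = wp' z / g z"
  define k where "k = wp'' z / g z"
  have dh: "((\<lambda>z. wp' z / g z) has_field_derivative k - h\<^sup>2) (at z)"
    using DERIV_log_deriv_g[OF z] by (simp add: h_def k_def wp''_def)
  have "((\<lambda>z. V1 T z - wp' z / g z * V0 T z) has_field_derivative V2 T z - ((k - h\<^sup>2) * V0 T z + V1 T z * h)) (at z)"
    unfolding h_def by (intro DERIV_diff DERIV_mult DERIV_V0 DERIV_V1 zL dh[unfolded h_def])
  from DERIV_div_g[OF z this] show ?thesis
    unfolding P1_def[abs_def] P2_def h_def[symmetric] k_def[symmetric]
    by (rule DERIV_cong) (simp add: algebra_simps power2_eq_square)
qed

text \<open>For \<open>y = w' - T w\<close> the Wronskian of \<open>y1 / sqrt g\<close> and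
  \<open>y2 / sqrt g\<close> is \<open>-N\<close> times that of \<open>w1\<close> and
  \<open>w2\<close>; the scaling of \<open>P0\<close> undoes the factor. The computation avoids the
  solutions and is a polynomial identity in the values of \<open>F0, F1, F2\<close> and of
  \<open>g'/g\<close>, \<open>g''/g\<close>.\<close>

lemma gle_spectral:
  assumes z: "z \<in> S"
  shows "gle1_q n p \<tau> T z * (P0 T z)\<^sup>2 - 1 / 2 * P0 T z * P2 T z + 1 / 4 * (P1 T z)\<^sup>2 = poly (lame_Q n \<tau>) (bpar T)"
proof -
  have zL: "z \<notin> \<Lambda>" using z by (rule S_not_lattice)
  have g0: "g z \<noteq> 0" using g_nonzero[OF z] .
  define G where "G = N * g z"
  have G0: "G \<noteq> 0" using g0 N_nonzero by (simp add: G_def)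
  define f0 f1 f2 where "f0 = F0 (bpar T) z" and "f1 = F1 (bpar T) z" and "f2 = F2 (bpar T) z"
  define h k where "h = wp' z / g z" and "k = wp'' z / g z"
  define v0 v1 v2 where "v0 = V0 T z" and "v1 = V1 T z" and "v2 = V2 T z"
  \<comment> \<open>Replacing \<open>N wp'\<close> by \<open>G h\<close> eliminates
    \<open>wp'\<close> from the identities to be checked.\<close>
  have W: "N * wp' z = G * h" using g0 by (simp add: G_def h_def)
  have W2: "2 * N * wp' z = 2 * (G * h)" using W by (simp only: mult.assoc)
  have v: "v0 = G * f0 + T * f1 - f2 / 2" "v1 = T * f2 - (2 * T\<^sup>2 + G) * f1"
     "v2 = T * (4 * (T\<^sup>2 + G) * f1 + 2 * (G * h) * f0) - (2 * T\<^sup>2 + G) * f2 - G * h * f1"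
    unfolding v0_def v1_def v2_def V0_def V1_def V2_def W2 W unfolding G_def[symmetric] f0_def[symmetric] f1_def[symmetric] f2_def[symmetric]
    by (rule refl)+
  have q: "gle1_q n p \<tau> T z = G + T\<^sup>2 + T * h + 3 / 4 * h\<^sup>2 - 1 / 2 * k"
    unfolding gle1_q_eq[OF z] by (simp add: G_def h_def k_def wp''_def)
  have P: "P0 T z = v0 / G" "P1 T z = (v1 - h * v0) / G" "P2 T z = (v2 - 2 * h * v1 + (2 * h\<^sup>2 - k) * v0) / G"
    by (simp_all add: P0_def P1_def P2_def v0_def v1_def v2_def h_def k_def G_def)
  have Q: "poly (lame_Q n \<tau>) (bpar T) = (T\<^sup>2 + G) * f0\<^sup>2 - 1 / 2 * f0 * f2 + 1 / 4 * f1\<^sup>2"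
    using poly_lame_Q[OF zL, of "bpar T"] unfolding lame_q_bpar by (simp add: G_def f0_def f1_def f2_def)
  have "(G + T\<^sup>2 + T * h + 3 / 4 * h\<^sup>2 - 1 / 2 * k) * v0\<^sup>2 - 1 / 2 * v0 * (v2 - 2 * h * v1 + (2 * h\<^sup>2 - k) * v0) + 1 / 4 * (v1 - h * v0)\<^sup>2
    = (T\<^sup>2 + G) * v0\<^sup>2 + h * v0 * (T * v0 + v1 / 2) - v0 * v2 / 2 + v1\<^sup>2 / 4"
    by (simp add: power2_eq_square algebra_simps)
  \<comment> \<open>The terms linear in \<open>h\<close> must cancel: this factor is divisible by
    \<open>G\<close> and matches the part \<open>G h (2 T f0 - f1)\<close> of
    \<open>v2\<close>.\<close>
  also have "T * v0 + v1 / 2 = G * (T * f0 - f1 / 2)"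
    unfolding v by (simp add: power2_eq_square field_simps)
  also have "(T\<^sup>2 + G) * v0\<^sup>2 + h * v0 * (G * (T * f0 - f1 / 2)) - v0 * v2 / 2 + v1\<^sup>2 / 4
    = (T\<^sup>2 + G) * v0\<^sup>2 - v0 * (4 * T * (T\<^sup>2 + G) * f1 - (2 * T\<^sup>2 + G) * f2) / 2 + v1\<^sup>2 / 4"
    unfolding v(3) by (simp add: power2_eq_square field_simps)
  also have "\<dots> = G\<^sup>2 * ((T\<^sup>2 + G) * f0\<^sup>2 - 1 / 2 * f0 * f2 + 1 / 4 * f1\<^sup>2)"
    unfolding v(1,2) by (simp add: power2_eq_square field_simps)
  finally have main: "(G + T\<^sup>2 + T * h + 3 / 4 * h\<^sup>2 - 1 / 2 * k) * v0\<^sup>2 - 1 / 2 * v0 * (v2 - 2 * h * v1 + (2 * h\<^sup>2 - k) * v0) + 1 / 4 * (v1 - h * v0)\<^sup>2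
    = G\<^sup>2 * ((T\<^sup>2 + G) * f0\<^sup>2 - 1 / 2 * f0 * f2 + 1 / 4 * f1\<^sup>2)" .
  have "a * (x / G)\<^sup>2 - 1 / 2 * (x / G) * (y / G) + 1 / 4 * (w / G)\<^sup>2 = (a * x\<^sup>2 - 1 / 2 * x * y + 1 / 4 * w\<^sup>2) / G\<^sup>2" for a x y w
    using G0 by (simp add: field_simps power2_eq_square)
  then have "(G + T\<^sup>2 + T * h + 3 / 4 * h\<^sup>2 - 1 / 2 * k) * (v0 / G)\<^sup>2 - 1 / 2 * (v0 / G) * ((v2 - 2 * h * v1 + (2 * h\<^sup>2 - k) * v0) / G)
     + 1 / 4 * ((v1 - h * v0) / G)\<^sup>2 = (G\<^sup>2 * ((T\<^sup>2 + G) * f0\<^sup>2 - 1 / 2 * f0 * f2 + 1 / 4 * f1\<^sup>2)) / G\<^sup>2"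
    by (simp only: main)
  moreover have "G\<^sup>2 * X / G\<^sup>2 = X" for X using G0 by simp
  ultimately show ?thesis unfolding q P Q by (rule trans)
qed

section \<open>Leading behaviour, third-order equation and monicity of the transformed
  product\<close>

lemma gle_q_holomorphic: "gle1_q n p \<tau> T holomorphic_on S"
proof (rule holomorphic_transform)
  show "(\<lambda>z. N * g z + T\<^sup>2 + T * (wp' z / g z) + 3 / 4 * (wp' z / g z)\<^sup>2 - 1 / 2 * ((6 * (wp \<tau> z)\<^sup>2 - inv_g2 / 2) / g z)) holomorphic_on S"
    using g_nonzero unfolding g_def by (intro holomorphic_intros S_holomorphic) (auto simp: g_def)
qed (use gle1_q_eq in auto)

lemma P0_holomorphic: "P0 T holomorphic_on S"
  unfolding holomorphic_on_def field_differentiable_def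
  using DERIV_P0 has_field_derivative_at_within by blast

lemma F12_asymptotics:
  "((\<lambda>z. z ^ (2 * n + 1) * F1 B z) \<longlongrightarrow> - 2 * of_nat n * lead) (at 0)"
  "((\<lambda>z. z ^ (2 * n + 2) * F2 B z) \<longlongrightarrow> 2 * of_nat n * (2 * of_nat n + 1) * lead) (at 0)"
proof -
  obtain r where r: "r > 0" "ball 0 r \<subseteq> preg" "ball 0 r - {0} \<subseteq> lreg" by (rule preg_ball)
  let ?A = "ball 0 r - {0} :: complex set"
  define u where "u = F0_num B"
  define s where "s = - int (2 * n)"
  define u1 where "u1 z = deriv u z * (z - 0) + of_int s * u z" for z
  define u2 where "u2 z = deriv u1 z * (z - 0) + of_int (s - 1) * u1 z" for z
  have uh: "u holomorphic_on ball 0 r" unfolding u_def by (rule holomorphic_on_subset[OF F0_num_holomorphic r(2)])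
  have u1h: "u1 holomorphic_on ball 0 r" unfolding u1_def by (intro holomorphic_intros uh) auto
  have u2h: "u2 holomorphic_on ball 0 r" unfolding u2_def by (intro holomorphic_intros u1h) auto
  have oA: "open ?A" by auto
  have zL: "z \<notin> \<Lambda>" if "z \<in> ?A" for z using r(3) that lreg_iff by blast
  have f0: "F0 B z = u z * (z - 0) powi s" if "z \<in> ?A" for z
    using that F0_num_eq[of z B] unfolding s_def power_int_minus power_int_of_nat by (simp add: u_def divide_inverse)
  have f1: "F1 B z = u1 z * (z - 0) powi (s - 1)" if z: "z \<in> ?A" for z
  proof -
    have "deriv (F0 B) z = (deriv u z * (z - 0) + of_int s * u z) * (z - 0) powi (s - 1)"
      by (rule deriv_eq_on_open[OF oA z f0 DERIV_mult_powi[OF uh z]])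
    then show ?thesis using F_ode(1)[OF zL[OF z]] by (simp add: u1_def)
  qed
  have f2: "F2 B z = u2 z * (z - 0) powi (s - 1 - 1)" if z: "z \<in> ?A" for z
  proof -
    have "deriv (F1 B) z = (deriv u1 z * (z - 0) + of_int (s - 1) * u1 z) * (z - 0) powi (s - 1 - 1)"
      by (rule deriv_eq_on_open[OF oA z f1 DERIV_mult_powi[OF u1h z]])
    then show ?thesis using DERIV_imp_deriv[OF DERIV_F1[OF zL[OF z]]] by (simp add: u2_def)
  qed
  have ev: "eventually (\<lambda>z. z \<in> ?A) (at 0)" by (rule eventually_at_in_open) (use r in auto)
  have s': "s - 1 = - int (2 * n + 1)" "s - 1 - 1 = - int (2 * n + 2)" by (simp_all add: s_def)
  have v: "u1 0 = - 2 * of_nat n * lead" "u2 0 = 2 * of_nat n * (2 * of_nat n + 1) * lead"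
    by (simp_all add: u1_def u2_def u_def F0_num_0 s_def algebra_simps)
  have "(u1 \<longlongrightarrow> u1 0) (at 0)" "(u2 \<longlongrightarrow> u2 0) (at 0)"
    using holomorphic_isCont[OF u1h open_ball, of 0] holomorphic_isCont[OF u2h open_ball, of 0] r(1) by (auto simp: isCont_def)
  note lim = this[unfolded v]
  have e1: "eventually (\<lambda>z. u1 z = z ^ (2 * n + 1) * F1 B z) (at 0)"
    using ev
  proof (rule eventually_mono)
    fix z assume z: "z \<in> ?A"
    have nz: "z ^ (2 * n + 1) \<noteq> 0" using z by simp
    have "F1 B z = u1 z * inverse (z ^ (2 * n + 1))"
      using f1[OF z] unfolding s' power_int_minus power_int_of_nat by simp
    then show "u1 z = z ^ (2 * n + 1) * F1 B z" using right_inverse[OF nz] by (metis mult.left_commute mult.right_neutral)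
  qed
  have e2: "eventually (\<lambda>z. u2 z = z ^ (2 * n + 2) * F2 B z) (at 0)"
    using ev
  proof (rule eventually_mono)
    fix z assume z: "z \<in> ?A"
    have nz: "z ^ (2 * n + 2) \<noteq> 0" using z by simp
    have "F2 B z = u2 z * inverse (z ^ (2 * n + 2))"
      using f2[OF z] unfolding s'(2) power_int_minus power_int_of_nat by (simp only: diff_zero)
    then show "u2 z = z ^ (2 * n + 2) * F2 B z" using right_inverse[OF nz] by (metis mult.left_commute mult.right_neutral)
  qed
  show "((\<lambda>z. z ^ (2 * n + 1) * F1 B z) \<longlongrightarrow> - 2 * of_nat n * lead) (at 0)"
     "((\<lambda>z. z ^ (2 * n + 2) * F2 B z) \<longlongrightarrow> 2 * of_nat n * (2 * of_nat n + 1) * lead) (at 0)"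
    by (rule Lim_transform_eventually[OF lim(1) e1], rule Lim_transform_eventually[OF lim(2) e2])
qed

lemma g_tendsto: "((\<lambda>z. z\<^sup>2 * g z) \<longlongrightarrow> 1) (at 0)"
proof -
  have "((\<lambda>z. z\<^sup>2 * wp \<tau> z - z\<^sup>2 * wp \<tau> p) \<longlongrightarrow> 1 - 0\<^sup>2 * wp \<tau> p) (at 0)"
    by (intro tendsto_intros wp_tendsto)
  then show ?thesis by (simp add: g_def right_diff_distrib)
qed

text \<open>The leading coefficient of \<open>P0\<close> at the origin is
  \<open>lead * (1 - (2 n + 1) / (n + 1))\<close>; the subtracted part comes from
  \<open>F2 / (2 N g)\<close>. It is nonzero since \<open>n > 0\<close>.\<close>

definition plead :: complex where "plead = - (of_nat n / (of_nat n + 1)) * lead"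

lemma n1_nonzero: "of_nat n + 1 \<noteq> (0 :: complex)"
proof -
  have "of_nat n + 1 = (of_nat (Suc n) :: complex)" by simp
  then show ?thesis by (simp only: of_nat_eq_0_iff)
qed

lemma plead_nonzero: "plead \<noteq> 0"
  using lead_nonzero n_pos n1_nonzero by (simp add: plead_def)

lemma eventually_in_S: "eventually (\<lambda>z. z \<in> S) (at x)"
proof -
  obtain B where B: "open B" "x \<in> B" "\<And>y. y \<in> B \<Longrightarrow> y \<noteq> x \<Longrightarrow> y \<notin> - S"
    by (rule sparse_in_not_in[OF sparse_Compl_S UNIV_I, of x]) auto
  show ?thesis using eventually_at_in_open[OF B(1,2)] by (rule eventually_mono) (use B in auto)
qed

lemma P0_tendsto: "((\<lambda>z. z ^ (2 * n) * P0 T z) \<longlongrightarrow> plead) (at 0)"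
proof -
  let ?B = "bpar T"
  have "((\<lambda>z. z ^ (2 * n) * F0 ?B z + (T * (z * (z ^ (2 * n + 1) * F1 ?B z)) - (z ^ (2 * n + 2) * F2 ?B z) / 2) / (N * (z\<^sup>2 * g z))) \<longlongrightarrow>
     lead + (T * (0 * (- 2 * of_nat n * lead)) - (2 * of_nat n * (2 * of_nat n + 1) * lead) / 2) / (N * 1)) (at 0)"
    by (intro tendsto_intros F0_tendsto F12_asymptotics g_tendsto) (use N_nonzero in auto)
  note lim = this
  have val: "lead + (T * (0 * (- 2 * of_nat n * lead)) - (2 * of_nat n * (2 * of_nat n + 1) * lead) / 2) / (N * 1) = plead"
  proof -
    define x where "x = (of_nat n :: complex)"
    have x: "x \<noteq> 0" "x + 1 \<noteq> 0" using n_pos n1_nonzero by (simp_all add: x_def)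
    have "l + (T * (0 * (- 2 * x * l)) - (2 * x * (2 * x + 1) * l) / 2) / ((x * (x + 1)) * 1) = - (x / (x + 1)) * l" for l
      using x by (simp add: divide_simps) (simp add: algebra_simps)
    then show ?thesis by (simp only: x_def plead_def)
  qed
  have ev: "eventually (\<lambda>z. z ^ (2 * n) * F0 ?B z + (T * (z * (z ^ (2 * n + 1) * F1 ?B z)) - (z ^ (2 * n + 2) * F2 ?B z) / 2) / (N * (z\<^sup>2 * g z)) = z ^ (2 * n) * P0 T z) (at 0)"
    using eventually_in_S
  proof (rule eventually_mono)
    fix z assume z: "z \<in> S"
    have z0: "z \<noteq> 0" using S_not_lattice[OF z] by auto
    define G where "G = N * g z"
    have G: "G \<noteq> 0" using g_nonzero[OF z] N_nonzero by (simp add: G_def)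
    define w where "w = z ^ (2 * n)"
    have e: "z * (z ^ (2 * n + 1) * F1 ?B z) = z\<^sup>2 * (w * F1 ?B z)" "z ^ (2 * n + 2) * F2 ?B z = z\<^sup>2 * (w * F2 ?B z)"
      "N * (z\<^sup>2 * g z) = z\<^sup>2 * G"
      by (simp_all add: w_def G_def power_add power2_eq_square)
    have "(T * (z\<^sup>2 * (w * F1 ?B z)) - z\<^sup>2 * (w * F2 ?B z) / 2) / (z\<^sup>2 * G) = w * (T * F1 ?B z - F2 ?B z / 2) / G"
      using z0 G by (simp add: field_simps)
    moreover have "P0 T z = F0 ?B z + (T * F1 ?B z - F2 ?B z / 2) / G"
      unfolding P0_def V0_def G_def[symmetric] using G by (simp add: field_simps)
    ultimately show "z ^ (2 * n) * F0 ?B z + (T * (z * (z ^ (2 * n + 1) * F1 ?B z)) - (z ^ (2 * n + 2) * F2 ?B z) / 2) / (N * (z\<^sup>2 * g z)) = z ^ (2 * n) * P0 T z"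
      unfolding e w_def[symmetric] by (simp add: algebra_simps)
  qed
  show ?thesis by (rule Lim_transform_eventually[OF lim[unfolded val] ev])
qed

lemma P0_not_zero: "\<exists>z\<in>S. P0 T z \<noteq> 0"
proof -
  have "eventually (\<lambda>z. z ^ (2 * n) * P0 T z \<noteq> 0) (at 0)"
    by (rule tendsto_imp_eventually_ne[OF P0_tendsto plead_nonzero])
  then have "eventually (\<lambda>z. z ^ (2 * n) * P0 T z \<noteq> 0 \<and> z \<in> S) (at 0)"
    using eventually_in_S by (rule eventually_conj)
  from eventually_happens'[OF at_neq_bot this] show ?thesis by auto
qed

lemma P_derivs:
  assumes "z \<in> S"
  shows "deriv (P0 T) z = P1 T z" "(deriv ^^ 2) (P0 T) z = P2 T z"
proof -
  have d1: "deriv (P0 T) z = P1 T z" if "z \<in> S" for z using DERIV_P0[OF that] by (rule DERIV_imp_deriv)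
  have "deriv (deriv (P0 T)) z = P2 T z" by (rule deriv_eq_on_open[OF open_S assms d1 DERIV_P1[OF assms]])
  then show "deriv (P0 T) z = P1 T z" "(deriv ^^ 2) (P0 T) z = P2 T z"
    using d1[OF assms] by (simp_all add: numeral_2_eq_2)
qed

text \<open>Differentiating the constant spectral expression gives \<open>P0\<close> times the third-order equation.\<close>

lemma P0_ode:
  assumes z: "z \<in> S"
  shows "(deriv ^^ 3) (P0 T) z - 4 * gle1_q n p \<tau> T z * deriv (P0 T) z - 2 * deriv (gle1_q n p \<tau> T) z * P0 T z = 0"
proof -
  let ?q = "gle1_q n p \<tau> T"
  define \<Omega> where "\<Omega> z = deriv (P2 T) z - 4 * ?q z * P1 T z - 2 * deriv ?q z * P0 T z" for z
  have P1h: "P1 T holomorphic_on S"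
    by (rule holomorphic_transform[OF holomorphic_deriv[OF P0_holomorphic open_S]]) (rule P_derivs(1))
  have P2h: "P2 T holomorphic_on S"
  proof (rule holomorphic_transform[OF holomorphic_deriv[OF P1h open_S]])
    show "deriv (P1 T) z = P2 T z" if "z \<in> S" for z using DERIV_P1[OF that] by (rule DERIV_imp_deriv)
  qed
  have Oh: "\<Omega> holomorphic_on S"
    unfolding \<Omega>_def by (intro holomorphic_intros holomorphic_deriv P0_holomorphic P1h P2h gle_q_holomorphic open_S)
  have OP: "P0 T z * \<Omega> z = 0" if z: "z \<in> S" for z
  proof -
    have dq: "(?q has_field_derivative deriv ?q z) (at z)"
      by (rule holomorphic_derivI[OF gle_q_holomorphic open_S z])
    have d2: "(P2 T has_field_derivative deriv (P2 T) z) (at z)"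
      by (rule holomorphic_derivI[OF P2h open_S z])
    have "((\<lambda>z. ?q z * (P0 T z)\<^sup>2 - 1 / 2 * P0 T z * P2 T z + 1 / 4 * (P1 T z)\<^sup>2) has_field_derivative
       deriv ?q z * (P0 T z)\<^sup>2 + ?q z * (2 * P0 T z * P1 T z) - (1 / 2 * P1 T z * P2 T z + 1 / 2 * P0 T z * deriv (P2 T) z)
       + 1 / 4 * (2 * P1 T z * P2 T z)) (at z)"
      by (rule derivative_eq_intros dq d2 DERIV_P0[OF z] DERIV_P1[OF z] refl | simp add: algebra_simps)+
    then have "((\<lambda>z. poly (lame_Q n \<tau>) (bpar T)) has_field_derivative
       deriv ?q z * (P0 T z)\<^sup>2 + ?q z * (2 * P0 T z * P1 T z) - (1 / 2 * P1 T z * P2 T z + 1 / 2 * P0 T z * deriv (P2 T) z)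
       + 1 / 4 * (2 * P1 T z * P2 T z)) (at z)"
      by (rule has_field_derivative_transform_within_open[OF _ open_S z]) (rule gle_spectral)
    then have "deriv ?q z * (P0 T z)\<^sup>2 + ?q z * (2 * P0 T z * P1 T z) - (1 / 2 * P1 T z * P2 T z + 1 / 2 * P0 T z * deriv (P2 T) z)
       + 1 / 4 * (2 * P1 T z * P2 T z) = 0"
      using DERIV_unique DERIV_const by blast
    then show ?thesis by (simp add: \<Omega>_def algebra_simps power2_eq_square)
  qed
  \<comment> \<open>The vanishing of \<open>P0 * \<Omega>\<close> gives the claim off the isolated
    zeros of \<open>P0\<close>, and continuity gives it at them.\<close>
  have "\<Omega> z = 0"
  proof -
    obtain \<beta> where "\<beta> \<in> S" "P0 T \<beta> \<noteq> 0" using P0_not_zero by blast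
    then have "eventually (\<lambda>w. P0 T w \<noteq> 0 \<and> w \<in> S) (at z)"
      by (rule non_zero_neighbour_alt[OF P0_holomorphic open_S connected_S z])
    then have "eventually (\<lambda>w. \<Omega> w = 0) (at z)" by (rule eventually_mono) (use OP in auto)
    then have "(\<Omega> \<longlongrightarrow> 0) (at z)" by (rule tendsto_eventually)
    moreover have "(\<Omega> \<longlongrightarrow> \<Omega> z) (at z)" using holomorphic_isCont[OF Oh open_S z] by (simp add: isCont_def)
    ultimately show ?thesis using tendsto_unique[OF trivial_limit_at] by blast
  qed
  moreover have "(deriv ^^ 3) (P0 T) z = deriv (P2 T) z"
  proof -
    have ev: "eventually (\<lambda>w. (deriv ^^ 2) (P0 T) w = P2 T w) (nhds z)"
      using eventually_nhds_in_open[OF open_S z] by (rule eventually_mono) (rule P_derivs(2))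
    have "(deriv ^^ 3) (P0 T) z = deriv ((deriv ^^ 2) (P0 T)) z" by (simp add: numeral_3_eq_3 numeral_2_eq_2)
    also have "\<dots> = deriv (P2 T) z" by (rule deriv_cong_ev[OF ev refl])
    finally show ?thesis .
  qed
  ultimately show ?thesis by (simp add: \<Omega>_def P_derivs[OF z])
qed

lemma periodic_domain_S: "periodic_domain S"
proof -
  have "z + l \<in> S" if l: "l \<in> \<Lambda>" and z: "z \<in> S" for z l
  proof -
    have "(z + p) + l \<notin> \<Lambda>" "(z - p) + l \<notin> \<Lambda>" "z + l \<notin> \<Lambda>" using z l by (simp_all add: S_iff)
    then show ?thesis by (simp add: S_iff algebra_simps)
  qed
  then show ?thesis using open_S sparse_Compl_S by (simp add: periodic_domain_def)
qed

lemma g_periodic: "l \<in> \<Lambda> \<Longrightarrow> z \<notin> \<Lambda> \<Longrightarrow> g (z + l) = g z"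
  by (simp add: g_def wp_periodic)

lemma gPhi_periodic: "l \<in> \<Lambda> \<Longrightarrow> z \<in> S \<Longrightarrow> gPhi (z + l) = gPhi z"
  by (simp add: gPhi_def LP_periodic g_periodic S_not_lattice)

lemma coeff_gPhi:
  "coeff (gPhi z) k = (\<Sum>m\<le>n. wp \<tau> z ^ m * coeff (pcompose (lc m) bpoly) k)
    + 1 / (N * g z) * ((\<Sum>m\<le>n. of_nat m * wp \<tau> z ^ (m - 1) * wp' z * coeff (pCons 0 (pcompose (lc m) bpoly)) k)
      - 1 / 2 * (\<Sum>m\<le>n. of_nat m * (of_nat (m - 1) * wp \<tau> z ^ (m - 2) * (wp' z)\<^sup>2 + wp \<tau> z ^ (m - 1) * wp'' z) * coeff (pcompose (lc m) bpoly) k))"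
proof -
  have "coeff (pCons 0 (\<Sum>m\<le>n. smult (f m) (X m))) k = (\<Sum>m\<le>n. f m * coeff (pCons 0 (X m)) k)" for f :: "nat \<Rightarrow> complex" and X
    by (cases k) (simp_all add: coeff_sum)
  then show ?thesis
    unfolding gPhi_def LP0_def LP1_def LP2_def pcompose_sum pcompose_smult
    by (simp add: coeff_sum)
qed

lemma gPhi_coeff_meromorphic: "(\<lambda>z. coeff (gPhi z) k) meromorphic_on UNIV"
  unfolding coeff_gPhi g_def wp''_def by (intro meromorphic_intros wp_meromorphic wp'_meromorphic)

lemma gPhi_coeff_holomorphic: "(\<lambda>z. coeff (gPhi z) k) holomorphic_on S"
proof -
  have "N * (wp \<tau> z - wp \<tau> p) \<noteq> 0" if "z \<in> S" for z using g_nonzero[OF that] N_nonzero by (simp add: g_def)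
  then show ?thesis
    unfolding coeff_gPhi g_def wp''_def by (intro holomorphic_intros S_holomorphic) auto
qed

lemma degree_bpoly: "degree bpoly = 2" "lead_coeff bpoly = 1"
  by (simp_all add: bpoly_def numeral_2_eq_2)

text \<open>The composed \<open>LP0\<close> has degree \<open>2 n\<close>; \<open>LP1\<close> and
  \<open>LP2\<close> have lost a degree before composition, so even after the factor
  \<open>T\<close> the correction has degree at most \<open>2 n - 1\<close>.\<close>

lemma gPhi_monic: "degree (gPhi z) = 2 * n \<and> lead_coeff (gPhi z) = 1"
proof -
  define A where "A = pcompose (LP0 z) bpoly"
  define D where "D = smult (1 / (N * g z)) (pCons 0 (pcompose (LP1 z) bpoly) - smult (1 / 2) (pcompose (LP2 z) bpoly))"
  have A: "degree A = 2 * n" "lead_coeff A = 1"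
    using LP0_monic[of z] lead_coeff_comp[of bpoly "LP0 z"] degree_bpoly by (simp_all add: A_def degree_pcompose)
  have d: "degree (pcompose q bpoly) \<le> 2 * (n - 1)" if "degree q \<le> n - 1" for q
    using that degree_bpoly by (simp add: degree_pcompose)
  have "degree D \<le> 2 * (n - 1) + 1"
    unfolding D_def
    using d[OF LP12_degree(1), of z] d[OF LP12_degree(2), of z]
    by (intro order.trans[OF degree_smult_le] degree_diff_le) (auto intro: order.trans[OF degree_pCons_le] order.trans[OF degree_smult_le])
  then have "degree D < degree A" using A n_pos by linarith
  then have "degree (A + D) = degree A" "coeff (A + D) (degree A) = 1"
    using A by (simp_all add: degree_add_eq_left coeff_eq_0)
  then show ?thesis using A(1) by (simp add: gPhi_def A_def[symmetric] D_def[symmetric])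
qed

end

section \<open>Uniqueness of the elliptic solution of the non-even equation\<close>

lemma holomorphic_quotient_limit:
  fixes f :: "complex \<Rightarrow> complex"
  assumes A: "open A" "a \<in> A" and f: "f holomorphic_on A - {a}" "(f \<longlongrightarrow> 0) (at a)"
  obtains L where "((\<lambda>z. f z / (z - a)) \<longlongrightarrow> L) (at a)"
proof -
  define F where "F z = (if z = a then 0 else f z)" for z
  have ev: "eventually (\<lambda>z. f z = F z) (at a)"
    unfolding eventually_at_filter by (rule always_eventually) (simp add: F_def)
  have "F holomorphic_on A"
  proof (rule no_isolated_singularity'[where K = "{a}"])
    show "F holomorphic_on A - {a}" by (rule holomorphic_transform[OF f(1)]) (simp add: F_def)
    have "(F \<longlongrightarrow> F a) (at a)" using Lim_transform_eventually[OF f(2) ev] by (simp add: F_def[of a])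
    then show "(F \<longlongrightarrow> F z) (at z within A)" if "z \<in> {a}" for z
      using that tendsto_within_subset[of F "nhds (F a)" a UNIV A] by simp
  qed (use A in auto)
  then have "(F has_field_derivative deriv F a) (at a)" by (rule holomorphic_derivI[OF _ A])
  then have l: "((\<lambda>z. (F z - F a) / (z - a)) \<longlongrightarrow> deriv F a) (at a)" by (simp add: has_field_derivative_iff)
  have "eventually (\<lambda>z. (F z - F a) / (z - a) = f z / (z - a)) (at a)"
    unfolding eventually_at_filter by (rule always_eventually) (simp add: F_def)
  from Lim_transform_eventually[OF l this] show ?thesis by (rule that)
qed

context upper_half begin

text \<open>A nonzero theta function of degree one has a single class of zeros; having exactly the
  multipliers of sigma forces that class to be 0 by \<open>lattice_multiplier\<close>.\<close>

lemma theta_like_1_multiplier: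
  assumes H: "H holomorphic_on UNIV" "\<And>z l. l \<in> {1,\<tau>} \<Longrightarrow> H (z + l) = sigma_mult l * exp (eta l * z) * H z"
  obtains K where "\<And>z. H z = K * wsigma \<tau> z"
proof (cases "\<exists>z. H z \<noteq> 0")
  case True
  then obtain z0 where z0: "H z0 \<noteq> 0" by blast
  have th: "theta_like 1 H"
    unfolding theta_like_def
  proof (intro conjI ballI)
    fix l assume l: "l \<in> {1,\<tau>}"
    then have "l \<in> \<Lambda>" by auto
    then show "\<exists>u. u \<noteq> 0 \<and> (\<forall>z. H (z + l) = u * exp (of_nat 1 * eta l * z) * H z)"
      using H(2)[OF l] sigma_mult_nonzero[of l] by (intro exI[of _ "sigma_mult l"]) simp
  qed (rule H(1))
  obtain K \<gamma> and a :: "nat \<Rightarrow> complex" where K: "\<And>z. H z = K * exp (\<gamma> * z) * (\<Prod>i=1..1. wsigma \<tau> (z - a i))"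
    by (rule theta_like_factor[where f = H and m = 1 and ?z0.0 = z0, OF th z0]) blast
  then have H1: "H z = K * exp (\<gamma> * z) * wsigma \<tau> (z - a 1)" for z by simp
  have "exp (\<gamma> * l - eta l * a 1) = 1" if l: "l \<in> {1,\<tau>}" for l
  proof -
    have lL: "l \<in> \<Lambda>" using l by auto
    define M where "M = sigma_mult l * exp (eta l * z0)"
    have M: "M \<noteq> 0" using sigma_mult_nonzero[OF lL] by (simp add: M_def)
    have q: "exp (\<gamma> * (z0 + l)) * wsigma \<tau> (z0 + l - a 1) = M * exp (\<gamma> * l - eta l * a 1) * (exp (\<gamma> * z0) * wsigma \<tau> (z0 - a 1))"
      using sigma_prod_quasi[OF lL, of \<gamma> z0 a "{1}"] by (simp only: M_def) simp
    have "M * H z0 = K * (exp (\<gamma> * (z0 + l)) * wsigma \<tau> (z0 + l - a 1))"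
      using H(2)[OF l, of z0] unfolding M_def H1[of "z0 + l"] by (simp only: mult.assoc)
    also have "\<dots> = M * exp (\<gamma> * l - eta l * a 1) * H z0"
      unfolding q H1[of z0] by (simp only: mult_ac)
    finally have e: "M * H z0 = M * exp (\<gamma> * l - eta l * a 1) * H z0" .
    have "M * (H z0 * exp (\<gamma> * l - eta l * a 1)) = M * exp (\<gamma> * l - eta l * a 1) * H z0" by (simp only: mult_ac)
    also have "\<dots> = M * (H z0 * 1)" unfolding e[symmetric] by simp
    finally show ?thesis unfolding mult_left_cancel[OF M] mult_left_cancel[OF z0] .
  qed
  note m = this
  have a: "a 1 \<in> \<Lambda> \<and> \<gamma> = eta (a 1)" by (rule lattice_multiplier[OF m[of 1] m[of \<tau>]]) simp_all
  have "H z = K * sigma_mult (- a 1) * wsigma \<tau> z" for z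
  proof -
    have "wsigma \<tau> (z - a 1) = sigma_mult (- a 1) * exp (- (\<gamma> * z)) * wsigma \<tau> z"
      using wsigma_quasi[of "- a 1" z] a eta_uminus[of "a 1"] by simp
    then show ?thesis by (simp add: H1 exp_minus field_simps)
  qed
  then show ?thesis by (rule that)
next
  case False
  then show ?thesis using that[of 0] by simp
qed

end

context gle_setting begin

text \<open>At the origin the term with \<open>T\<close> contributes only the simple pole
  \<open>-2 T / z\<close>, so the double-pole coefficient, and with it the exponents, are those of
  the Lame equation.\<close>

lemma gle_lattice_form:
  obtains r v where "r > 0" "ball 0 r - {0} \<subseteq> S" "v holomorphic_on ball 0 r" "v 0 = N"
    "\<And>z. z \<in> ball 0 r - {0} \<Longrightarrow> gle1_q n p \<tau> T z = v z / z\<^sup>2"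
proof -
  let ?P = "{z. z + p \<notin> \<Lambda> \<and> z - p \<notin> \<Lambda>}"
  have Pe: "?P = - ({z. z - - p \<in> \<Lambda>} \<union> {z. z - p \<in> \<Lambda>})" by auto
  have sp: "{z. z - - p \<in> \<Lambda>} \<union> {z. z - p \<in> \<Lambda>} sparse_in UNIV"
    by (intro sparse_in_union' sparse_lattice_translate)
  have oP: "open ?P" unfolding Pe using sparse_in_UNIV_imp_closed[OF sp] by (rule open_Compl)
  have "0 \<in> preg \<inter> ?P" using p_notin by simp
  then obtain r where r: "r > 0" "ball 0 r \<subseteq> preg \<inter> ?P"
    using open_Int[OF open_preg oP] by (meson openE)
  define D where "D = (deriv ^^ 2) (wp \<tau>) p / (4 * deriv (wp \<tau>) p)"
  define v where "v z = N * (1 + z\<^sup>2 * wp_reg z) + z\<^sup>2 * (3 / 4 * (wp \<tau> (z + p) + wp \<tau> (z - p))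
     + T * (wzeta \<tau> (z + p) + wzeta \<tau> (z - p)) - D * (wzeta \<tau> (z + p) - wzeta \<tau> (z - p)) + gle1_B n p \<tau> T)
     - 2 * T * (z + z\<^sup>2 * zeta_reg z)" for z
  have hs: "(\<lambda>z. wp \<tau> (z + l)) holomorphic_on ball 0 r" "(\<lambda>z. wzeta \<tau> (z + l)) holomorphic_on ball 0 r"
    if "\<And>z. z \<in> ball 0 r \<Longrightarrow> z + l \<notin> \<Lambda>" for l
    unfolding holomorphic_on_def field_differentiable_def
    using DERIV_wp_shift DERIV_wzeta_shift that has_field_derivative_at_within by blast+
  have pl: "z + p \<notin> \<Lambda>" "z + - p \<notin> \<Lambda>" if "z \<in> ball 0 r" for z using r(2) that by auto
  have hz: "zeta_reg holomorphic_on ball 0 r"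
    by (rule holomorphic_on_subset[OF zeta_reg_holomorphic]) (use r in simp)
  have vh: "v holomorphic_on ball 0 r"
    unfolding v_def
    using hs(1)[OF pl(1)] hs(1)[OF pl(2)] hs(2)[OF pl(1)] hs(2)[OF pl(2)]
    by (intro holomorphic_intros holomorphic_on_subset[OF wp_reg_holomorphic] hz) (use r in auto)
  have S: "ball 0 r - {0} \<subseteq> S"
  proof
    fix z :: complex assume z: "z \<in> ball 0 r - {0}"
    have "ball 0 r \<subseteq> preg" "ball 0 r \<subseteq> ?P" using r(2) by simp_all
    then have "z \<in> preg" "z \<in> ?P" using z by blast+
    then show "z \<in> S" using z by (simp add: S_iff preg_def)
  qed
  have "gle1_q n p \<tau> T z = v z / z\<^sup>2" if z: "z \<in> ball 0 r - {0}" for z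
  proof -
    have "M * (1 / z\<^sup>2 + w) + a + T * (b - 2 * (1 / z + y)) - e + d = (M * (1 + z\<^sup>2 * w) + z\<^sup>2 * (a + T * b - e + d) - 2 * T * (z + z\<^sup>2 * y)) / z\<^sup>2"
      for M w a b y d e using z by (simp add: field_simps power2_eq_square)
    then show ?thesis unfolding gle1_q_def v_def wp_eq[of z] wzeta_eq[of z] D_def .
  qed
  with r(1) S vh show ?thesis by (intro that[of r v]) (auto simp: v_def)
qed

lemma gle_pole_form:
  assumes b: "b - p \<in> \<Lambda> \<or> b + p \<in> \<Lambda>"
  obtains r v where "r > 0" "ball b r - {b} \<subseteq> S" "v holomorphic_on ball b r" "v b = 3 / 4"
    "\<And>z. z \<in> ball b r - {b} \<Longrightarrow> gle1_q n p \<tau> T z = v z / (z - b)\<^sup>2"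
proof -
  \<comment> \<open>The terms of the potential are symmetric in \<open>p\<close> and
    \<open>-p\<close> except the one with \<open>D\<close>, which changes sign; the sign
    \<open>\<epsilon>\<close> lets both kinds of poles be treated by one computation.\<close>
  define \<epsilon> :: complex where "\<epsilon> = (if b - p \<in> \<Lambda> then 1 else -1)"
  have ee: "\<epsilon> = 1 \<or> \<epsilon> = -1" by (auto simp: \<epsilon>_def)
  have be: "b - \<epsilon> * p \<in> \<Lambda>" using b by (auto simp: \<epsilon>_def)
  define l where "l = b - \<epsilon> * p"
  have l: "l \<in> \<Lambda>" using be by (simp add: l_def)
  have ep: "\<epsilon> * p \<notin> \<Lambda>" "2 * (\<epsilon> * p) \<notin> \<Lambda>"
    using ee p_notin double_notin lattice_uminus_iff[of "2 * p"] by auto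
  have bb: "b \<notin> \<Lambda>" "b + \<epsilon> * p \<notin> \<Lambda>"
  proof -
    have e: "b = \<epsilon> * p + l" "b + \<epsilon> * p = 2 * (\<epsilon> * p) + l" by (simp_all add: l_def)
    show "b \<notin> \<Lambda>" "b + \<epsilon> * p \<notin> \<Lambda>"
      unfolding e(2) unfolding e(1) lattice_add_iff[OF l] by (rule ep)+
  qed
  let ?P = "{z. z \<notin> \<Lambda> \<and> z + \<epsilon> * p \<notin> \<Lambda>}"
  have Pe: "?P = - ({z. z - 0 \<in> \<Lambda>} \<union> {z. z - (- (\<epsilon> * p)) \<in> \<Lambda>})" by auto
  have sp: "{z. z - 0 \<in> \<Lambda>} \<union> {z. z - (- (\<epsilon> * p)) \<in> \<Lambda>} sparse_in UNIV"
    by (intro sparse_in_union' sparse_lattice_translate)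
  have oP: "open ?P" unfolding Pe using sparse_in_UNIV_imp_closed[OF sp] by (rule open_Compl)
  have "b \<in> ?P" using bb by simp
  then obtain r1 where r1: "r1 > 0" "ball b r1 \<subseteq> ?P" using open_contains_ball_eq[OF oP] by blast
  obtain r2 where r2: "r2 > 0" "ball 0 r2 \<subseteq> preg" by (rule preg_ball)
  define r where "r = min r1 r2"
  have r: "r > 0" using r1 r2 by (simp add: r_def)
  have sh: "z - b \<in> preg" if "z \<in> ball b r" for z
  proof -
    have "z - b \<in> ball 0 r2" using that by (simp add: r_def dist_norm norm_minus_commute)
    then show ?thesis using r2(2) by blast
  qed
  have zP: "z \<notin> \<Lambda>" "z + \<epsilon> * p \<notin> \<Lambda>" if "z \<in> ball b r" for z
  proof -
    have "z \<in> ball b r1" using that by (simp add: r_def)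
    then show "z \<notin> \<Lambda>" "z + \<epsilon> * p \<notin> \<Lambda>" using r1(2) by auto
  qed
  have zb: "z - b \<notin> \<Lambda>" if "z \<in> ball b r - {b}" for z using sh[of z] that by (auto simp: preg_def)
  have ze: "z - \<epsilon> * p = (z - b) + l" for z by (simp add: l_def)
  have S: "ball b r - {b} \<subseteq> S"
  proof
    fix z assume z: "z \<in> ball b r - {b}"
    have "z - \<epsilon> * p \<notin> \<Lambda>" unfolding ze using zb[OF z] l by simp
    then show "z \<in> S" using zP[of z] z ee by (auto simp: S_iff)
  qed
  define D where "D = (deriv ^^ 2) (wp \<tau>) p / (4 * deriv (wp \<tau>) p)"
  define v where "v z = 3 / 4 * (1 + (z - b)\<^sup>2 * wp_reg (z - b)) + (z - b)\<^sup>2 * (N * wp \<tau> z + 3 / 4 * wp \<tau> (z + \<epsilon> * p)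
     + (T - \<epsilon> * D) * wzeta \<tau> (z + \<epsilon> * p) - 2 * T * wzeta \<tau> z + gle1_B n p \<tau> T)
     + (T + \<epsilon> * D) * ((z - b) + (z - b)\<^sup>2 * (zeta_reg (z - b) + eta l))" for z
  have hs: "(\<lambda>z. wp \<tau> (z + l)) holomorphic_on ball b r" "(\<lambda>z. wzeta \<tau> (z + l)) holomorphic_on ball b r"
    if "\<And>z. z \<in> ball b r \<Longrightarrow> z + l \<notin> \<Lambda>" for l
    unfolding holomorphic_on_def field_differentiable_def
    using DERIV_wp_shift DERIV_wzeta_shift that has_field_derivative_at_within by blast+
  have h0: "wp \<tau> holomorphic_on ball b r" "wzeta \<tau> holomorphic_on ball b r"
    using hs[of 0] zP by simp_all
  have shh: "(\<lambda>z. z - b) holomorphic_on ball b r" "(\<lambda>z. z - b) ` ball b r \<subseteq> preg"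
    using sh by (auto intro!: holomorphic_intros)
  have hr: "(\<lambda>z. wp_reg (z - b)) holomorphic_on ball b r"
    using holomorphic_on_compose_gen[OF shh(1) wp_reg_holomorphic shh(2)] by (simp add: o_def)
  from holomorphic_on_compose_gen[OF shh(1) zeta_reg_holomorphic shh(2)]
  have hz: "(\<lambda>z. zeta_reg (z - b)) holomorphic_on ball b r" by (simp add: o_def)
  have vh: "v holomorphic_on ball b r"
    unfolding v_def using hs(1)[OF zP(2)] hs(2)[OF zP(2)] by (intro holomorphic_intros h0 hr hz) auto
  have q: "gle1_q n p \<tau> T z = v z / (z - b)\<^sup>2" if z: "z \<in> ball b r - {b}" for z
  proof -
    have w: "wp \<tau> (z - \<epsilon> * p) = 1 / (z - b)\<^sup>2 + wp_reg (z - b)"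
      unfolding ze wp_periodic[OF l zb[OF z]] by (rule wp_eq)
    have y: "wzeta \<tau> (z - \<epsilon> * p) = 1 / (z - b) + zeta_reg (z - b) + eta l"
      unfolding ze wzeta_quasi[OF l zb[OF z]] wzeta_eq[of "z - b"] ..
    have "gle1_q n p \<tau> T z = N * wp \<tau> z + 3 / 4 * (wp \<tau> (z + \<epsilon> * p) + wp \<tau> (z - \<epsilon> * p))
        + T * (wzeta \<tau> (z + \<epsilon> * p) + wzeta \<tau> (z - \<epsilon> * p) - 2 * wzeta \<tau> z)
        - \<epsilon> * D * (wzeta \<tau> (z + \<epsilon> * p) - wzeta \<tau> (z - \<epsilon> * p)) + gle1_B n p \<tau> T"
      using ee unfolding gle1_q_def D_def[symmetric] by (auto simp: algebra_simps)
    also have "\<dots> = v z / (z - b)\<^sup>2"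
    proof -
      define h where "h = z - b"
      have h: "h \<noteq> 0" using z by (auto simp: h_def)
      have "A + 3 / 4 * (B + (1 / h\<^sup>2 + w)) + T * (C + (1 / h + y + e) - 2 * c) - \<delta> * (C - (1 / h + y + e)) + d
        = (3 / 4 * (1 + h\<^sup>2 * w) + h\<^sup>2 * (A + 3 / 4 * B + (T - \<delta>) * C - 2 * T * c + d) + (T + \<delta>) * (h + h\<^sup>2 * (y + e))) / h\<^sup>2"
        for A B w C y e c d \<delta> using h by (simp add: field_simps power2_eq_square)
      then show ?thesis unfolding w y v_def h_def .
    qed
    finally show ?thesis .
  qed
  show ?thesis by (rule that[OF r S vh _ q]) (simp add: v_def)
qed

text \<open>The double-pole coefficient \<open>3/4\<close> yields the exponents \<open>-1\<close>,
  \<open>1\<close> and \<open>3\<close>, so a pole at these points is at most simple.\<close>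

lemma gle_local_limit:
  assumes b: "b - p \<in> \<Lambda> \<or> b + p \<in> \<Lambda>" and f: "f meromorphic_on UNIV"
    and ode: "\<And>z. z \<in> S \<Longrightarrow> (deriv ^^ 3) f z - 4 * gle1_q n p \<tau> T z * deriv f z - 2 * deriv (gle1_q n p \<tau> T) z * f z = 0"
  obtains L where "((\<lambda>z. (z - b) * f z) \<longlongrightarrow> L) (at b)"
proof -
  have fb: "f meromorphic_on {b}" by (rule meromorphic_on_subset[OF f]) simp
  show ?thesis
    using fb
  proof (cases rule: meromorphic_local_form)
    case zero
    have "((\<lambda>z. (z - b) * f z) \<longlongrightarrow> 0) (at b)"
      by (rule tendsto_eventually) (use zero in \<open>auto elim: eventually_mono\<close>)
    then show ?thesis by (rule that)
  next
    case (form u s t)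
    obtain r v where v: "r > 0" "ball b r - {b} \<subseteq> S" "v holomorphic_on ball b r" "v b = 3 / 4"
      "\<And>z. z \<in> ball b r - {b} \<Longrightarrow> gle1_q n p \<tau> T z = v z / (z - b)\<^sup>2"
      by (rule gle_pole_form[OF b, of T]) blast
    let ?r = "min r t"
    have sub: "ball b ?r \<subseteq> ball b r" "ball b ?r \<subseteq> ball b t" by auto
    have "(of_int s - 1) * ((of_int s)\<^sup>2 - 2 * of_int s - 4 * v b) = (0 :: complex)"
    proof (rule indicial_equation[where u = u and r = ?r and f = f and q = "gle1_q n p \<tau> T" and v = v and a = b])
      show "u holomorphic_on ball b ?r" "v holomorphic_on ball b ?r"
        using holomorphic_on_subset[OF form(2) sub(2)] holomorphic_on_subset[OF v(3) sub(1)] by auto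
      show "f z = u z * (z - b) powi s" if "z \<in> ball b ?r - {b}" for z using form(4) that by auto
      show "gle1_q n p \<tau> T z = v z / (z - b)\<^sup>2" if "z \<in> ball b ?r - {b}" for z using v(5) that by auto
      show "(deriv ^^ 3) f z - 4 * gle1_q n p \<tau> T z * deriv f z - 2 * deriv (gle1_q n p \<tau> T) z * f z = 0"
        if "z \<in> ball b ?r - {b}" for z using ode v(2) that by auto
    qed (use form(1,3) v(1) in auto)
    moreover have "(of_int s - 1) * ((of_int s)\<^sup>2 - 2 * of_int s - 4 * v b) = (of_int ((s - 1) * ((s - 3) * (s + 1))) :: complex)"
      unfolding v(4) by (simp add: algebra_simps power2_eq_square)
    ultimately have "(s - 1) * ((s - 3) * (s + 1)) = 0" by (simp only: of_int_eq_0_iff)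
    then have s: "s + 1 \<ge> 0" by auto
    define k where "k = nat (s + 1)"
    have u0: "(u \<longlongrightarrow> u b) (at b)"
      using holomorphic_isCont[OF form(2) open_ball] form(1) by (simp add: isCont_def)
    have ev: "eventually (\<lambda>z. z \<in> ball b t - {b}) (at b)"
      by (rule eventually_at_in_open) (use form(1) in auto)
    have l: "((\<lambda>z. u z * (z - b) ^ k) \<longlongrightarrow> u b * (b - b) ^ k) (at b)" by (intro tendsto_intros u0)
    have "eventually (\<lambda>z. u z * (z - b) ^ k = (z - b) * f z) (at b)"
      using ev
    proof (rule eventually_mono)
      fix z assume z: "z \<in> ball b t - {b}"
      have "(z - b) ^ k = (z - b) powi (s + 1)" using s by (simp add: k_def power_int_def)
      also have "\<dots> = (z - b) powi s * (z - b)" using z by (simp add: power_int_add)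
      finally show "u z * (z - b) ^ k = (z - b) * f z" using form(4)[OF z] by simp
    qed
    from Lim_transform_eventually[OF l this] show ?thesis by (rule that)
  qed
qed

lemma S_minus: "b \<notin> S \<longleftrightarrow> b \<in> \<Lambda> \<or> (b - p \<in> \<Lambda> \<or> b + p \<in> \<Lambda>)"
  by (auto simp: S_iff)

lemma S_periodic: "l \<in> \<Lambda> \<Longrightarrow> z \<in> S \<Longrightarrow> z + l \<in> S"
  using periodic_domain_S by (simp add: periodic_domain_def)

lemma P0_periodic: "l \<in> \<Lambda> \<Longrightarrow> z \<in> S \<Longrightarrow> P0 T (z + l) = P0 T z"
  using gPhi_periodic S_periodic poly_gPhi by metis

lemma P0_meromorphic: "P0 T meromorphic_on UNIV"
proof -
  have "F1 B meromorphic_on UNIV" "F2 B meromorphic_on UNIV" for B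
    unfolding F1_def[abs_def] F2_def[abs_def] LP1_def LP2_def wp''_def poly_sum poly_smult
    by (intro meromorphic_intros wp_meromorphic wp'_meromorphic)+
  then show ?thesis
    unfolding P0_def[abs_def] V0_def g_def by (intro meromorphic_intros F0_meromorphic wp_meromorphic)
qed

text \<open>Multiplication by \<open>g\<close> cancels the simple poles at the points congruent to
  \<open>p\<close> and \<open>-p\<close>, and sigma cancels the pole, at most simple, that the
  double pole of \<open>g\<close> and the zero of \<open>f\<close> leave at lattice points. The
  result has the multipliers of sigma, so \<open>g f = K\<close>. Then \<open>f = K / g\<close>
  behaves like \<open>K z^2\<close> at the origin, which \<open>f2\<close> forbids unless
  \<open>K = 0\<close>.\<close>

lemma gle_vanishing:
  assumes f: "f holomorphic_on S" "f meromorphic_on UNIV"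
    and per: "\<And>z l. z \<in> S \<Longrightarrow> l \<in> \<Lambda> \<Longrightarrow> f (z + l) = f z"
    and ode: "\<And>z. z \<in> S \<Longrightarrow> (deriv ^^ 3) f z - 4 * gle1_q n p \<tau> T z * deriv f z - 2 * deriv (gle1_q n p \<tau> T) z * f z = 0"
    and f0: "(f \<longlongrightarrow> 0) (at 0)" and f2: "\<And>d. d \<noteq> 0 \<Longrightarrow> \<not> ((\<lambda>z. f z / z\<^sup>2) \<longlongrightarrow> d) (at 0)"
    and z: "z \<in> S"
  shows "f z = 0"
proof -
  define E where "E z = wsigma \<tau> z * (g z * f z)" for z
  have quasi: "E (z + l) = sigma_mult l * exp (eta l * z) * E z" if "z \<in> S" "l \<in> \<Lambda>" for z l
    using that per wsigma_quasi g_periodic S_not_lattice by (simp add: E_def)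
  have "g holomorphic_on S" unfolding g_def by (intro holomorphic_intros S_holomorphic)
  then have Eh: "E holomorphic_on S"
    unfolding E_def by (intro holomorphic_intros f holomorphic_on_subset[OF wsigma_holomorphic]) auto
  have lim0: "\<exists>L. (E \<longlongrightarrow> L) (at 0)"
  proof -
    obtain B where B: "open B" "0 \<in> B" "\<And>y. y \<in> B \<Longrightarrow> y \<noteq> 0 \<Longrightarrow> y \<notin> - S"
      by (rule sparse_in_not_in[OF sparse_Compl_S UNIV_I, of 0]) auto
    have "f holomorphic_on B - {0}" by (rule holomorphic_on_subset[OF f(1)]) (use B in auto)
    then obtain L where L: "((\<lambda>z. f z / (z - 0)) \<longlongrightarrow> L) (at 0)"
      by (rule holomorphic_quotient_limit[OF B(1,2) _ f0])
    have "((\<lambda>z. wsigma \<tau> z / z * ((z\<^sup>2 * g z) * (f z / (z - 0)))) \<longlongrightarrow> 1 * (1 * L)) (at 0)"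
      by (intro tendsto_intros wsigma_div_tendsto g_tendsto L)
    moreover have "eventually (\<lambda>z. wsigma \<tau> z / z * ((z\<^sup>2 * g z) * (f z / (z - 0))) = E z) (at 0)"
      unfolding eventually_at_filter by (rule always_eventually) (simp add: E_def power2_eq_square)
    ultimately show ?thesis using Lim_transform_eventually by blast
  qed
  have lim: "\<exists>L. (E \<longlongrightarrow> L) (at b)" if bS: "b \<in> - S" for b
  proof -
    consider "b \<in> \<Lambda>" | "b \<notin> \<Lambda>" "b - p \<in> \<Lambda> \<or> b + p \<in> \<Lambda>" using bS S_minus[of b] by auto
    then show ?thesis
    proof cases
      case 1
      obtain L where L: "(E \<longlongrightarrow> L) (at 0)" using lim0 by blast
      have l: "((\<lambda>h. sigma_mult b * exp (eta b * h) * E h) \<longlongrightarrow> sigma_mult b * exp (eta b * 0) * L) (at 0)"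
        by (intro tendsto_intros L)
      have "eventually (\<lambda>h. sigma_mult b * exp (eta b * h) * E h = E (b + h)) (at 0)"
        using eventually_in_S by (rule eventually_mono) (use quasi[OF _ 1] in \<open>simp add: add.commute\<close>)
      from LIM_offset_zero_cancel[OF Lim_transform_eventually[OF l this]] show ?thesis by blast
    next
      case 2
      obtain L where L: "((\<lambda>z. (z - b) * f z) \<longlongrightarrow> L) (at b)" by (rule gle_local_limit[OF 2(2) f(2) ode])
      have gb: "g b = 0"
      proof -
        have "wp \<tau> b = wp \<tau> p"
          using 2(2) wp_periodic[of "b - p" p] wp_periodic[of "b + p" "- p"] p_notin wp_even[of p] by auto
        then show ?thesis by (simp add: g_def)
      qed
      have dg: "((\<lambda>z. g z / (z - b)) \<longlongrightarrow> wp' b) (at b)"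
        using DERIV_g[OF 2(1)] gb by (simp add: has_field_derivative_iff)
      have s: "(wsigma \<tau> \<longlongrightarrow> wsigma \<tau> b) (at b)"
        using holomorphic_isCont[OF wsigma_holomorphic, of b] by (simp add: isCont_def)
      have "((\<lambda>z. wsigma \<tau> z * (g z / (z - b) * ((z - b) * f z))) \<longlongrightarrow> wsigma \<tau> b * (wp' b * L)) (at b)"
        by (intro tendsto_intros s dg L)
      moreover have "eventually (\<lambda>z. wsigma \<tau> z * (g z / (z - b) * ((z - b) * f z)) = E z) (at b)"
        unfolding eventually_at_filter by (rule always_eventually) (simp add: E_def)
      ultimately show ?thesis using Lim_transform_eventually by blast
    qed
  qed
  have dE: "E field_differentiable (at z)" if "z \<notin> - S" for z
    using holomorphic_on_imp_differentiable_at[OF Eh open_S] that by simp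
  obtain H where H: "H holomorphic_on UNIV" "\<And>z. z \<notin> - S \<Longrightarrow> H z = E z" "\<And>x L. (E \<longlongrightarrow> L) (at x) \<Longrightarrow> H x = L"
    by (rule holomorphic_extension_by_limits[OF sparse_Compl_S dE lim]) blast+
  have Hc: "continuous_on UNIV H" by (rule holomorphic_on_imp_continuous_on[OF H(1)])
  have Hq: "H (z + l) = sigma_mult l * exp (eta l * z) * H z" if "l \<in> {1,\<tau>}" for z l
  proof (rule continuous_eq_off_sparse[where f = "\<lambda>z. H (z + l)" and g = "\<lambda>z. sigma_mult l * exp (eta l * z) * H z", OF _ _ sparse_Compl_S])
    show "continuous_on UNIV (\<lambda>z. H (z + l))"
      by (rule continuous_on_compose2[OF Hc]) (auto intro!: continuous_intros)
    show "continuous_on UNIV (\<lambda>z. sigma_mult l * exp (eta l * z) * H z)" by (intro continuous_intros Hc)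
    fix z assume z: "z \<notin> - S"
    have l: "l \<in> \<Lambda>" using that by auto
    show "H (z + l) = sigma_mult l * exp (eta l * z) * H z"
      using H(2)[OF z] H(2)[of "z + l"] quasi[OF _ l] S_periodic[OF l] z by simp
  qed
  obtain K where K: "\<And>z. H z = K * wsigma \<tau> z" by (rule theta_like_1_multiplier[OF H(1) Hq]) (simp, rule that)
  have gf: "g z * f z = K" if "z \<in> S" for z
    using H(2)[of z] K[of z] that S_not_lattice[OF that] by (simp add: E_def)
  have "K = 0"
  proof (rule ccontr)
    assume K0: "K \<noteq> 0"
    have l: "((\<lambda>z. K / (z\<^sup>2 * g z)) \<longlongrightarrow> K / 1) (at 0)"
      by (intro tendsto_intros g_tendsto) simp
    have "eventually (\<lambda>z. K / (z\<^sup>2 * g z) = f z / z\<^sup>2) (at 0)"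
      using eventually_in_S
    proof (rule eventually_mono)
      fix z assume z: "z \<in> S"
      then show "K / (z\<^sup>2 * g z) = f z / z\<^sup>2" using gf[OF z] g_nonzero[OF z] by auto
    qed
    from Lim_transform_eventually[OF l this] f2[OF K0] show False by simp
  qed
  then show ?thesis using gf[OF z] g_nonzero[OF z] by simp
qed

text \<open>As for the Lame equation, a multiple of \<open>P0\<close> cancels the term of order
  \<open>-2 n\<close>. Simple poles at \<open>p\<close> and \<open>-p\<close> may survive, so the
  conclusion passes through \<open>gle_vanishing\<close> instead of Liouville's theorem
  alone.\<close>

lemma P0_unique:
  assumes f: "f holomorphic_on S" "f meromorphic_on UNIV"
    and per: "\<And>z l. z \<in> S \<Longrightarrow> l \<in> \<Lambda> \<Longrightarrow> f (z + l) = f z"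
    and ode: "\<And>z. z \<in> S \<Longrightarrow> (deriv ^^ 3) f z - 4 * gle1_q n p \<tau> T z * deriv f z - 2 * deriv (gle1_q n p \<tau> T) z * f z = 0"
  shows "\<exists>c. \<forall>z\<in>S. f z = c * P0 T z"
proof -
  let ?q = "gle1_q n p \<tau> T"
  obtain r v where v: "r > 0" "ball 0 r - {0} \<subseteq> S" "v holomorphic_on ball 0 r" "v 0 = N"
    "\<And>z. z \<in> ball 0 r - {0} \<Longrightarrow> ?q z = v z / z\<^sup>2"
    by (rule gle_lattice_form[of T]) blast
  have ode': "(deriv ^^ 3) f z - 4 * ?q z * deriv f z - 2 * deriv ?q z * f z = 0" if "z \<in> ball 0 r - {0}" for z
    using ode v(2) that by blast
  obtain l where l: "((\<lambda>z. z ^ (2 * n) * f z) \<longlongrightarrow> l) (at 0)"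
    by (rule lame_pole_alternative[OF meromorphic_on_subset[OF f(2) subset_UNIV] v(1,3,4,5) ode']) blast+
  define c where "c = l / plead"
  define h where "h z = f z - c * P0 T z" for z
  have hm: "h meromorphic_on UNIV" unfolding h_def by (intro meromorphic_intros f P0_meromorphic)
  have hh: "h holomorphic_on S" unfolding h_def by (intro holomorphic_intros f P0_holomorphic)
  have hode: "(deriv ^^ 3) h z - 4 * ?q z * deriv h z - 2 * deriv ?q z * h z = 0" if z: "z \<in> S" for z
  proof -
    have cF: "(\<lambda>z. c * P0 T z) holomorphic_on S" by (intro holomorphic_intros P0_holomorphic)
    have d: "(deriv ^^ k) h z = (deriv ^^ k) f z - c * (deriv ^^ k) (P0 T) z" for k
      unfolding h_def[abs_def] higher_deriv_diff[OF f(1) cF open_S z] higher_deriv_cmult[OF P0_holomorphic z open_S] ..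
    have e1: "deriv h z = deriv f z - c * deriv (P0 T) z" using d[of 1] by simp
    have F: "(deriv ^^ 3) (P0 T) z = 4 * ?q z * deriv (P0 T) z + 2 * deriv ?q z * P0 T z"
      using P0_ode[OF z, of T] by (simp add: algebra_simps)
    have G: "(deriv ^^ 3) f z = 4 * ?q z * deriv f z + 2 * deriv ?q z * f z"
      using ode[OF z] by (simp add: algebra_simps)
    show ?thesis unfolding d e1 F G h_def by (simp add: algebra_simps)
  qed
  have hode': "(deriv ^^ 3) h z - 4 * ?q z * deriv h z - 2 * deriv ?q z * h z = 0" if "z \<in> ball 0 r - {0}" for z
    using hode v(2) that by blast
  obtain l' where l': "((\<lambda>z. z ^ (2 * n) * h z) \<longlongrightarrow> l') (at 0)" "l' = 0 \<Longrightarrow> (h \<longlongrightarrow> 0) (at 0)"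
      "\<And>d. l' = 0 \<Longrightarrow> d \<noteq> 0 \<Longrightarrow> \<not> ((\<lambda>z. h z / z\<^sup>2) \<longlongrightarrow> d) (at 0)"
    by (rule lame_pole_alternative[OF meromorphic_on_subset[OF hm subset_UNIV] v(1,3,4,5) hode']) blast+
  have "((\<lambda>z. z ^ (2 * n) * f z - c * (z ^ (2 * n) * P0 T z)) \<longlongrightarrow> l - c * plead) (at 0)"
    by (intro tendsto_intros l P0_tendsto)
  then have "((\<lambda>z. z ^ (2 * n) * h z) \<longlongrightarrow> 0) (at 0)"
    using plead_nonzero by (simp add: h_def c_def algebra_simps)
  then have l0: "l' = 0" using tendsto_unique[OF trivial_limit_at l'(1)] by blast
  have hper: "h (z + l) = h z" if "z \<in> S" "l \<in> \<Lambda>" for z l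
    using that per by (simp add: h_def P0_periodic)
  have "h z = 0" if z: "z \<in> S" for z
    by (rule gle_vanishing[OF hh hm hper hode l'(2)[OF l0] l'(3)[OF l0] z])
  then show ?thesis by (intro exI[of _ c]) (auto simp: h_def)
qed

section \<open>The spectral polynomial of the non-even equation\<close>

lemma gle_Phi_eq: "z \<in> S \<Longrightarrow> gle1_Phi n p \<tau> z = gPhi z"
proof -
  have P: "(deriv ^^ k) (\<lambda>w. poly (gPhi w) T) z = (deriv ^^ k) (P0 T) z" if z: "z \<in> S" for k z T
    by (rule higher_deriv_cong_ev[OF _ refl])
       (rule eventually_mono[OF eventually_nhds_in_open[OF open_S z] poly_gPhi])
  obtain \<Phi> where \<Phi>: "monic_elliptic_solution \<tau> S (gle1_q n p \<tau>) (2 * n) \<Phi>" "\<And>z. z \<in> S \<Longrightarrow> \<Phi> z = gPhi z"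
  proof (rule monic_solution_regularize[OF periodic_domain_S, of gPhi "2 * n" "gle1_q n p \<tau>"])
    show "(deriv ^^ 3) (\<lambda>w. poly (gPhi w) T) z - 4 * gle1_q n p \<tau> T z * deriv (\<lambda>w. poly (gPhi w) T) z
       - 2 * deriv (gle1_q n p \<tau> T) z * poly (gPhi z) T = 0" if z: "z \<in> S" for z T
      using P0_ode[OF z, of T] P[OF z, of 3 T] P[OF z, of 1 T] poly_gPhi[OF z, of T] by simp
    show "degree (gPhi z) = 2 * n \<and> lead_coeff (gPhi z) = 1" for z by (rule gPhi_monic)
  qed (simp_all add: gPhi_coeff_meromorphic gPhi_coeff_holomorphic gPhi_periodic)
  have "Phi_fun \<tau> S (gle1_q n p \<tau>) (2 * n) = \<Phi>"
  proof (rule Phi_fun_eqI[OF periodic_domain_S \<Phi>(1)])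
    show "\<exists>z\<in>S. poly (\<Phi> z) T \<noteq> 0" for T using P0_not_zero[of T] \<Phi>(2) poly_gPhi by auto
    show "\<exists>c. \<forall>z\<in>S. f z = c * poly (\<Phi> z) T"
      if "f holomorphic_on S" "f meromorphic_on UNIV" "\<And>z l. z \<in> S \<Longrightarrow> l \<in> \<Lambda> \<Longrightarrow> f (z + l) = f z"
        "\<And>z. z \<in> S \<Longrightarrow> (deriv ^^ 3) f z - 4 * gle1_q n p \<tau> T z * deriv f z - 2 * deriv (gle1_q n p \<tau> T) z * f z = 0" for f T
      using P0_unique[OF that] \<Phi>(2) poly_gPhi by auto
  qed
  then show "z \<in> S \<Longrightarrow> gle1_Phi n p \<tau> z = gPhi z"
    using \<Phi>(2)[of z] by (simp add: gle1_Phi_def)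
qed

lemma gle_Phi_P:
  assumes "z \<in> S"
  shows "poly (gle1_Phi n p \<tau> z) T = P0 T z" "deriv (\<lambda>w. poly (gle1_Phi n p \<tau> w) T) z = P1 T z"
    "(deriv ^^ 2) (\<lambda>w. poly (gle1_Phi n p \<tau> w) T) z = P2 T z"
proof -
  have eq: "poly (gle1_Phi n p \<tau> w) T = P0 T w" if "w \<in> S" for w
    using that by (simp add: gle_Phi_eq poly_gPhi)
  then show "poly (gle1_Phi n p \<tau> z) T = P0 T z" using assms .
  have ev: "eventually (\<lambda>w. poly (gle1_Phi n p \<tau> w) T = P0 T w) (nhds z)"
    by (rule eventually_mono[OF eventually_nhds_in_open[OF open_S assms] eq])
  show "deriv (\<lambda>w. poly (gle1_Phi n p \<tau> w) T) z = P1 T z"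
    unfolding deriv_cong_ev[OF ev refl] by (rule P_derivs(1)[OF assms])
  show "(deriv ^^ 2) (\<lambda>w. poly (gle1_Phi n p \<tau> w) T) z = P2 T z"
    unfolding higher_deriv_cong_ev[OF ev refl] by (rule P_derivs(2)[OF assms])
qed

lemma gle_Q_eq: "gle1_Q n p \<tau> = pcompose (lame_Q n \<tau>) bpoly"
  unfolding gle1_Q_def spectral_poly_def
proof (rule the_equality)
  have eq: "gle1_q n p \<tau> T z * (poly (gle1_Phi n p \<tau> z) T)\<^sup>2
      - 1 / 2 * poly (gle1_Phi n p \<tau> z) T * (deriv ^^ 2) (\<lambda>w. poly (gle1_Phi n p \<tau> w) T) z
      + 1 / 4 * (deriv (\<lambda>w. poly (gle1_Phi n p \<tau> w) T) z)\<^sup>2 = poly (pcompose (lame_Q n \<tau>) bpoly) T" if "z \<in> S" for z T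
    unfolding gle_Phi_P[OF that] gle_spectral[OF that] poly_pcompose poly_bpoly ..
  then show "\<forall>T. \<forall>z\<in>S. poly (pcompose (lame_Q n \<tau>) bpoly) T = gle1_q n p \<tau> T z * (poly (gle1_Phi n p \<tau> z) T)\<^sup>2
      - 1 / 2 * poly (gle1_Phi n p \<tau> z) T * (deriv ^^ 2) (\<lambda>w. poly (gle1_Phi n p \<tau> w) T) z
      + 1 / 4 * (deriv (\<lambda>w. poly (gle1_Phi n p \<tau> w) T) z)\<^sup>2" by simp
  fix R assume R: "\<forall>T. \<forall>z\<in>S. poly R T = gle1_q n p \<tau> T z * (poly (gle1_Phi n p \<tau> z) T)\<^sup>2
      - 1 / 2 * poly (gle1_Phi n p \<tau> z) T * (deriv ^^ 2) (\<lambda>w. poly (gle1_Phi n p \<tau> w) T) z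
      + 1 / 4 * (deriv (\<lambda>w. poly (gle1_Phi n p \<tau> w) T) z)\<^sup>2"
  obtain z where z: "z \<in> S" using S_nonempty by blast
  have "poly R T = poly (pcompose (lame_Q n \<tau>) bpoly) T" for T using R eq[OF z] z by simp
  then show "R = pcompose (lame_Q n \<tau>) bpoly" by (simp add: poly_eq_poly_eq_iff[symmetric] fun_eq_iff)
qed

text \<open>\<open>T\<close> enters the spectral polynomial only through \<open>bpar T\<close>, a
  polynomial in \<open>T^2\<close>. Every complex number is a square, so the values at squares
  determine the descended polynomial.\<close>

lemma poly_gle_Q_hat: "poly (gle1_Q_hat n p \<tau>) X = poly (lame_Q n \<tau>) (X - N * wp \<tau> p)"
proof -
  define R where "R = pcompose (lame_Q n \<tau>) [:- (N * wp \<tau> p), 1:]"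
  have R: "poly R X = poly (lame_Q n \<tau>) (X - N * wp \<tau> p)" for X by (simp add: R_def poly_pcompose)
  have Q: "poly (gle1_Q n p \<tau>) T = poly R (T\<^sup>2)" for T
    unfolding gle_Q_eq poly_pcompose poly_bpoly R bpar_def ..
  have "gle1_Q_hat n p \<tau> = R"
    unfolding gle1_Q_hat_def
  proof (rule the_equality)
    show "\<forall>T. poly (gle1_Q n p \<tau>) T = poly R (T\<^sup>2)" using Q by blast
    fix R' assume R': "\<forall>T. poly (gle1_Q n p \<tau>) T = poly R' (T\<^sup>2)"
    have "poly R' X = poly R X" for X
      using R'[rule_format, of "csqrt X"] Q[of "csqrt X"] by simp
    then show "R' = R" by (simp add: poly_eq_poly_eq_iff[symmetric] fun_eq_iff)
  qed
  then show ?thesis by (simp add: R)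
qed

end

section \<open>Baker--Akhiezer functions of the non-even equation\<close>

lemma DERIV_sqrt_branch:
  fixes r w :: "complex \<Rightarrow> complex"
  assumes r: "r holomorphic_on U" and U: "open U" "z \<in> U" and sq: "\<And>z. z \<in> U \<Longrightarrow> (r z)\<^sup>2 = w z"
    and w: "(w has_field_derivative L * w z) (at z)" and nz: "w z \<noteq> 0"
  shows "(r has_field_derivative L / 2 * r z) (at z)"
proof -
  have dr: "(r has_field_derivative deriv r z) (at z)" by (rule holomorphic_derivI[OF r U])
  have "((\<lambda>z. (r z)\<^sup>2) has_field_derivative 2 * r z * deriv r z) (at z)"
    by (rule derivative_eq_intros dr refl | simp)+
  then have "(w has_field_derivative 2 * r z * deriv r z) (at z)"
    by (rule has_field_derivative_transform_within_open[OF _ U]) (rule sq)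
  from DERIV_unique[OF this w] have "r z * (2 * deriv r z) = r z * (L * r z)"
    using sq[OF U(2)] by (simp add: power2_eq_square mult_ac)
  moreover have "r z \<noteq> 0" using sq[OF U(2)] nz by auto
  ultimately have "2 * deriv r z = L * r z" by simp
  then have "deriv r z = L / 2 * r z" by (metis mult.commute nonzero_mult_div_cancel_left times_divide_eq_left zero_neq_numeral)
  then show ?thesis using dr by (simp only:)
qed

lemma affine_shift_isomorphism:
  assumes "\<And>x y. (x, y) \<in> V \<longleftrightarrow> (x - c, y) \<in> W"
  shows "curve_isomorphism V W (\<lambda>(x, y). (x - c, y))"
proof -
  have m: "curve_morphism V' W' (\<lambda>(x, y). (x + d, y))" if "\<And>x y. (x, y) \<in> V' \<Longrightarrow> (x + d, y) \<in> W'" for V' W' d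
    unfolding curve_morphism_def
  proof
    show "(\<lambda>(x, y). (x + d, y)) ` V' \<subseteq> W'" using that by auto
    \<comment> \<open>In \<open>poly2\<close> the outer variable is \<open>y\<close> and the inner
      one is \<open>x\<close>: the first witness is \<open>x + d\<close>, the second is
      \<open>y\<close>.\<close>
    show "\<exists>F G. \<forall>P\<in>V'. (case P of (x, y) \<Rightarrow> (x + d, y)) = (poly2 F P, poly2 G P)"
      by (rule exI[of _ "[:[:d, 1:]:]"], rule exI[of _ "[:0, 1:]"]) (auto simp: poly2_def add.commute)
  qed
  show ?thesis
    unfolding curve_isomorphism_def
  proof (intro conjI exI[of _ "\<lambda>(x, y). (x + c, y)"])
    show "curve_morphism V W (\<lambda>(x, y). (x - c, y))"
      using m[of V "- c" W] assms by simp
    show "curve_morphism W V (\<lambda>(x, y). (x + c, y))"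
      by (rule m) (simp add: assms)
  qed auto
qed

context gle_setting begin

text \<open>This is \<open>F0 * (w' / w - T)\<close> for the solution \<open>w\<close> at
  \<open>(bpar T, C)\<close>; clearing the denominator leaves an elliptic function holomorphic off
  the lattice.\<close>

definition gnum :: "complex \<Rightarrow> complex \<Rightarrow> complex \<Rightarrow> complex" where
  "gnum T C z = C + F1 (bpar T) z / 2 - T * F0 (bpar T) z"

text \<open>The solutions at \<open>C\<close> and \<open>-C\<close> have product \<open>F0\<close>
  when suitably scaled, so the left side is \<open>F0 (w1' - T w1) (w2' - T w2)\<close>, that is
  \<open>- F0 V0\<close>. The identity confines the zeros of \<open>gnum\<close> to those of
  \<open>F0\<close> and \<open>P0\<close>.\<close>

lemma gnum_product:
  assumes curve: "C\<^sup>2 = poly (lame_Q n \<tau>) (bpar T)" and z: "z \<notin> \<Lambda>"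
  shows "gnum T C z * gnum T (- C) z = - F0 (bpar T) z * V0 T z"
proof -
  define G where "G = N * g z"
  define f0 f1 f2 where "f0 = F0 (bpar T) z" and "f1 = F1 (bpar T) z" and "f2 = F2 (bpar T) z"
  have Q: "C\<^sup>2 = (T\<^sup>2 + G) * f0\<^sup>2 - 1 / 2 * f0 * f2 + 1 / 4 * f1\<^sup>2"
    using curve poly_lame_Q[OF z, of "bpar T"] unfolding lame_q_bpar by (simp add: G_def f0_def f1_def f2_def)
  have "(C + f1 / 2 - T * f0) * (- C + f1 / 2 - T * f0) = (f1 / 2 - T * f0)\<^sup>2 - C\<^sup>2"
    by (simp add: power2_eq_square algebra_simps)
  also have "\<dots> = - f0 * (G * f0 + T * f1 - f2 / 2)"
    unfolding Q by (simp add: power2_eq_square field_simps)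
  finally show ?thesis by (simp only: gnum_def V0_def G_def f0_def f1_def f2_def)
qed

lemma P0_zero_iff: "z \<in> S \<Longrightarrow> P0 T z = 0 \<longleftrightarrow> V0 T z = 0"
  using g_nonzero N_nonzero by (simp add: P0_def)

lemma gnum_nonzero:
  assumes "C\<^sup>2 = poly (lame_Q n \<tau>) (bpar T)" "z \<in> S" "z \<notin> badset (bpar T)" "P0 T z \<noteq> 0"
  shows "gnum T C z \<noteq> 0"
proof
  assume "gnum T C z = 0"
  then have "- F0 (bpar T) z * V0 T z = 0"
    using gnum_product[OF assms(1) S_not_lattice[OF assms(2)]] by simp
  then show False using assms(2-4) P0_zero_iff[OF assms(2)] by (auto simp: badset_def)
qed

lemma FF_gnum: "z \<notin> badset (bpar T) \<Longrightarrow> FF (bpar T) C z - T = gnum T C z / F0 (bpar T) z"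
  by (simp add: FF_def gnum_def badset_def diff_divide_distrib)

text \<open>For \<open>y = w (F - T)\<close> with \<open>F = w' / w\<close> the logarithmic
  derivative of \<open>y / sqrt g\<close> is \<open>F + F' / (F - T) - g' / (2 g)\<close>, with
  \<open>F'\<close> taken from the Riccati equation. The equality fixes the sign of \<open>C\<close>
  and not only its square: the point \<open>(T, C)\<close> corresponds to
  \<open>(bpar T, C)\<close>.\<close>

lemma gle_log_derivative:
  assumes curve: "C\<^sup>2 = poly (lame_Q n \<tau>) (bpar T)" and z: "z \<in> S" "z \<notin> badset (bpar T)" "P0 T z \<noteq> 0"
  shows "(C + P1 T z / 2) / P0 T z = FF (bpar T) C z
      + (lame_q n \<tau> (bpar T) z - (FF (bpar T) C z)\<^sup>2) / (FF (bpar T) C z - T) - wp' z / g z / 2"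
proof -
  have zL: "z \<notin> \<Lambda>" using z(1) by (rule S_not_lattice)
  define G where "G = N * g z"
  define h where "h = wp' z / g z"
  define f0 f1 f2 where "f0 = F0 (bpar T) z" and "f1 = F1 (bpar T) z" and "f2 = F2 (bpar T) z"
  define q where "q = T\<^sup>2 + G"
  define v0 v1 m where "v0 = V0 T z" and "v1 = V1 T z" and "m = gnum T C z"
  have nz: "G \<noteq> 0" "f0 \<noteq> 0" "v0 \<noteq> 0" "m \<noteq> 0"
    using g_nonzero[OF z(1)] N_nonzero z(2,3) P0_zero_iff[OF z(1)] gnum_nonzero[OF curve z] zL
    by (auto simp: G_def f0_def v0_def m_def badset_def)
  have q: "lame_q n \<tau> (bpar T) z = q" unfolding lame_q_def lame_q_bpar q_def G_def ..
  have Q: "C\<^sup>2 = q * f0\<^sup>2 - 1 / 2 * f0 * f2 + 1 / 4 * f1\<^sup>2"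
    using curve poly_lame_Q[OF zL, of "bpar T"] unfolding lame_q_bpar by (simp add: q_def G_def f0_def f1_def f2_def)
  define F where "F = FF (bpar T) C z"
  have F: "F * f0 = C + f1 / 2" using nz(2) by (simp add: F_def FF_def f0_def f1_def)
  have FT: "F - T = m / f0" unfolding F_def FF_gnum[OF z(2)] m_def f0_def ..
  have mv: "m = C + f1 / 2 - T * f0" "v0 = G * f0 + T * f1 - f2 / 2" "v1 = T * f2 - (2 * T\<^sup>2 + G) * f1"
    by (simp_all only: m_def gnum_def v0_def V0_def v1_def V1_def G_def f0_def f1_def f2_def)
  \<comment> \<open>This is the claim after cross-multiplication; the two sides differ by
    \<open>G\<close> times the curve equation.\<close>
  have "(C * G + v1 / 2) * m - v0 * (q * f0 - T * (C + f1 / 2)) = G * (C\<^sup>2 - (q * f0\<^sup>2 - 1 / 2 * f0 * f2 + 1 / 4 * f1\<^sup>2))"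
    unfolding mv q_def by (simp add: power2_eq_square field_simps)
  then have key: "(C * G + v1 / 2) * m = v0 * (q * f0 - T * (C + f1 / 2))" using Q by simp
  have "(C + (v1 - h * v0) / G / 2) / (v0 / G) = (C * G + v1 / 2) / v0 - h / 2"
    using nz by (simp add: field_simps)
  also have "(C * G + v1 / 2) / v0 = (q * f0 - T * (C + f1 / 2)) / m"
    using key nz by (simp add: frac_eq_eq mult.commute)
  also have "\<dots> = (q - T * F) / (F - T)"
    unfolding FT F[symmetric] using nz by (simp add: field_simps)
  also have "\<dots> = F + (q - F\<^sup>2) / (F - T)"
  proof -
    have "F - T \<noteq> 0" using FT nz by simp
    then show ?thesis by (simp add: field_simps power2_eq_square)
  qed
  finally show ?thesis
    unfolding q F_def[symmetric] P0_def P1_def v0_def[symmetric] v1_def[symmetric] h_def[symmetric] G_def[symmetric] .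
qed

text \<open>For a Baker--Akhiezer solution \<open>w\<close> of the Lame equation, \<open>LL\<close> is the logarithmic derivative of
  \<open>\<sigma>\<^sup>n\<^sup>+\<^sup>1 (w' - T w)\<close>.\<close>

definition LL :: "complex \<Rightarrow> complex \<Rightarrow> complex \<Rightarrow> complex" where
  "LL T C z = FF (bpar T) C z + of_nat (n + 1) * wzeta \<tau> z
     + (lame_q n \<tau> (bpar T) z - (FF (bpar T) C z)\<^sup>2) / (FF (bpar T) C z - T)"

text \<open>By \<open>log_deriv_g\<close> the root of \<open>wsigma (z + p) * wsigma (z - p)\<close>
  has the logarithmic derivative of \<open>wsigma * sqrt g\<close>. Hence clearing the denominator
  of the Baker-Akhiezer function raises the power of sigma to \<open>n + 1\<close> and removes
  \<open>sqrt g\<close>.\<close>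

lemma DERIV_psi_sigma:
  assumes curve: "C\<^sup>2 = poly (lame_Q n \<tau>) (bpar T)" and U: "open U" "U \<subseteq> S"
    and G: "(G has_field_derivative (C + P1 T z / 2) / P0 T z) (at z)"
    and r: "r holomorphic_on U" "\<And>z. z \<in> U \<Longrightarrow> (r z)\<^sup>2 = wsigma \<tau> (z + p) * wsigma \<tau> (z - p)"
    and z: "z \<in> U" "z \<notin> badset (bpar T)" "P0 T z \<noteq> 0"
  shows "((\<lambda>z. exp (G z) * (wsigma \<tau> z ^ n * r z)) has_field_derivative
     LL T C z * (exp (G z) * (wsigma \<tau> z ^ n * r z))) (at z)"
proof -
  have zS: "z \<in> S" using z(1) U(2) by blast
  then have zn: "z \<notin> \<Lambda>" "z + p \<notin> \<Lambda>" "z - p \<notin> \<Lambda>" by (auto simp: S_iff)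
  have ds: "((\<lambda>z. wsigma \<tau> (z + a)) has_field_derivative wzeta \<tau> (z + a) * wsigma \<tau> (z + a)) (at z)" if "z + a \<notin> \<Lambda>" for a
    using DERIV_wsigma[OF that] by (simp add: DERIV_shift)
  have dw: "((\<lambda>z. wsigma \<tau> (z + p) * wsigma \<tau> (z - p)) has_field_derivative
      (wzeta \<tau> (z + p) + wzeta \<tau> (z - p)) * (wsigma \<tau> (z + p) * wsigma \<tau> (z - p))) (at z)"
    by (rule DERIV_cong[OF DERIV_mult[OF ds[OF zn(2)] ds[of "- p", simplified, OF zn(3)]]]) (simp add: algebra_simps)
  have dr: "(r has_field_derivative (wzeta \<tau> (z + p) + wzeta \<tau> (z - p)) / 2 * r z) (at z)"
    by (rule DERIV_sqrt_branch[OF r(1) U(1) z(1) r(2) dw]) (use zn in simp_all)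
  have dG: "((\<lambda>z. exp (G z)) has_field_derivative (C + P1 T z / 2) / P0 T z * exp (G z)) (at z)"
    using DERIV_chain2[where f = exp, OF DERIV_exp G] by (simp add: mult.commute)
  have L: "LL T C z = (C + P1 T z / 2) / P0 T z + of_nat n * wzeta \<tau> z + (wzeta \<tau> (z + p) + wzeta \<tau> (z - p)) / 2"
    unfolding LL_def gle_log_derivative[OF curve zS z(2,3)] log_deriv_g[OF zS] by (simp add: field_simps)
  show ?thesis
    unfolding L
    by (rule DERIV_cong[OF DERIV_mult[OF dG DERIV_mult[OF DERIV_wsigma_power[OF zn(1)] dr]]]) (simp add: algebra_simps)
qed

text \<open>For existence, \<open>wsigma^(n+1) (w' - T w)\<close> is an entire theta function of
  degree \<open>n + 1\<close>, so it factors into sigma functions. For uniqueness and the values,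
  every such factorisation differs from the Lame product by the elliptic factor
  \<open>w' / w - T\<close> and a constant, and \<open>sigma_quotient_periodic\<close> applies once
  the Lame product is given an additional zero at the origin.\<close>

lemma gle_values:
  assumes curve: "C\<^sup>2 = poly (lame_Q n \<tau>) (bpar T)"
  shows "gle1_sigma n p \<tau> (T, C) = lame_sigma n \<tau> (bpar T, C)"
    "gle1_kappa n p \<tau> (T, C) = lame_kappa n \<tau> (bpar T, C)"
proof -
  let ?B = "bpar T"
  obtain a c where a: "\<And>j. j \<in> {1..n} \<Longrightarrow> a j \<notin> \<Lambda> \<and> F0 ?B (a j) = 0"
    and rep: "\<And>z. z \<notin> badset ?B \<Longrightarrow> FF ?B C z = c + (\<Sum>j=1..n. wzeta \<tau> (z - a j)) - of_nat n * wzeta \<tau> z"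
    and lame: "lame_sigma n \<tau> (?B, C) = ell_point \<tau> (\<Sum>j=1..n. a j)"
      "lame_kappa n \<tau> (?B, C) = kappa_value \<tau> (\<Sum>j=1..n. a j) c"
    by (rule lame_values[OF curve]) blast
  have za: "z - a j \<notin> \<Lambda>" if "z \<notin> badset ?B" "j \<in> {1..n}" for z j
  proof
    assume l: "z - a j \<in> \<Lambda>"
    have "a j \<in> badset ?B" using a[OF that(2)] by (simp add: badset_def)
    then show False using bad_periodic[OF l, of "a j" ?B] that(1) by simp
  qed
  have nbL: "z \<notin> \<Lambda>" if "z \<notin> badset ?B" for z using that by (simp add: badset_def)
  define W where "W z = exp (c * z) * (\<Prod>j=1..n. wsigma \<tau> (z - a j))" for z
  have dW: "(W has_field_derivative (FF ?B C z + of_nat n * wzeta \<tau> z) * W z) (at z)" if "z \<notin> badset ?B" for z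
    using DERIV_sigma_prod[of "{1..n}" z a c] za[OF that] rep[OF that] by (simp add: W_def[abs_def])
  define Y where "Y z = wsigma \<tau> z * W z * (FF ?B C z - T)" for z
  have dY: "(Y has_field_derivative LL T C z * Y z) (at z)" if z: "z \<notin> badset ?B" "gnum T C z \<noteq> 0" for z
  proof -
    have FT: "FF ?B C z - T \<noteq> 0" unfolding FF_gnum[OF z(1)] using z by (simp add: badset_def)
    have alg: "(s * w) * (q - 0) + (x * s * w + y * w * s) * F = (F' + (n1) * x + q / F) * (s * w * F)"
      if "F \<noteq> 0" "x + y = F' + n1 * x" for s w q x y F F' n1 :: complex
    proof -
      have "(F' + n1 * x + q / F) * (s * w * F) = (x + y) * (s * w * F) + q * (s * w)"
        unfolding that(2) using that(1) by (simp add: field_simps)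
      then show ?thesis by (simp add: algebra_simps)
    qed
    have "(Y has_field_derivative (wsigma \<tau> z * W z) * ((lame_q n \<tau> ?B z - (FF ?B C z)\<^sup>2) - 0)
        + (wzeta \<tau> z * wsigma \<tau> z * W z + (FF ?B C z + of_nat n * wzeta \<tau> z) * W z * wsigma \<tau> z) * (FF ?B C z - T)) (at z)"
      unfolding Y_def[abs_def]
      by (rule DERIV_cong[OF DERIV_mult[OF DERIV_mult[OF DERIV_wsigma[OF nbL[OF z(1)]] dW[OF z(1)]] DERIV_diff[OF DERIV_FF[OF curve z(1)] DERIV_const]]])
         (simp add: algebra_simps)
    then show ?thesis
      by (rule DERIV_cong) (unfold LL_def Y_def, rule alg[OF FT], simp add: algebra_simps)
  qed
  have W_nz: "W z \<noteq> 0" if "z \<notin> badset ?B" for z using za[OF that] by (simp add: W_def)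
  have Y_nz: "Y z \<noteq> 0" if z: "z \<notin> badset ?B" "gnum T C z \<noteq> 0" for z
    using W_nz[OF z(1)] nbL[OF z(1)] z by (simp add: Y_def FF_gnum badset_def)
  define good where "good = {z \<in> S. z \<notin> badset ?B \<and> P0 T z \<noteq> 0}"
  have good_num: "gnum T C z \<noteq> 0" if "z \<in> good" for z
    using that gnum_nonzero[OF curve] by (simp add: good_def)
  have open_good: "open good"
  proof -
    have "open (S \<inter> P0 T -` (- {0}))"
      by (rule continuous_open_preimage[OF holomorphic_on_imp_continuous_on[OF P0_holomorphic] open_S]) auto
    moreover have "good = (S \<inter> P0 T -` (- {0})) \<inter> - badset ?B" by (auto simp: good_def)
    ultimately show ?thesis using open_Int[OF _ open_not_bad] by simp
  qed
  obtain v where v: "v \<in> good"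
  proof -
    have "eventually (\<lambda>z. z ^ (2 * n) * P0 T z \<noteq> 0) (at 0)"
      by (rule tendsto_imp_eventually_ne[OF P0_tendsto plead_nonzero])
    then have "eventually (\<lambda>z. z \<in> good) (at 0)"
      using eventually_in_S[of 0] eventually_not_bad[of ?B 0] by eventually_elim (simp add: good_def)
    then show ?thesis using eventually_happens'[OF at_neq_bot] that by blast
  qed
  have ex: "\<exists>a' c'. gle1_zeros n p \<tau> (T, C) a' c'"
  proof -
    \<comment> \<open>With \<open>w = W / wsigma^n\<close> this is
      \<open>wsigma^(n+1) (w' - T w)\<close> expanded without any division, hence visibly
      entire.\<close>
    define A where "A z = wsigma \<tau> z * (deriv W z - T * W z) - of_nat n * deriv (wsigma \<tau>) z * W z" for z
    have Wh: "W holomorphic_on UNIV"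
      unfolding W_def by (intro holomorphic_intros wsigma_shift_holomorphic)
    have Ah: "A holomorphic_on UNIV"
      unfolding A_def by (intro holomorphic_intros holomorphic_deriv Wh wsigma_holomorphic open_UNIV)
    have AY: "A z = Y z" if z: "z \<notin> badset ?B" for z
      using DERIV_imp_deriv[OF dW[OF z]] DERIV_imp_deriv[OF DERIV_wsigma[OF nbL[OF z]]]
      by (simp add: A_def Y_def algebra_simps)
    have th: "theta_like (n + 1) A"
      unfolding theta_like_def
    proof (intro conjI ballI Ah)
      fix l assume "l \<in> {1, \<tau>}"
      then have l: "l \<in> \<Lambda>" by auto
      define u where "u = sigma_mult l ^ (n + 1) * exp (c * l - eta l * (\<Sum>j=1..n. a j))"
      have u: "u \<noteq> 0" using sigma_mult_nonzero[OF l] by (simp add: u_def)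
      have Ac: "continuous_on UNIV A" by (rule holomorphic_on_imp_continuous_on[OF Ah])
      have "A (z + l) = u * exp (of_nat (n + 1) * eta l * z) * A z" for z
      proof (rule continuous_eq_off_sparse[where f = "\<lambda>z. A (z + l)" and g = "\<lambda>z. u * exp (of_nat (n + 1) * eta l * z) * A z", OF _ _ sparse_badset])
        show "continuous_on UNIV (\<lambda>z. A (z + l))"
          by (rule continuous_on_compose2[OF Ac]) (auto intro!: continuous_intros)
        show "continuous_on UNIV (\<lambda>z. u * exp (of_nat (n + 1) * eta l * z) * A z)" by (intro continuous_intros Ac)
        fix z assume z: "z \<notin> badset ?B"
        then have zl: "z + l \<notin> badset ?B" using bad_periodic[OF l] by simp
        have "W (z + l) = sigma_mult l ^ n * exp (of_nat n * eta l * z) * exp (c * l - eta l * (\<Sum>j=1..n. a j)) * W z"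
          using sigma_prod_quasi[OF l, of c z a "{1..n}"] by (simp add: W_def)
        moreover have "exp (of_nat (n + 1) * eta l * z) = exp (eta l * z) * exp (of_nat n * eta l * z)"
          by (simp add: exp_add[symmetric] algebra_simps)
        ultimately show "A (z + l) = u * exp (of_nat (n + 1) * eta l * z) * A z"
          unfolding AY[OF z] AY[OF zl] Y_def wsigma_quasi[OF l] FF_periodic[OF l nbL[OF z]]
          by (simp add: u_def mult_ac)
      qed
      then show "\<exists>u. u \<noteq> 0 \<and> (\<forall>z. A (z + l) = u * exp (of_nat (n + 1) * eta l * z) * A z)"
        using u by blast
    qed
    have nb: "z \<in> S" "z \<notin> badset ?B" "P0 T z \<noteq> 0" if "z \<in> good" for z using that by (auto simp: good_def)
    have "A v \<noteq> 0" using AY[OF nb(2)[OF v]] Y_nz[OF nb(2)[OF v] good_num[OF v]] by simp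
    then obtain K' \<gamma> a' where K': "K' \<noteq> 0" "\<And>z. A z = K' * exp (\<gamma> * z) * (\<Prod>i=1..n+1. wsigma \<tau> (z - a' i))"
      by (rule theta_like_factor[OF th]) blast
    obtain t where t: "t > 0" "ball v t \<subseteq> good" using open_contains_ball_eq[OF open_good] v by blast
    let ?U = "ball v t"
    have Ug: "z \<in> good" if "z \<in> ?U" for z using t(2) that by blast
    have US: "?U \<subseteq> S" using t(2) nb(1) by blast
    have hP: "(\<lambda>z. (C + P1 T z / 2) / P0 T z) holomorphic_on ?U"
    proof -
      have "P1 T holomorphic_on S"
        by (rule holomorphic_transform[OF holomorphic_deriv[OF P0_holomorphic open_S]]) (rule P_derivs(1))
      then show ?thesis
        by (intro holomorphic_intros holomorphic_on_subset[OF _ US] P0_holomorphic) (use nb(3)[OF Ug] in auto)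
    qed
    obtain G where G: "\<And>z. z \<in> ?U \<Longrightarrow> (G has_field_derivative (C + P1 T z / 2) / P0 T z) (at z within ?U)"
      by (rule holomorphic_convex_primitive'[OF convex_ball open_ball hP]) blast
    have G': "(G has_field_derivative (C + P1 T z / 2) / P0 T z) (at z)" if "z \<in> ?U" for z
      using G[OF that] unfolding at_within_open[OF that open_ball] .
    have hs: "(\<lambda>z. wsigma \<tau> (z + p) * wsigma \<tau> (z - p)) holomorphic_on ?U"
      using wsigma_shift_holomorphic[of "- p"] wsigma_shift_holomorphic[of p]
      by (auto intro!: holomorphic_intros)
    have hsn: "wsigma \<tau> (z + p) * wsigma \<tau> (z - p) \<noteq> 0" if "z \<in> ?U" for z
      using US that by (auto simp: S_iff)
    obtain r where r: "r holomorphic_on ?U" "\<And>z. z \<in> ?U \<Longrightarrow> wsigma \<tau> (z + p) * wsigma \<tau> (z - p) = (r z)\<^sup>2"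
      by (rule contractible_imp_holomorphic_sqrt[OF hs convex_imp_contractible[OF convex_ball] hsn]) blast+
    have ba: "baker_akhiezer_on ?U S (gle1_Phi n p \<tau>) (T, C) (\<lambda>z. exp (G z))"
      unfolding baker_akhiezer_on_def prod.case
    proof (intro conjI exI[of _ G] ballI)
      fix z assume z: "z \<in> ?U"
      have zS: "z \<in> S" using US z by blast
      show "poly (gle1_Phi n p \<tau> z) T \<noteq> 0" using nb(3)[OF Ug[OF z]] by (simp add: gle_Phi_P[OF zS])
      show "(G has_field_derivative (C + 1 / 2 * deriv (\<lambda>w. poly (gle1_Phi n p \<tau> w) T) z) / poly (gle1_Phi n p \<tau> z) T) (at z)"
        using G'[OF z] by (simp add: gle_Phi_P[OF zS])
    qed (use t US in auto)
    have d1: "((\<lambda>z. exp (G z) * (wsigma \<tau> z ^ n * r z)) has_field_derivative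
       LL T C z * (exp (G z) * (wsigma \<tau> z ^ n * r z))) (at z)" if z: "z \<in> ?U" for z
      by (rule DERIV_psi_sigma[OF curve open_ball US G'[OF z] r(1) r(2)[symmetric] z nb(2,3)[OF Ug[OF z]]])
    have d2: "(Y has_field_derivative LL T C z * Y z) (at z)" if "z \<in> ?U" for z
      by (rule dY[OF nb(2)[OF Ug[OF that]] good_num[OF Ug[OF that]]])
    have d3: "Y z \<noteq> 0" if "z \<in> ?U" for z by (rule Y_nz[OF nb(2)[OF Ug[OF that]] good_num[OF Ug[OF that]]])
    obtain k where k: "\<And>z. z \<in> ?U \<Longrightarrow> exp (G z) * (wsigma \<tau> z ^ n * r z) = k * Y z"
      using same_log_derivative[OF open_ball connected_ball d1 d2 d3] by blast
    have sr: "wsigma \<tau> z ^ n * r z \<noteq> 0" if "z \<in> ?U" for z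
      using r(2)[OF that] hsn[OF that] nbL[OF nb(2)[OF Ug[OF that]]] by auto
    have vU: "v \<in> ?U" using t(1) by simp
    have k0: "k \<noteq> 0" using k[OF vU] sr[OF vU] by auto
    have "exp (G z) = k * K' * (exp (\<gamma> * z) * (\<Prod>i=1..n+1. wsigma \<tau> (z - a' i)) / (wsigma \<tau> z ^ n * r z))" if z: "z \<in> ?U" for z
    proof -
      have "exp (G z) * (wsigma \<tau> z ^ n * r z) = k * K' * (exp (\<gamma> * z) * (\<Prod>i=1..n+1. wsigma \<tau> (z - a' i)))"
        unfolding k[OF z] AY[OF nb(2)[OF Ug[OF z]], symmetric] K'(2) by (simp only: mult_ac)
      then show ?thesis using sr[OF z] by (metis nonzero_eq_divide_eq times_divide_eq_right)
    qed
    then have "gle1_zeros n p \<tau> (T, C) a' \<gamma>"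
      unfolding gle1_zeros_def using ba r k0 K'(1)
      by (intro exI[of _ ?U] exI[of _ "\<lambda>z. exp (G z)"] exI[of _ r] exI[of _ "k * K'"]) auto
    then show ?thesis by blast
  qed
  have uniq: "(\<Sum>i=1..n+1. a' i) - (\<Sum>j=1..n. a j) \<in> \<Lambda> \<and> c' - c = eta ((\<Sum>i=1..n+1. a' i) - (\<Sum>j=1..n. a j))"
    if gz: "gle1_zeros n p \<tau> (T, C) a' c'" for a' c'
  proof -
    define X where "X z = exp (c' * z) * (\<Prod>i=1..n+1. wsigma \<tau> (z - a' i))" for z
    obtain U \<psi> r K where U: "baker_akhiezer_on U S (gle1_Phi n p \<tau>) (T, C) \<psi>"
      "r holomorphic_on U" "\<And>z. z \<in> U \<Longrightarrow> (r z)\<^sup>2 = wsigma \<tau> (z + p) * wsigma \<tau> (z - p)" "K \<noteq> 0"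
      "\<And>z. z \<in> U \<Longrightarrow> \<psi> z = K * (X z / (wsigma \<tau> z ^ n * r z))"
      using gz unfolding gle1_zeros_def X_def by blast
    obtain G where G: "open U" "connected U" "U \<noteq> {}" "U \<subseteq> S" "\<And>z. z \<in> U \<Longrightarrow> poly (gle1_Phi n p \<tau> z) T \<noteq> 0"
      "\<And>z. z \<in> U \<Longrightarrow> (G has_field_derivative (C + 1 / 2 * deriv (\<lambda>w. poly (gle1_Phi n p \<tau> w) T) z) / poly (gle1_Phi n p \<tau> z) T) (at z)"
      "\<And>z. z \<in> U \<Longrightarrow> \<psi> z = exp (G z)"
      using U(1) unfolding baker_akhiezer_on_def prod.case by blast
    have US: "z \<in> S" if "z \<in> U" for z using G(4) that by blast
    have P0U: "P0 T z \<noteq> 0" if "z \<in> U" for z using G(5)[OF that] gle_Phi_P[OF US[OF that]] by simp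
    have dG: "(G has_field_derivative (C + P1 T z / 2) / P0 T z) (at z)" if "z \<in> U" for z
      using G(6)[OF that] gle_Phi_P[OF US[OF that]] by simp
    \<comment> \<open>\<open>U\<close> avoids the zeros of \<open>P0\<close> but perhaps not those
      of \<open>F0\<close>, where the Lame side may be singular; removing a sparse set keeps the
      domain connected.\<close>
    define V where "V = U - badset ?B"
    have V: "z \<in> U" "z \<notin> badset ?B" "z \<in> good" if "z \<in> V" for z
      using that P0U US by (auto simp: V_def good_def)
    have oV: "open V"
      unfolding V_def by (rule open_Diff[OF G(1) sparse_in_UNIV_imp_closed[OF sparse_badset]])
    have cV: "connected V"
      unfolding V_def by (rule sparse_imp_connected[OF _ G(2,1) sparse_in_subset[OF sparse_badset subset_UNIV]]) simp
    obtain x where x: "x \<in> V"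
    proof -
      obtain y where y: "y \<in> U" using G(3) by blast
      have "eventually (\<lambda>z. z \<in> U \<and> z \<notin> badset ?B) (at y)"
        using eventually_at_in_open'[OF G(1) y] eventually_not_bad by (rule eventually_conj)
      then have "eventually (\<lambda>z. z \<in> V) (at y)" by (rule eventually_mono) (simp add: V_def)
      then show ?thesis using eventually_happens'[OF at_neq_bot] that by blast
    qed
    have sr: "wsigma \<tau> z ^ n * r z \<noteq> 0" if "z \<in> U" for z
      using U(3)[OF that] US[OF that] by (auto simp: S_iff)
    have GX: "exp (G z) * (wsigma \<tau> z ^ n * r z) = K * X z" if "z \<in> U" for z
      using U(5)[OF that] G(7)[OF that] sr[OF that] by simp
    have d1: "((\<lambda>z. exp (G z) * (wsigma \<tau> z ^ n * r z)) has_field_derivative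
       LL T C z * (exp (G z) * (wsigma \<tau> z ^ n * r z))) (at z)" if z: "z \<in> V" for z
      by (rule DERIV_psi_sigma[OF curve G(1,4) dG[OF V(1)[OF z]] U(2,3) V(1,2)[OF z] P0U[OF V(1)[OF z]]])
    have d2: "(Y has_field_derivative LL T C z * Y z) (at z)" if "z \<in> V" for z
      by (rule dY[OF V(2)[OF that] good_num[OF V(3)[OF that]]])
    have d3: "Y z \<noteq> 0" if "z \<in> V" for z by (rule Y_nz[OF V(2)[OF that] good_num[OF V(3)[OF that]]])
    obtain k where k: "\<And>z. z \<in> V \<Longrightarrow> exp (G z) * (wsigma \<tau> z ^ n * r z) = k * Y z"
      using same_log_derivative[OF oV cV d1 d2 d3] by blast
    \<comment> \<open>The extra index 0 carries the zero 0: it supplies the factor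
      \<open>wsigma z\<close> that equalises the numbers of factors and leaves the sum of zeros
      unchanged.\<close>
    define b where "b = a(0 := 0)"
    have b: "(\<Prod>j\<in>{0..n}. wsigma \<tau> (z - b j)) = wsigma \<tau> z * (\<Prod>j=1..n. wsigma \<tau> (z - a j))"
      "sum b {0..n} = (\<Sum>j=1..n. a j)" for z
    proof -
      have "{0..n} = insert 0 {1..n}" by auto
      then show "(\<Prod>j\<in>{0..n}. wsigma \<tau> (z - b j)) = wsigma \<tau> z * (\<Prod>j=1..n. wsigma \<tau> (z - a j))"
        "sum b {0..n} = (\<Sum>j=1..n. a j)"
        by (auto simp: b_def intro!: arg_cong2[where f = times] prod.cong sum.cong)
    qed
    have F1h: "F1 ?B holomorphic_on lreg"
    proof (rule holomorphic_transform[OF holomorphic_deriv[OF F0_holomorphic open_lreg]])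
      show "deriv (F0 ?B) z = F1 ?B z" if "z \<in> lreg" for z using that F_ode(1) by (simp add: lreg_iff)
    qed
    have "sum a' {1..n+1} - sum b {0..n} \<in> \<Lambda> \<and> c' - c = eta (sum a' {1..n+1} - sum b {0..n})"
    proof (rule sigma_quotient_periodic[where X = "gnum T C" and Y = "F0 ?B" and V = V and v = x and k = "k / K"])
      show "gnum T C holomorphic_on lreg"
        unfolding gnum_def[abs_def] by (intro holomorphic_intros F1h F0_holomorphic) auto
      show "gnum T C (z + l) = gnum T C z" if "l \<in> \<Lambda>" "z \<notin> \<Lambda>" for l z
        using that by (simp add: gnum_def F_periodic)
      show "exp (c' * z) * (\<Prod>i\<in>{1..n+1}. wsigma \<tau> (z - a' i)) * F0 ?B z =
          k / K * (exp (c * z) * (\<Prod>j\<in>{0..n}. wsigma \<tau> (z - b j)) * gnum T C z)" if z: "z \<in> V" for z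
      proof -
        have f0: "F0 ?B z \<noteq> 0" using V(2)[OF z] by (auto simp: badset_def)
        have "K * X z = k * Y z" using k[OF z] GX[OF V(1)[OF z]] by simp
        also have "Y z = wsigma \<tau> z * W z * (gnum T C z / F0 ?B z)" by (simp add: Y_def FF_gnum[OF V(2)[OF z]])
        finally have "X z * F0 ?B z = k / K * (wsigma \<tau> z * W z * gnum T C z)"
          using f0 U(4) by (simp add: field_simps)
        then show ?thesis unfolding b(1) by (simp add: X_def W_def mult_ac)
      qed
      have "X x \<noteq> 0" using k[OF x] GX[OF V(1)[OF x]] sr[OF V(1)[OF x]] by auto
      moreover have "F0 ?B x \<noteq> 0" using V(2)[OF x] by (auto simp: badset_def)
      ultimately show "exp (c' * x) * (\<Prod>i\<in>{1..n+1}. wsigma \<tau> (x - a' i)) * F0 ?B x \<noteq> 0" by (simp add: X_def)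
      show "V \<subseteq> lreg" using V(2) nbL by (auto simp: lreg_iff)
    qed (use oV x F0_holomorphic F_periodic(1) in auto)
    then show ?thesis unfolding b(2) .
  qed
  have "gle1_sigma n p \<tau> (T, C) = ell_point \<tau> (\<Sum>j=1..n. a j)"
    unfolding gle1_sigma_def
  proof (rule the_equality)
    show "\<exists>a' c'. gle1_zeros n p \<tau> (T, C) a' c' \<and> ell_point \<tau> (\<Sum>j=1..n. a j) = ell_point \<tau> (\<Sum>i=1..n+1. a' i)"
      using ex uniq ell_point_eq_iff by metis
    fix s assume "\<exists>a' c'. gle1_zeros n p \<tau> (T, C) a' c' \<and> s = ell_point \<tau> (\<Sum>i=1..n+1. a' i)"
    then show "s = ell_point \<tau> (\<Sum>j=1..n. a j)" using uniq ell_point_eq_iff by blast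
  qed
  then show "gle1_sigma n p \<tau> (T, C) = lame_sigma n \<tau> (?B, C)" by (simp add: lame)
  have "gle1_kappa n p \<tau> (T, C) = kappa_value \<tau> (\<Sum>j=1..n. a j) c"
    unfolding gle1_kappa_def
  proof (rule the_equality)
    show "\<exists>a' c'. gle1_zeros n p \<tau> (T, C) a' c' \<and> kappa_value \<tau> (\<Sum>j=1..n. a j) c = kappa_value \<tau> (\<Sum>i=1..n+1. a' i) c'"
      using ex uniq kappa_value_cong by metis
    fix s assume "\<exists>a' c'. gle1_zeros n p \<tau> (T, C) a' c' \<and> s = kappa_value \<tau> (\<Sum>i=1..n+1. a' i) c'"
    then show "s = kappa_value \<tau> (\<Sum>j=1..n. a j) c" using uniq kappa_value_cong by blast
  qed
  then show "gle1_kappa n p \<tau> (T, C) = lame_kappa n \<tau> (?B, C)" by (simp add: lame)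
qed

text \<open>Only \<open>T^2\<close> enters \<open>bpar\<close>, so both square roots of
  \<open>X\<close> give the same value, and the existence of a root makes the description determine
  it.\<close>

lemma gle_hat_values:
  assumes "(X, C) \<in> gle1_curve_hat n p \<tau>"
  shows "gle1_sigma_hat n p \<tau> (X, C) = lame_sigma n \<tau> (X - N * wp \<tau> p, C)"
    "gle1_kappa_hat n p \<tau> (X, C) = lame_kappa n \<tau> (X - N * wp \<tau> p, C)"
proof -
  have curve: "C\<^sup>2 = poly (lame_Q n \<tau>) (X - N * wp \<tau> p)"
    using assms by (simp add: gle1_curve_hat_def poly_gle_Q_hat)
  have val: "gle1_sigma n p \<tau> (T, C) = lame_sigma n \<tau> (X - N * wp \<tau> p, C)"
    "gle1_kappa n p \<tau> (T, C) = lame_kappa n \<tau> (X - N * wp \<tau> p, C)" if "T\<^sup>2 = X" for T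
  proof -
    have b: "bpar T = X - N * wp \<tau> p" by (simp add: bpar_def that)
    show "gle1_sigma n p \<tau> (T, C) = lame_sigma n \<tau> (X - N * wp \<tau> p, C)"
      "gle1_kappa n p \<tau> (T, C) = lame_kappa n \<tau> (X - N * wp \<tau> p, C)"
      using gle_values[of C T] curve unfolding b by blast+
  qed
  have root: "(csqrt X)\<^sup>2 = X" by simp
  show "gle1_sigma_hat n p \<tau> (X, C) = lame_sigma n \<tau> (X - N * wp \<tau> p, C)"
    unfolding gle1_sigma_hat_def prod.case
    by (rule the_equality) (use val(1) root in \<open>simp, metis\<close>)
  show "gle1_kappa_hat n p \<tau> (X, C) = lame_kappa n \<tau> (X - N * wp \<tau> p, C)"
    unfolding gle1_kappa_hat_def prod.case
    by (rule the_equality) (use val(2) root in \<open>simp, metis\<close>)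
qed

end

theorem theorem1p3:
  fixes n :: nat and \<tau> :: complex and \<pp> :: "complex set"
  assumes "0 < n" and "0 < Im \<tau>" and "\<pp> \<in> ell_curve \<tau> - two_torsion \<tau>"
  shows "\<exists>\<iota>. \<forall>p\<in>\<pp>.
           curve_isomorphism (gle1_curve_hat n p \<tau>) (lame_curve n \<tau>) \<iota> \<and>
           (\<forall>P\<in>gle1_curve_hat n p \<tau>.
              lame_sigma n \<tau> (\<iota> P) = gle1_sigma_hat n p \<tau> P \<and>
              lame_kappa n \<tau> (\<iota> P) = gle1_kappa_hat n p \<tau> P)"
proof -
  interpret upper_half \<tau> by unfold_locales (rule assms(2))
  obtain x where x: "\<pp> = ell_point \<tau> x"
    using assms(3) by (auto simp: ell_curve_def ell_point_def quotient_def)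
  have shift: "x - p \<in> \<Lambda>" if "p \<in> \<pp>" for p
    using that by (simp add: x ell_point_def lattice_rel_def)
  have double: "2 * p \<notin> \<Lambda>" if "p \<in> \<pp>" for p
  proof
    assume "2 * p \<in> \<Lambda>"
    moreover have "\<pp> = ell_point \<tau> p" using shift[OF that] by (simp add: x ell_point_eq_iff)
    ultimately have "\<pp> \<in> two_torsion \<tau>" by (auto simp: two_torsion_def)
    then show False using assms(3) by simp
  qed
  \<comment> \<open>The map is fixed by one lift \<open>x\<close> before \<open>p\<close> varies;
    periodicity of \<open>wp\<close> shows that it is the right translation for every lift of the
    point.\<close>
  define c where "c = of_nat n * (of_nat n + 1) * wp \<tau> x"
  show ?thesis
  proof (intro exI[of _ "\<lambda>(X, C). (X - c, C)"] ballI)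
    fix p assume p: "p \<in> \<pp>"
    interpret gle_setting \<tau> n p
      by unfold_locales (use assms(1) double[OF p] in auto)
    have "wp \<tau> x = wp \<tau> p" using wp_periodic[OF shift[OF p] p_notin] by simp
    then have c: "c = N * wp \<tau> p" by (simp add: c_def)
    have "curve_isomorphism (gle1_curve_hat n p \<tau>) (lame_curve n \<tau>) (\<lambda>(X, C). (X - c, C))"
      by (rule affine_shift_isomorphism) (simp add: gle1_curve_hat_def lame_curve_def poly_gle_Q_hat c)
    moreover have "\<forall>P\<in>gle1_curve_hat n p \<tau>.
       lame_sigma n \<tau> (case P of (X, C) \<Rightarrow> (X - c, C)) = gle1_sigma_hat n p \<tau> P \<and>
       lame_kappa n \<tau> (case P of (X, C) \<Rightarrow> (X - c, C)) = gle1_kappa_hat n p \<tau> P"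
      using gle_hat_values by (auto simp: c)
    ultimately show "curve_isomorphism (gle1_curve_hat n p \<tau>) (lame_curve n \<tau>) (\<lambda>(X, C). (X - c, C)) \<and>
      (\<forall>P\<in>gle1_curve_hat n p \<tau>.
         lame_sigma n \<tau> (case P of (X, C) \<Rightarrow> (X - c, C)) = gle1_sigma_hat n p \<tau> P \<and>
         lame_kappa n \<tau> (case P of (X, C) \<Rightarrow> (X - c, C)) = gle1_kappa_hat n p \<tau> P)" ..
  qed
qed

end
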